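(* Let $i\in\{0,1,\dots,n-1\}$, $s,t>0$, $\alpha\in[-\frac1{n-i},+\infty]$, and let $f,g\in\mathcal Q^n_\alpha$. If $\alpha=0$, assume in addition that $s+t=1$. Then $$W_i(s\cdot f\oplus t\cdot g)\ge M_\beta^{(s,t)}(W_i(f),W_i(g)),\qquad\beta=\frac{\alpha}{1+\alpha(n-i)},$$ where $\beta=-\infty$ if $\alpha=-\frac1{n-i}$ and $\beta=\frac1{n-i}$ if $\alpha=+\infty$. Here $\oplus$ and $\cdot$ are the operations associated with the given $\alpha$.
   Context: Means: for $s,t>0$ and $u,v\in[0,+\infty]$, $M_\alpha^{(s,t)}(u,v)=(su^\alpha+tv^\alpha)^{1/\alpha}$ for finite $\alpha\neq0$, $M_0^{(s,t)}(u,v)=u^sv^t$, $M_{-\infty}^{(s,t)}(u,v)=\min(u,v)$, $M_{+\infty}^{(s,t)}(u,v)=\max(u,v)$. If $\alpha\le0$ and one of $u,v$ is $0$ (even if the other is $+\infty$) the value is $0$. When $u$ or $v$ is $+\infty$ the value is otherwise defined by monotone limits (e.g. $+\infty$ if $\alpha>0$). For $\lambda\in(0,1)$, $M_\alpha^{(\lambda)}=M_\alpha^{(1-\lambda,\lambda)}$. $\mathcal Q^n_\alpha$ is the set of functions $f:\mathbb R^n\to[0,+\infty]$, not identically zero, upper semicontinuous, with $\lim_{\|x\|\to\infty}f(x)=0$, that are $\alpha$-concave: $f((1-\lambda)x+\lambda y)\ge M_\alpha^{(\lambda)}(f(x),f(y))$ for all $x,y$ with $f(x)f(y)>0$ and all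 $\lambda\in(0,1)$. Operations (for fixed $\alpha$): with $K_f=\{f>0\}$, $K_g=\{g>0\}$, $(s\cdot f\oplus t\cdot g)(z)=\sup\{M_\alpha^{(s,t)}(f(x),g(y)): z=sx+ty,\ f(x)g(y)>0\}$ if $z\in sK_f+tK_g$, and $0$ otherwise. For a non-empty compact convex $K\subset\mathbb R^n$, the quermassintegrals $W_i(K)$ are defined by $\mathcal H^n(K+\rho B)=\sum_{i=0}^n\binom ni W_i(K)\rho^i$ for all $\rho\ge0$ ($B$ the closed Euclidean unit ball, $\mathcal H^n$ Lebesgue measure); $W_i(\emptyset)=0$. For a convex set $C\subset\mathbb R^n$ that is not compact, $W_i(C)$ is the supremum of $W_i(K)$ over non-empty compact convex $K\subseteq C$. For a quasi-concave function $h\ge0$ (in particular for $f$, $g$ and $s\cdot f\oplus t\cdot g$), $W_i(h)=\int_0^{+\infty}W_i(\{h\ge r\})\,dr$. *)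

theory Defs
  imports "HOL-Analysis.Analysis"
begin

text \<open>Real powers on \<open>[0, \<infinity>]\<close>, extended to \<open>0\<close> and \<open>\<infinity>\<close> by monotone limits.\<close>

definition ennreal_powr :: "ennreal \<Rightarrow> real \<Rightarrow> ennreal" where
  "ennreal_powr u a =
    (if a = 0 then 1
     else if u = 0 then (if a > 0 then 0 else \<infinity>)
     else if u = \<infinity> then (if a > 0 then \<infinity> else 0)
     else ennreal (enn2real u powr a))"

text \<open>The mean \<open>M\<^sub>\<alpha>\<^sup>(\<^sup>s\<^sup>,\<^sup>t\<^sup>)(u, v)\<close>, for \<open>s, t > 0\<close>. For nonzero arguments, infinite values need no
  extra clause: the arithmetic of \<^typ>\<open>ennreal\<close> and \<^const>\<open>ennreal_powr\<close> yield the monotone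
  limits.\<close>

definition power_mean :: "ereal \<Rightarrow> real \<Rightarrow> real \<Rightarrow> ennreal \<Rightarrow> ennreal \<Rightarrow> ennreal" where
  "power_mean \<alpha> s t u v =
    (if \<alpha> \<le> 0 \<and> (u = 0 \<or> v = 0) then 0
     else if \<alpha> = \<infinity> then max u v
     else if \<alpha> = -\<infinity> then min u v
     else if \<alpha> = 0 then ennreal_powr u s * ennreal_powr v t
     else (let a = real_of_ereal \<alpha> in
       ennreal_powr (ennreal s * ennreal_powr u a + ennreal t * ennreal_powr v a) (1 / a)))"

definition alpha_concave :: "ereal \<Rightarrow> ('a::real_vector \<Rightarrow> ennreal) \<Rightarrow> bool" where
  "alpha_concave \<alpha> f \<longleftrightarrow>
    (\<forall>x y. f x > 0 \<and> f y > 0 \<longrightarrow>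
      (\<forall>l\<in>{0<..<1}.
        f ((1 - l) *\<^sub>R x + l *\<^sub>R y) \<ge> power_mean \<alpha> (1 - l) l (f x) (f y)))"

definition upper_semicontinuous :: "('a::topological_space \<Rightarrow> 'b::order) \<Rightarrow> bool" where
  "upper_semicontinuous f \<longleftrightarrow> (\<forall>x. \<forall>c>f x. \<forall>\<^sub>F y in nhds x. f y < c)"

definition Q_class :: "ereal \<Rightarrow> ('a::real_normed_vector \<Rightarrow> ennreal) set" where
  "Q_class \<alpha> = {f. (\<exists>x. f x \<noteq> 0) \<and> upper_semicontinuous f \<and>
      (f \<longlongrightarrow> 0) at_infinity \<and> alpha_concave \<alpha> f}"

text \<open>The combination \<open>s \<cdot> f \<oplus> t \<cdot> g\<close> associated with \<open>\<alpha>\<close>.\<close>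

definition sup_combination ::
  "ereal \<Rightarrow> real \<Rightarrow> real \<Rightarrow> ('a::real_vector \<Rightarrow> ennreal) \<Rightarrow> ('a \<Rightarrow> ennreal) \<Rightarrow> 'a \<Rightarrow> ennreal" where
  "sup_combination \<alpha> s t f g z =
    (if z \<in> {s *\<^sub>R x + t *\<^sub>R y | x y. f x > 0 \<and> g y > 0}
     then Sup {power_mean \<alpha> s t (f x) (g y) | x y. z = s *\<^sub>R x + t *\<^sub>R y \<and> f x > 0 \<and> g y > 0}
     else 0)"

text \<open>Steiner's formula: \<open>w 0, \<dots>, w n\<close> are the normalised coefficients of the volume of the outer
  parallel body \<open>K + \<rho> B\<close>, where \<open>n\<close> is the dimension.\<close>

definition steiner_coeffs :: "'a::euclidean_space set \<Rightarrow> (nat \<Rightarrow> real) \<Rightarrow> bool" where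
  "steiner_coeffs K w \<longleftrightarrow>
    (\<forall>\<rho>\<ge>0. measure lborel {x + \<rho> *\<^sub>R b | x b. x \<in> K \<and> b \<in> cball 0 1} =
      (\<Sum>j\<le>DIM('a). real (DIM('a) choose j) * w j * \<rho> ^ j))"

text \<open>Quermassintegral of a nonempty compact convex set; a polynomial identity on \<open>[0, \<infinity>)\<close> determines
  the coefficients, so the description is unambiguous for \<open>i \<le> n\<close>.\<close>

definition quermass_body :: "nat \<Rightarrow> 'a::euclidean_space set \<Rightarrow> real" where
  "quermass_body i K = (THE c. \<exists>w. steiner_coeffs K w \<and> w i = c)"

text \<open>Meaningful for convex \<open>C\<close>. The values of \<^const>\<open>quermass_body\<close> on convex bodies are
  nonnegative, so \<^const>\<open>ennreal\<close> does not truncate.\<close>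

definition quermass :: "nat \<Rightarrow> 'a::euclidean_space set \<Rightarrow> ennreal" where
  "quermass i C =
    (if C = {} then 0
     else if compact C then ennreal (quermass_body i C)
     else (SUP K\<in>{K. compact K \<and> convex K \<and> K \<noteq> {} \<and> K \<subseteq> C}. ennreal (quermass_body i K)))"

text \<open>Meaningful for quasi-concave \<open>h\<close>, whose superlevel sets are convex.\<close>

definition quermass_fun :: "nat \<Rightarrow> ('a::euclidean_space \<Rightarrow> ennreal) \<Rightarrow> ennreal" where
  "quermass_fun i h = (\<integral>\<^sup>+ r\<in>{0<..}. quermass i {x. h x \<ge> ennreal r} \<partial>lborel)"

text \<open>The exponent \<open>\<alpha> / (1 + \<alpha> m)\<close>, for \<open>\<alpha> \<in> [-1/m, \<infinity>]\<close> and \<open>m > 0\<close>.\<close>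

definition beta_exponent :: "ereal \<Rightarrow> nat \<Rightarrow> ereal" where
  "beta_exponent \<alpha> m =
    (if \<alpha> = \<infinity> then ereal (1 / real m)
     else if \<alpha> = ereal (- 1 / real m) then -\<infinity>
     else \<alpha> / (1 + \<alpha> * ereal (real m)))"

end

theory Submission
  imports Defs "HOL-Probability.Probability"
begin

text \<open>
  Quermassintegrals of bodies satisfy \<open>W\<^sub>i (K + L)\<^sup>1\<^sup>/\<^sup>m \<ge> W\<^sub>i K\<^sup>1\<^sup>/\<^sup>m + W\<^sub>i L\<^sup>1\<^sup>/\<^sup>m\<close> with \<open>m = n - i\<close>. To see this,
  the ball is approximated by zonotopes \<open>Z = \<Sum> [0, v]\<close> with edges in general position. Volume is affine in
  the length of each edge, so \<open>vol (K + \<rho> Z)\<close> is a polynomial in \<open>\<rho>\<close> whose coefficients are iterated finite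
  differences along the edges, and they converge to those of Steiner's formula. Log-concavity is inherited by
  differences along one edge, because they are leading coefficients for long edges. It passes to the sum over
  all edges by a Bochner-type argument: if the sum were not concave after taking roots, a parabola would touch
  it from below, whereas a second difference along directions in which every single term is balanced (found by
  solving a weighted graph Laplacian) is nonpositive up to third order.

  For functions, superlevel sets turn this into \<open>H (M\<^sub>\<alpha> (r, \<rho>)) \<ge> (s x + t y)\<^sup>m\<close> whenever \<open>F r \<ge> x\<^sup>m\<close> and
  \<open>G \<rho> \<ge> y\<^sup>m\<close>, where \<open>F, G, H\<close> are the quermassintegrals of the superlevel sets. Rescaling \<open>F\<close> and \<open>G\<close> by
  powers of their integrals, together with the monotonicity of power means, reduces everything to
  \<open>\<alpha> = -1/m\<close>. There one takes \<open>x\<close> as the new variable: the functions \<open>m x\<^sup>m\<^sup>-\<^sup>1 |{F > x\<^sup>m}|\<close> have the same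
  integrals as \<open>F\<close>, and their superlevel sets satisfy the one-dimensional Brunn-Minkowski inequality.
\<close>

section \<open>Superlevel sets on the line\<close>

text \<open>A sum of log-concave functionals need not be log-concave, so adding up the estimates for
  single edges on one common pair of bodies fails. Instead each summand \<open>dseg j H\<close> is
  tested on its own pair with the common midpoint, the edge lengths being displaced by
  \<open>w v - \<tau> j\<close>. The scalar \<open>\<tau> j\<close> removes the first-order
  difference of that summand, and \<open>w\<close> solves a Laplace equation whose weights are
  second differences of the total; with this choice the displacement terms add up to squares. The
  equation is solvable only if the second iterate of \<open>dzon\<close> agrees at the two bodies.
  For this reason dilation is added as a second direction beside the segment from \<open>K\<close>
  to \<open>L\<close>: on a half circle of directions the discrepancy changes sign. General position
  makes the weights strictly positive, and since volume is affine in each edge length the errors are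
  cubic, against a quadratic gain from the parabola. The order -1/m is the one for which Jensen's
  inequality for the m-th power converts a bound on superlevel sets into a harmonic-mean bound on
  layer densities.\<close>

lemma compact_below_emeasure:
  fixes A :: "'a::euclidean_space set"
  assumes A: "A \<in> sets borel" and a: "a < emeasure lborel A"
  obtains K where "compact K" "K \<subseteq> A" "a < emeasure lborel K"
proof -
  define B where "B k = A \<inter> cball 0 (real k)" for k
  have B: "B k \<in> sets lborel" for k using A by (auto simp: B_def)
  have "(\<Union>k. B k) = A"
    using real_arch_simple by (fastforce simp: B_def)
  moreover have "(SUP k. emeasure lborel (B k)) = emeasure lborel (\<Union>k. B k)"
    by (rule SUP_emeasure_incseq) (use B in \<open>auto simp: incseq_def B_def\<close>)
  ultimately obtain k where k: "a < emeasure lborel (B k)"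
    using a by (metis less_SUP_iff)
  have "emeasure lborel (B k) < \<infinity>"
    by (rule emeasure_bounded_finite) (auto simp: B_def bounded_Int)
  then obtain b where b: "emeasure lborel (B k) = ennreal b" "b \<ge> 0"
    by (cases "emeasure lborel (B k)") auto
  from k b obtain c where c: "a = ennreal c" "c \<ge> 0" by (cases a) auto
  have cb: "c < b" using k b c by (simp add: ennreal_less_iff)
  obtain T where T: "closed T" "T \<subseteq> B k" "B k - T \<in> lmeasurable"
      "emeasure lebesgue (B k - T) < ennreal (b - c)"
    using sets_lebesgue_inner_closed[of "B k" "b - c"] B cb by auto
  have Tb: "T \<in> sets borel" using T(1) by (rule borel_closed)
  have comp: "compact T"
    using T by (auto simp: compact_eq_bounded_closed B_def intro: bounded_subset[OF bounded_cball])
  have "emeasure lborel (B k) = emeasure lborel T + emeasure lborel (B k - T)"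
    using B Tb T(2) by (subst plus_emeasure) (auto simp: Un_absorb1)
  also have "emeasure lborel (B k - T) = emeasure lebesgue (B k - T)"
    using B Tb by simp
  finally have eq: "ennreal b = emeasure lborel T + emeasure lebesgue (B k - T)"
    using b by simp
  have "a < emeasure lborel T"
  proof (rule ccontr)
    assume "\<not> a < emeasure lborel T"
    then have "emeasure lborel T \<le> ennreal c" using c by simp
    then have "ennreal b \<le> ennreal c + emeasure lebesgue (B k - T)"
      unfolding eq by (rule add_right_mono)
    also have "\<dots> < ennreal c + ennreal (b - c)"
      using T(4) by (simp add: ennreal_add_left_cancel_less)
    finally have "ennreal b < ennreal c + ennreal (b - c)" .
    then show False using cb c by (simp flip: ennreal_plus)
  qed
  then show ?thesis using comp T(2) that by (auto simp: B_def)
qed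

text \<open>The translates of \<open>A\<close> by min \<open>B\<close> and of \<open>B\<close> by
  max \<open>A\<close> both lie in \<open>E\<close>, and they meet at most in the single point max
  \<open>A\<close> + min \<open>B\<close>.\<close>

lemma brunn_minkowski_real_compact:
  fixes A B :: "real set"
  assumes A: "compact A" "A \<noteq> {}" and B: "compact B" "B \<noteq> {}" and E: "E \<in> sets borel"
    and sub: "\<And>x y. x \<in> A \<Longrightarrow> y \<in> B \<Longrightarrow> x + y \<in> E"
  shows "emeasure lborel A + emeasure lborel B \<le> emeasure lborel E"
proof -
  obtain a where a: "a \<in> A" "\<And>x. x \<in> A \<Longrightarrow> x \<le> a"
    using compact_attains_sup[OF A] by blast
  obtain b where b: "b \<in> B" "\<And>y. y \<in> B \<Longrightarrow> b \<le> y"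
    using compact_attains_inf[OF B] by blast
  let ?A = "(+) b ` A" and ?B = "(+) a ` B"
  have meas: "?A \<in> sets borel" "?B \<in> sets borel"
    using A B by (auto intro!: borel_compact compact_translation)
  have eqA: "emeasure lborel ?A = emeasure lborel A"
    using emeasure_lebesgue_affine[of 1 b A] meas A borel_compact[of A] by (simp add: add.commute[of b] image_def)
  have eqB: "emeasure lborel ?B = emeasure lborel B"
    using emeasure_lebesgue_affine[of 1 a B] meas B borel_compact[of B] by (simp add: add.commute[of a] image_def)
  have "?A \<inter> ?B \<subseteq> {a + b}"
    using a b by force
  then have "emeasure lborel (?A \<inter> ?B) = 0"
    by (metis emeasure_empty emeasure_lborel_singleton subset_singleton_iff)
  then have "emeasure lborel ?A + emeasure lborel ?B = emeasure lborel (?A \<union> ?B)"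
    using meas emeasure_Un_Int[of ?A lborel ?B] by simp
  also have "\<dots> \<le> emeasure lborel E"
    using E sub[OF _ b(1)] sub[OF a(1)] by (intro emeasure_mono) (auto simp: add.commute[of b])
  finally show ?thesis unfolding eqA eqB .
qed

text \<open>Both measures are suprema over nonempty compact subsets, and the factors
  \<open>s\<close> and \<open>t\<close> enter as dilations. Without nonemptiness of \<open>A\<close>
  and \<open>B\<close> the hypothesis on sums would be vacuous.\<close>

lemma brunn_minkowski_real:
  fixes A B :: "real set"
  assumes A: "A \<in> sets borel" "A \<noteq> {}" and B: "B \<in> sets borel" "B \<noteq> {}"
    and E: "E \<in> sets borel" and st: "s > 0" "t > 0"
    and sub: "\<And>x y. x \<in> A \<Longrightarrow> y \<in> B \<Longrightarrow> s * x + t * y \<in> E"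
  shows "ennreal s * emeasure lborel A + ennreal t * emeasure lborel B \<le> emeasure lborel E"
proof -
  let ?C = "\<lambda>A. {K. compact K \<and> K \<subseteq> A \<and> K \<noteq> {}}"
  have sup: "emeasure lborel A = (SUP K\<in>?C A. emeasure lborel K)" if "A \<in> sets borel" for A :: "real set"
  proof (rule antisym)
    show "emeasure lborel A \<le> (SUP K\<in>?C A. emeasure lborel K)"
    proof (rule dense_le)
      fix a assume "a < emeasure lborel A"
      then obtain K where "compact K" "K \<subseteq> A" "a < emeasure lborel K"
        using compact_below_emeasure \<open>A \<in> sets borel\<close> by metis
      then show "a \<le> (SUP K\<in>?C A. emeasure lborel K)"
        by (intro SUP_upper2[of K]) auto
    qed
    show "(SUP K\<in>?C A. emeasure lborel K) \<le> emeasure lborel A"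
      using that by (auto intro!: SUP_least emeasure_mono)
  qed
  have sc: "emeasure lborel ((*) r ` K) = ennreal r * emeasure lborel K"
    if "compact K" "r > 0" for K :: "real set" and r
    using emeasure_lebesgue_affine[of r 0 K] that borel_compact[of K]
      borel_compact[of "(*) r ` K"] compact_scaling[of K r]
    by (simp add: image_def)
  have ne: "?C A \<noteq> {}" "?C B \<noteq> {}"
  proof -
    from A B obtain a b where "a \<in> A" "b \<in> B" by blast
    then have "{a} \<in> ?C A" "{b} \<in> ?C B" by auto
    then show "?C A \<noteq> {}" "?C B \<noteq> {}" by blast+
  qed
  have *: "ennreal s * emeasure lborel K + ennreal t * emeasure lborel L \<le> emeasure lborel E"
    if "K \<in> ?C A" "L \<in> ?C B" for K L
  proof -
    have "emeasure lborel ((*) s ` K) + emeasure lborel ((*) t ` L) \<le> emeasure lborel E"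
      using that sub E compact_scaling[of K s] compact_scaling[of L t]
      by (intro brunn_minkowski_real_compact) auto
    then show ?thesis using that st by (simp add: sc)
  qed
  have "ennreal s * emeasure lborel A + ennreal t * emeasure lborel B
     = (SUP K\<in>?C A. ennreal s * emeasure lborel K) + (SUP L\<in>?C B. ennreal t * emeasure lborel L)"
    using A B by (simp only: sup SUP_mult_left_ennreal)
  also have "\<dots> \<le> emeasure lborel E"
    unfolding ennreal_SUP_add_left[OF ne(1), symmetric]
  proof (intro SUP_least)
    fix K assume K: "K \<in> ?C A"
    show "ennreal s * emeasure lborel K + (SUP L\<in>?C B. ennreal t * emeasure lborel L) \<le> emeasure lborel E"
      unfolding ennreal_SUP_add_right[OF ne(2)] using *[OF K] by (intro SUP_least)
  qed
  finally show ?thesis .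
qed

lemma nn_integral_layer_cake:
  fixes u :: "'a \<Rightarrow> ennreal"
  assumes "sigma_finite_measure M" and [measurable]: "u \<in> borel_measurable M"
  shows "(\<integral>\<^sup>+x. u x \<partial>M) = (\<integral>\<^sup>+c\<in>{0<..}. emeasure M {x \<in> space M. ennreal c < u x} \<partial>lborel)"
proof -
  interpret M: sigma_finite_measure M by fact
  interpret pair_sigma_finite M "lborel :: real measure" ..
  have 1: "u x = (\<integral>\<^sup>+c. indicator {0<..} c * indicator {y \<in> space M. ennreal c < u y} x \<partial>lborel)"
    if "x \<in> space M" for x
  proof -
    have "(\<integral>\<^sup>+c. indicator {0<..} c * indicator {y \<in> space M. ennreal c < u y} x \<partial>lborel) =
      (\<integral>\<^sup>+c. indicator {c. 0 < c \<and> ennreal c < u x} c \<partial>lborel)"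
      using that by (intro nn_integral_cong) (auto simp: indicator_def)
    also have "\<dots> = emeasure lborel {c. 0 < c \<and> ennreal c < u x}"
      by (subst nn_integral_indicator) auto
    also have "\<dots> = u x"
    proof (cases "u x")
      case (real r)
      then have "{c. 0 < c \<and> ennreal c < u x} = {0<..<r}"
        by (auto simp: ennreal_less_iff)
      then show ?thesis using real by simp
    next
      case top
      then have "{c. 0 < c \<and> ennreal c < u x} = {0<..}" by auto
      moreover have "of_nat n \<le> emeasure lborel {0::real<..}" for n :: nat
      proof -
        have "emeasure lborel {0<..real n} \<le> emeasure lborel {0::real<..}"
          by (intro emeasure_mono) auto
        then show ?thesis by (simp add: ennreal_of_nat_eq_real_of_nat)
      qed
      then have "emeasure lborel {0::real<..} = \<top>"
        using SUP_least[of UNIV "of_nat" "emeasure lborel {0::real<..}"]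
        by (simp add: ennreal_SUP_of_nat_eq_top top_unique)
      ultimately show ?thesis using top by simp
    qed
    finally show ?thesis by simp
  qed
  have "(\<integral>\<^sup>+x. u x \<partial>M) = (\<integral>\<^sup>+x. (\<integral>\<^sup>+c. indicator {0<..} c * indicator {y \<in> space M. ennreal c < u y} x \<partial>lborel) \<partial>M)"
    by (intro nn_integral_cong 1)
  also have "\<dots> = (\<integral>\<^sup>+c. (\<integral>\<^sup>+x. indicator {0<..} c * indicator {y \<in> space M. ennreal c < u y} x \<partial>M) \<partial>lborel)"
    by (rule Fubini'[symmetric]) (auto simp: split_def)
  also have "\<dots> = (\<integral>\<^sup>+c\<in>{0<..}. emeasure M {x \<in> space M. ennreal c < u x} \<partial>lborel)"
    by (intro nn_integral_cong) (simp add: nn_integral_cmult mult.commute)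
  finally show ?thesis .
qed

text \<open>Levels are normalised to the unit interval so that functions truncated at different
  heights can be compared at the same relative level \<open>c\<close>.\<close>

lemma nn_integral_min_layer_cake:
  fixes u :: "real \<Rightarrow> ennreal"
  assumes [measurable]: "u \<in> borel_measurable borel" and U: "U > 0"
  shows "(\<integral>\<^sup>+x. min (u x) (ennreal U) \<partial>lborel) =
    ennreal U * (\<integral>\<^sup>+c\<in>{0<..<1}. emeasure lborel {x. ennreal (c * U) < u x} \<partial>lborel)"
proof -
  have "(\<integral>\<^sup>+x. min (u x) (ennreal U) \<partial>lborel) =
     (\<integral>\<^sup>+c\<in>{0<..}. emeasure lborel {x \<in> space lborel. ennreal c < min (u x) (ennreal U)} \<partial>lborel)"
    by (rule nn_integral_layer_cake) (auto intro: sigma_finite_lborel)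
  also have "\<dots> = ennreal \<bar>U\<bar> * (\<integral>\<^sup>+c. emeasure lborel {x \<in> space lborel. ennreal (0 + U * c) < min (u x) (ennreal U)} * indicator {0<..} (0 + U * c) \<partial>lborel)"
    using U by (intro nn_integral_real_affine) auto
  also have "(\<integral>\<^sup>+c. emeasure lborel {x \<in> space lborel. ennreal (0 + U * c) < min (u x) (ennreal U)} * indicator {0<..} (0 + U * c) \<partial>lborel)
     = (\<integral>\<^sup>+c\<in>{0<..<1}. emeasure lborel {x. ennreal (c * U) < u x} \<partial>lborel)"
  proof (intro nn_integral_cong)
    fix c :: real
    have "ennreal (U * c) < ennreal U \<longleftrightarrow> c < 1" if "c > 0"
      using U that by (subst ennreal_less_iff) auto
    then show "emeasure lborel {x \<in> space lborel. ennreal (0 + U * c) < min (u x) (ennreal U)} * indicator {0<..} (0 + U * c)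
      = emeasure lborel {x. ennreal (c * U) < u x} * indicator {0<..<1} c"
      using U by (cases "0 < c"; cases "c < 1") (auto simp: indicator_def mult.commute zero_less_mult_iff)
  qed
  finally show ?thesis using U by simp
qed

text \<open>Brunn-Minkowski on the line is applied at every relative level \<open>c\<close>;
  truncation at \<open>U\<close> and \<open>V\<close> keeps the superlevel sets nonempty for all
  \<open>c\<close> below 1. The height \<open>N\<close> is left free: the geometric mean of
  \<open>U\<close> and \<open>V\<close> leads to Prekopa-Leindler, a weighted harmonic mean to the
  layer inequality further below.\<close>

lemma nn_integral_superlevel_ineq:
  fixes u v w :: "real \<Rightarrow> ennreal"
  assumes [measurable]: "u \<in> borel_measurable borel" "v \<in> borel_measurable borel" "w \<in> borel_measurable borel"
    and pos: "U > 0" "V > 0" "N > 0" "s > 0" "t > 0"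
    and neu: "\<And>c. 0 < c \<Longrightarrow> c < 1 \<Longrightarrow> \<exists>x. ennreal (c * U) < u x"
    and nev: "\<And>c. 0 < c \<Longrightarrow> c < 1 \<Longrightarrow> \<exists>x. ennreal (c * V) < v x"
    and sub: "\<And>c x y. 0 < c \<Longrightarrow> c < 1 \<Longrightarrow> ennreal (c * U) < u x \<Longrightarrow> ennreal (c * V) < v y
                \<Longrightarrow> ennreal (c * N) < w (s * x + t * y)"
  shows "ennreal (N * s / U) * (\<integral>\<^sup>+x. min (u x) (ennreal U) \<partial>lborel) +
         ennreal (N * t / V) * (\<integral>\<^sup>+x. min (v x) (ennreal V) \<partial>lborel) \<le> (\<integral>\<^sup>+x. w x \<partial>lborel)"
proof -
  let ?L = "\<lambda>u c. emeasure lborel {x. ennreal c < u x}"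
  have "ennreal (N * s / U) * (\<integral>\<^sup>+x. min (u x) (ennreal U) \<partial>lborel) +
         ennreal (N * t / V) * (\<integral>\<^sup>+x. min (v x) (ennreal V) \<partial>lborel) =
     ennreal N * (ennreal s * (\<integral>\<^sup>+c\<in>{0<..<1}. ?L u (c * U) \<partial>lborel) + ennreal t * (\<integral>\<^sup>+c\<in>{0<..<1}. ?L v (c * V) \<partial>lborel))"
    using pos by (simp add: nn_integral_min_layer_cake distrib_left flip: mult.assoc ennreal_mult)
  also have "ennreal s * (\<integral>\<^sup>+c\<in>{0<..<1}. ?L u (c * U) \<partial>lborel) + ennreal t * (\<integral>\<^sup>+c\<in>{0<..<1}. ?L v (c * V) \<partial>lborel)
    = (\<integral>\<^sup>+c\<in>{0<..<1}. (ennreal s * ?L u (c * U) + ennreal t * ?L v (c * V)) \<partial>lborel)"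
    by (simp add: distrib_right nn_integral_add nn_integral_cmult mult.assoc)
  also have "\<dots> \<le> (\<integral>\<^sup>+c\<in>{0<..<1}. ?L w (c * N) \<partial>lborel)"
  proof (intro nn_integral_mono)
    fix c :: real
    show "(ennreal s * ?L u (c * U) + ennreal t * ?L v (c * V)) * indicator {0<..<1} c \<le> ?L w (c * N) * indicator {0<..<1} c"
    proof (cases "0 < c \<and> c < 1")
      case True
      have "ennreal s * ?L u (c * U) + ennreal t * ?L v (c * V) \<le> ?L w (c * N)"
        using True neu nev sub pos by (intro brunn_minkowski_real) auto
      then show ?thesis using True by simp
    qed auto
  qed
  also have "ennreal N * (\<integral>\<^sup>+c\<in>{0<..<1}. ?L w (c * N) \<partial>lborel) = (\<integral>\<^sup>+x. min (w x) (ennreal N) \<partial>lborel)"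
    using pos by (simp add: nn_integral_min_layer_cake)
  also have "\<dots> \<le> (\<integral>\<^sup>+x. w x \<partial>lborel)"
    by (intro nn_integral_mono) auto
  finally show ?thesis by (simp add: mult_left_mono)
qed

section \<open>Midpoint log-concavity of volume\<close>

text \<open>\<open>U\<close> is the supremum of \<open>u\<close> if that is finite. Otherwise it is
  an integer so large that, by monotone convergence, the truncated integral still exceeds
  \<open>\<theta>\<close>.\<close>

lemma truncation_level:
  fixes u :: "real \<Rightarrow> ennreal"
  assumes [measurable]: "u \<in> borel_measurable borel" and \<theta>: "ennreal \<theta> < (\<integral>\<^sup>+x. u x \<partial>lborel)"
  obtains U where "U > 0" "\<And>c. 0 < c \<Longrightarrow> c < 1 \<Longrightarrow> \<exists>x. ennreal (c * U) < u x"
    "ennreal \<theta> < (\<integral>\<^sup>+x. min (u x) (ennreal U) \<partial>lborel)"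
proof (cases "SUP x. u x")
  case (real S)
  have "S > 0"
  proof (rule ccontr)
    assume "\<not> S > 0"
    then have "(SUP x. u x) = 0" using real by simp
    then have "u x = 0" for x by (simp add: SUP_eq_iff[of UNIV, simplified] bot_ennreal)
    then show False using \<theta> by simp
  qed
  have "u x \<le> ennreal S" for x unfolding real(2)[symmetric] by (intro SUP_upper) auto
  then have "min (u x) (ennreal S) = u x" for x by (simp add: min_absorb1)
  moreover have "\<exists>x. ennreal (c * S) < u x" if "0 < c" "c < 1" for c
  proof -
    have "ennreal (c * S) < (SUP x. u x)"
      unfolding real(2) using that \<open>S > 0\<close> by (auto simp: ennreal_less_iff)
    then show ?thesis by (simp add: less_SUP_iff)
  qed
  ultimately show ?thesis using that[of S] \<open>S > 0\<close> \<theta> by simp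
next
  case top
  have "(\<integral>\<^sup>+x. u x \<partial>lborel) = (\<integral>\<^sup>+x. (SUP n. min (u x) (of_nat n)) \<partial>lborel)"
  proof (intro nn_integral_cong)
    fix x
    have "(SUP n. inf (u x) (of_nat n)) = inf (u x) (SUP n. of_nat n)"
      by (simp add: inf_SUP)
    then show "u x = (SUP n. min (u x) (of_nat n))"
      by (simp add: ennreal_SUP_of_nat_eq_top inf_min[symmetric])
  qed
  also have "\<dots> = (SUP n. (\<integral>\<^sup>+x. min (u x) (of_nat n) \<partial>lborel))"
    by (intro nn_integral_monotone_convergence_SUP) (auto simp: incseq_def le_fun_def min_le_iff_disj intro: min.coboundedI2)
  finally obtain n where n: "ennreal \<theta> < (\<integral>\<^sup>+x. min (u x) (of_nat n) \<partial>lborel)"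
    using \<theta> by (auto simp: less_SUP_iff)
  then have "n \<noteq> 0" by (auto intro: gr0I)
  show ?thesis
  proof (rule that[of "real n"])
    fix c :: real
    have "ennreal (c * real n) < (SUP x. u x)" unfolding top by simp
    then show "\<exists>x. ennreal (c * real n) < u x" by (simp add: less_SUP_iff)
  qed (use n \<open>n \<noteq> 0\<close> in \<open>auto simp: ennreal_of_nat_eq_real_of_nat\<close>)
qed

lemma ennreal_less_mult_mono:
  fixes x y :: ennreal
  assumes "ennreal a < x" "ennreal b < y"
  shows "ennreal a * ennreal b < x * y"
proof -
  have pos: "0 < x" "0 < y" using assms by (auto intro: le_less_trans)
  show ?thesis
  proof (cases "y = \<top>")
    case True
    then show ?thesis using pos by (simp add: ennreal_mult_eq_top_iff less_top ennreal_mult_less_top)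
  next
    case False
    have "ennreal a * ennreal b \<le> ennreal a * y"
      using assms by (intro mult_left_mono) auto
    also have "\<dots> < x * y"
      using assms pos False by (intro ennreal_mult_strict_right_mono) (auto simp: less_top)
    finally show ?thesis .
  qed
qed

text \<open>Testing only with positive reals strictly below the factors avoids every case
  distinction for products of 0 and infinity.\<close>

lemma ennreal_mult_leI_dense:
  fixes x y z :: ennreal
  assumes "\<And>a b. 0 < a \<Longrightarrow> 0 < b \<Longrightarrow> ennreal a < x \<Longrightarrow> ennreal b < y \<Longrightarrow> ennreal (a * b) \<le> z"
  shows "x * y \<le> z"
proof -
  have sup: "x = (SUP a\<in>{a. 0 < a \<and> ennreal a < x}. ennreal a)" for x
  proof (rule antisym)
    show "x \<le> (SUP a\<in>{a. 0 < a \<and> ennreal a < x}. ennreal a)"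
    proof (rule dense_le)
      fix y assume "y < x"
      then obtain z where z: "y < z" "z < x" using dense by blast
      then obtain a where "z = ennreal a" "a \<ge> 0" by (cases z) auto
      then show "y \<le> (SUP a\<in>{a. 0 < a \<and> ennreal a < x}. ennreal a)"
        using z by (intro SUP_upper2[of a]) (auto simp: le_less intro: gr0I)
    qed
  qed (auto intro: SUP_least)
  have "x * y = (SUP a\<in>{a. 0 < a \<and> ennreal a < x}. ennreal a) * (SUP b\<in>{b. 0 < b \<and> ennreal b < y}. ennreal b)"
    using sup by metis
  also have "\<dots> = (SUP b\<in>{b. 0 < b \<and> ennreal b < y}. (SUP a\<in>{a. 0 < a \<and> ennreal a < x}. ennreal a * ennreal b))"
    by (simp add: SUP_mult_left_ennreal SUP_mult_right_ennreal)
  also have "\<dots> \<le> z"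
    using assms by (intro SUP_least) (auto simp flip: ennreal_mult)
  finally show ?thesis .
qed

text \<open>With \<open>N\<close> the geometric mean of \<open>U\<close> and \<open>V\<close>, the
  superlevel inequality bounds the integral of \<open>w\<close> below by the arithmetic mean of
  \<open>a * sqrt (V / U)\<close> and \<open>b * sqrt (U / V)\<close>, which dominates
  \<open>sqrt (a * b)\<close>.\<close>

lemma prekopa_leindler_midpoint_real:
  fixes u v w :: "real \<Rightarrow> ennreal"
  assumes [measurable]: "u \<in> borel_measurable borel" "v \<in> borel_measurable borel" "w \<in> borel_measurable borel"
    and le: "\<And>x y. u x * v y \<le> (w ((x + y) / 2))\<^sup>2"
  shows "(\<integral>\<^sup>+x. u x \<partial>lborel) * (\<integral>\<^sup>+x. v x \<partial>lborel) \<le> (\<integral>\<^sup>+x. w x \<partial>lborel)\<^sup>2"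
proof (rule ennreal_mult_leI_dense)
  fix a b :: real assume ab: "0 < a" "0 < b"
    "ennreal a < (\<integral>\<^sup>+x. u x \<partial>lborel)" "ennreal b < (\<integral>\<^sup>+x. v x \<partial>lborel)"
  obtain U where U: "U > 0" "\<And>c. 0 < c \<Longrightarrow> c < 1 \<Longrightarrow> \<exists>x. ennreal (c * U) < u x"
    "ennreal a < (\<integral>\<^sup>+x. min (u x) (ennreal U) \<partial>lborel)"
    using truncation_level[of u a] ab by auto
  obtain V where V: "V > 0" "\<And>c. 0 < c \<Longrightarrow> c < 1 \<Longrightarrow> \<exists>x. ennreal (c * V) < v x"
    "ennreal b < (\<integral>\<^sup>+x. min (v x) (ennreal V) \<partial>lborel)"
    using truncation_level[of v b] ab by auto
  define N where "N = sqrt (U * V)"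
  have N: "N > 0" "N * N = U * V" using U V by (auto simp: N_def)
  have lev: "ennreal (c * N) < w ((1/2) * x + (1/2) * y)"
    if "0 < c" "ennreal (c * U) < u x" "ennreal (c * V) < v y" for c x y
  proof (rule ccontr)
    assume "\<not> ?thesis"
    then have "w ((x + y) / 2) \<le> ennreal (c * N)" by (simp add: add_divide_distrib)
    then have "(w ((x + y) / 2))\<^sup>2 \<le> (ennreal (c * N))\<^sup>2" by (intro power_mono) auto
    also have "\<dots> = ennreal (c * U) * ennreal (c * V)"
      using that N U V by (simp add: power2_eq_square algebra_simps flip: ennreal_mult)
    also have "\<dots> < u x * v y"
      using that by (intro ennreal_less_mult_mono)
    finally show False using le[of x y] by simp
  qed
  have "sqrt (a * b) = sqrt ((N * a / U) * (N * b / V))"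
    using N U V by (simp add: field_simps)
  also have "\<dots> \<le> (N * a / U + N * b / V) / 2"
    using N U V ab by (intro arith_geo_mean_sqrt) auto
  finally have "ennreal (sqrt (a * b)) \<le> ennreal (N * (1/2) / U * a + N * (1/2) / V * b)"
    by (intro ennreal_leI) (simp add: field_simps)
  also have "\<dots> = ennreal (N * (1/2) / U) * ennreal a + ennreal (N * (1/2) / V) * ennreal b"
    using N U V ab by (simp flip: ennreal_mult ennreal_plus)
  also have "\<dots> \<le> ennreal (N * (1/2) / U) * (\<integral>\<^sup>+x. min (u x) (ennreal U) \<partial>lborel) +
         ennreal (N * (1/2) / V) * (\<integral>\<^sup>+x. min (v x) (ennreal V) \<partial>lborel)"
    using U V by (intro add_mono mult_left_mono) auto
  also have "\<dots> \<le> (\<integral>\<^sup>+x. w x \<partial>lborel)"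
    using U V N lev by (intro nn_integral_superlevel_ineq) auto
  finally have "(ennreal (sqrt (a * b)))\<^sup>2 \<le> (\<integral>\<^sup>+x. w x \<partial>lborel)\<^sup>2"
    by (intro power_mono) auto
  then show "ennreal (a * b) \<le> (\<integral>\<^sup>+x. w x \<partial>lborel)\<^sup>2"
    using ab by (simp add: ennreal_power)
qed

text \<open>Integrating out all coordinates but the new one leaves three functions of one variable,
  which satisfy the one-dimensional hypothesis by the induction hypothesis. Only extensional
  arguments are constrained, since the product space contains no others.\<close>

lemma prekopa_leindler_midpoint_PiM:
  fixes f g h :: "('i \<Rightarrow> real) \<Rightarrow> ennreal"
  assumes "finite I"
    and "f \<in> borel_measurable (PiM I (\<lambda>_. lborel))" "g \<in> borel_measurable (PiM I (\<lambda>_. lborel))"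
      "h \<in> borel_measurable (PiM I (\<lambda>_. lborel))"
    and "\<And>x y. x \<in> extensional I \<Longrightarrow> y \<in> extensional I \<Longrightarrow> f x * g y \<le> (h (\<lambda>i\<in>I. (x i + y i) / 2))\<^sup>2"
  shows "(\<integral>\<^sup>+x. f x \<partial>PiM I (\<lambda>_. lborel)) * (\<integral>\<^sup>+x. g x \<partial>PiM I (\<lambda>_. lborel))
      \<le> (\<integral>\<^sup>+x. h x \<partial>PiM I (\<lambda>_. lborel))\<^sup>2"
  using assms
proof (induction I arbitrary: f g h rule: finite_induct)
  case empty
  interpret product_sigma_finite "\<lambda>_. lborel :: real measure" ..
  have "f (\<lambda>_. undefined) * g (\<lambda>_. undefined) \<le> (h (\<lambda>i\<in>{}. undefined))\<^sup>2"
    using empty(4)[of "\<lambda>_. undefined" "\<lambda>_. undefined"] by simp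
  then show ?case by (simp add: nn_integral_empty)
next
  case (insert i I)
  interpret product_sigma_finite "\<lambda>_. lborel :: real measure" ..
  interpret I: finite_product_sigma_finite "\<lambda>_. lborel :: real measure" I
    by standard (use insert in auto)
  note [measurable] = insert.prems(1-3)
  let ?M = "PiM I (\<lambda>_. lborel :: real measure)"
  have meas: "(\<lambda>y. \<integral>\<^sup>+x. k (x(i := y)) \<partial>?M) \<in> borel_measurable borel"
    if [measurable]: "k \<in> borel_measurable (PiM (insert i I) (\<lambda>_. lborel))" for k :: "('i \<Rightarrow> real) \<Rightarrow> ennreal"
    by (rule I.borel_measurable_nn_integral) (simp add: split_def)
  have sec: "(\<lambda>x. k (x(i := y))) \<in> borel_measurable ?M"
    if [measurable]: "k \<in> borel_measurable (PiM (insert i I) (\<lambda>_. lborel))" for k :: "('i \<Rightarrow> real) \<Rightarrow> ennreal" and y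
    by (rule measurable_compose[OF _ that]) (rule measurable_fun_upd[where J=I], auto)
  have "(\<integral>\<^sup>+y. (\<integral>\<^sup>+x. f (x(i := y)) \<partial>?M) \<partial>lborel) * (\<integral>\<^sup>+y. (\<integral>\<^sup>+x. g (x(i := y)) \<partial>?M) \<partial>lborel)
    \<le> (\<integral>\<^sup>+y. (\<integral>\<^sup>+x. h (x(i := y)) \<partial>?M) \<partial>lborel)\<^sup>2"
  proof (rule prekopa_leindler_midpoint_real)
    fix a b :: real
    show "(\<integral>\<^sup>+x. f (x(i := a)) \<partial>?M) * (\<integral>\<^sup>+x. g (x(i := b)) \<partial>?M) \<le> (\<integral>\<^sup>+x. h (x(i := (a + b) / 2)) \<partial>?M)\<^sup>2"
    proof (rule insert.IH)
      fix x y :: "'i \<Rightarrow> real" assume xy: "x \<in> extensional I" "y \<in> extensional I"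
      have "f (x(i := a)) * g (y(i := b)) \<le> (h (\<lambda>j\<in>insert i I. ((x(i := a)) j + (y(i := b)) j) / 2))\<^sup>2"
        using xy by (intro insert.prems(4)) (auto simp: extensional_def)
      moreover have "(\<lambda>j\<in>insert i I. ((x(i := a)) j + (y(i := b)) j) / 2) = (\<lambda>j\<in>I. (x j + y j) / 2)(i := (a + b) / 2)"
        using insert.hyps by (auto simp: fun_eq_iff)
      ultimately show "f (x(i := a)) * g (y(i := b)) \<le> (h ((\<lambda>j\<in>I. (x j + y j) / 2)(i := (a + b) / 2)))\<^sup>2"
        by simp
    qed (rule sec, fact)+
  qed (auto intro: meas)
  then show ?case
    using insert.hyps by (simp add: product_nn_integral_insert_rev)
qed

lemma prekopa_leindler_midpoint:
  fixes f g h :: "'a::euclidean_space \<Rightarrow> ennreal"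
  assumes [measurable]: "f \<in> borel_measurable borel" "g \<in> borel_measurable borel" "h \<in> borel_measurable borel"
    and le: "\<And>x y. f x * g y \<le> (h ((1/2) *\<^sub>R (x + y)))\<^sup>2"
  shows "(\<integral>\<^sup>+x. f x \<partial>lborel) * (\<integral>\<^sup>+x. g x \<partial>lborel) \<le> (\<integral>\<^sup>+x. h x \<partial>lborel)\<^sup>2"
proof -
  let ?P = "PiM (Basis :: 'a set) (\<lambda>_. lborel :: real measure)"
  let ?e = "\<lambda>x. \<Sum>b\<in>Basis. x b *\<^sub>R (b :: 'a)"
  have eq: "(\<integral>\<^sup>+x. k x \<partial>lborel) = (\<integral>\<^sup>+x. k (?e x) \<partial>?P)"
    if [measurable]: "k \<in> borel_measurable borel" for k :: "'a \<Rightarrow> ennreal"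
    by (subst lborel_eq) (simp add: nn_integral_distr)
  have "(\<integral>\<^sup>+x. f (?e x) \<partial>?P) * (\<integral>\<^sup>+x. g (?e x) \<partial>?P) \<le> (\<integral>\<^sup>+x. h (?e x) \<partial>?P)\<^sup>2"
  proof (rule prekopa_leindler_midpoint_PiM)
    fix x y :: "'a \<Rightarrow> real"
    have "?e (\<lambda>i\<in>Basis. (x i + y i) / 2) = (1/2) *\<^sub>R (?e x + ?e y)"
      by (simp add: sum.distrib[symmetric] scaleR_sum_right scaleR_add_left[symmetric] del: scaleR_add_left)
    then show "f (?e x) * g (?e y) \<le> (h (?e (\<lambda>i\<in>Basis. (x i + y i) / 2)))\<^sup>2"
      using le[of "?e x" "?e y"] by simp
  qed auto
  then show ?thesis by (simp add: eq)
qed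

lemma measure_midpoint_log_concave:
  fixes A B C :: "'a::euclidean_space set"
  assumes "compact A" "compact B" "compact C"
    and sub: "\<And>x y. x \<in> A \<Longrightarrow> y \<in> B \<Longrightarrow> (1/2) *\<^sub>R (x + y) \<in> C"
  shows "measure lborel A * measure lborel B \<le> (measure lborel C)\<^sup>2"
proof -
  have [measurable]: "A \<in> sets borel" "B \<in> sets borel" "C \<in> sets borel"
    using assms by (auto intro: borel_compact)
  have fin: "emeasure lborel K = ennreal (measure lborel K)" if "compact K" for K :: "'a set"
    using emeasure_compact_finite[OF that] by (intro emeasure_eq_ennreal_measure) auto
  have "(\<integral>\<^sup>+x. indicator A x \<partial>lborel) * (\<integral>\<^sup>+x. indicator B x \<partial>lborel) \<le> (\<integral>\<^sup>+x. indicator C x \<partial>(lborel :: 'a measure))\<^sup>2"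
    using sub by (intro prekopa_leindler_midpoint) (auto simp: indicator_def)
  then show ?thesis
    using assms by (simp add: fin ennreal_power flip: ennreal_mult)
qed

section \<open>Compact convex bodies\<close>

definition cbody :: "'a::euclidean_space set \<Rightarrow> bool" where
  "cbody K \<longleftrightarrow> compact K \<and> convex K \<and> K \<noteq> {}"

definition dilate :: "real \<Rightarrow> 'a::real_vector set \<Rightarrow> 'a set" where
  "dilate c K = (\<lambda>x. c *\<^sub>R x) ` K"

text \<open>The multiplier \<open>r\<close> is kept apart from the direction \<open>v\<close>
  because all later expansions are in the lengths of fixed edges.\<close>

definition seg :: "'a::real_vector \<Rightarrow> real \<Rightarrow> 'a set" where
  "seg v r = (\<lambda>c. c *\<^sub>R v) ` {0..r}"

lemma set_plus_eq: "A + B = {x + y |x y. x \<in> A \<and> y \<in> B}"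
  by (auto simp: set_plus_def)

lemma compact_set_plus: "compact A \<Longrightarrow> compact B \<Longrightarrow> compact (A + B)"
  for A B :: "'a::real_normed_vector set"
  using compact_sums[of A B] by (simp add: set_plus_eq)

lemma cbody_plus [simp]: "cbody A \<Longrightarrow> cbody B \<Longrightarrow> cbody (A + B)"
  by (auto simp: cbody_def compact_set_plus convex_set_plus)

lemma cbody_dilate [simp]: "cbody A \<Longrightarrow> cbody (dilate c A)"
  by (auto simp: cbody_def dilate_def intro: compact_scaling convex_scaling)

lemma cbody_translation [simp]: "cbody A \<Longrightarrow> cbody ((+) a ` A)"
  by (auto simp: cbody_def intro: compact_translation convex_translation)

lemma cbody_singleton [simp]: "cbody {a}"
  by (auto simp: cbody_def)

lemma cbody_cball [simp]: "0 \<le> r \<Longrightarrow> cbody (cball a r)"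
  by (auto simp: cbody_def)

lemma cbody_seg [simp]: "0 \<le> r \<Longrightarrow> cbody (seg v r)"
proof -
  assume "0 \<le> r"
  moreover have "compact (seg v r)"
    unfolding seg_def by (intro compact_continuous_image continuous_intros) auto
  moreover have "convex (seg v r)"
    unfolding seg_def by (intro convex_linear_image linearI) (auto simp: algebra_simps)
  ultimately show "cbody (seg v r)" by (auto simp: cbody_def seg_def)
qed

lemma cbody_sum [simp]: "(\<And>i. i \<in> I \<Longrightarrow> cbody (A i)) \<Longrightarrow> cbody (\<Sum>i\<in>I. A i)"
  by (induction I rule: infinite_finite_induct) auto

lemma dilate_plus: "dilate c (A + B) = dilate c A + dilate c B"
  by (force simp: dilate_def set_plus_def scaleR_add_right)

lemma dilate_dilate [simp]: "dilate a (dilate b K) = dilate (a * b) K"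
  by (auto simp: dilate_def image_image)

lemma dilate_1 [simp]: "dilate 1 K = K"
  by (auto simp: dilate_def)

lemma dilate_zero_set: "dilate c (0::'a::real_vector set) = 0"
  by (auto simp: dilate_def)

lemma dilate_sum: "dilate c (\<Sum>i\<in>I. A i) = (\<Sum>i\<in>I. dilate c (A i))"
  by (induction I rule: infinite_finite_induct) (simp_all add: dilate_plus dilate_zero_set del: set_zero)

lemma dilate_seg:
  assumes "0 \<le> c" "0 \<le> r"
  shows "dilate c (seg v r) = seg v (c * r)"
proof -
  have eq: "(*) c ` {0..r} = {0..c * r}"
    using assms by (cases "c = 0") (auto simp: image_mult_atLeastAtMost)
  have "dilate c (seg v r) = (\<lambda>x. x *\<^sub>R v) ` ((*) c ` {0..r})"
    by (simp add: dilate_def seg_def image_image)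
  then show ?thesis unfolding eq by (simp add: seg_def)
qed

lemma seg_plus: "0 \<le> r \<Longrightarrow> 0 \<le> r' \<Longrightarrow> seg v r + seg v r' = seg v (r + r')"
proof -
  assume r: "0 \<le> r" "0 \<le> r'"
  have "x \<in> seg v r + seg v r'" if x: "x \<in> seg v (r + r')" for x
  proof -
    obtain c where c: "c \<in> {0..r + r'}" "x = c *\<^sub>R v" using x unfolding seg_def by blast
    have "x = min c r *\<^sub>R v + (c - min c r) *\<^sub>R v" using c(2) by (simp flip: scaleR_add_left)
    moreover have "min c r \<in> {0..r}" "c - min c r \<in> {0..r'}" using c(1) r by auto
    ultimately show ?thesis unfolding seg_def by (metis imageI set_plus_intro)
  qed
  moreover have "x \<in> seg v (r + r')" if x: "x \<in> seg v r + seg v r'" for x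
  proof -
    obtain c d where "x = c *\<^sub>R v + d *\<^sub>R v" "0 \<le> c" "c \<le> r" "0 \<le> d" "d \<le> r'"
      using x by (auto simp: seg_def set_plus_def)
    then show ?thesis unfolding seg_def by (intro image_eqI[of _ _ "c + d"]) (auto simp: scaleR_add_left)
  qed
  ultimately show ?thesis by blast
qed

text \<open>The right-hand side is the neutral element of Minkowski addition, the singleton of the
  origin.\<close>

lemma seg_0 [simp]: "seg v 0 = 0"
  by (auto simp: seg_def)

lemma zero_in_seg [simp]: "0 \<le> r \<Longrightarrow> 0 \<in> seg v r"
  by (auto simp: seg_def image_iff intro!: bexI[of _ 0])

text \<open>Convexity is what gives the inclusion from left to right: a sum of two points is
  \<open>a + b\<close> times their convex combination with weights \<open>a / (a + b)\<close> and
  \<open>b / (a + b)\<close>.\<close>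

lemma dilate_add:
  assumes "convex K" "0 \<le> a" "0 \<le> b"
  shows "dilate a K + dilate b K = dilate (a + b) K"
proof (cases "a + b = 0")
  case True
  then have "a = 0" "b = 0" using assms by auto
  then show ?thesis by (auto simp: dilate_def set_plus_def)
next
  case False
  then have ab: "a + b > 0" using assms by auto
  have "x \<in> dilate (a + b) K" if x: "x \<in> dilate a K + dilate b K" for x
  proof -
    obtain y z where yz: "y \<in> K" "z \<in> K" "x = a *\<^sub>R y + b *\<^sub>R z"
      using x by (auto simp: dilate_def set_plus_def)
    have "(a / (a + b)) *\<^sub>R y + (b / (a + b)) *\<^sub>R z \<in> K"
      using assms ab yz by (intro convexD) (auto simp: add_divide_distrib[symmetric])
    moreover have "x = (a + b) *\<^sub>R ((a / (a + b)) *\<^sub>R y + (b / (a + b)) *\<^sub>R z)"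
      using ab yz by (simp add: scaleR_add_right)
    ultimately show ?thesis by (auto simp: dilate_def)
  qed
  moreover have "dilate (a + b) K \<subseteq> dilate a K + dilate b K"
    by (auto simp: dilate_def set_plus_def scaleR_add_left)
  ultimately show ?thesis by blast
qed

lemma dilate_mono_star:
  assumes "convex K" "0 \<in> K" "0 \<le> a" "a \<le> b"
  shows "dilate a K \<subseteq> dilate b K"
proof -
  have "dilate b K = dilate a K + dilate (b - a) K" using assms by (subst dilate_add) auto
  moreover have "0 \<in> dilate (b - a) K" using assms by (force simp: dilate_def)
  ultimately show ?thesis using set_zero_plus2[of "dilate (b - a) K" "dilate a K"] by (simp add: add.commute)
qed

lemma translation_plus: "(+) a ` A + B = (+) a ` (A + B)" for A :: "'a::ab_group_add set"
  by (force simp: set_plus_def add.assoc)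

lemma singleton_plus: "{a} + B = (+) a ` B" for B :: "'a::ab_group_add set"
  by (auto simp: set_plus_def)

lemma cbody_measure [simp]:
  assumes "cbody K"
  shows "K \<in> sets borel" "emeasure lborel K = ennreal (measure lborel K)" "K \<in> fmeasurable lborel"
proof -
  have "compact K" using assms by (auto simp: cbody_def)
  then show "K \<in> sets borel" "emeasure lborel K = ennreal (measure lborel K)" "K \<in> fmeasurable lborel"
    using emeasure_compact_finite[of K]
    by (auto intro!: borel_compact emeasure_eq_ennreal_measure fmeasurableI)
qed

lemma measure_dilate: "cbody K \<Longrightarrow> c > 0 \<Longrightarrow> measure lborel (dilate c K) = c ^ DIM('a) * measure lborel K"
  for K :: "'a::euclidean_space set"
proof -
  assume K: "cbody K" "c > 0"
  have "measure lebesgue (dilate c K) = c ^ DIM('a) * measure lebesgue K"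
    using measure_lebesgue_affine[of c 0 K] K by (simp add: dilate_def)
  then show ?thesis using K cbody_measure(1)[of K] cbody_measure(1)[of "dilate c K"] by simp
qed

lemma measure_translate:
  fixes A :: "'a::euclidean_space set"
  assumes "A \<in> sets borel" "(+) a ` A \<in> sets borel"
  shows "measure lborel ((+) a ` A) = measure lborel A"
  using measure_translation[of a A] assms by simp

text \<open>On every line parallel to \<open>v\<close>, adding a segment to a convex set extends it
  at the far end only. The piece gained therefore depends on the previous length only through a
  shift.\<close>

lemma seg_increment_translate:
  fixes v :: "'a::real_vector"
  assumes K: "convex K" and r: "0 \<le> u" "0 \<le> d" "0 \<le> h"
  shows "(K + seg v (u + d + h)) - (K + seg v (u + d)) = (+) (d *\<^sub>R v) ` ((K + seg v (u + h)) - (K + seg v u))"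
proof -
  have mem: "x \<in> K + seg v r \<longleftrightarrow> (\<exists>c. 0 \<le> c \<and> c \<le> r \<and> x - c *\<^sub>R v \<in> K)" for x r
  proof
    assume "x \<in> K + seg v r"
    then obtain k c where "k \<in> K" "0 \<le> c" "c \<le> r" "x = k + c *\<^sub>R v"
      by (auto simp: set_plus_def seg_def)
    then show "\<exists>c. 0 \<le> c \<and> c \<le> r \<and> x - c *\<^sub>R v \<in> K" by auto
  next
    assume "\<exists>c. 0 \<le> c \<and> c \<le> r \<and> x - c *\<^sub>R v \<in> K"
    then obtain c where c: "0 \<le> c" "c \<le> r" "x - c *\<^sub>R v \<in> K" by blast
    then have "(x - c *\<^sub>R v) + c *\<^sub>R v \<in> K + seg v r"
      by (intro set_plus_intro) (auto simp: seg_def)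
    then show "x \<in> K + seg v r" by simp
  qed
  have "x + d *\<^sub>R v \<in> (K + seg v (u + d + h)) - (K + seg v (u + d)) \<longleftrightarrow> x \<in> (K + seg v (u + h)) - (K + seg v u)" for x
  proof
    assume x: "x \<in> (K + seg v (u + h)) - (K + seg v u)"
    then obtain w where w: "0 \<le> w" "w \<le> u + h" "x - w *\<^sub>R v \<in> K" by (auto simp: mem)
    with x have "u < w" by (auto simp: mem not_le[symmetric])
    have "x + d *\<^sub>R v \<in> K + seg v (u + d + h)"
      unfolding mem using w r by (intro exI[of _ "w + d"]) (auto simp: algebra_simps)
    moreover have "x + d *\<^sub>R v \<notin> K + seg v (u + d)"
    proof
      assume "x + d *\<^sub>R v \<in> K + seg v (u + d)"
      then obtain w' where w': "0 \<le> w'" "w' \<le> u + d" "x - (w' - d) *\<^sub>R v \<in> K"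
        by (auto simp: mem algebra_simps)
      \<comment> \<open>If \<open>w' < d\<close>, then 0 lies between \<open>w' - d\<close> and
        \<open>w\<close>, so convexity of \<open>K\<close> puts \<open>x\<close> itself into
        \<open>K\<close>.\<close>
      have "x - max 0 (w' - d) *\<^sub>R v \<in> K"
      proof (cases "w' - d \<ge> 0")
        case False
        define a where "a = w' - d"
        define b where "b = w / (w - a)"
        have a: "a < 0" "w - a > 0" using False w by (auto simp: a_def)
        have b: "0 \<le> b" "b \<le> 1" using a w by (auto simp: b_def)
        have "b *\<^sub>R (x - a *\<^sub>R v) + (1 - b) *\<^sub>R (x - w *\<^sub>R v) \<in> K"
          using b w w'(3) K by (intro convexD) (auto simp: a_def)
        also have "b *\<^sub>R (x - a *\<^sub>R v) + (1 - b) *\<^sub>R (x - w *\<^sub>R v) = x - (b * a + (1 - b) * w) *\<^sub>R v"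
          by (simp add: algebra_simps)
        also have "b * a + (1 - b) * w = w - b * (w - a)" by (simp add: algebra_simps)
        also have "\<dots> = 0" using a by (simp add: b_def)
        finally show ?thesis using False by simp
      qed (use w' in auto)
      then have "x \<in> K + seg v u" unfolding mem using w' r by (intro exI[of _ "max 0 (w' - d)"]) auto
      with x show False by simp
    qed
    ultimately show "x + d *\<^sub>R v \<in> (K + seg v (u + d + h)) - (K + seg v (u + d))" by simp
  next
    assume x: "x + d *\<^sub>R v \<in> (K + seg v (u + d + h)) - (K + seg v (u + d))"
    then obtain w where w: "0 \<le> w" "w \<le> u + d + h" "x + d *\<^sub>R v - w *\<^sub>R v \<in> K" by (auto simp: mem)
    with x have "u + d < w" by (auto simp: mem not_le[symmetric])
    have "x \<in> K + seg v (u + h)"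
      unfolding mem using w r \<open>u + d < w\<close> by (intro exI[of _ "w - d"]) (auto simp: algebra_simps)
    moreover have "x \<notin> K + seg v u"
    proof
      assume "x \<in> K + seg v u"
      then obtain w' where "0 \<le> w'" "w' \<le> u" "x - w' *\<^sub>R v \<in> K" by (auto simp: mem)
      then have "x + d *\<^sub>R v \<in> K + seg v (u + d)"
        unfolding mem using r by (intro exI[of _ "w' + d"]) (auto simp: algebra_simps)
      with x show False by simp
    qed
    ultimately show "x \<in> (K + seg v (u + h)) - (K + seg v u)" by simp
  qed
  note * = this
  show ?thesis
  proof (intro set_eqI iffI)
    fix y assume "y \<in> (K + seg v (u + d + h)) - (K + seg v (u + d))"
    then have "y - d *\<^sub>R v \<in> (K + seg v (u + h)) - (K + seg v u)"
      using *[of "y - d *\<^sub>R v"] by simp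
    then show "y \<in> (+) (d *\<^sub>R v) ` ((K + seg v (u + h)) - (K + seg v u))"
      by (intro image_eqI[of _ _ "y - d *\<^sub>R v"]) simp_all
  next
    fix y assume "y \<in> (+) (d *\<^sub>R v) ` ((K + seg v (u + h)) - (K + seg v u))"
    then obtain x where "x \<in> (K + seg v (u + h)) - (K + seg v u)" "y = x + d *\<^sub>R v"
      by (auto simp: add.commute)
    then show "y \<in> (K + seg v (u + d + h)) - (K + seg v (u + d))"
      using *[of x] by simp
  qed
qed

text \<open>Cauchy's functional equation: it is exact at rational arguments, and monotonicity
  squeezes \<open>r\<close> between neighbouring multiples of \<open>1 / Suc n\<close>.\<close>

lemma additive_mono_linear:
  fixes g :: "real \<Rightarrow> real"
  assumes add: "\<And>x y. 0 \<le> x \<Longrightarrow> 0 \<le> y \<Longrightarrow> g (x + y) = g x + g y"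
    and mono: "\<And>x y. 0 \<le> x \<Longrightarrow> x \<le> y \<Longrightarrow> g x \<le> g y" and r: "0 \<le> r"
  shows "g r = r * g 1"
proof -
  have g0: "g 0 = 0" using add[of 0 0] by simp
  have nat: "g (real n * x) = real n * g x" if "0 \<le> x" for n x
    using that by (induction n) (auto simp: g0 add algebra_simps)
  have g1: "g 1 \<ge> 0" using mono[of 0 1] g0 by simp
  have "\<bar>g r - r * g 1\<bar> \<le> g 1 * inverse (real (Suc n))" for n
  proof -
    let ?n = "real (Suc n)"
    define k where "k = nat \<lfloor>?n * r\<rfloor>"
    have k: "real k \<le> ?n * r" "?n * r \<le> real (Suc k)" using r by (auto simp: k_def) linarith+
    have q: "g (real j / ?n) = real j * g 1 / ?n" for j
      using nat[of "1 / ?n" j] nat[of "1 / ?n" "Suc n"] by (simp add: field_simps)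
    have "g (real k / ?n) \<le> g r" "g r \<le> g (real (Suc k) / ?n)"
      using k r by (auto intro!: mono simp: field_simps)
    then have 1: "real k * g 1 / ?n \<le> g r" "g r \<le> real (Suc k) * g 1 / ?n" unfolding q by auto
    have "real k * g 1 / ?n \<le> r * g 1" "r * g 1 \<le> real (Suc k) * g 1 / ?n"
      using mult_right_mono[OF k(1) g1] mult_right_mono[OF k(2) g1] by (auto simp: field_simps)
    with 1 show ?thesis by (auto simp: abs_le_iff field_simps)
  qed
  moreover have "(\<lambda>n. g 1 * inverse (real (Suc n))) \<longlonglongrightarrow> g 1 * 0"
    by (intro tendsto_intros LIMSEQ_inverse_real_of_nat)
  ultimately have "\<bar>g r - r * g 1\<bar> \<le> g 1 * 0"
    by (intro LIMSEQ_le_const) auto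
  then show ?thesis by simp
qed

text \<open>The volume gained is additive in the length, because increments are translates of each
  other, and it is monotone; hence it is linear. This is the source of all polynomial behaviour
  below.\<close>

lemma measure_plus_seg:
  fixes K :: "'a::euclidean_space set"
  assumes K: "cbody K" and r: "0 \<le> r"
  shows "measure lborel (K + seg v r) = measure lborel K + r * (measure lborel (K + seg v 1) - measure lborel K)"
proof -
  let ?\<phi> = "\<lambda>r. measure lborel (K + seg v r)"
  have sub: "K + seg v a \<subseteq> K + seg v b" if "a \<le> b" for a b
    using that by (intro set_plus_mono2) (auto simp: seg_def)
  have diff: "measure lborel ((K + seg v b) - (K + seg v a)) = ?\<phi> b - ?\<phi> a" if "0 \<le> a" "a \<le> b" for a b
    using that K by (intro measure_Diff sub) (auto simp: less_top[symmetric])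
  have inc: "?\<phi> (d + h) - ?\<phi> d = ?\<phi> h - ?\<phi> 0" if "0 \<le> d" "0 \<le> h" for d h
  proof -
    have eq: "(K + seg v (d + h)) - (K + seg v d) = (+) (d *\<^sub>R v) ` ((K + seg v h) - (K + seg v 0))"
      using seg_increment_translate[of K 0 d h v] K that by (simp add: cbody_def)
    have "measure lborel ((K + seg v (d + h)) - (K + seg v d)) = measure lborel ((K + seg v h) - (K + seg v 0))"
      unfolding eq using K that
      by (intro measure_translate) (auto simp: eq[symmetric] simp del: seg_0)
    then show ?thesis using that by (simp add: diff del: seg_0)
  qed
  have "?\<phi> r - ?\<phi> 0 = r * (?\<phi> 1 - ?\<phi> 0)"
  proof (rule additive_mono_linear[of "\<lambda>r. ?\<phi> r - ?\<phi> 0"])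
    fix x y :: real assume "0 \<le> x" "0 \<le> y"
    then show "?\<phi> (x + y) - ?\<phi> 0 = ?\<phi> x - ?\<phi> 0 + (?\<phi> y - ?\<phi> 0)"
      using inc[of x y] by simp
  next
    fix x y :: real assume "0 \<le> x" "x \<le> y"
    then show "?\<phi> x - ?\<phi> 0 \<le> ?\<phi> y - ?\<phi> 0"
      using sub[of x y] K by (intro diff_right_mono measure_mono_fmeasurable) auto
  qed (use r in auto)
  then show ?thesis by simp
qed

section \<open>Functionals affine along segments\<close>

text \<open>These are the properties shared by volume and its iterated differences along segments,
  that is, by mixed volumes with \<open>k\<close> free arguments. The list is stable under
  \<open>dseg\<close>, which lowers the degree \<open>k\<close> by one, so that all arguments can be
  repeated at every order.\<close>

definition body_functional :: "nat \<Rightarrow> ('a::euclidean_space set \<Rightarrow> real) \<Rightarrow> bool" where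
  "body_functional k F \<longleftrightarrow>
    (\<forall>K. cbody K \<longrightarrow> 0 \<le> F K) \<and>
    (\<forall>K L. cbody K \<longrightarrow> cbody L \<longrightarrow> K \<subseteq> L \<longrightarrow> F K \<le> F L) \<and>
    (\<forall>K a. cbody K \<longrightarrow> F ((+) a ` K) = F K) \<and>
    (\<forall>K c. cbody K \<longrightarrow> 0 < c \<longrightarrow> F (dilate c K) = c ^ k * F K) \<and>
    (\<forall>K v r. cbody K \<longrightarrow> 0 \<le> r \<longrightarrow> F (K + seg v r) = F K + r * (F (K + seg v 1) - F K))"

text \<open>A body functional is affine along \<open>r \<mapsto> K + [0, r v]\<close>, so this difference is its derivative.\<close>

definition dseg :: "'a \<Rightarrow> ('a::euclidean_space set \<Rightarrow> real) \<Rightarrow> 'a set \<Rightarrow> real" where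
  "dseg v F K = F (K + seg v 1) - F K"

text \<open>For a body functional this is the derivative in the direction of the zonotope with edge
  set \<open>V\<close>.\<close>

definition dzon :: "'a set \<Rightarrow> ('a::euclidean_space set \<Rightarrow> real) \<Rightarrow> 'a set \<Rightarrow> real" where
  "dzon V F K = (\<Sum>v\<in>V. dseg v F K)"

definition midpoint_log_concave :: "('a::euclidean_space set \<Rightarrow> real) \<Rightarrow> bool" where
  "midpoint_log_concave F \<longleftrightarrow>
    (\<forall>X Y. cbody X \<longrightarrow> cbody Y \<longrightarrow> F X * F Y \<le> (F (dilate (1/2) (X + Y)))\<^sup>2)"

definition root_superadditive :: "nat \<Rightarrow> ('a::euclidean_space set \<Rightarrow> real) \<Rightarrow> bool" where
  "root_superadditive k F \<longleftrightarrow>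
    (\<forall>X Y. cbody X \<longrightarrow> cbody Y \<longrightarrow> root k (F X) + root k (F Y) \<le> root k (F (X + Y)))"

context
  fixes k F assumes F: "body_functional k F"
begin

lemma bf_nonneg: "cbody K \<Longrightarrow> 0 \<le> F K"
  using F by (auto simp: body_functional_def)

lemma bf_mono: "cbody K \<Longrightarrow> cbody L \<Longrightarrow> K \<subseteq> L \<Longrightarrow> F K \<le> F L"
  using F by (auto simp: body_functional_def)

lemma bf_translate: "cbody K \<Longrightarrow> F ((+) a ` K) = F K"
  using F by (auto simp: body_functional_def)

lemma bf_dilate: "cbody K \<Longrightarrow> 0 < c \<Longrightarrow> F (dilate c K) = c ^ k * F K"
  using F by (auto simp: body_functional_def)

lemma bf_seg: "cbody K \<Longrightarrow> 0 \<le> r \<Longrightarrow> F (K + seg v r) = F K + r * dseg v F K"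
  using F unfolding body_functional_def dseg_def by blast

lemma dseg_nonneg: "cbody K \<Longrightarrow> 0 \<le> dseg v F K"
proof -
  assume K: "cbody K"
  have "K \<subseteq> K + seg v 1" using set_zero_plus2[of "seg v 1" K] by (simp add: add.commute)
  then show ?thesis using K bf_mono[of K "K + seg v 1"] by (simp add: dseg_def)
qed

text \<open>If the slope at \<open>K\<close> exceeded the slope at \<open>L\<close>, a sufficiently
  long segment would make \<open>F\<close> larger on the smaller of the two sums.\<close>

lemma dseg_mono:
  assumes "cbody K" "cbody L" "K \<subseteq> L"
  shows "dseg v F K \<le> dseg v F L"
proof (rule ccontr)
  assume "\<not> ?thesis"
  then have pos: "0 < dseg v F K - dseg v F L" by simp
  obtain r where r: "r \<ge> 0" "F L < F K + r * (dseg v F K - dseg v F L)"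
  proof
    let ?r = "(F L - F K + 1) / (dseg v F K - dseg v F L)"
    show "?r \<ge> 0" using pos assms bf_mono[OF assms] by (intro divide_nonneg_pos) auto
    show "F L < F K + ?r * (dseg v F K - dseg v F L)" using pos by simp
  qed
  have "F (K + seg v r) \<le> F (L + seg v r)"
    using assms r by (intro bf_mono set_plus_mono2) auto
  then show False using assms r by (simp add: bf_seg algebra_simps)
qed

lemma dseg_seg:
  assumes "cbody K" "0 \<le> r"
  shows "dseg v F (K + seg v r) = dseg v F K"
proof -
  have "dseg v F (K + seg v r) = F (K + seg v (r + 1)) - F (K + seg v r)"
    using assms by (simp add: dseg_def add.assoc seg_plus)
  then show ?thesis using assms by (simp add: bf_seg algebra_simps)
qed

text \<open>An affine function has no second difference. This removes the diagonal terms from the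
  quadratic forms below and cuts exponential series down to two terms.\<close>

lemma dseg_dseg_zero: "cbody K \<Longrightarrow> dseg v (dseg v F) K = 0"
  unfolding dseg_def[of v "dseg v F"] by (simp add: dseg_seg)

end

lemma dseg_commute: "dseg v (dseg w F) = dseg w (dseg v F)"
  by (rule ext) (simp add: dseg_def algebra_simps)

lemma dseg_sum: "dseg v (\<lambda>K. \<Sum>i\<in>I. F i K) K = (\<Sum>i\<in>I. dseg v (F i) K)"
  by (simp add: dseg_def sum_subtractf)

lemma dseg_dzon: "dseg v (dzon V F) = dzon V (dseg v F)"
proof
  fix K
  have "dseg v (dzon V F) K = (\<Sum>w\<in>V. dseg v (dseg w F) K)"
    by (simp add: dzon_def[abs_def] dseg_sum)
  also have "\<dots> = dzon V (dseg v F) K"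
    unfolding dzon_def by (intro sum.cong refl fun_cong[OF dseg_commute])
  finally show "dseg v (dzon V F) K = dzon V (dseg v F) K" .
qed

text \<open>The degree drops by one because a unit segment added to \<open>dilate c K\<close> is the
  dilate of a segment of length \<open>1 / c\<close> added to \<open>K\<close>.\<close>

lemma body_functional_dseg:
  fixes F :: "'a::euclidean_space set \<Rightarrow> real"
  assumes F: "body_functional (Suc k) F"
  shows "body_functional k (dseg v F)"
  unfolding body_functional_def
proof (intro conjI allI impI)
  fix K :: "'a set" and a assume K: "cbody K"
  have "dseg v F ((+) a ` K) = F ((+) a ` (K + seg v 1)) - F ((+) a ` K)"
    by (simp add: dseg_def translation_plus)
  then show "dseg v F ((+) a ` K) = dseg v F K"
    using K by (simp add: bf_translate[OF F] dseg_def)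
next
  fix K :: "'a set" and c :: real assume K: "cbody K" "0 < c"
  have "F (dilate c K) + 1 * dseg v F (dilate c K) = F (dilate c K + seg v 1)"
    using bf_seg[OF F, of "dilate c K" 1 v] K by simp
  also have "\<dots> = F (dilate c (K + seg v (1 / c)))"
    using K by (simp add: dilate_plus dilate_seg)
  also have "\<dots> = c ^ Suc k * (F K + (1 / c) * dseg v F K)"
    using K by (simp add: bf_dilate[OF F] bf_seg[OF F])
  also have "\<dots> = F (dilate c K) + c ^ k * dseg v F K"
    using K by (simp add: bf_dilate[OF F] algebra_simps)
  finally show "dseg v F (dilate c K) = c ^ k * dseg v F K" by simp
next
  fix K :: "'a set" and w r assume K: "cbody K" "0 \<le> (r::real)"
  have "dseg v F (K + seg w r) = F (K + seg v 1 + seg w r) - F (K + seg w r)"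
    by (simp add: dseg_def ac_simps)
  also have "\<dots> = dseg v F K + r * (dseg w F (K + seg v 1) - dseg w F K)"
    unfolding dseg_def[of v F K] using bf_seg[OF F, of "K + seg v 1" r w] bf_seg[OF F, of K r w] K
    by (simp add: right_diff_distrib)
  also have "dseg w F (K + seg v 1) - dseg w F K = dseg v F (K + seg w 1) - dseg v F K"
    by (simp add: dseg_def ac_simps)
  finally show "dseg v F (K + seg w r) = dseg v F K + r * (dseg v F (K + seg w 1) - dseg v F K)" .
qed (use dseg_nonneg[OF F] dseg_mono[OF F] in auto)

lemma body_functional_sum:
  fixes F :: "'i \<Rightarrow> 'a::euclidean_space set \<Rightarrow> real"
  assumes F: "\<And>i. i \<in> I \<Longrightarrow> body_functional k (F i)"
  shows "body_functional k (\<lambda>K. \<Sum>i\<in>I. F i K)"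
  unfolding body_functional_def
proof (intro conjI allI impI)
  fix K :: "'a set" and w r assume K: "cbody K" "0 \<le> (r::real)"
  have "(\<Sum>i\<in>I. F i (K + seg w r)) = (\<Sum>i\<in>I. F i K + r * (F i (K + seg w 1) - F i K))"
    using K by (intro sum.cong refl bf_seg[OF F, unfolded dseg_def])
  then show "(\<Sum>i\<in>I. F i (K + seg w r)) = (\<Sum>i\<in>I. F i K) + r * ((\<Sum>i\<in>I. F i (K + seg w 1)) - (\<Sum>i\<in>I. F i K))"
    by (simp only: sum.distrib sum_subtractf[symmetric] sum_distrib_left)
next
  fix K :: "'a set" assume "cbody K"
  then show "0 \<le> (\<Sum>i\<in>I. F i K)" by (intro sum_nonneg bf_nonneg[OF F])
next
  fix K L :: "'a set" assume "cbody K" "cbody L" "K \<subseteq> L"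
  then show "(\<Sum>i\<in>I. F i K) \<le> (\<Sum>i\<in>I. F i L)" by (intro sum_mono bf_mono[OF F])
next
  fix K :: "'a set" and a assume "cbody K"
  then show "(\<Sum>i\<in>I. F i ((+) a ` K)) = (\<Sum>i\<in>I. F i K)" by (intro sum.cong refl bf_translate[OF F])
next
  fix K :: "'a set" and c :: real assume "cbody K" "0 < c"
  then show "(\<Sum>i\<in>I. F i (dilate c K)) = c ^ k * (\<Sum>i\<in>I. F i K)"
    unfolding sum_distrib_left by (intro sum.cong refl bf_dilate[OF F])
qed

lemma body_functional_dzon: "body_functional (Suc k) F \<Longrightarrow> body_functional k (dzon V F)"
  unfolding dzon_def[abs_def] by (intro body_functional_sum body_functional_dseg)

lemma body_functional_measure:
  "body_functional DIM('a) (\<lambda>K::'a::euclidean_space set. measure lborel K)"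
  unfolding body_functional_def
proof (intro conjI allI impI)
  fix K L :: "'a set" assume "cbody K" "cbody L" "K \<subseteq> L"
  then show "measure lborel K \<le> measure lborel L" by (intro measure_mono_fmeasurable) auto
next
  fix K :: "'a set" and a assume "cbody K"
  then show "measure lborel ((+) a ` K) = measure lborel K" by (intro measure_translate) auto
qed (auto simp: measure_dilate intro: measure_plus_seg)

lemma midpoint_log_concave_measure:
  "midpoint_log_concave (\<lambda>K::'a::euclidean_space set. measure lborel K)"
  unfolding midpoint_log_concave_def
proof (intro allI impI)
  fix X Y :: "'a set" assume "cbody X" "cbody Y"
  moreover have "cbody (dilate (1/2) (X + Y))" using calculation by simp
  ultimately show "measure lborel X * measure lborel Y \<le> (measure lborel (dilate (1/2) (X + Y)))\<^sup>2"
    unfolding cbody_def by (intro measure_midpoint_log_concave) (auto simp: dilate_def)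
qed

text \<open>\<open>F (X + seg v R) / R\<close> tends to \<open>dseg v F X\<close> as
  \<open>R\<close> grows. Adding the same segment to \<open>X\<close>, to \<open>Y\<close> and to
  their midpoint preserves the midpoint relation, so the inequality survives division by the square
  of \<open>R\<close> and the limit.\<close>

lemma midpoint_log_concave_dseg:
  fixes F :: "'a::euclidean_space set \<Rightarrow> real"
  assumes F: "body_functional (Suc k) F" and lc: "midpoint_log_concave F"
  shows "midpoint_log_concave (dseg v F)"
  unfolding midpoint_log_concave_def
proof (intro allI impI)
  fix X Y :: "'a set" assume XY: "cbody X" "cbody Y"
  let ?M = "dilate (1/2) (X + Y)"
  have *: "(F X / R + dseg v F X) * (F Y / R + dseg v F Y) \<le> (F ?M / R + dseg v F ?M)\<^sup>2" if R: "R > 0" for R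
  proof -
    have "dilate (1/2) ((X + seg v R) + (Y + seg v R)) = dilate (1/2) ((X + Y) + (seg v R + seg v R))"
      by (simp add: ac_simps)
    also have "\<dots> = ?M + seg v R"
      using R by (simp add: seg_plus dilate_plus dilate_seg)
    finally have "F (X + seg v R) * F (Y + seg v R) \<le> (F (?M + seg v R))\<^sup>2"
      using lc XY R unfolding midpoint_log_concave_def by (metis cbody_plus cbody_seg less_imp_le)
    then have "(F X + R * dseg v F X) * (F Y + R * dseg v F Y) \<le> (F ?M + R * dseg v F ?M)\<^sup>2"
      using XY R by (simp add: bf_seg[OF F])
    then have "(F X + R * dseg v F X) * (F Y + R * dseg v F Y) / R\<^sup>2 \<le> (F ?M + R * dseg v F ?M)\<^sup>2 / R\<^sup>2"
      by (rule divide_right_mono) simp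
    then show ?thesis using R by (simp add: power2_eq_square field_simps)
  qed
  have lim: "((\<lambda>R. a / R + b) \<longlongrightarrow> 0 + b) at_top" for a b :: real
    by (intro tendsto_add tendsto_const tendsto_divide_0[OF tendsto_const]
      filterlim_at_top_imp_at_infinity filterlim_ident)
  have "(0 + dseg v F X) * (0 + dseg v F Y) \<le> (0 + dseg v F ?M)\<^sup>2"
    by (rule tendsto_le[OF _ tendsto_power[OF lim] tendsto_mult[OF lim lim]])
      (auto intro: eventually_mono[OF eventually_gt_at_top[of 0] *])
  then show "dseg v F X * dseg v F Y \<le> (dseg v F ?M)\<^sup>2" by simp
qed

text \<open>By homogeneity the root at the midpoint is at least the arithmetic mean of the two
  roots, hence at least their geometric mean.\<close>

lemma root_superadditive_imp_mlc:
  fixes F :: "'a::euclidean_space set \<Rightarrow> real"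
  assumes F: "body_functional k F" and k: "k > 0" and sa: "root_superadditive k F"
  shows "midpoint_log_concave F"
  unfolding midpoint_log_concave_def
proof (intro allI impI)
  fix X Y :: "'a set" assume XY: "cbody X" "cbody Y"
  define a b where "a = root k (F X)" and "b = root k (F Y)"
  have ab: "0 \<le> a" "0 \<le> b" "a ^ k = F X" "b ^ k = F Y"
    using XY k bf_nonneg[OF F] by (auto simp: a_def b_def)
  have "a + b \<le> root k (F (X + Y))"
    using sa XY unfolding root_superadditive_def a_def b_def by blast
  then have "(a + b) ^ k \<le> root k (F (X + Y)) ^ k" using ab by (intro power_mono) auto
  also have "\<dots> = F (X + Y)" using k XY bf_nonneg[OF F, of "X + Y"] by simp
  finally have 1: "((a + b) / 2) ^ k \<le> F (dilate (1/2) (X + Y))"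
    using XY by (simp add: bf_dilate[OF F] power_divide field_simps)
  have "F X * F Y = (a * b) ^ k" using ab by (simp add: power_mult_distrib)
  also have "\<dots> \<le> (((a + b) / 2)\<^sup>2) ^ k"
  proof (intro power_mono)
    have "0 \<le> (a - b)\<^sup>2" by simp
    then show "a * b \<le> ((a + b) / 2)\<^sup>2" by (simp add: power2_eq_square field_simps)
  qed (use ab in auto)
  also have "\<dots> = (((a + b) / 2) ^ k)\<^sup>2" by (simp flip: power_mult add: mult.commute)
  also have "\<dots> \<le> (F (dilate (1/2) (X + Y)))\<^sup>2" using 1 ab by (intro power_mono) auto
  finally show "F X * F Y \<le> (F (dilate (1/2) (X + Y)))\<^sup>2" .
qed

section \<open>Combinations of three bodies, and the passage from log-concavity to roots\<close>

definition comb3 :: "'a::euclidean_space set \<Rightarrow> 'a set \<Rightarrow> 'a set \<Rightarrow> real \<Rightarrow> real \<Rightarrow> real \<Rightarrow> 'a set" where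
  "comb3 K L Z x y z = dilate x K + dilate y L + dilate z Z"

lemma cbody_comb3 [simp]: "cbody K \<Longrightarrow> cbody L \<Longrightarrow> cbody Z \<Longrightarrow> cbody (comb3 K L Z x y z)"
  by (simp add: comb3_def)

lemma comb3_plus:
  assumes "cbody K" "cbody L" "cbody Z" "0 \<le> x" "0 \<le> y" "0 \<le> z" "0 \<le> x'" "0 \<le> y'" "0 \<le> z'"
  shows "comb3 K L Z x y z + comb3 K L Z x' y' z' = comb3 K L Z (x + x') (y + y') (z + z')"
proof -
  have "comb3 K L Z x y z + comb3 K L Z x' y' z' =
    (dilate x K + dilate x' K) + (dilate y L + dilate y' L) + (dilate z Z + dilate z' Z)"
    by (simp add: comb3_def ac_simps)
  then show ?thesis using assms by (simp add: dilate_add cbody_def comb3_def)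
qed

lemma dilate_comb3: "dilate c (comb3 K L Z x y z) = comb3 K L Z (c * x) (c * y) (c * z)"
  by (simp add: comb3_def dilate_plus)

lemma comb3_mono:
  assumes "cbody K" "cbody L" "cbody Z" "0 \<in> K" "0 \<in> L" "0 \<in> Z"
    "0 \<le> x" "0 \<le> y" "0 \<le> z" "x \<le> x'" "y \<le> y'" "z \<le> z'"
  shows "comb3 K L Z x y z \<subseteq> comb3 K L Z x' y' z'"
  using assms unfolding comb3_def by (intro set_plus_mono2 dilate_mono_star) (auto simp: cbody_def)

lemma one_plus_power_le: "0 \<le> e \<Longrightarrow> e \<le> 1 \<Longrightarrow> (1 + e) ^ k \<le> 1 + e * (2 ^ k - 1)" for e :: real
proof (induction k)
  case (Suc k)
  have "(1 + e) ^ Suc k \<le> (1 + e) * (1 + e * (2 ^ k - 1))"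
    using Suc by (simp add: mult_left_mono)
  also have "\<dots> = 1 + e * 2 ^ k + e * (e * (2 ^ k - 1))" by (simp add: algebra_simps)
  also have "e * (e * (2 ^ k - 1)) \<le> e * (1 * (2 ^ k - 1))"
    using Suc.prems by (intro mult_left_mono mult_right_mono) auto
  finally show ?case by (simp add: algebra_simps)
qed auto

text \<open>Monotonicity and homogeneity suffice. Coefficients within \<open>\<eta>\<close> of
  positive ones agree up to a factor \<open>1 + e\<close> with \<open>e = 2 * \<eta> / m\<close>,
  where \<open>m\<close> is the smallest of them; bodies containing the origin are then nested up to
  this dilation, and the values of \<open>F\<close> differ by a factor of at most
  \<open>(1 + e) ^ k\<close>.\<close>

lemma comb3_lipschitz:
  fixes F :: "'a::euclidean_space set \<Rightarrow> real"
  assumes F: "body_functional k F"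
    and KLZ: "cbody K" "cbody L" "cbody Z" "0 \<in> K" "0 \<in> L" "0 \<in> Z"
    and pos: "x\<^sub>0 > 0" "y\<^sub>0 > 0" "z\<^sub>0 > 0"
  obtains C \<eta>\<^sub>0 where "C \<ge> 0" "\<eta>\<^sub>0 > 0"
    "\<And>\<eta> x y z. \<eta> \<le> \<eta>\<^sub>0 \<Longrightarrow> \<bar>x - x\<^sub>0\<bar> \<le> \<eta> \<Longrightarrow> \<bar>y - y\<^sub>0\<bar> \<le> \<eta> \<Longrightarrow> \<bar>z - z\<^sub>0\<bar> \<le> \<eta> \<Longrightarrow>
      \<bar>F (comb3 K L Z x y z) - F (comb3 K L Z x\<^sub>0 y\<^sub>0 z\<^sub>0)\<bar> \<le> C * \<eta>"
proof
  define m where "m = min x\<^sub>0 (min y\<^sub>0 z\<^sub>0)"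
  have m: "m > 0" "m \<le> x\<^sub>0" "m \<le> y\<^sub>0" "m \<le> z\<^sub>0" using pos by (auto simp: m_def)
  let ?G = "\<lambda>x y z. F (comb3 K L Z x y z)"
  let ?H = "?G x\<^sub>0 y\<^sub>0 z\<^sub>0"
  have G0: "?H \<ge> 0" using KLZ by (intro bf_nonneg[OF F]) simp
  show "0 \<le> 2 ^ k * ?H * (2 ^ k * (2 / m))" using G0 m by auto
  show "0 < m / 2" using m by simp
  fix \<eta> x y z assume \<eta>: "\<eta> \<le> m / 2" "\<bar>x - x\<^sub>0\<bar> \<le> \<eta>" "\<bar>y - y\<^sub>0\<bar> \<le> \<eta>" "\<bar>z - z\<^sub>0\<bar> \<le> \<eta>"
  define e where "e = 2 * \<eta> / m"
  have e: "0 \<le> e" "e \<le> 1" "\<eta> = e * m / 2" using \<eta> m by (auto simp: e_def field_simps)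
  have cmp: "a \<le> (1 + e) * a\<^sub>0" "a\<^sub>0 \<le> (1 + e) * a" "0 < a" if a: "\<bar>a - a\<^sub>0\<bar> \<le> \<eta>" "m \<le> a\<^sub>0" for a a\<^sub>0
  proof -
    have "e * m \<le> e * a\<^sub>0" using a e by (intro mult_left_mono)
    moreover have "0 \<le> e * m" using e m by simp
    moreover have "a \<le> a\<^sub>0 + \<eta>" using a by linarith
    ultimately have "a \<le> a\<^sub>0 + e * a\<^sub>0" using e(3) by linarith
    then show "a \<le> (1 + e) * a\<^sub>0" by (simp add: algebra_simps)
    have em: "e * m \<le> e * a\<^sub>0" using a e by (intro mult_left_mono)
    have "a \<ge> a\<^sub>0 / 2" using a \<eta> by linarith
    then show "0 < a" using a m by linarith
    have "e * (a\<^sub>0 / 2) \<le> e * a" using \<open>a \<ge> a\<^sub>0 / 2\<close> e by (intro mult_left_mono) auto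
    then have "e * m \<le> 2 * (e * a)" using em by simp
    moreover have "a\<^sub>0 \<le> a + \<eta>" using a by linarith
    ultimately have "a\<^sub>0 \<le> a + e * a" using e(3) by linarith
    then show "a\<^sub>0 \<le> (1 + e) * a" by (simp add: algebra_simps)
  qed
  note x = cmp[OF \<eta>(2) m(2)] and y = cmp[OF \<eta>(3) m(3)] and z = cmp[OF \<eta>(4) m(4)]
  have le: "?G a b c \<le> (1 + e) ^ k * ?G a' b' c'"
    if "0 \<le> a" "0 \<le> b" "0 \<le> c" "a \<le> (1 + e) * a'" "b \<le> (1 + e) * b'" "c \<le> (1 + e) * c'" for a b c a' b' c'
  proof -
    have "?G a b c \<le> F (dilate (1 + e) (comb3 K L Z a' b' c'))"
      unfolding dilate_comb3 using that KLZ by (intro bf_mono[OF F] comb3_mono) auto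
    then show ?thesis using KLZ e by (simp add: bf_dilate[OF F])
  qed
  have 1: "?G x y z \<le> (1 + e) ^ k * ?H" using x y z by (intro le) auto
  have 2: "?H \<le> (1 + e) ^ k * ?G x y z" using x y z pos by (intro le) auto
  have G: "?G x y z \<ge> 0" using KLZ by (intro bf_nonneg[OF F]) simp
  have p: "(1 + e) ^ k - 1 \<le> e * 2 ^ k" using one_plus_power_le[of e k] e by (simp add: algebra_simps)
  have q: "(1 + e) ^ k \<le> 2 ^ k" using e by (intro power_mono) auto
  have b: "?G x y z \<le> 2 ^ k * ?H" using 1 mult_right_mono[OF q G0] by linarith
  have "1 * ?H \<le> 2 ^ k * ?H" using G0 by (intro mult_right_mono) auto
  then have c: "?H \<le> 2 ^ k * ?H" by simp
  have "?G x y z - ?H \<le> e * 2 ^ k * ?H" using 1 mult_right_mono[OF p G0] by (simp add: algebra_simps)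
  also have "\<dots> \<le> e * 2 ^ k * (2 ^ k * ?H)" using c e by (intro mult_left_mono) auto
  finally have 3: "?G x y z - ?H \<le> e * 2 ^ k * (2 ^ k * ?H)" .
  have "?H - ?G x y z \<le> e * 2 ^ k * ?G x y z" using 2 mult_right_mono[OF p G] by (simp add: algebra_simps)
  also have "\<dots> \<le> e * 2 ^ k * (2 ^ k * ?H)" using b e by (intro mult_left_mono) auto
  finally have "\<bar>?G x y z - ?H\<bar> \<le> e * 2 ^ k * (2 ^ k * ?H)" using 3 by linarith
  then show "\<bar>?G x y z - ?H\<bar> \<le> 2 ^ k * ?H * (2 ^ k * (2 / m)) * \<eta>"
    by (simp add: e_def field_simps)
qed

lemma comb3_tendsto:
  fixes F :: "'a::euclidean_space set \<Rightarrow> real"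
  assumes F: "body_functional k F"
    and KLZ: "cbody K" "cbody L" "cbody Z" "0 \<in> K" "0 \<in> L" "0 \<in> Z"
    and pos: "x\<^sub>0 > 0" "y\<^sub>0 > 0" "z\<^sub>0 > 0"
    and lim: "(x \<longlongrightarrow> x\<^sub>0) A" "(y \<longlongrightarrow> y\<^sub>0) A" "(z \<longlongrightarrow> z\<^sub>0) A"
  shows "((\<lambda>t. F (comb3 K L Z (x t) (y t) (z t))) \<longlongrightarrow> F (comb3 K L Z x\<^sub>0 y\<^sub>0 z\<^sub>0)) A"
proof -
  obtain C \<eta>\<^sub>0 where C: "C \<ge> 0" "\<eta>\<^sub>0 > 0"
    "\<And>\<eta> x y z. \<eta> \<le> \<eta>\<^sub>0 \<Longrightarrow> \<bar>x - x\<^sub>0\<bar> \<le> \<eta> \<Longrightarrow> \<bar>y - y\<^sub>0\<bar> \<le> \<eta> \<Longrightarrow> \<bar>z - z\<^sub>0\<bar> \<le> \<eta> \<Longrightarrow>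
      \<bar>F (comb3 K L Z x y z) - F (comb3 K L Z x\<^sub>0 y\<^sub>0 z\<^sub>0)\<bar> \<le> C * \<eta>"
    by (rule comb3_lipschitz[OF F KLZ pos]) (rule that)
  define \<eta> where "\<eta> t = \<bar>x t - x\<^sub>0\<bar> + \<bar>y t - y\<^sub>0\<bar> + \<bar>z t - z\<^sub>0\<bar>" for t
  have "(\<eta> \<longlongrightarrow> \<bar>x\<^sub>0 - x\<^sub>0\<bar> + \<bar>y\<^sub>0 - y\<^sub>0\<bar> + \<bar>z\<^sub>0 - z\<^sub>0\<bar>) A"
    unfolding \<eta>_def by (intro tendsto_intros lim)
  then have \<eta>: "(\<eta> \<longlongrightarrow> 0) A" by simp
  then have "eventually (\<lambda>t. \<eta> t < \<eta>\<^sub>0) A" using C(2) by (rule order_tendstoD(2))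
  then have "eventually (\<lambda>t. norm (F (comb3 K L Z (x t) (y t) (z t)) - F (comb3 K L Z x\<^sub>0 y\<^sub>0 z\<^sub>0)) \<le> C * \<eta> t) A"
    by eventually_elim (auto simp: \<eta>_def intro!: C(3))
  moreover have "((\<lambda>t. C * \<eta> t) \<longlongrightarrow> 0) A" using tendsto_mult_left[OF \<eta>, of C] by simp
  ultimately show ?thesis
    by (subst Lim_null) (rule Lim_null_comparison)
qed

text \<open>At an interior leftmost minimiser \<open>l\<close>, the values at \<open>l - h\<close>
  and \<open>l + h\<close> have a product strictly above the square of the minimum, against
  log-concavity. So the minimum is attained at an endpoint.\<close>

lemma midpoint_log_concave_min:
  fixes f :: "real \<Rightarrow> real"
  assumes cont: "continuous_on {0..1} f" and pos: "\<And>s. s \<in> {0..1} \<Longrightarrow> f s > 0"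
    and lc: "\<And>s t. s \<in> {0..1} \<Longrightarrow> t \<in> {0..1} \<Longrightarrow> f s * f t \<le> (f ((s + t) / 2))\<^sup>2"
    and ends: "f 0 \<ge> 1" "f 1 \<ge> 1" and s: "s \<in> {0..1}"
  shows "f s \<ge> 1"
proof (rule ccontr)
  assume fs: "\<not> f s \<ge> 1"
  obtain m where m: "m \<in> {0..1}" "\<And>t. t \<in> {0..1} \<Longrightarrow> f m \<le> f t"
    using continuous_attains_inf[OF _ _ cont] by auto
  define S where "S = {t \<in> {0..1}. f t = f m}"
  have "closed S" unfolding S_def
    by (intro continuous_closed_preimage_constant cont) auto
  moreover have "bounded S" by (rule bounded_subset[of "{0..1}"]) (auto simp: S_def)
  ultimately have "compact S" by (simp add: compact_eq_bounded_closed)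
  moreover have "S \<noteq> {}" using m by (auto simp: S_def)
  ultimately obtain l where l: "l \<in> S" "\<And>t. t \<in> S \<Longrightarrow> l \<le> t"
    using compact_attains_inf[of S] by blast
  have fl: "f l = f m" "l \<in> {0..1}" using l by (auto simp: S_def)
  have "f l < 1" using m(2)[OF s] fl fs by simp
  then have "l \<noteq> 0" "l \<noteq> 1" using ends by auto
  define h where "h = min l (1 - l)"
  have h: "h > 0" "l - h \<in> {0..1}" "l + h \<in> {0..1}" using fl \<open>l \<noteq> 0\<close> \<open>l \<noteq> 1\<close> by (auto simp: h_def)
  have "l - h \<notin> S" using l(2)[of "l - h"] h by auto
  then have "f m < f (l - h)" using m(2)[OF h(2)] h(2) by (auto simp: S_def)
  then have "f m * f m < f (l - h) * f m" using pos[OF m(1)] by simp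
  also have "\<dots> \<le> f (l - h) * f (l + h)"
    using m(2)[OF h(3)] pos[OF h(2)] by (intro mult_left_mono) auto
  also have "\<dots> \<le> (f l)\<^sup>2" using lc[OF h(2,3)] by simp
  finally show False using fl by (simp add: power2_eq_square)
qed

text \<open>After scaling both bodies to value 1, log-concavity keeps \<open>F\<close> at least 1 on
  the segment between them, and the parameter \<open>b / (a + b)\<close> hits a dilate of
  \<open>X + Y\<close>.\<close>

lemma mlc_imp_root_superadditive_zero:
  fixes F :: "'a::euclidean_space set \<Rightarrow> real"
  assumes F: "body_functional k F" and k: "k > 0" and lc: "midpoint_log_concave F"
    and X: "cbody X" "0 \<in> X" and Y: "cbody Y" "0 \<in> Y"
  shows "root k (F X) + root k (F Y) \<le> root k (F (X + Y))"
proof -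
  define a b where "a = root k (F X)" and "b = root k (F Y)"
  have ab: "0 \<le> a" "0 \<le> b" "a ^ k = F X" "b ^ k = F Y"
    using X Y k bf_nonneg[OF F] by (auto simp: a_def b_def)
  have sub: "X \<subseteq> X + Y" "Y \<subseteq> X + Y"
    using X Y set_zero_plus2[of Y X] set_zero_plus2[of X Y] by (auto simp: add.commute)
  have le: "F X \<le> F (X + Y)" "F Y \<le> F (X + Y)"
    using X Y sub by (auto intro!: bf_mono[OF F])
  show ?thesis
  proof (cases "a = 0 \<or> b = 0")
    case True
    then show ?thesis using le k real_root_le_iff[of k] by (auto simp: a_def b_def)
  next
    case False
    with ab have ab0: "a > 0" "b > 0" by auto
    let ?G = "\<lambda>x y. F (comb3 X Y {0} x y 1)"
    have pm: "?G x y \<le> ?G x' y'" if "0 \<le> x" "0 \<le> y" "x \<le> x'" "y \<le> y'" for x y x' y'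
      using that X Y by (intro bf_mono[OF F] comb3_mono) auto
    have d0: "dilate 0 K = {0}" if "0 \<in> K" for K :: "'a set" using that by (auto simp: dilate_def)
    have dz: "dilate c {0} = ({0} :: 'a set)" for c by (auto simp: dilate_def)
    have X1: "?G x 0 = x ^ k * F X" "?G 0 x = x ^ k * F Y" if "x > 0" for x
      using that X Y by (auto simp: comb3_def d0 dz bf_dilate[OF F] simp flip: set_zero)
    have key: "1 \<le> (1 / (a + b) + \<epsilon>) ^ k * F (X + Y)" if \<epsilon>: "\<epsilon> > 0" for \<epsilon>
    proof -
      \<comment> \<open>The share \<open>\<epsilon>\<close> of the other body keeps both
        coefficients positive up to the endpoints, where continuity is needed too. The third
        coefficient 1 belongs to the dummy body \<open>{0}\<close>.\<close>
      let ?x = "\<lambda>l. (1 - l) / a + l * \<epsilon>" and ?y = "\<lambda>l. (1 - l) * \<epsilon> + l / b"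
      have pos: "?x l > 0" "?y l > 0" if "l \<in> {0..1}" for l
        using that ab0 \<epsilon> by (cases "l = 0"; cases "l = 1"; auto intro!: add_pos_pos)+
      let ?l = "b / (a + b)"
      have "1 \<le> ?G (?x ?l) (?y ?l)"
      proof (rule midpoint_log_concave_min[of "\<lambda>l. ?G (?x l) (?y l)"])
        show "continuous_on {0..1} (\<lambda>l. ?G (?x l) (?y l))"
          unfolding continuous_on_def
        proof
          fix l :: real assume "l \<in> {0..1}"
          then show "((\<lambda>l. ?G (?x l) (?y l)) \<longlongrightarrow> ?G (?x l) (?y l)) (at l within {0..1})"
            using X Y pos[of l] ab0
            by (intro comb3_tendsto[OF F] tendsto_intros) auto
        qed
        show "?G (?x l) (?y l) > 0" if "l \<in> {0..1}" for l
        proof -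
          have "0 < ?G (?x l) 0" using pos[OF that] ab0 ab by (simp add: X1 flip: ab(3))
          also have "\<dots> \<le> ?G (?x l) (?y l)" using pos[OF that] by (intro pm) auto
          finally show ?thesis .
        qed
        show "?G (?x s) (?y s) * ?G (?x t) (?y t) \<le> (?G (?x ((s + t) / 2)) (?y ((s + t) / 2)))\<^sup>2"
          if "s \<in> {0..1}" "t \<in> {0..1}" for s t
        proof -
          have "dilate (1/2) (comb3 X Y {0} (?x s) (?y s) 1 + comb3 X Y {0} (?x t) (?y t) 1)
            = comb3 X Y {0} ((1/2) * (?x s + ?x t)) ((1/2) * (?y s + ?y t)) ((1/2) * (1 + 1))"
            using pos[OF that(1)] pos[OF that(2)] X Y
            by (subst comb3_plus) (auto simp: dilate_comb3 less_imp_le)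
          also have "(1/2) * (?x s + ?x t) = ?x ((s + t) / 2)" using ab0 by (simp add: field_simps)
          also have "(1/2) * (?y s + ?y t) = ?y ((s + t) / 2)" using ab0 by (simp add: field_simps)
          finally have eq: "dilate (1/2) (comb3 X Y {0} (?x s) (?y s) 1 + comb3 X Y {0} (?x t) (?y t) 1)
            = comb3 X Y {0} (?x ((s + t) / 2)) (?y ((s + t) / 2)) 1" by simp
          have "cbody (comb3 X Y {0} (?x s) (?y s) 1)" "cbody (comb3 X Y {0} (?x t) (?y t) 1)"
            using X Y by simp_all
          then show ?thesis using lc unfolding midpoint_log_concave_def eq[symmetric] by blast
        qed
        have "1 = ?G (1 / a) 0" using ab0 by (simp add: X1 power_divide flip: ab(3))
        also have "\<dots> \<le> ?G (?x 0) (?y 0)" using ab0 \<epsilon> by (intro pm) auto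
        finally show "1 \<le> ?G (?x 0) (?y 0)" .
        have "1 = ?G 0 (1 / b)" using ab0 by (simp add: X1 power_divide flip: ab(4))
        also have "\<dots> \<le> ?G (?x 1) (?y 1)" using ab0 \<epsilon> by (intro pm) auto
        finally show "1 \<le> ?G (?x 1) (?y 1)" .
        show "?l \<in> {0..1}" using ab0 by auto
      qed
      also have "\<dots> \<le> ?G (1 / (a + b) + \<epsilon>) (1 / (a + b) + \<epsilon>)"
      proof (rule pm)
        have l: "0 \<le> ?l" "?l \<le> 1" "(1 - ?l) / a = 1 / (a + b)" "?l / b = 1 / (a + b)"
        proof -
          have s: "a + b > 0" using ab0 by simp
          then show "0 \<le> ?l" "?l \<le> 1" using ab0 by auto
          have "1 - ?l = a / (a + b)" using s by (simp add: field_simps)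
          then show "(1 - ?l) / a = 1 / (a + b)" "?l / b = 1 / (a + b)" using ab0 by simp_all
        qed
        have "?l * \<epsilon> \<le> 1 * \<epsilon>" "(1 - ?l) * \<epsilon> \<le> 1 * \<epsilon>"
          using l(1,2) \<epsilon> by (intro mult_right_mono; simp)+
        then show "?x ?l \<le> 1 / (a + b) + \<epsilon>" "?y ?l \<le> 1 / (a + b) + \<epsilon>" unfolding l(3,4) by auto
        show "0 \<le> ?x ?l" "0 \<le> ?y ?l" using pos[of ?l] l by auto
      qed
      also have "\<dots> = (1 / (a + b) + \<epsilon>) ^ k * F (X + Y)"
      proof -
        have "comb3 X Y {0} (1 / (a + b) + \<epsilon>) (1 / (a + b) + \<epsilon>) 1 = dilate (1 / (a + b) + \<epsilon>) (X + Y)"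
          by (simp add: comb3_def dilate_plus dz flip: set_zero)
        then show ?thesis using X Y ab0 \<epsilon> by (simp add: bf_dilate[OF F] add_pos_pos)
      qed
      finally show ?thesis .
    qed
    have "((\<lambda>\<epsilon>. (1 / (a + b) + \<epsilon>) ^ k * F (X + Y)) \<longlongrightarrow> (1 / (a + b) + 0) ^ k * F (X + Y)) (at_right 0)"
      by (intro tendsto_intros)
    then have "1 \<le> (1 / (a + b) + 0) ^ k * F (X + Y)"
      by (rule tendsto_lowerbound) (auto intro: eventually_at_right_less[THEN eventually_mono] key)
    then have "(a + b) ^ k \<le> F (X + Y)" using ab0 by (simp add: power_divide field_simps)
    then have "root k ((a + b) ^ k) \<le> root k (F (X + Y))" using k by simp
    moreover have "root k ((a + b) ^ k) = a + b" using ab k by (intro real_root_power_cancel) auto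
    ultimately show ?thesis unfolding a_def[symmetric] b_def[symmetric] by simp
  qed
qed

lemma mlc_imp_root_superadditive:
  fixes F :: "'a::euclidean_space set \<Rightarrow> real"
  assumes F: "body_functional k F" and k: "k > 0" and lc: "midpoint_log_concave F"
  shows "root_superadditive k F"
  unfolding root_superadditive_def
proof (intro allI impI)
  fix X Y :: "'a set" assume XY: "cbody X" "cbody Y"
  then obtain x y where xy: "x \<in> X" "y \<in> Y" by (auto simp: cbody_def)
  let ?X = "(+) (-x) ` X" and ?Y = "(+) (-y) ` Y"
  have "?X + ?Y = (+) (-x) ` (X + ?Y)" by (rule translation_plus)
  also have "X + ?Y = (+) (-y) ` (X + Y)" using translation_plus[of "-y" Y X] by (simp add: add.commute)
  finally have eq: "F (?X + ?Y) = F (X + Y)"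
    using trans[OF bf_translate[OF F] bf_translate[OF F]] XY by (metis cbody_plus cbody_translation)
  have "cbody ?X" "cbody ?Y" using XY by (intro cbody_translation; simp)+
  moreover have "0 \<in> ?X" by (rule image_eqI[of _ _ x]) (use xy in auto)
  moreover have "0 \<in> ?Y" by (rule image_eqI[of _ _ y]) (use xy in auto)
  ultimately have "root k (F ?X) + root k (F ?Y) \<le> root k (F (?X + ?Y))"
    by (intro mlc_imp_root_superadditive_zero[OF F k lc])
  then show "root k (F X) + root k (F Y) \<le> root k (F (X + Y))"
    unfolding eq bf_translate[OF F XY(1)] bf_translate[OF F XY(2)] .
qed

section \<open>Laplace equations on finite weighted graphs\<close>

text \<open>Elimination of one vertex of a weighted complete graph (star-mesh transform).\<close>

lemma laplacian_solvable:
  fixes Q :: "'b \<Rightarrow> 'b \<Rightarrow> real"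
  assumes "finite W"
    and "\<And>u v. u \<in> W \<Longrightarrow> v \<in> W \<Longrightarrow> u \<noteq> v \<Longrightarrow> Q u v > 0" "\<And>u v. Q u v = Q v u"
    and "(\<Sum>v\<in>W. \<gamma> v) = 0"
  shows "\<exists>w. \<forall>v\<in>W. (\<Sum>u\<in>W. Q v u * (w v - w u)) = \<gamma> v"
  using assms
proof (induction W arbitrary: Q \<gamma> rule: finite_induct)
  case (insert a W)
  show ?case
  proof (cases "W = {}")
    case True
    then show ?thesis using insert.prems by auto
  next
    case False
    define d where "d = (\<Sum>u\<in>W. Q a u)"
    have d: "d > 0" unfolding d_def using False insert.hyps by (intro sum_pos insert.prems(1)) auto
    let ?Q = "\<lambda>v u. Q v u + Q v a * Q a u / d" and ?g = "\<lambda>v. \<gamma> v + Q v a * \<gamma> a / d"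
    have "(\<Sum>v\<in>W. Q v a * \<gamma> a / d) = (\<Sum>v\<in>W. Q a v) * \<gamma> a / d"
      by (simp add: sum_divide_distrib sum_distrib_right insert.prems(2)[of _ a])
    also have "\<dots> = \<gamma> a" using d by (simp add: d_def)
    finally have "(\<Sum>v\<in>W. ?g v) = 0"
      using insert by (simp add: sum.distrib)
    moreover have "?Q u v > 0" if "u \<in> W" "v \<in> W" "u \<noteq> v" for u v
    proof -
      have "u \<noteq> a" "v \<noteq> a" using that insert.hyps by auto
      then have "Q u v > 0" "Q u a > 0" "Q a v > 0" using that by (auto intro!: insert.prems(1))
      then show ?thesis using d by (intro add_pos_nonneg) auto
    qed
    moreover have "?Q u v = ?Q v u" for u v
      by (simp add: insert.prems(2)[of u v] insert.prems(2)[of u a] insert.prems(2)[of a v] mult.commute)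
    ultimately have "\<exists>w. \<forall>v\<in>W. (\<Sum>u\<in>W. ?Q v u * (w v - w u)) = ?g v"
      by (intro insert.IH)
    then obtain w where w: "\<And>v. v \<in> W \<Longrightarrow> (\<Sum>u\<in>W. ?Q v u * (w v - w u)) = ?g v" by blast
    define wa where "wa = (\<gamma> a + (\<Sum>u\<in>W. Q a u * w u)) / d"
    have wa: "(\<Sum>u\<in>W. Q a u * w u) = d * wa - \<gamma> a" using d by (simp add: wa_def)
    let ?w = "w(a := wa)"
    have neq: "u \<noteq> a" if "u \<in> W" for u using that insert by auto
    have "(\<Sum>u\<in>insert a W. Q v u * (?w v - ?w u)) = \<gamma> v" if v: "v \<in> insert a W" for v
    proof (cases "v = a")
      case True
      have "(\<Sum>u\<in>W. Q a u * (wa - ?w u)) = (\<Sum>u\<in>W. Q a u * wa - Q a u * w u)"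
        using neq by (intro sum.cong) (auto simp: right_diff_distrib)
      also have "\<dots> = d * wa - (\<Sum>u\<in>W. Q a u * w u)" by (simp add: sum_subtractf d_def sum_distrib_right)
      finally show ?thesis using insert.hyps True wa by simp
    next
      case False
      with v have vW: "v \<in> W" by simp
      have "(\<Sum>u\<in>W. Q a u * (w v - w u)) = d * w v - (\<Sum>u\<in>W. Q a u * w u)"
        by (simp add: right_diff_distrib sum_subtractf d_def sum_distrib_right)
      then have "(\<Sum>u\<in>W. Q v a * Q a u / d * (w v - w u)) = Q v a / d * (d * w v - (d * wa - \<gamma> a))"
        unfolding wa by (simp add: sum_distrib_left flip: ) (simp add: sum_distrib_left[symmetric] mult.assoc flip: sum_divide_distrib)
      also have "\<dots> = Q v a * (w v - wa) + Q v a * \<gamma> a / d" using d by (simp add: field_simps)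
      finally have "(\<Sum>u\<in>W. Q v u * (w v - w u)) + Q v a * (w v - wa) = \<gamma> v"
        using w[OF vW] by (simp add: distrib_right sum.distrib)
      moreover have "(\<Sum>u\<in>W. Q v u * (?w v - ?w u)) = (\<Sum>u\<in>W. Q v u * (w v - w u))"
        using neq False by (intro sum.cong) auto
      ultimately show ?thesis using insert.hyps False by simp
    qed
    then show ?thesis by blast
  qed
qed auto

text \<open>Solutions for unit mass at \<open>k\<close> minus unit mass at \<open>a\<close>
  superpose to a solution for every right-hand side of total zero. The constant depends on the
  weights alone, which later makes the edge displacements uniform in the direction and the
  step.\<close>

lemma laplacian_solvable_bounded:
  fixes Q :: "'b \<Rightarrow> 'b \<Rightarrow> real"
  assumes W: "finite W" "W \<noteq> {}"
    and Q: "\<And>u v. u \<in> W \<Longrightarrow> v \<in> W \<Longrightarrow> u \<noteq> v \<Longrightarrow> Q u v > 0" "\<And>u v. Q u v = Q v u"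
  obtains C where "C \<ge> 0"
    "\<And>\<gamma>. (\<Sum>v\<in>W. \<gamma> v) = 0 \<Longrightarrow>
      \<exists>w. (\<forall>v\<in>W. (\<Sum>u\<in>W. Q v u * (w v - w u)) = \<gamma> v) \<and> (\<forall>v\<in>W. \<bar>w v\<bar> \<le> C * (\<Sum>u\<in>W. \<bar>\<gamma> u\<bar>))"
proof -
  obtain a where a: "a \<in> W" using W by blast
  have "\<forall>k\<in>W. \<exists>w. \<forall>v\<in>W. (\<Sum>u\<in>W. Q v u * (w v - w u)) = of_bool (v = k) - of_bool (v = a)"
  proof
    fix k assume k: "k \<in> W"
    show "\<exists>w. \<forall>v\<in>W. (\<Sum>u\<in>W. Q v u * (w v - w u)) = of_bool (v = k) - of_bool (v = a)"
    proof (rule laplacian_solvable[OF W(1)])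
      show "Q u v > 0" if "u \<in> W" "v \<in> W" "u \<noteq> v" for u v using that by (rule Q(1))
      show "Q u v = Q v u" for u v by (rule Q(2))
      show "(\<Sum>v\<in>W. of_bool (v = k) - of_bool (v = a) :: real) = 0"
        using a k W by (simp add: sum_subtractf of_bool_def)
    qed
  qed
  from bchoice[OF this] obtain w where w: "\<forall>k\<in>W. \<forall>v\<in>W.
      (\<Sum>u\<in>W. Q v u * (w k v - w k u)) = of_bool (v = k) - of_bool (v = a)" ..
  let ?C = "\<Sum>k\<in>W. \<Sum>v\<in>W. \<bar>w k v\<bar>"
  show ?thesis
  proof
    show "?C \<ge> 0" by (intro sum_nonneg) auto
    fix \<gamma> :: "'b \<Rightarrow> real" assume \<gamma>: "(\<Sum>v\<in>W. \<gamma> v) = 0"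
    let ?w = "\<lambda>v. \<Sum>k\<in>W. \<gamma> k * w k v"
    have "(\<Sum>u\<in>W. Q v u * (?w v - ?w u)) = \<gamma> v" if v: "v \<in> W" for v
    proof -
      have "(\<Sum>u\<in>W. Q v u * (?w v - ?w u)) = (\<Sum>u\<in>W. \<Sum>k\<in>W. \<gamma> k * (Q v u * (w k v - w k u)))"
      proof (intro sum.cong refl)
        fix u
        have "?w v - ?w u = (\<Sum>k\<in>W. \<gamma> k * w k v - \<gamma> k * w k u)" by (simp only: sum_subtractf)
        then show "Q v u * (?w v - ?w u) = (\<Sum>k\<in>W. \<gamma> k * (Q v u * (w k v - w k u)))"
          by (simp add: sum_distrib_left right_diff_distrib mult.left_commute)
      qed
      also have "\<dots> = (\<Sum>k\<in>W. \<gamma> k * (\<Sum>u\<in>W. Q v u * (w k v - w k u)))"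
        by (subst sum.swap) (simp only: sum_distrib_left)
      also have "\<dots> = (\<Sum>k\<in>W. \<gamma> k * (of_bool (v = k) - of_bool (v = a)))"
        proof (intro sum.cong refl)
        fix k assume "k \<in> W"
        then show "\<gamma> k * (\<Sum>u\<in>W. Q v u * (w k v - w k u)) = \<gamma> k * (of_bool (v = k) - of_bool (v = a))"
          using v by (simp only: w[rule_format])
      qed
      also have "\<dots> = (\<Sum>k\<in>W. if k = v then \<gamma> k else 0) - (\<Sum>k\<in>W. \<gamma> k) * of_bool (v = a)"
      proof -
        have "(\<Sum>k\<in>W. \<gamma> k * (of_bool (v = k) - of_bool (v = a))) =
            (\<Sum>k\<in>W. (if k = v then \<gamma> k else 0) - \<gamma> k * of_bool (v = a))"
          by (intro sum.cong refl) auto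
        then show ?thesis by (simp only: sum_subtractf sum_distrib_right)
      qed
      also have "\<dots> = \<gamma> v" using v W \<gamma> by simp
      finally show ?thesis .
    qed
    moreover have "\<bar>?w v\<bar> \<le> ?C * (\<Sum>u\<in>W. \<bar>\<gamma> u\<bar>)" if v: "v \<in> W" for v
    proof -
      have "\<bar>?w v\<bar> \<le> (\<Sum>k\<in>W. \<bar>\<gamma> k\<bar> * \<bar>w k v\<bar>)"
        by (rule order_trans[OF sum_abs]) (simp add: abs_mult)
      also have "\<dots> \<le> (\<Sum>k\<in>W. \<bar>\<gamma> k\<bar> * ?C)"
      proof (intro sum_mono mult_left_mono)
        fix k assume k: "k \<in> W"
        have "\<bar>w k v\<bar> \<le> (\<Sum>v\<in>W. \<bar>w k v\<bar>)" using v W by (intro member_le_sum) auto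
        also have "\<dots> \<le> ?C" using k W by (intro member_le_sum[where f="\<lambda>k. \<Sum>v\<in>W. \<bar>w k v\<bar>"]) (auto intro: sum_nonneg)
        finally show "\<bar>w k v\<bar> \<le> ?C" .
      qed auto
      also have "\<dots> = (\<Sum>k\<in>W. \<bar>\<gamma> k\<bar>) * ?C" by (rule sum_distrib_right[symmetric])
      finally show ?thesis by (metis mult.commute)
    qed
    ultimately show "\<exists>w. (\<forall>v\<in>W. (\<Sum>u\<in>W. Q v u * (w v - w u)) = \<gamma> v) \<and> (\<forall>v\<in>W. \<bar>w v\<bar> \<le> ?C * (\<Sum>u\<in>W. \<bar>\<gamma> u\<bar>))"
      by (intro exI[of _ ?w] conjI ballI)
  qed
qed

text \<open>Subtract from \<open>f\<close> its chord and
  \<open>\<epsilon> * ((x - l1) * (x - l2))\<close>. The result vanishes at both ends and is still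
  negative at the midpoint, because \<open>\<epsilon>\<close> uses up only half of the gap; so its
  minimum is interior, and there the parabola touches.\<close>

lemma touching_parabola:
  fixes f :: "real \<Rightarrow> real"
  assumes cont: "continuous_on {l1..l2} f" and l: "l1 < l2"
    and gap: "f ((l1 + l2) / 2) < (f l1 + f l2) / 2"
  obtains l\<^sub>0 a \<epsilon> where "l1 < l\<^sub>0" "l\<^sub>0 < l2" "\<epsilon> > 0"
    "\<And>x. l1 \<le> x \<Longrightarrow> x \<le> l2 \<Longrightarrow> f l\<^sub>0 + a * (x - l\<^sub>0) + \<epsilon> * (x - l\<^sub>0)\<^sup>2 \<le> f x"
proof -
  define G where "G = (f l1 + f l2) / 2 - f ((l1 + l2) / 2)"
  define D where "D = (l2 - l1)\<^sup>2 / 4"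
  define \<epsilon> where "\<epsilon> = G / (2 * D)"
  define \<kappa> where "\<kappa> = (f l2 - f l1) / (l2 - l1)"
  define g where "g x = f x - f l1 - (x - l1) * \<kappa> - \<epsilon> * ((x - l1) * (x - l2))" for x
  have D: "D > 0" using l by (simp add: D_def)
  have G: "G > 0" using gap by (simp add: G_def)
  have e: "\<epsilon> > 0" using D G by (simp add: \<epsilon>_def)
  have "continuous_on {l1..l2} g" unfolding g_def by (intro continuous_intros cont)
  then obtain m where m: "m \<in> {l1..l2}" "\<And>x. x \<in> {l1..l2} \<Longrightarrow> g m \<le> g x"
    using continuous_attains_inf[of "{l1..l2}" g] l by auto
  have g0: "g l1 = 0" "g l2 = 0" using l by (auto simp: g_def \<kappa>_def)
  have "g ((l1 + l2) / 2) = - G + \<epsilon> * D"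
    using l by (simp add: g_def \<kappa>_def G_def D_def power2_eq_square field_simps)
  also have "\<dots> = - G / 2" using D by (simp add: \<epsilon>_def field_simps)
  finally have "g ((l1 + l2) / 2) < 0" using G by simp
  moreover have "g m \<le> g ((l1 + l2) / 2)" using l by (intro m(2)) auto
  ultimately have "g m < 0" by simp
  then have "m \<noteq> l1" "m \<noteq> l2" using g0 by auto
  then have ml: "l1 < m" "m < l2" using m(1) by auto
  show ?thesis
  proof (rule that[of m \<epsilon> "\<kappa> + \<epsilon> * (2 * m - l1 - l2)"])
    fix x assume "l1 \<le> x" "x \<le> l2"
    then have "g m \<le> g x" by (intro m(2)) auto
    moreover have "f m + (\<kappa> + \<epsilon> * (2 * m - l1 - l2)) * (x - m) + \<epsilon> * (x - m)\<^sup>2 - f x = g m - g x"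
      by (simp add: g_def power2_eq_square algebra_simps)
    ultimately show "f m + (\<kappa> + \<epsilon> * (2 * m - l1 - l2)) * (x - m) + \<epsilon> * (x - m)\<^sup>2 \<le> f x" by linarith
  qed (use ml e in auto)
qed

text \<open>A joint induction: each of the two statements for \<open>Suc n\<close> uses both of them
  for \<open>n\<close>. The coefficient 2 of the square is exact for \<open>n = 0\<close>, and its
  positivity is all that the contradiction argument needs.\<close>

lemma power_symmetric_sum_ge:
  fixes g z :: real
  assumes g: "g \<ge> 0"
  shows "2 * g ^ Suc (Suc n) + 2 * g ^ n * z\<^sup>2 \<le> (g + z) ^ Suc (Suc n) + (g - z) ^ Suc (Suc n)"
    and "0 \<le> z * ((g + z) ^ Suc (Suc n) - (g - z) ^ Suc (Suc n))"
proof (induction n)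
  case (Suc n)
  let ?S = "(g + z) ^ Suc (Suc n) + (g - z) ^ Suc (Suc n)" and ?T = "(g + z) ^ Suc (Suc n) - (g - z) ^ Suc (Suc n)"
  case 1
  have "g * (2 * g ^ Suc (Suc n) + 2 * g ^ n * z\<^sup>2) \<le> g * ?S"
    using Suc(1) g by (rule mult_left_mono)
  moreover have "(g + z) ^ Suc (Suc (Suc n)) + (g - z) ^ Suc (Suc (Suc n)) = g * ?S + z * ?T"
    by (simp add: algebra_simps)
  moreover have "g * (2 * g ^ Suc (Suc n) + 2 * g ^ n * z\<^sup>2) = 2 * g ^ Suc (Suc (Suc n)) + 2 * g ^ Suc n * z\<^sup>2"
    by (simp add: algebra_simps)
  ultimately show ?case using Suc(2) by linarith
  case 2
  have "z * ((g + z) ^ Suc (Suc (Suc n)) - (g - z) ^ Suc (Suc (Suc n))) = g * (z * ?T) + z\<^sup>2 * ?S"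
    by (simp add: algebra_simps power2_eq_square)
  also have "\<dots> \<ge> 0"
  proof -
    have "0 \<le> 2 * g ^ Suc (Suc n) + 2 * g ^ n * z\<^sup>2" using g by auto
    then have "0 \<le> ?S" using Suc(1) by linarith
    then show ?thesis using mult_nonneg_nonneg[OF g Suc(2)] by simp
  qed
  finally show ?case .
qed (auto simp: power2_eq_square algebra_simps g)

text \<open>\<open>X\<close> and \<open>Y\<close> are values at two bodies whose midpoint has the
  value \<open>q\<^sub>0\<close>. By \<open>crit\<close> their difference is of second order, so
  arithmetic and geometric mean differ only in fourth order, and the bound on the product becomes a
  bound on the sum up to \<open>h ^ 3\<close>.\<close>

lemma second_difference_bound:
  fixes X Y :: real
  assumes h: "0 < h" "h \<le> 1" and C: "C \<ge> 0" and q: "q\<^sub>0 > 0"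
    and X: "\<bar>X - (qp + h * ap + h\<^sup>2 * bp / 2)\<bar> \<le> C * h ^ 3"
    and Y: "\<bar>Y - (qm - h * am + h\<^sup>2 * bm / 2)\<bar> \<le> C * h ^ 3"
    and a: "\<bar>ap - a\<^sub>0\<bar> \<le> C * h" "\<bar>am - a\<^sub>0\<bar> \<le> C * h"
    and b: "\<bar>bp - b\<^sub>0\<bar> \<le> C * h" "\<bar>bm - b\<^sub>0\<bar> \<le> C * h"
    and crit: "qp - qm + 2 * h * a\<^sub>0 = 0" and XY: "X * Y \<le> q\<^sub>0\<^sup>2"
  shows "qp + qm - 2 * q\<^sub>0 + h * (ap - am) + h\<^sup>2 * b\<^sub>0 \<le> (3 * C + 25 * C\<^sup>2 / (4 * q\<^sub>0)) * h ^ 3"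
proof -
  have h3: "h ^ 3 \<le> h\<^sup>2" "h ^ 4 \<le> h ^ 3" using h by (auto intro!: power_decreasing)
  have m: "\<bar>h * x\<bar> \<le> C * h\<^sup>2" "\<bar>h\<^sup>2 * x\<bar> \<le> C * h ^ 3" if "\<bar>x\<bar> \<le> C * h" for x
  proof -
    have "\<bar>h * x\<bar> = h * \<bar>x\<bar>" "\<bar>h\<^sup>2 * x\<bar> = h\<^sup>2 * \<bar>x\<bar>" using h by (auto simp: abs_mult)
    moreover have "h * \<bar>x\<bar> \<le> h * (C * h)" "h\<^sup>2 * \<bar>x\<bar> \<le> h\<^sup>2 * (C * h)"
      using that h by (auto intro!: mult_left_mono)
    moreover have "h * (C * h) = C * h\<^sup>2" "h\<^sup>2 * (C * h) = C * h ^ 3"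
      by (auto simp: power2_eq_square power3_eq_cube)
    ultimately show "\<bar>h * x\<bar> \<le> C * h\<^sup>2" "\<bar>h\<^sup>2 * x\<bar> \<le> C * h ^ 3" by linarith+
  qed
  note ma = m(1)[OF a(1)] m(1)[OF a(2)] and mb = m(2)[OF b(1)] m(2)[OF b(2)]
  have tri: "\<bar>r1 - r2 + 0 + r3 + r4 + (r5 - r6) / 2\<bar> \<le> 5 * c"
    if "\<bar>r1\<bar> \<le> d" "\<bar>r2\<bar> \<le> d" "\<bar>r3\<bar> \<le> c" "\<bar>r4\<bar> \<le> c" "\<bar>r5\<bar> \<le> d" "\<bar>r6\<bar> \<le> d" "d \<le> c"
    for r1 r2 r3 r4 r5 r6 c d :: real
  proof -
    have 1: "\<bar>r1 - r2\<bar> \<le> 2 * d" using that(1,2) by linarith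
    have 2: "\<bar>r3 + r4\<bar> \<le> 2 * c" using that(3,4) by linarith
    have "\<bar>r5 - r6\<bar> \<le> 2 * d" using that(5,6) by linarith
    then have 3: "\<bar>(r5 - r6) / 2\<bar> \<le> d" by simp
    show ?thesis using 1 2 3 that(7) by linarith
  qed
  have tri2: "r - r1 - r2 - (r5 + r6) / 2 \<le> r + 3 * d"
    if "\<bar>r1\<bar> \<le> d" "\<bar>r2\<bar> \<le> d" "\<bar>r5\<bar> \<le> d" "\<bar>r6\<bar> \<le> d" for r r1 r2 r5 r6 d :: real
  proof -
    have "- (r5 + r6) \<le> 2 * d" using that(3,4) by linarith
    then have "- ((r5 + r6) / 2) \<le> d" by (simp add: field_simps)
    then show ?thesis using that(1,2) by linarith
  qed
  have Ch: "C * h ^ 3 \<le> C * h\<^sup>2" using h3 C by (intro mult_left_mono) auto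
  have "X - Y = (X - (qp + h * ap + h\<^sup>2 * bp / 2)) - (Y - (qm - h * am + h\<^sup>2 * bm / 2))
     + (qp - qm + 2 * h * a\<^sub>0) + h * (ap - a\<^sub>0) + h * (am - a\<^sub>0) + (h\<^sup>2 * (bp - b\<^sub>0) - h\<^sup>2 * (bm - b\<^sub>0)) / 2"
    by (simp add: field_simps)
  then have "\<bar>X - Y\<bar> \<le> 5 * (C * h\<^sup>2)" using tri[OF X Y ma mb Ch] unfolding crit by (simp only:)
  then have "(X - Y)\<^sup>2 \<le> (5 * (C * h\<^sup>2))\<^sup>2" by (rule abs_le_square_iff[THEN iffD1, OF order_trans]) auto
  also have "\<dots> = 25 * C\<^sup>2 * h ^ 4" by (simp add: power_mult_distrib flip: power_mult)
  also have "\<dots> \<le> 25 * C\<^sup>2 * h ^ 3" using h3 by (intro mult_left_mono) auto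
  finally have d: "(X - Y)\<^sup>2 \<le> 25 * C\<^sup>2 * h ^ 3" .
  have "(X + Y)\<^sup>2 = 4 * (X * Y) + (X - Y)\<^sup>2" by (simp add: power2_eq_square algebra_simps)
  also have "\<dots> \<le> 4 * q\<^sub>0\<^sup>2 + (X - Y)\<^sup>2" using XY by simp
  also have "\<dots> \<le> (2 * q\<^sub>0 + (X - Y)\<^sup>2 / (4 * q\<^sub>0))\<^sup>2"
    using q by (simp add: power2_sum)
  finally have "X + Y \<le> 2 * q\<^sub>0 + (X - Y)\<^sup>2 / (4 * q\<^sub>0)"
    by (rule power2_le_imp_le) (use q in auto)
  also have "(X - Y)\<^sup>2 / (4 * q\<^sub>0) \<le> 25 * C\<^sup>2 * h ^ 3 / (4 * q\<^sub>0)"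
    using d q by (intro divide_right_mono) auto
  finally have S: "X + Y \<le> 2 * q\<^sub>0 + 25 * C\<^sup>2 / (4 * q\<^sub>0) * h ^ 3" by simp
  have "qp + qm + h * (ap - am) + h\<^sup>2 * b\<^sub>0 = X + Y - (X - (qp + h * ap + h\<^sup>2 * bp / 2)) - (Y - (qm - h * am + h\<^sup>2 * bm / 2))
     - (h\<^sup>2 * (bp - b\<^sub>0) + h\<^sup>2 * (bm - b\<^sub>0)) / 2"
    by (simp add: field_simps)
  also have "\<dots> \<le> X + Y + 3 * (C * h ^ 3)" by (rule tri2[OF X Y mb])
  finally show ?thesis using S by (simp add: algebra_simps)
qed

section \<open>Zonotopes\<close>

definition zono :: "'a::euclidean_space set \<Rightarrow> ('a \<Rightarrow> real) \<Rightarrow> 'a set" where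
  "zono W u = (\<Sum>v\<in>W. seg v (u v))"

lemma zono_empty [simp]: "zono {} u = 0"
  by (simp add: zono_def del: set_zero)

lemma zono_insert: "finite W \<Longrightarrow> a \<notin> W \<Longrightarrow> zono (insert a W) u = seg a (u a) + zono W u"
  by (simp add: zono_def)

lemma cbody_zono [simp]: "(\<And>v. v \<in> W \<Longrightarrow> 0 \<le> u v) \<Longrightarrow> cbody (zono W u)"
  by (simp add: zono_def)

lemma zono_plus:
  "(\<And>v. v \<in> W \<Longrightarrow> 0 \<le> u v) \<Longrightarrow> (\<And>v. v \<in> W \<Longrightarrow> 0 \<le> u' v) \<Longrightarrow>
    zono W u + zono W u' = zono W (\<lambda>v. u v + u' v)"
  unfolding zono_def sum.distrib[symmetric] by (intro sum.cong refl seg_plus)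

lemma dilate_zono:
  "0 \<le> c \<Longrightarrow> (\<And>v. v \<in> W \<Longrightarrow> 0 \<le> u v) \<Longrightarrow> dilate c (zono W u) = zono W (\<lambda>v. c * u v)"
  unfolding zono_def dilate_sum by (intro sum.cong refl dilate_seg)

lemma set_sum_mono: "(\<And>i. i \<in> I \<Longrightarrow> A i \<subseteq> B i) \<Longrightarrow> (\<Sum>i\<in>I. A i) \<subseteq> (\<Sum>i\<in>I. B i)"
  for A B :: "'i \<Rightarrow> 'a::comm_monoid_add set"
proof (induction I rule: infinite_finite_induct)
  case (insert x I)
  then have "A x + sum A I \<subseteq> B x + sum B I" by (intro set_plus_mono2) auto
  then show ?case using insert by simp
qed auto

lemma zono_mono: "(\<And>v. v \<in> W \<Longrightarrow> u v \<le> u' v) \<Longrightarrow> zono W u \<subseteq> zono W u'"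
  unfolding zono_def seg_def by (intro set_sum_mono image_mono) auto

lemma zero_in_zono: "(\<And>v. v \<in> W \<Longrightarrow> 0 \<le> u v) \<Longrightarrow> 0 \<in> zono W u"
proof -
  assume u: "\<And>v. v \<in> W \<Longrightarrow> 0 \<le> u v"
  have "(\<Sum>v\<in>W. {0}) \<subseteq> zono W u"
    unfolding zono_def using u by (intro set_sum_mono) auto
  moreover have "(\<Sum>v\<in>W. {0::'a}) = {0}"
    by (simp flip: set_zero)
  ultimately show ?thesis by auto
qed

context
  fixes F :: "'a::euclidean_space set \<Rightarrow> real" and k :: nat and a :: 'a and A B :: "'a set"
  assumes F: "body_functional k F" and A: "cbody A" and B: "cbody B"
begin

text \<open>Both lengths are compared with length 0, so the increment \<open>\<omega>\<close> may be
  negative.\<close>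

lemma seg_signed:
  assumes "0 \<le> u" "0 \<le> u + \<omega>"
  shows "F (A + (seg a (u + \<omega>) + B)) = F (A + seg a u + B) + \<omega> * dseg a F (A + seg a u + B)"
proof -
  have "F (A + B + seg a (u + \<omega>)) = F (A + B) + (u + \<omega>) * dseg a F (A + B)"
    "F (A + B + seg a u) = F (A + B) + u * dseg a F (A + B)"
    "dseg a F (A + B + seg a u) = dseg a F (A + B)"
    using A B assms by (auto intro: bf_seg[OF F] dseg_seg[OF F])
  moreover have "A + (seg a (u + \<omega>) + B) = A + B + seg a (u + \<omega>)" "A + seg a u + B = A + B + seg a u"
    by (simp_all add: ac_simps)
  ultimately show ?thesis by (simp add: algebra_simps)
qed

lemma seg_succ:
  assumes "0 \<le> u"
  shows "F (A + (seg a (u + 1) + B)) = F (A + seg a u + B) + dseg a F (A + seg a u + B)"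
  using seg_signed[of u 1] assms by simp

end

text \<open>The error bound, \<open>F\<close> with every edge one unit longer, obeys the same
  recursion over the edges as the expansion: a new edge adds exactly one \<open>dseg\<close> term to
  it. So the induction closes without constants that depend on \<open>W\<close>.\<close>

lemma zono_expand0:
  fixes F :: "'a::euclidean_space set \<Rightarrow> real"
  assumes F: "body_functional k F" and "finite W" and "cbody A"
    and "\<And>v. v \<in> W \<Longrightarrow> \<bar>\<omega> v\<bar> \<le> \<eta>" "\<And>v. v \<in> W \<Longrightarrow> \<eta> \<le> u v" and \<eta>: "0 \<le> \<eta>" "\<eta> \<le> 1"
  shows "\<bar>F (A + zono W (\<lambda>v. u v + \<omega> v)) - F (A + zono W u)\<bar> \<le> \<eta> * F (A + zono W (\<lambda>v. u v + 1))"
  using assms(2-5)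
proof (induction W arbitrary: A rule: finite_induct)
  case empty
  then show ?case using bf_nonneg[OF F, of A] \<eta> by simp
next
  case (insert a W)
  let ?A = "A + seg a (u a)" and ?u = "\<lambda>v. u v + \<omega> v" and ?u1 = "\<lambda>v. u v + 1"
  have \<omega>: "\<bar>\<omega> v\<bar> \<le> \<eta>" "\<eta> \<le> u v" "0 \<le> u v" "0 \<le> u v + \<omega> v" "u v + \<omega> v \<le> u v + 1" if "v \<in> insert a W" for v
    using insert.prems(2)[OF that] insert.prems(3)[OF that] \<eta> by linarith+
  have cb: "cbody ?A" "cbody (zono W u)" "cbody (zono W ?u)" "cbody (zono W ?u1)"
    using insert.prems \<omega> by (auto intro!: cbody_plus cbody_seg cbody_zono add_nonneg_nonneg)
  note z = zono_insert[OF insert.hyps]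
  have IH: "\<bar>F (?A + zono W ?u) - F (?A + zono W u)\<bar> \<le> \<eta> * F (?A + zono W ?u1)"
    using cb \<omega> by (intro insert.IH) auto
  have D: "0 \<le> dseg a F (?A + zono W ?u)" "dseg a F (?A + zono W ?u) \<le> dseg a F (?A + zono W ?u1)"
  proof -
    have cbo: "cbody (?A + zono W ?u)" "cbody (?A + zono W ?u1)" using cb by (simp_all only: cbody_plus)
    show "0 \<le> dseg a F (?A + zono W ?u)" by (rule dseg_nonneg[OF F cbo(1)])
    show "dseg a F (?A + zono W ?u) \<le> dseg a F (?A + zono W ?u1)"
      by (rule dseg_mono[OF F cbo set_plus_mono2[OF order_refl zono_mono]]) (use \<omega>(5) in auto)
  qed
  have "\<bar>\<omega> a * dseg a F (?A + zono W ?u)\<bar> \<le> \<eta> * dseg a F (?A + zono W ?u1)"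
    unfolding abs_mult using \<omega>[of a] D by (intro mult_mono) auto
  moreover have "F (A + zono (insert a W) ?u) = F (?A + zono W ?u) + \<omega> a * dseg a F (?A + zono W ?u)"
    unfolding z using \<omega>[of a] cb insert.prems by (intro seg_signed[OF F]) auto
  moreover have "A + zono (insert a W) u = ?A + zono W u"
    unfolding z by (simp add: ac_simps)
  moreover have "F (A + zono (insert a W) ?u1) = F (?A + zono W ?u1) + dseg a F (?A + zono W ?u1)"
    unfolding z using \<omega>[of a] cb insert.prems by (intro seg_succ[OF F]) auto
  ultimately show ?case using IH by (simp only: distrib_left)
qed

text \<open>The slope along the new edge varies with the other edges; the expansion of order zero,
  applied to \<open>dseg a F\<close>, bounds this variation.\<close>

lemma zono_expand1:
  fixes F :: "'a::euclidean_space set \<Rightarrow> real"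
  assumes F: "body_functional (Suc k) F" and "finite W" and "cbody A"
    and "\<And>v. v \<in> W \<Longrightarrow> \<bar>\<omega> v\<bar> \<le> \<eta>" "\<And>v. v \<in> W \<Longrightarrow> \<eta> \<le> u v" and \<eta>: "0 \<le> \<eta>" "\<eta> \<le> 1"
  shows "\<bar>F (A + zono W (\<lambda>v. u v + \<omega> v)) - F (A + zono W u) - (\<Sum>v\<in>W. \<omega> v * dseg v F (A + zono W u))\<bar>
     \<le> \<eta>\<^sup>2 * F (A + zono W (\<lambda>v. u v + 1))"
  using assms(2-5)
proof (induction W arbitrary: A rule: finite_induct)
  case empty
  then show ?case using bf_nonneg[OF F, of A] \<eta> by simp
next
  case (insert a W)
  let ?A = "A + seg a (u a)" and ?u = "\<lambda>v. u v + \<omega> v" and ?u1 = "\<lambda>v. u v + 1"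
  have \<omega>: "\<bar>\<omega> v\<bar> \<le> \<eta>" "\<eta> \<le> u v" "0 \<le> u v" "0 \<le> u v + \<omega> v" "u v + \<omega> v \<le> u v + 1" if "v \<in> insert a W" for v
    using insert.prems(2)[OF that] insert.prems(3)[OF that] \<eta> by linarith+
  have cb: "cbody ?A" "cbody (zono W u)" "cbody (zono W ?u)" "cbody (zono W ?u1)"
    using insert.prems \<omega> by (auto intro!: cbody_plus cbody_seg cbody_zono add_nonneg_nonneg)
  note z = zono_insert[OF insert.hyps]
  let ?D = "dseg a F"
  have IH: "\<bar>F (?A + zono W ?u) - F (?A + zono W u) - (\<Sum>v\<in>W. \<omega> v * dseg v F (?A + zono W u))\<bar> \<le> \<eta>\<^sup>2 * F (?A + zono W ?u1)"
    using cb \<omega> by (intro insert.IH) auto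
  have D: "\<bar>?D (?A + zono W ?u) - ?D (?A + zono W u)\<bar> \<le> \<eta> * ?D (?A + zono W ?u1)"
    using cb \<omega> \<eta> insert.hyps by (intro zono_expand0[OF body_functional_dseg[OF F]]) auto
  have "\<bar>\<omega> a * (?D (?A + zono W ?u) - ?D (?A + zono W u))\<bar> \<le> \<eta> * (\<eta> * ?D (?A + zono W ?u1))"
    unfolding abs_mult using \<omega>[of a] D \<eta> by (intro mult_mono) auto
  then have D': "\<bar>\<omega> a * ?D (?A + zono W ?u) - \<omega> a * ?D (?A + zono W u)\<bar> \<le> \<eta>\<^sup>2 * ?D (?A + zono W ?u1)"
    by (simp add: right_diff_distrib power2_eq_square mult.assoc)
  have 1: "F (A + zono (insert a W) ?u) = F (?A + zono W ?u) + \<omega> a * ?D (?A + zono W ?u)"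
    unfolding z using \<omega>[of a] cb insert.prems by (intro seg_signed[OF F]) auto
  have 2: "A + zono (insert a W) u = ?A + zono W u"
    unfolding z by (simp add: ac_simps)
  have 3: "F (A + zono (insert a W) ?u1) = F (?A + zono W ?u1) + ?D (?A + zono W ?u1)"
    unfolding z using \<omega>[of a] cb insert.prems by (intro seg_succ[OF F]) auto
  show ?case
    unfolding 1 2 3 sum.insert[OF insert.hyps] distrib_left using IH D' by linarith
qed

text \<open>The double sum counts every pair of distinct edges twice, whence the division by 2; its
  diagonal vanishes because the second difference along a single edge is zero.\<close>

lemma zono_expand2:
  fixes F :: "'a::euclidean_space set \<Rightarrow> real"
  assumes F: "body_functional (Suc (Suc k)) F" and "finite W" and "cbody A"
    and "\<And>v. v \<in> W \<Longrightarrow> \<bar>\<omega> v\<bar> \<le> \<eta>" "\<And>v. v \<in> W \<Longrightarrow> \<eta> \<le> u v" and \<eta>: "0 \<le> \<eta>" "\<eta> \<le> 1"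
  shows "\<bar>F (A + zono W (\<lambda>v. u v + \<omega> v)) - F (A + zono W u) - (\<Sum>v\<in>W. \<omega> v * dseg v F (A + zono W u))
      - (\<Sum>v\<in>W. \<Sum>w\<in>W. \<omega> v * \<omega> w * dseg v (dseg w F) (A + zono W u)) / 2\<bar>
     \<le> \<eta> ^ 3 * F (A + zono W (\<lambda>v. u v + 1))"
  using assms(2-5)
proof (induction W arbitrary: A rule: finite_induct)
  case empty
  then show ?case using bf_nonneg[OF F, of A] \<eta> by simp
next
  case (insert a W)
  let ?A = "A + seg a (u a)" and ?u = "\<lambda>v. u v + \<omega> v" and ?u1 = "\<lambda>v. u v + 1"
  have \<omega>: "\<bar>\<omega> v\<bar> \<le> \<eta>" "\<eta> \<le> u v" "0 \<le> u v" "0 \<le> u v + \<omega> v" "u v + \<omega> v \<le> u v + 1" if "v \<in> insert a W" for v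
    using insert.prems(2)[OF that] insert.prems(3)[OF that] \<eta> by linarith+
  have cb: "cbody ?A" "cbody (zono W u)" "cbody (zono W ?u)" "cbody (zono W ?u1)"
    using insert.prems \<omega> by (auto intro!: cbody_plus cbody_seg cbody_zono add_nonneg_nonneg)
  note z = zono_insert[OF insert.hyps]
  let ?D = "dseg a F" and ?AZ = "?A + zono W u"
  let ?SL = "\<Sum>v\<in>W. \<omega> v * dseg v F ?AZ" and ?SQ = "\<Sum>v\<in>W. \<Sum>w\<in>W. \<omega> v * \<omega> w * dseg v (dseg w F) ?AZ"
  let ?T = "\<Sum>v\<in>W. \<omega> v * dseg v ?D ?AZ"
  have IH: "\<bar>F (?A + zono W ?u) - F ?AZ - ?SL - ?SQ / 2\<bar> \<le> \<eta> ^ 3 * F (?A + zono W ?u1)"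
    using cb \<omega> by (intro insert.IH) auto
  have D: "\<bar>?D (?A + zono W ?u) - ?D ?AZ - ?T\<bar> \<le> \<eta>\<^sup>2 * ?D (?A + zono W ?u1)"
    using cb \<omega> \<eta> insert.hyps by (intro zono_expand1[OF body_functional_dseg[OF F]]) auto
  have "\<bar>\<omega> a * (?D (?A + zono W ?u) - ?D ?AZ - ?T)\<bar> \<le> \<eta> * (\<eta>\<^sup>2 * ?D (?A + zono W ?u1))"
    unfolding abs_mult using \<omega>[of a] D \<eta> by (intro mult_mono) auto
  then have D': "\<bar>\<omega> a * ?D (?A + zono W ?u) - \<omega> a * ?D ?AZ - \<omega> a * ?T\<bar> \<le> \<eta> ^ 3 * ?D (?A + zono W ?u1)"
    by (simp add: right_diff_distrib power2_eq_square power3_eq_cube mult.assoc)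
  have 1: "F (A + zono (insert a W) ?u) = F (?A + zono W ?u) + \<omega> a * ?D (?A + zono W ?u)"
    unfolding z using \<omega>[of a] cb insert.prems by (intro seg_signed[OF F]) auto
  have 2: "A + zono (insert a W) u = ?AZ"
    unfolding z by (simp add: ac_simps)
  have 3: "F (A + zono (insert a W) ?u1) = F (?A + zono W ?u1) + ?D (?A + zono W ?u1)"
    unfolding z using \<omega>[of a] cb insert.prems by (intro seg_succ[OF F]) auto
  have zz: "dseg a ?D ?AZ = 0" using cb by (intro dseg_dseg_zero[OF F]) auto
  have c1: "(\<Sum>w\<in>W. \<omega> a * \<omega> w * dseg a (dseg w F) ?AZ) = \<omega> a * ?T"
    unfolding sum_distrib_left
    by (intro sum.cong refl) (simp only: mult.assoc, simp only: fun_cong[OF dseg_commute, of _ a])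
  have c2: "(\<Sum>v\<in>W. \<omega> v * \<omega> a * dseg v ?D ?AZ) = \<omega> a * ?T"
    unfolding sum_distrib_left by (intro sum.cong refl) (simp only: mult.assoc mult.left_commute)
  have 4: "(\<Sum>v\<in>insert a W. \<Sum>w\<in>insert a W. \<omega> v * \<omega> w * dseg v (dseg w F) ?AZ) = ?SQ + 2 * (\<omega> a * ?T)"
    using c1 c2 by (simp add: sum.insert[OF insert.hyps] zz sum.distrib)
  have "\<bar>F (?A + zono W ?u) + \<omega> a * ?D (?A + zono W ?u) - F ?AZ - (\<omega> a * ?D ?AZ + ?SL) - (?SQ + 2 * (\<omega> a * ?T)) / 2\<bar>
      \<le> \<eta> ^ 3 * F (?A + zono W ?u1) + \<eta> ^ 3 * ?D (?A + zono W ?u1)"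
    using IH D' by (simp add: add_divide_distrib)
  then show ?case
    unfolding 1 2 3 4 unfolding sum.insert[OF insert.hyps] distrib_left .
qed

text \<open>The expression equals half the sum of \<open>Q v u * (w v - w u)\<^sup>2\<close>, the
  Dirichlet form of \<open>w\<close>, plus the sum of \<open>p v * (w v - \<tau> v)\<^sup>2\<close>,
  where \<open>p v\<close> is the total weight at \<open>v\<close>. The Laplace equation for
  \<open>w\<close> is what turns the linear terms into squares. In the application \<open>Q\<close>
  and \<open>S\<close> are second differences of the total and third differences of
  \<open>H\<close>.\<close>

lemma bochner_algebra:
  fixes G :: "'b \<Rightarrow> 'b \<Rightarrow> real" and S :: "'b \<Rightarrow> 'b \<Rightarrow> 'b \<Rightarrow> real"
  assumes W: "finite W"
    and eq: "\<And>v. v \<in> W \<Longrightarrow> (\<Sum>u\<in>W. Q v u * (w v - w u)) = (\<Sum>j\<in>W. G j v)"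
    and Gs: "\<And>v. v \<in> W \<Longrightarrow> (\<Sum>u\<in>W. G v u) = (\<Sum>j\<in>W. G j v)"
    and Q: "\<And>u v. Q v u = (\<Sum>j\<in>W. S j v u)"
    and Ss: "\<And>j v. j \<in> W \<Longrightarrow> v \<in> W \<Longrightarrow> (\<Sum>u\<in>W. S j v u) = Q v j"
    and sym: "\<And>j u v. S j v u = S j u v"
    and nonneg: "\<And>j u v. j \<in> W \<Longrightarrow> u \<in> W \<Longrightarrow> v \<in> W \<Longrightarrow> 0 \<le> S j v u"
  shows "0 \<le> 2 * (\<Sum>j\<in>W. \<Sum>v\<in>W. (w v - \<tau> j) * G j v)
     + (\<Sum>j\<in>W. \<Sum>v\<in>W. \<Sum>u\<in>W. (w v - \<tau> j) * (w u - \<tau> j) * S j v u)"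
proof -
  define \<gamma> where "\<gamma> v = (\<Sum>j\<in>W. G j v)" for v
  define p where "p v = (\<Sum>u\<in>W. Q v u)" for v
  define N where "N v = (\<Sum>u\<in>W. Q v u * w u)" for v
  have Qs: "Q u v = Q v u" for u v unfolding Q by (intro sum.cong refl sym)
  have Q0: "0 \<le> Q v u" if "u \<in> W" "v \<in> W" for u v unfolding Q using that by (intro sum_nonneg nonneg)
  have g: "\<gamma> v = p v * w v - N v" if "v \<in> W" for v
    unfolding \<gamma>_def eq[OF that, symmetric] p_def N_def by (simp add: right_diff_distrib sum_subtractf sum_distrib_right)
  have T1: "(\<Sum>j\<in>W. \<Sum>v\<in>W. (w v - \<tau> j) * G j v) = (\<Sum>v\<in>W. w v * \<gamma> v) - (\<Sum>j\<in>W. \<tau> j * \<gamma> j)"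
  proof -
    have "(\<Sum>j\<in>W. \<Sum>v\<in>W. (w v - \<tau> j) * G j v) = (\<Sum>j\<in>W. \<Sum>v\<in>W. w v * G j v) - (\<Sum>j\<in>W. \<Sum>v\<in>W. \<tau> j * G j v)"
      by (simp only: left_diff_distrib sum_subtractf)
    also have "(\<Sum>j\<in>W. \<Sum>v\<in>W. w v * G j v) = (\<Sum>v\<in>W. w v * \<gamma> v)"
      unfolding \<gamma>_def sum_distrib_left by (rule sum.swap)
    also have "(\<Sum>j\<in>W. \<Sum>v\<in>W. \<tau> j * G j v) = (\<Sum>j\<in>W. \<tau> j * \<gamma> j)"
      unfolding \<gamma>_def sum_distrib_left[symmetric] by (intro sum.cong refl) (simp only: Gs)
    finally show ?thesis .
  qed
  have N': "(\<Sum>v\<in>W. w v * Q v j) = N j" for j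
    unfolding N_def by (intro sum.cong refl) (simp only: Qs[of j] mult.commute)
  have T2: "(\<Sum>v\<in>W. \<Sum>u\<in>W. (w v - \<tau> j) * (w u - \<tau> j) * S j v u) =
     (\<Sum>v\<in>W. \<Sum>u\<in>W. w v * w u * S j v u) - 2 * (\<tau> j * N j) + \<tau> j * \<tau> j * p j" if j: "j \<in> W" for j
  proof -
    have a: "(\<Sum>v\<in>W. \<Sum>u\<in>W. w v * S j v u) = N j"
      unfolding sum_distrib_left[symmetric] N'[symmetric] using j by (intro sum.cong refl) (simp only: Ss)
    have b: "(\<Sum>v\<in>W. \<Sum>u\<in>W. w u * S j v u) = N j"
      by (subst sum.swap) (simp only: sym[of j] a)
    have c: "(\<Sum>v\<in>W. \<Sum>u\<in>W. S j v u) = p j"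
      unfolding p_def using j by (intro sum.cong refl) (simp only: Ss Qs[of j])
    have "(\<Sum>v\<in>W. \<Sum>u\<in>W. (w v - \<tau> j) * (w u - \<tau> j) * S j v u) =
       (\<Sum>v\<in>W. \<Sum>u\<in>W. w v * w u * S j v u - \<tau> j * (w v * S j v u) - \<tau> j * (w u * S j v u) + \<tau> j * \<tau> j * S j v u)"
      by (intro sum.cong refl) (simp add: algebra_simps)
    also have "\<dots> = (\<Sum>v\<in>W. \<Sum>u\<in>W. w v * w u * S j v u) - \<tau> j * (\<Sum>v\<in>W. \<Sum>u\<in>W. w v * S j v u)
        - \<tau> j * (\<Sum>v\<in>W. \<Sum>u\<in>W. w u * S j v u) + \<tau> j * \<tau> j * (\<Sum>v\<in>W. \<Sum>u\<in>W. S j v u)"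
      by (simp only: sum.distrib sum_subtractf sum_distrib_left)
    finally show ?thesis unfolding a b c by simp
  qed
  have T3: "(\<Sum>j\<in>W. \<Sum>v\<in>W. \<Sum>u\<in>W. w v * w u * S j v u) = (\<Sum>v\<in>W. w v * N v)"
  proof -
    have "(\<Sum>j\<in>W. \<Sum>v\<in>W. \<Sum>u\<in>W. w v * w u * S j v u) = (\<Sum>v\<in>W. \<Sum>j\<in>W. \<Sum>u\<in>W. w v * w u * S j v u)"
      by (rule sum.swap)
    also have "\<dots> = (\<Sum>v\<in>W. \<Sum>u\<in>W. \<Sum>j\<in>W. w v * w u * S j v u)"
      by (intro sum.cong refl sum.swap)
    also have "\<dots> = (\<Sum>v\<in>W. w v * N v)"
      unfolding N_def Q sum_distrib_left sum_distrib_right by (intro sum.cong refl) (simp only: mult_ac)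
    finally show ?thesis .
  qed
  have sq: "(\<Sum>v\<in>W. w v * \<gamma> v) \<ge> 0"
  proof -
    have "(\<Sum>v\<in>W. w v * \<gamma> v) = (\<Sum>v\<in>W. \<Sum>u\<in>W. Q v u * ((w v - w u) * w v))"
      unfolding \<gamma>_def eq[symmetric] by (intro sum.cong refl) (simp add: eq[symmetric] sum_distrib_left mult_ac)
    also have "\<dots> = (\<Sum>v\<in>W. \<Sum>u\<in>W. Q v u * ((w u - w v) * w u))"
      by (subst sum.swap) (simp only: Qs)
    finally have 1: "(\<Sum>v\<in>W. w v * \<gamma> v) = (\<Sum>v\<in>W. \<Sum>u\<in>W. Q v u * ((w u - w v) * w u))" .
    have "2 * (\<Sum>v\<in>W. w v * \<gamma> v) = (\<Sum>v\<in>W. \<Sum>u\<in>W. Q v u * ((w v - w u) * w v)) + (\<Sum>v\<in>W. \<Sum>u\<in>W. Q v u * ((w u - w v) * w u))"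
      using 1 \<open>(\<Sum>v\<in>W. w v * \<gamma> v) = (\<Sum>v\<in>W. \<Sum>u\<in>W. Q v u * ((w v - w u) * w v))\<close> by simp
    also have "\<dots> = (\<Sum>v\<in>W. \<Sum>u\<in>W. Q v u * (w v - w u)\<^sup>2)"
      unfolding sum.distrib[symmetric] by (intro sum.cong refl) (simp add: power2_eq_square algebra_simps)
    also have "\<dots> \<ge> 0" by (intro sum_nonneg mult_nonneg_nonneg Q0) auto
    finally show ?thesis by simp
  qed
  have p0: "p v \<ge> 0" if "v \<in> W" for v unfolding p_def using that by (intro sum_nonneg Q0)
  have "2 * ((\<Sum>v\<in>W. w v * \<gamma> v) - (\<Sum>j\<in>W. \<tau> j * \<gamma> j)) + ((\<Sum>v\<in>W. w v * N v) - (\<Sum>j\<in>W. 2 * (\<tau> j * N j)) + (\<Sum>j\<in>W. \<tau> j * \<tau> j * p j))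
     = (\<Sum>v\<in>W. w v * \<gamma> v) + (\<Sum>v\<in>W. w v * \<gamma> v - 2 * (\<tau> v * \<gamma> v) + w v * N v - 2 * (\<tau> v * N v) + \<tau> v * \<tau> v * p v)"
    by (simp add: sum.distrib sum_subtractf sum_distrib_left[symmetric])
  also have "(\<Sum>v\<in>W. w v * \<gamma> v - 2 * (\<tau> v * \<gamma> v) + w v * N v - 2 * (\<tau> v * N v) + \<tau> v * \<tau> v * p v) = (\<Sum>v\<in>W. p v * (w v - \<tau> v)\<^sup>2)"
    by (intro sum.cong refl) (simp add: g power2_eq_square algebra_simps)
  finally have fin: "2 * ((\<Sum>v\<in>W. w v * \<gamma> v) - (\<Sum>j\<in>W. \<tau> j * \<gamma> j)) + ((\<Sum>v\<in>W. w v * N v) - (\<Sum>j\<in>W. 2 * (\<tau> j * N j)) + (\<Sum>j\<in>W. \<tau> j * \<tau> j * p j))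
     = (\<Sum>v\<in>W. w v * \<gamma> v) + (\<Sum>v\<in>W. p v * (w v - \<tau> v)\<^sup>2)" .
  have "(\<Sum>j\<in>W. \<Sum>v\<in>W. \<Sum>u\<in>W. (w v - \<tau> j) * (w u - \<tau> j) * S j v u) =
      (\<Sum>v\<in>W. w v * N v) - (\<Sum>j\<in>W. 2 * (\<tau> j * N j)) + (\<Sum>j\<in>W. \<tau> j * \<tau> j * p j)"
    unfolding T3[symmetric] sum.distrib[symmetric] sum_subtractf[symmetric] by (intro sum.cong refl T2)
  moreover have "0 \<le> (\<Sum>v\<in>W. p v * (w v - \<tau> v)\<^sup>2)"
    by (intro sum_nonneg mult_nonneg_nonneg p0) auto
  ultimately show ?thesis unfolding T1 using fin sq by linarith
qed

section \<open>The second difference of the surface derivative\<close>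

lemma comb3_lipschitz_family:
  fixes \<F> :: "('a::euclidean_space set \<Rightarrow> real) set"
  assumes "finite \<F>" and "\<forall>F\<in>\<F>. \<exists>k. body_functional k F"
    and KLZ: "cbody K" "cbody L" "cbody Z" "0 \<in> K" "0 \<in> L" "0 \<in> Z"
    and pos: "x\<^sub>0 > 0" "y\<^sub>0 > 0" "z\<^sub>0 > 0"
  shows "\<exists>C \<eta>\<^sub>0. C \<ge> 0 \<and> \<eta>\<^sub>0 > 0 \<and> (\<forall>F\<in>\<F>. \<forall>\<eta> x y z. \<eta> \<le> \<eta>\<^sub>0 \<longrightarrow> \<bar>x - x\<^sub>0\<bar> \<le> \<eta> \<longrightarrow> \<bar>y - y\<^sub>0\<bar> \<le> \<eta> \<longrightarrow> \<bar>z - z\<^sub>0\<bar> \<le> \<eta> \<longrightarrow>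
      \<bar>F (comb3 K L Z x y z) - F (comb3 K L Z x\<^sub>0 y\<^sub>0 z\<^sub>0)\<bar> \<le> C * \<eta>)"
  using assms(1,2)
proof (induction \<F> rule: finite_induct)
  case empty
  then show ?case by (intro exI[of _ 0] exI[of _ 1]) auto
next
  case (insert F \<F>)
  obtain k where k: "body_functional k F" using insert.prems by blast
  obtain C1 e1 where 1: "C1 \<ge> 0" "e1 > 0"
    "\<And>\<eta> x y z. \<eta> \<le> e1 \<Longrightarrow> \<bar>x - x\<^sub>0\<bar> \<le> \<eta> \<Longrightarrow> \<bar>y - y\<^sub>0\<bar> \<le> \<eta> \<Longrightarrow> \<bar>z - z\<^sub>0\<bar> \<le> \<eta> \<Longrightarrow>
      \<bar>F (comb3 K L Z x y z) - F (comb3 K L Z x\<^sub>0 y\<^sub>0 z\<^sub>0)\<bar> \<le> C1 * \<eta>"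
    by (rule comb3_lipschitz[OF k KLZ pos]) (rule that)
  have "\<forall>F\<in>\<F>. \<exists>k. body_functional k F" using insert.prems by blast
  from insert.IH[OF this] obtain C2 e2 where 2: "C2 \<ge> 0" "e2 > 0"
    "\<forall>F\<in>\<F>. \<forall>\<eta> x y z. \<eta> \<le> e2 \<longrightarrow> \<bar>x - x\<^sub>0\<bar> \<le> \<eta> \<longrightarrow> \<bar>y - y\<^sub>0\<bar> \<le> \<eta> \<longrightarrow> \<bar>z - z\<^sub>0\<bar> \<le> \<eta> \<longrightarrow>
      \<bar>F (comb3 K L Z x y z) - F (comb3 K L Z x\<^sub>0 y\<^sub>0 z\<^sub>0)\<bar> \<le> C2 * \<eta>"
    by (elim exE conjE) (rule that)
  have "\<bar>G (comb3 K L Z x y z) - G (comb3 K L Z x\<^sub>0 y\<^sub>0 z\<^sub>0)\<bar> \<le> max C1 C2 * \<eta>"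
    if G: "G \<in> insert F \<F>" and e: "\<eta> \<le> min e1 e2" "\<bar>x - x\<^sub>0\<bar> \<le> \<eta>" "\<bar>y - y\<^sub>0\<bar> \<le> \<eta>" "\<bar>z - z\<^sub>0\<bar> \<le> \<eta>" for G \<eta> x y z
  proof -
    have "0 \<le> \<eta>" using e(2) by linarith
    then have m: "C1 * \<eta> \<le> max C1 C2 * \<eta>" "C2 * \<eta> \<le> max C1 C2 * \<eta>" by (auto intro: mult_right_mono)
    show ?thesis
    proof (cases "G = F")
      case True
      then show ?thesis using 1(3)[of \<eta> x y z] e m by auto
    next
      case False
      then show ?thesis using 2(3)[rule_format, of G \<eta> x y z] G e m by auto
    qed
  qed
  then show ?case using 1 2 by (intro exI[of _ "max C1 C2"] exI[of _ "min e1 e2"]) auto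
qed

text \<open>The two bodies \<open>P h\<close> and \<open>P (- h)\<close> are displaced by zonotopes with edge lengths \<open>O (h)\<close>, chosen by solving a
  graph Laplacian so that the log-concavity of every \<open>dseg j H\<close> can be applied without first-order loss.\<close>

lemma second_difference_upper:
  fixes H :: "'a::euclidean_space set \<Rightarrow> real"
  assumes H: "body_functional (Suc (Suc (Suc n))) H"
    and W: "finite W" "W \<noteq> {}"
    and KL: "cbody K" "cbody L" "0 \<in> K" "0 \<in> L"
    and \<theta>: "0 < \<theta>" "\<theta> < 1" and \<delta>: "\<delta> > 0"
    and lc: "\<And>j. j \<in> W \<Longrightarrow> midpoint_log_concave (dseg j H)"
    and Pdef: "\<And>s \<xi> \<zeta>. P s \<xi> \<zeta> = comb3 K L (zono W (\<lambda>_. 1)) ((1 + s * \<xi>) * (1 - \<theta>) - s * \<zeta>) ((1 + s * \<xi>) * \<theta> + s * \<zeta>) ((1 + s * \<xi>) * \<delta>)"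
    and posQ: "\<And>v u. v \<in> W \<Longrightarrow> u \<in> W \<Longrightarrow> v \<noteq> u \<Longrightarrow> 0 < dseg v (dseg u (dzon W H)) (P 0 0 0)"
    and posD: "\<And>j. j \<in> W \<Longrightarrow> 0 < dseg j (dzon W H) (P 0 0 0)"
    and posq: "\<And>j. j \<in> W \<Longrightarrow> 0 < dseg j H (P 0 0 0)"
  obtains C h\<^sub>1 where "h\<^sub>1 > 0"
    "\<And>h \<xi> \<zeta>. 0 < h \<Longrightarrow> h \<le> h\<^sub>1 \<Longrightarrow> \<bar>\<xi>\<bar> \<le> 1 \<Longrightarrow> \<bar>\<zeta>\<bar> \<le> 1 \<Longrightarrow>
      dzon W (dzon W H) (P h \<xi> \<zeta>) = dzon W (dzon W H) (P (- h) \<xi> \<zeta>) \<Longrightarrow>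
      dzon W H (P h \<xi> \<zeta>) + dzon W H (P (- h) \<xi> \<zeta>) - 2 * dzon W H (P 0 0 0) \<le> C * h ^ 3"
proof -
  define q where "q = dzon W H"
  define Z where "Z = zono W (\<lambda>_. 1)"
  define A where "A = P 0 0 0"
  have Z: "cbody Z" "0 \<in> Z" by (auto simp: Z_def zero_in_zono)
  have A_eq: "A = comb3 K L Z (1 - \<theta>) \<theta> \<delta>" by (simp add: A_def Pdef Z_def)
  have cA: "cbody A" using KL Z by (simp add: A_eq)
  have cP: "cbody (P s \<xi> \<zeta>)" for s \<xi> \<zeta> using KL Z by (simp add: Pdef Z_def)
  note bD = body_functional_dseg
  have qj: "body_functional (Suc (Suc n)) (dseg j H)" for j by (intro bD H)
  have q: "body_functional (Suc (Suc n)) q" unfolding q_def by (intro body_functional_dzon H)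
  have dq: "dseg v q B = (\<Sum>j\<in>W. dseg v (dseg j H) B)" for v B
    unfolding q_def dzon_def[abs_def] by (rule dseg_sum)
  have ddq: "dseg v (dseg u q) B = (\<Sum>j\<in>W. dseg v (dseg u (dseg j H)) B)" for v u B
  proof -
    have "dseg u q = (\<lambda>B. \<Sum>j\<in>W. dseg u (dseg j H) B)" by (rule ext) (rule dq)
    then show ?thesis by (simp add: dseg_sum)
  qed
  \<comment> \<open>One Lipschitz constant must serve all differences that occur in the expansions
    below.\<close>
  define Fam where "Fam = (\<lambda>j. dseg j H) ` W \<union> (\<lambda>(v, j). dseg v (dseg j H)) ` (W \<times> W)
     \<union> (\<lambda>(v, u, j). dseg v (dseg u (dseg j H))) ` (W \<times> W \<times> W) \<union> (\<lambda>v. dseg v q) ` W"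
  have "finite Fam" unfolding Fam_def using W by auto
  have "\<forall>F\<in>Fam. \<exists>k. body_functional k F"
  proof
    fix F assume "F \<in> Fam"
    have "\<exists>k. body_functional k (dseg j H)" "\<exists>k. body_functional k (dseg v (dseg j H))"
      "\<exists>k. body_functional k (dseg v (dseg u (dseg j H)))" "\<exists>k. body_functional k (dseg v q)" for j v u
      using qj bD[OF qj] bD[OF bD[OF qj]] bD[OF q] by blast+
    then show "\<exists>k. body_functional k F" using \<open>F \<in> Fam\<close> unfolding Fam_def by auto
  qed
  from comb3_lipschitz_family[OF \<open>finite Fam\<close> this, of K L Z "1 - \<theta>" \<theta> \<delta>] KL Z \<theta> \<delta>
  obtain M1 \<eta>\<^sub>1 where M1: "M1 \<ge> 0" "\<eta>\<^sub>1 > 0" and M1': "\<forall>F\<in>Fam. \<forall>\<eta> x y z. \<eta> \<le> \<eta>\<^sub>1 \<longrightarrow>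
      \<bar>x - (1 - \<theta>)\<bar> \<le> \<eta> \<longrightarrow> \<bar>y - \<theta>\<bar> \<le> \<eta> \<longrightarrow> \<bar>z - \<delta>\<bar> \<le> \<eta> \<longrightarrow>
      \<bar>F (comb3 K L Z x y z) - F (comb3 K L Z (1 - \<theta>) \<theta> \<delta>)\<bar> \<le> M1 * \<eta>"
    by (simp del: abs_le_iff) blast
  define M where "M = M1 * (2 + \<delta>)"
  have M: "M \<ge> 0" using M1 \<delta> by (simp add: M_def)
  have lip: "\<bar>F (P s \<xi> \<zeta>) - F A\<bar> \<le> M * \<bar>s\<bar>"
    if F: "F \<in> Fam" and s: "\<bar>s\<bar> * (2 + \<delta>) \<le> \<eta>\<^sub>1" "\<bar>\<xi>\<bar> \<le> 1" "\<bar>\<zeta>\<bar> \<le> 1" for F s \<xi> \<zeta>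
  proof -
    have sx: "\<bar>s * \<xi>\<bar> \<le> \<bar>s\<bar>" "\<bar>s * \<zeta>\<bar> \<le> \<bar>s\<bar>"
      using s mult_left_mono[OF s(2), of "\<bar>s\<bar>"] mult_left_mono[OF s(3), of "\<bar>s\<bar>"] by (auto simp: abs_mult)
    have c: "\<bar>s * \<xi> * c\<bar> \<le> \<bar>s\<bar> * c'" if "0 \<le> c" "c \<le> c'" for c c'
      unfolding abs_mult[of "s * \<xi>"] using sx that by (intro mult_mono) auto
    have "\<bar>s * \<xi> * (1 - \<theta>)\<bar> \<le> \<bar>s\<bar> * 1" "\<bar>s * \<xi> * \<theta>\<bar> \<le> \<bar>s\<bar> * 1" "\<bar>s * \<xi> * \<delta>\<bar> \<le> \<bar>s\<bar> * \<delta>"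
      using c[of "1 - \<theta>" 1] c[of \<theta> 1] c[of \<delta> \<delta>] \<theta> \<delta> by auto
    moreover have "0 \<le> \<bar>s\<bar> * \<delta>" using \<delta> by simp
    ultimately have "\<bar>F (P s \<xi> \<zeta>) - F A\<bar> \<le> M1 * (\<bar>s\<bar> * (2 + \<delta>))"
      unfolding Pdef Z_def[symmetric] A_eq using sx s
      by (intro M1'[rule_format] F) (simp_all add: algebra_simps, linarith+)
    then show ?thesis by (simp add: M_def mult_ac)
  qed
  obtain Cw where Cw: "Cw \<ge> 0"
    "\<And>\<gamma>. (\<Sum>v\<in>W. \<gamma> v) = 0 \<Longrightarrow>
      \<exists>w. (\<forall>v\<in>W. (\<Sum>u\<in>W. dseg v (dseg u q) A * (w v - w u)) = \<gamma> v) \<and> (\<forall>v\<in>W. \<bar>w v\<bar> \<le> Cw * (\<Sum>u\<in>W. \<bar>\<gamma> u\<bar>))"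
  proof (rule laplacian_solvable_bounded[of W "\<lambda>v u. dseg v (dseg u q) A"])
    show "dseg u (dseg v q) A > 0" if "u \<in> W" "v \<in> W" "u \<noteq> v" for u v
      using posQ[OF that] by (simp add: q_def A_def)
    show "dseg u (dseg v q) A = dseg v (dseg u q) A" for u v by (rule fun_cong[OF dseg_commute])
  qed (use W in auto)
  define N where "N = real (card W)"
  \<comment> \<open>\<open>\<Omega>1\<close> will bound the solution \<open>w\<close> of the Laplace
    equation and \<open>\<Omega>2\<close> the shifts \<open>\<tau> j\<close>. Both are fixed before
    the step and the direction are known.\<close>
  define \<Omega>1 where "\<Omega>1 = Cw * (N * M)"
  define D where "D j = dseg j q A" for j
  define \<Omega>2 where "\<Omega>2 = (\<Sum>j\<in>W. (M + (\<Sum>v\<in>W. \<Omega>1 * dseg v (dseg j H) A)) / D j)"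
  define \<Omega> where "\<Omega> = \<Omega>1 + \<Omega>2"
  have N: "N \<ge> 0" by (simp add: N_def)
  have D: "D j > 0" if "j \<in> W" for j using posD[OF that] by (simp add: D_def q_def A_def)
  have d0: "0 \<le> dseg v (dseg j H) A" for v j by (intro dseg_nonneg[OF qj] cA)
  have \<Omega>1: "\<Omega>1 \<ge> 0" using Cw N M by (simp add: \<Omega>1_def)
  have \<Omega>2j: "(M + (\<Sum>v\<in>W. \<Omega>1 * dseg v (dseg j H) A)) / D j \<ge> 0" if "j \<in> W" for j
    using M \<Omega>1 D[OF that] d0 by (intro divide_nonneg_pos add_nonneg_nonneg sum_nonneg mult_nonneg_nonneg) auto
  have \<Omega>: "\<Omega> \<ge> 0" using \<Omega>1 \<Omega>2j unfolding \<Omega>_def \<Omega>2_def by (intro add_nonneg_nonneg sum_nonneg) auto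
  \<comment> \<open>With \<open>s = h\<close> or \<open>s = - h\<close> the coefficients of
    \<open>K\<close> and \<open>L\<close> stay below 3 and that of the zonotope below
    \<open>2 * \<delta>\<close>; one more unit of edge length comes from the error bound of the
    expansion. So \<open>B j\<close> controls the cubic remainder.\<close>
  define B where "B j = dseg j H (comb3 K L Z 3 3 (2 * \<delta> + 1))" for j
  have B: "B j \<ge> 0" for j unfolding B_def using KL Z by (intro dseg_nonneg[OF H]) auto
  define C0 where "C0 j = \<Omega> ^ 3 * B j + N * (\<Omega> * M) + N * (N * (\<Omega> * \<Omega> * M))" for j
  have C0: "C0 j \<ge> 0" "\<Omega> ^ 3 * B j \<le> C0 j" "N * (\<Omega> * M) \<le> C0 j" "N * (N * (\<Omega> * \<Omega> * M)) \<le> C0 j" for j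
    using \<Omega> B[of j] N M by (auto simp: C0_def)
  define C where "C = (\<Sum>j\<in>W. 3 * C0 j + 25 * (C0 j)\<^sup>2 / (4 * dseg j H A))"
  \<comment> \<open>In this order the bounds keep: the dilation factor away from 0, the bodies
    within the Lipschitz radius, the displacements at most 1 and at most
    \<open>\<delta> / 2\<close>, and the coefficients of \<open>K\<close> and \<open>L\<close>
    nonnegative.\<close>
  define h\<^sub>1 where "h\<^sub>1 = min (1/2) (min (\<eta>\<^sub>1 / (2 + \<delta>)) (min (1 / (\<Omega> + 1)) (min (\<delta> / (2 * (\<Omega> + 1))) (min ((1 - \<theta>) / 2) (\<theta> / 2)))))"
  show ?thesis
  proof (rule that[of h\<^sub>1 C])
    show "h\<^sub>1 > 0" unfolding h\<^sub>1_def using M1 \<delta> \<Omega> \<theta> by simp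
    fix h \<xi> \<zeta> :: real
    assume h: "0 < h" "h \<le> h\<^sub>1" and \<xi>: "\<bar>\<xi>\<bar> \<le> 1" and \<zeta>: "\<bar>\<zeta>\<bar> \<le> 1"
      and Zeq: "dzon W (dzon W H) (P h \<xi> \<zeta>) = dzon W (dzon W H) (P (- h) \<xi> \<zeta>)"
    have h1: "h \<le> 1/2" "h \<le> (1 - \<theta>) / 2" "h \<le> \<theta> / 2" "h * (2 + \<delta>) \<le> \<eta>\<^sub>1" "h * \<Omega> \<le> 1" "h * \<Omega> \<le> \<delta> / 2"
    proof -
      show "h \<le> 1/2" "h \<le> (1 - \<theta>) / 2" "h \<le> \<theta> / 2" using h by (simp_all add: h\<^sub>1_def)
      have "h \<le> \<eta>\<^sub>1 / (2 + \<delta>)" "h \<le> 1 / (\<Omega> + 1)" "h \<le> \<delta> / (2 * (\<Omega> + 1))" using h by (simp_all add: h\<^sub>1_def)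
      then have "h * (2 + \<delta>) \<le> \<eta>\<^sub>1" "h * (\<Omega> + 1) \<le> 1" "h * (2 * (\<Omega> + 1)) \<le> \<delta>"
        using \<delta> \<Omega> by (simp_all add: pos_le_divide_eq)
      then show "h * (2 + \<delta>) \<le> \<eta>\<^sub>1" "h * \<Omega> \<le> 1" "h * \<Omega> \<le> \<delta> / 2"
        using h by (simp_all add: algebra_simps)
    qed
    let ?p = "P h \<xi> \<zeta>" and ?m = "P (- h) \<xi> \<zeta>"
    have lipp: "\<bar>F ?p - F A\<bar> \<le> M * h" "\<bar>F ?m - F A\<bar> \<le> M * h" if "F \<in> Fam" for F
      using lip[OF that, of h \<xi> \<zeta>] lip[OF that, of "- h" \<xi> \<zeta>] h h1 \<xi> \<zeta> by auto
    define G where "G j v = (dseg v (dseg j H) ?p - dseg v (dseg j H) ?m) / (2 * h)" for j v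
    have Gsum: "(\<Sum>j\<in>W. G j v) = (dseg v q ?p - dseg v q ?m) / (2 * h)" for v
      unfolding G_def dq by (simp only: sum_divide_distrib[symmetric] sum_subtractf)
    have Gsum': "(\<Sum>u\<in>W. G v u) = (\<Sum>j\<in>W. G j v)" for v
      unfolding G_def by (intro sum.cong refl) (simp only: dseg_commute[of v])
    \<comment> \<open>This is the solvability condition of the Laplace equation. It holds because
      the second iterate of \<open>dzon\<close> takes the same value at both bodies.\<close>
    have g0: "(\<Sum>v\<in>W. \<Sum>j\<in>W. G j v) = 0"
    proof -
      have "(\<Sum>v\<in>W. \<Sum>j\<in>W. G j v) = ((\<Sum>v\<in>W. dseg v q ?p) - (\<Sum>v\<in>W. dseg v q ?m)) / (2 * h)"
        unfolding Gsum by (simp add: sum_divide_distrib[symmetric] sum_subtractf)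
      also have "\<dots> = 0" using Zeq by (simp add: q_def dzon_def[of W "dzon W H"])
      finally show ?thesis .
    qed
    obtain w where w: "\<And>v. v \<in> W \<Longrightarrow> (\<Sum>u\<in>W. dseg v (dseg u q) A * (w v - w u)) = (\<Sum>j\<in>W. G j v)"
      and wb: "\<And>v. v \<in> W \<Longrightarrow> \<bar>w v\<bar> \<le> Cw * (\<Sum>u\<in>W. \<bar>\<Sum>j\<in>W. G j u\<bar>)"
      using Cw(2)[OF g0] by blast
    have half: "\<bar>(a - b) / (2 * h)\<bar> \<le> M" if ab: "\<bar>a - c\<bar> \<le> M * h" "\<bar>b - c\<bar> \<le> M * h" for a b c
    proof -
      have "\<bar>a - b\<bar> \<le> M * (2 * h)" using ab by (simp add: algebra_simps)
      then show ?thesis using h by (simp add: abs_divide pos_divide_le_eq)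
    qed
    have "\<bar>\<Sum>j\<in>W. G j u\<bar> \<le> M" if "u \<in> W" for u
      unfolding Gsum using lipp[of "dseg u q"] that by (intro half) (auto simp: Fam_def)
    then have "(\<Sum>u\<in>W. \<bar>\<Sum>j\<in>W. G j u\<bar>) \<le> N * M" unfolding N_def by (intro sum_bounded_above) auto
    then have "Cw * (\<Sum>u\<in>W. \<bar>\<Sum>j\<in>W. G j u\<bar>) \<le> \<Omega>1" unfolding \<Omega>1_def using Cw(1) by (rule mult_left_mono)
    then have wb: "\<bar>w v\<bar> \<le> \<Omega>1" if "v \<in> W" for v using wb[OF that] by linarith
    define \<beta> where "\<beta> j = (dseg j H ?p - dseg j H ?m) / (2 * h)" for j
    have \<beta>: "\<bar>\<beta> j\<bar> \<le> M" if "j \<in> W" for j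
      unfolding \<beta>_def using lipp[of "dseg j H"] that by (intro half) (auto simp: Fam_def)
    \<comment> \<open>Shifting all edges by a constant changes the value of \<open>dseg j H\<close>
      at the rate \<open>D j > 0\<close>, so this shift makes the first-order difference of the j-th
      summand vanish.\<close>
    define \<tau> where "\<tau> j = (\<beta> j + (\<Sum>v\<in>W. w v * dseg v (dseg j H) A)) / D j" for j
    have \<tau>: "\<bar>\<tau> j\<bar> \<le> \<Omega>2" if j: "j \<in> W" for j
    proof -
      have "\<bar>\<Sum>v\<in>W. w v * dseg v (dseg j H) A\<bar> \<le> (\<Sum>v\<in>W. \<Omega>1 * dseg v (dseg j H) A)"
        by (rule order_trans[OF sum_abs]) (intro sum_mono, use wb d0 in \<open>auto simp: abs_mult intro!: mult_right_mono\<close>)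
      then have "\<bar>\<beta> j + (\<Sum>v\<in>W. w v * dseg v (dseg j H) A)\<bar> \<le> M + (\<Sum>v\<in>W. \<Omega>1 * dseg v (dseg j H) A)"
        using \<beta>[OF j] by linarith
      then have "\<bar>\<tau> j\<bar> \<le> (M + (\<Sum>v\<in>W. \<Omega>1 * dseg v (dseg j H) A)) / D j"
        unfolding \<tau>_def using D[OF j] by (simp add: abs_divide divide_right_mono)
      also have "\<dots> \<le> \<Omega>2" unfolding \<Omega>2_def using j W \<Omega>2j by (intro member_le_sum) auto
      finally show ?thesis .
    qed
    define \<omega> where "\<omega> j v = w v - \<tau> j" for j v
    have \<omega>: "\<bar>\<omega> j v\<bar> \<le> \<Omega>" if "j \<in> W" "v \<in> W" for j v
      using wb[OF that(2)] \<tau>[OF that(1)] unfolding \<omega>_def \<Omega>_def by linarith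
    define S where "S j v u = dseg v (dseg u (dseg j H)) A" for j v u
    have step: "dseg j H ?p + dseg j H ?m - 2 * dseg j H A
        + h\<^sup>2 * (2 * (\<Sum>v\<in>W. \<omega> j v * G j v) + (\<Sum>v\<in>W. \<Sum>u\<in>W. \<omega> j v * \<omega> j u * S j v u))
        \<le> (3 * C0 j + 25 * (C0 j)\<^sup>2 / (4 * dseg j H A)) * h ^ 3" if j: "j \<in> W" for j
    proof -
      define x where "x s = (1 + s * \<xi>) * (1 - \<theta>) - s * \<zeta>" for s
      define y where "y s = (1 + s * \<xi>) * \<theta> + s * \<zeta>" for s
      define c where "c s = (1 + s * \<xi>) * \<delta>" for s
      define E where "E s = dilate (x s) K + dilate (y s) L" for s
      define a where "a s = (\<Sum>v\<in>W. \<omega> j v * dseg v (dseg j H) (P s \<xi> \<zeta>))" for s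
      define b where "b s = (\<Sum>v\<in>W. \<Sum>u\<in>W. \<omega> j v * \<omega> j u * dseg v (dseg u (dseg j H)) (P s \<xi> \<zeta>))" for s
      define X where "X s = dseg j H (E s + zono W (\<lambda>v. c s + s * \<omega> j v))" for s
      have cE: "cbody (E s)" for s using KL by (simp add: E_def)
      have P_eq: "P s \<xi> \<zeta> = E s + zono W (\<lambda>_. c s)" if "0 \<le> c s" for s
        using dilate_zono[of "c s" W "\<lambda>_. 1"] that by (simp add: Pdef comb3_def E_def x_def y_def c_def)
      have sb: "\<delta> / 2 \<le> c s" "c s \<le> 2 * \<delta>" "0 \<le> x s" "x s \<le> 3" "0 \<le> y s" "y s \<le> 3"
        if s: "\<bar>s\<bar> = h" for s
      proof -
        have sx: "\<bar>s * \<xi>\<bar> \<le> 1/2" "\<bar>s * \<zeta>\<bar> \<le> h"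
          using mult_mono[of "\<bar>s\<bar>" "1/2" "\<bar>\<xi>\<bar>" 1] mult_left_mono[of "\<bar>\<zeta>\<bar>" 1 "\<bar>s\<bar>"] \<xi> \<zeta> s h1 by (auto simp: abs_mult)
        have cc: "1/2 * k \<le> (1 + s * \<xi>) * k" "(1 + s * \<xi>) * k \<le> 2 * k" if "k \<ge> 0" for k
        proof -
          have s1: "1/2 \<le> 1 + s * \<xi>" and s2: "1 + s * \<xi> \<le> 2" using sx(1) by linarith+
          show "1/2 * k \<le> (1 + s * \<xi>) * k" by (rule mult_right_mono[OF s1 that])
          show "(1 + s * \<xi>) * k \<le> 2 * k" by (rule mult_right_mono[OF s2 that])
        qed
        show "\<delta> / 2 \<le> c s" "c s \<le> 2 * \<delta>" using cc[of \<delta>] \<delta> by (auto simp: c_def)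
        have t0: "0 \<le> 1 - \<theta>" "0 \<le> \<theta>" using \<theta> by auto
        have z: "s * \<zeta> \<le> h" "- (s * \<zeta>) \<le> h" using sx(2) by linarith+
        have gen: "A - B \<le> 3" "A + B \<le> 3" "0 \<le> A - B" "0 \<le> A + B"
          if "1/2 * k \<le> A" "A \<le> 2 * k" "B \<le> h" "- B \<le> h" "h \<le> k / 2" "k \<le> 1" "h \<le> 1/2" for A B k :: real
        proof -
          have "A \<le> 2" using that(2,6) by linarith
          then show "A - B \<le> 3" "A + B \<le> 3" using that(3,4,7) by linarith+
          have "h \<le> A" using that(1,5) by simp
          then show "0 \<le> A - B" "0 \<le> A + B" using that(3,4) by linarith+
        qed
        show "x s \<le> 3" unfolding x_def using \<theta> by (intro gen(1)[OF cc[OF t0(1)] z h1(2)] h1(1)) auto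
        show "y s \<le> 3" unfolding y_def using \<theta> by (intro gen(2)[OF cc[OF t0(2)] z h1(3)] h1(1)) auto
        show "0 \<le> x s" unfolding x_def using \<theta> by (intro gen(3)[OF cc[OF t0(1)] z h1(2)] h1(1)) auto
        show "0 \<le> y s" unfolding y_def using \<theta> by (intro gen(4)[OF cc[OF t0(2)] z h1(3)] h1(1)) auto
      qed
      have c0: "0 \<le> c s" if "\<bar>s\<bar> = h" for s using sb(1)[OF that] \<delta> by linarith
      have exp: "\<bar>X s - (dseg j H (P s \<xi> \<zeta>) + s * a s + s\<^sup>2 * b s / 2)\<bar> \<le> C0 j * h ^ 3" if s: "\<bar>s\<bar> = h" for s
      proof -
        have sw: "\<bar>s * \<omega> j v\<bar> \<le> h * \<Omega>" if "v \<in> W" for v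
          unfolding abs_mult s using \<omega>[OF j that] h by (intro mult_left_mono) auto
        have "\<bar>X s - dseg j H (P s \<xi> \<zeta>) - (\<Sum>v\<in>W. (s * \<omega> j v) * dseg v (dseg j H) (P s \<xi> \<zeta>))
            - (\<Sum>v\<in>W. \<Sum>u\<in>W. (s * \<omega> j v) * (s * \<omega> j u) * dseg v (dseg u (dseg j H)) (P s \<xi> \<zeta>)) / 2\<bar>
            \<le> (h * \<Omega>) ^ 3 * dseg j H (E s + zono W (\<lambda>v. c s + 1))"
          unfolding X_def P_eq[OF c0[OF s]] using sw sb[OF s] h1 h \<Omega> W cE
          by (intro zono_expand2[OF qj]) auto
        also have "(\<Sum>v\<in>W. (s * \<omega> j v) * dseg v (dseg j H) (P s \<xi> \<zeta>)) = s * a s"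
          by (simp add: a_def sum_distrib_left mult.assoc)
        also have "(\<Sum>v\<in>W. \<Sum>u\<in>W. (s * \<omega> j v) * (s * \<omega> j u) * dseg v (dseg u (dseg j H)) (P s \<xi> \<zeta>)) = s\<^sup>2 * b s"
          unfolding b_def sum_distrib_left by (intro sum.cong refl) (simp add: power2_eq_square)
        also have "(h * \<Omega>) ^ 3 * dseg j H (E s + zono W (\<lambda>v. c s + 1)) \<le> (h * \<Omega>) ^ 3 * B j"
        proof (rule mult_left_mono)
          have "E s + zono W (\<lambda>v. c s + 1) = comb3 K L Z (x s) (y s) (c s + 1)"
            using dilate_zono[of "c s + 1" W "\<lambda>_. 1"] c0[OF s] by (simp add: comb3_def E_def Z_def)
          then show "dseg j H (E s + zono W (\<lambda>v. c s + 1)) \<le> B j"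
            unfolding B_def using sb[OF s] c0[OF s] KL Z
            by (simp only:) (intro dseg_mono[OF H] comb3_mono cbody_comb3; simp)
        qed (use h \<Omega> in auto)
        also have "(h * \<Omega>) ^ 3 * B j = (\<Omega> ^ 3 * B j) * h ^ 3" by (simp add: power_mult_distrib)
        also have "\<dots> \<le> C0 j * h ^ 3" using C0(2) h by (intro mult_right_mono) auto
        finally show ?thesis by (simp add: algebra_simps)
      qed
      define a\<^sub>0 where "a\<^sub>0 = (\<Sum>v\<in>W. \<omega> j v * dseg v (dseg j H) A)"
      define b\<^sub>0 where "b\<^sub>0 = (\<Sum>v\<in>W. \<Sum>u\<in>W. \<omega> j v * \<omega> j u * S j v u)"
      have lips: "\<bar>F (P s \<xi> \<zeta>) - F A\<bar> \<le> M * h" if "F \<in> Fam" "\<bar>s\<bar> = h" for F s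
        using lip[OF that(1), of s \<xi> \<zeta>] that(2) h1 \<xi> \<zeta> by auto
      have ab: "\<bar>a s - a\<^sub>0\<bar> \<le> C0 j * h" if s: "\<bar>s\<bar> = h" for s
      proof -
        have "a s - a\<^sub>0 = (\<Sum>v\<in>W. \<omega> j v * (dseg v (dseg j H) (P s \<xi> \<zeta>) - dseg v (dseg j H) A))"
          by (simp add: a_def a\<^sub>0_def right_diff_distrib sum_subtractf)
        also have "\<bar>\<dots>\<bar> \<le> (\<Sum>v\<in>W. \<Omega> * (M * h))"
        proof (rule order_trans[OF sum_abs], rule sum_mono)
          fix v assume v: "v \<in> W"
          show "\<bar>\<omega> j v * (dseg v (dseg j H) (P s \<xi> \<zeta>) - dseg v (dseg j H) A)\<bar> \<le> \<Omega> * (M * h)"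
            unfolding abs_mult using \<omega>[OF j v] \<Omega> v j s by (intro mult_mono lips) (auto simp: Fam_def)
        qed
        also have "\<dots> = (N * (\<Omega> * M)) * h" by (simp add: N_def)
        also have "\<dots> \<le> C0 j * h" using C0(3) h by (intro mult_right_mono) auto
        finally show ?thesis .
      qed
      have bb: "\<bar>b s - b\<^sub>0\<bar> \<le> C0 j * h" if s: "\<bar>s\<bar> = h" for s
      proof -
        have "b s - b\<^sub>0 = (\<Sum>v\<in>W. \<Sum>u\<in>W. \<omega> j v * \<omega> j u * (dseg v (dseg u (dseg j H)) (P s \<xi> \<zeta>) - S j v u))"
          by (simp add: b_def b\<^sub>0_def right_diff_distrib sum_subtractf)
        also have "\<bar>\<dots>\<bar> \<le> (\<Sum>v\<in>W. \<Sum>u\<in>W. \<Omega> * \<Omega> * (M * h))"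
        proof (rule order_trans[OF sum_abs], rule sum_mono, rule order_trans[OF sum_abs], rule sum_mono)
          fix v u assume v: "v \<in> W" "u \<in> W"
          have "\<bar>dseg v (dseg u (dseg j H)) (P s \<xi> \<zeta>) - S j v u\<bar> \<le> M * h"
            unfolding S_def using v j s by (intro lips) (auto simp: Fam_def intro!: image_eqI[of _ _ "(v, u, j)"])
          then show "\<bar>\<omega> j v * \<omega> j u * (dseg v (dseg u (dseg j H)) (P s \<xi> \<zeta>) - S j v u)\<bar> \<le> \<Omega> * \<Omega> * (M * h)"
            unfolding abs_mult using \<omega>[OF j v(1)] \<omega>[OF j v(2)] \<Omega> by (intro mult_mono) auto
        qed
        also have "\<dots> = (N * (N * (\<Omega> * \<Omega> * M))) * h" by (simp add: N_def)
        also have "\<dots> \<le> C0 j * h" using C0(4) h by (intro mult_right_mono) auto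
        finally show ?thesis .
      qed
      have Dj: "D j = (\<Sum>v\<in>W. dseg v (dseg j H) A)"
        unfolding D_def dq by (intro sum.cong refl fun_cong[OF dseg_commute])
      have "a\<^sub>0 = (\<Sum>v\<in>W. w v * dseg v (dseg j H) A) - \<tau> j * D j"
        by (simp add: a\<^sub>0_def \<omega>_def left_diff_distrib sum_subtractf Dj sum_distrib_left)
      also have "\<dots> = - \<beta> j" using D[OF j] by (simp add: \<tau>_def)
      finally have crit: "dseg j H ?p - dseg j H ?m + 2 * h * a\<^sub>0 = 0"
        using h by (simp add: \<beta>_def)
      have A_P: "A = E 0 + zono W (\<lambda>_. \<delta>)" using P_eq[of 0] \<delta> by (simp add: A_def c_def Pdef)
      have cX: "cbody (E s + zono W (\<lambda>v. c s + s * \<omega> j v))" if s: "\<bar>s\<bar> = h" for s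
      proof (intro cbody_plus cE cbody_zono)
        fix v assume v: "v \<in> W"
        have "\<bar>s * \<omega> j v\<bar> \<le> h * \<Omega>"
          unfolding abs_mult s using \<omega>[OF j v] h by (intro mult_left_mono) auto
        then show "0 \<le> c s + s * \<omega> j v" using sb(1)[OF s] h1 by linarith
      qed
      \<comment> \<open>The displacements at \<open>h\<close> and \<open>- h\<close> cancel, so the
        midpoint of the two displaced bodies is exactly \<open>A\<close>, for every
        \<open>j\<close>.\<close>
      have XY: "X h * X (- h) \<le> (dseg j H A)\<^sup>2"
      proof -
        have nn: "0 \<le> c s + s * \<omega> j v" if s: "\<bar>s\<bar> = h" and v: "v \<in> W" for s v
        proof -
          have "\<bar>s * \<omega> j v\<bar> \<le> h * \<Omega>"
            unfolding abs_mult s using \<omega>[OF j v] h by (intro mult_left_mono) auto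
          then show "0 \<le> c s + s * \<omega> j v" using sb(1)[OF s] h1 by linarith
        qed
        have hh: "\<bar>h\<bar> = h" "\<bar>- h\<bar> = h" using h by auto
        have "(E h + zono W (\<lambda>v. c h + h * \<omega> j v)) + (E (- h) + zono W (\<lambda>v. c (- h) + - h * \<omega> j v))
          = (dilate (x h) K + dilate (x (- h)) K) + (dilate (y h) L + dilate (y (- h)) L)
            + (zono W (\<lambda>v. c h + h * \<omega> j v) + zono W (\<lambda>v. c (- h) + - h * \<omega> j v))"
          by (simp only: E_def ac_simps)
        also have "dilate (x h) K + dilate (x (- h)) K = dilate (2 * (1 - \<theta>)) K"
          using KL sb[OF hh(1)] sb[OF hh(2)] by (subst dilate_add) (auto simp: cbody_def x_def algebra_simps)
        also have "dilate (y h) L + dilate (y (- h)) L = dilate (2 * \<theta>) L"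
          using KL sb[OF hh(1)] sb[OF hh(2)] by (subst dilate_add) (auto simp: cbody_def y_def algebra_simps)
        also have "zono W (\<lambda>v. c h + h * \<omega> j v) + zono W (\<lambda>v. c (- h) + - h * \<omega> j v) = zono W (\<lambda>v. 2 * \<delta>)"
          using nn[OF hh(1)] nn[OF hh(2)] by (subst zono_plus) (auto simp: c_def algebra_simps)
        finally have "dilate (1/2) ((E h + zono W (\<lambda>v. c h + h * \<omega> j v)) + (E (- h) + zono W (\<lambda>v. c (- h) + - h * \<omega> j v)))
          = A" unfolding A_P using \<delta> by (simp add: dilate_plus dilate_zono E_def x_def y_def diff_divide_distrib)
        then show ?thesis
          using lc[OF j] cX[OF hh(1)] cX[OF hh(2)] unfolding midpoint_log_concave_def X_def by metis
      qed
      have hh: "\<bar>h\<bar> = h" "\<bar>- h\<bar> = h" using h by auto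
      have "dseg j H ?p + dseg j H ?m - 2 * dseg j H A + h * (a h - a (- h)) + h\<^sup>2 * b\<^sub>0
         \<le> (3 * C0 j + 25 * (C0 j)\<^sup>2 / (4 * dseg j H A)) * h ^ 3"
      proof (rule second_difference_bound[where X="X h" and Y="X (- h)" and bp="b h" and bm="b (- h)" and a\<^sub>0=a\<^sub>0])
        show "0 < dseg j H A" using posq[OF j] by (simp add: A_def)
        show "\<bar>X h - (dseg j H ?p + h * a h + h\<^sup>2 * b h / 2)\<bar> \<le> C0 j * h ^ 3" by (rule exp[OF hh(1)])
        show "\<bar>X (- h) - (dseg j H ?m - h * a (- h) + h\<^sup>2 * b (- h) / 2)\<bar> \<le> C0 j * h ^ 3"
          using exp[OF hh(2)] by simp
      qed (use h h1 C0(1) ab[OF hh(1)] ab[OF hh(2)] bb[OF hh(1)] bb[OF hh(2)] crit XY in auto)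
      \<comment> \<open>The slopes at the two bodies differ by \<open>2 * h * G j v\<close>, so the
        first-order term of the expansion contributes in second order.\<close>
      moreover have "h * (a h - a (- h)) = h\<^sup>2 * (2 * (\<Sum>v\<in>W. \<omega> j v * G j v))"
      proof -
        have "a h - a (- h) = (\<Sum>v\<in>W. \<omega> j v * (2 * h * G j v))"
          unfolding a_def sum_subtractf[symmetric] right_diff_distrib[symmetric]
          by (intro sum.cong refl) (use h in \<open>simp add: G_def\<close>)
        then show ?thesis by (simp add: sum_distrib_left power2_eq_square mult_ac)
      qed
      ultimately show ?thesis by (simp add: b\<^sub>0_def distrib_left)
    qed
    have "(\<Sum>j\<in>W. dseg j H ?p + dseg j H ?m - 2 * dseg j H A
        + h\<^sup>2 * (2 * (\<Sum>v\<in>W. \<omega> j v * G j v) + (\<Sum>v\<in>W. \<Sum>u\<in>W. \<omega> j v * \<omega> j u * S j v u))) \<le> C * h ^ 3"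
      unfolding C_def sum_distrib_right by (intro sum_mono step)
    moreover have "(\<Sum>j\<in>W. dseg j H ?p + dseg j H ?m - 2 * dseg j H A
        + h\<^sup>2 * (2 * (\<Sum>v\<in>W. \<omega> j v * G j v) + (\<Sum>v\<in>W. \<Sum>u\<in>W. \<omega> j v * \<omega> j u * S j v u)))
      = (dzon W H ?p + dzon W H ?m - 2 * dzon W H A) + h\<^sup>2 * (2 * (\<Sum>j\<in>W. \<Sum>v\<in>W. \<omega> j v * G j v) + (\<Sum>j\<in>W. \<Sum>v\<in>W. \<Sum>u\<in>W. \<omega> j v * \<omega> j u * S j v u))"
      unfolding dzon_def sum.distrib sum_subtractf sum_distrib_left[symmetric] ..
    moreover have "0 \<le> 2 * (\<Sum>j\<in>W. \<Sum>v\<in>W. \<omega> j v * G j v) + (\<Sum>j\<in>W. \<Sum>v\<in>W. \<Sum>u\<in>W. \<omega> j v * \<omega> j u * S j v u)"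
      unfolding \<omega>_def
    proof (rule bochner_algebra[OF W(1) w Gsum'])
      show "dseg v (dseg u q) A = (\<Sum>j\<in>W. S j v u)" for u v unfolding S_def by (rule ddq)
      show "(\<Sum>u\<in>W. S j v u) = dseg v (dseg j q) A" for j v
        unfolding S_def ddq by (intro sum.cong refl) (simp only: dseg_commute[of _ j])
      show "S j v u = S j u v" for j u v unfolding S_def by (rule fun_cong[OF dseg_commute])
      show "0 \<le> S j v u" for j u v unfolding S_def by (rule dseg_nonneg[OF bD[OF qj] cA])
    qed
    then have "0 \<le> h\<^sup>2 * (2 * (\<Sum>j\<in>W. \<Sum>v\<in>W. \<omega> j v * G j v) + (\<Sum>j\<in>W. \<Sum>v\<in>W. \<Sum>u\<in>W. \<omega> j v * \<omega> j u * S j v u))"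
      by (intro mult_nonneg_nonneg) auto
    ultimately show "dzon W H ?p + dzon W H ?m - 2 * dzon W H (P 0 0 0) \<le> C * h ^ 3"
      unfolding A_def by linarith
  qed
qed

text \<open>The quadratic form in \<open>\<xi>\<close> and \<open>\<zeta>\<close> is positive
  definite, and this is an explicit lower bound on the unit circle. Uniformity matters because the
  direction is found only after the step \<open>h\<close> has been fixed.\<close>

lemma ellipse_lower_bound:
  fixes f\<^sub>0 :: real
  assumes f: "f\<^sub>0 > 0" and e: "\<epsilon> > 0" and u: "\<xi>\<^sup>2 + \<zeta>\<^sup>2 = 1"
  shows "1 \<le> (f\<^sub>0 * \<epsilon> * \<zeta>\<^sup>2 + 2 * (\<xi> * f\<^sub>0 + a * \<zeta>)\<^sup>2) * (1 / f\<^sub>0\<^sup>2 + (2 * a\<^sup>2 / f\<^sub>0\<^sup>2 + 1) / (f\<^sub>0 * \<epsilon>))"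
proof -
  define b where "b = \<xi> * f\<^sub>0 + a * \<zeta>"
  define X where "X = f\<^sub>0 * \<epsilon> * \<zeta>\<^sup>2 + 2 * b\<^sup>2"
  have fe: "f\<^sub>0 * \<epsilon> > 0" using f e by simp
  have X1: "2 * b\<^sup>2 \<le> X" "f\<^sub>0 * \<epsilon> * \<zeta>\<^sup>2 \<le> X" using fe by (auto simp: X_def)
  then have X2: "\<zeta>\<^sup>2 \<le> X / (f\<^sub>0 * \<epsilon>)" using fe by (simp add: pos_le_divide_eq mult.commute)
  have "0 \<le> (b + a * \<zeta>)\<^sup>2" by simp
  then have "(\<xi> * f\<^sub>0)\<^sup>2 \<le> 2 * b\<^sup>2 + 2 * a\<^sup>2 * \<zeta>\<^sup>2"
    by (simp add: b_def power2_eq_square algebra_simps)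
  then have "\<xi>\<^sup>2 \<le> (2 * b\<^sup>2 + 2 * a\<^sup>2 * \<zeta>\<^sup>2) / f\<^sub>0\<^sup>2" using f by (simp add: pos_le_divide_eq power_mult_distrib)
  then have "1 \<le> 2 * b\<^sup>2 / f\<^sub>0\<^sup>2 + (2 * a\<^sup>2 / f\<^sub>0\<^sup>2 + 1) * \<zeta>\<^sup>2"
    using u by (simp add: add_divide_distrib distrib_right)
  also have "\<dots> \<le> X / f\<^sub>0\<^sup>2 + (2 * a\<^sup>2 / f\<^sub>0\<^sup>2 + 1) * (X / (f\<^sub>0 * \<epsilon>))"
    using X1 X2 f by (intro add_mono divide_right_mono mult_left_mono) auto
  also have "\<dots> = X * (1 / f\<^sub>0\<^sup>2 + (2 * a\<^sup>2 / f\<^sub>0\<^sup>2 + 1) / (f\<^sub>0 * \<epsilon>))"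
  proof -
    have "X / p + d * (X / e) = X * (1 / p + d / e)" for p d e :: real
      by (simp add: distrib_left mult.commute)
    then show ?thesis .
  qed
  finally show ?thesis by (simp add: X_def b_def)
qed

text \<open>The fixed share \<open>\<delta>\<close> of the zonotope makes the second differences
  strictly positive, as the Laplace equation requires; the parameters 0 and 1 are excluded so that
  both bodies have positive coefficients. Both restrictions are lifted by limits afterwards.\<close>

lemma dzon_root_midpoint_concave:
  fixes H :: "'a::euclidean_space set \<Rightarrow> real"
  assumes H: "body_functional (Suc (Suc (Suc n))) H"
    and W: "finite W" "W \<noteq> {}"
    and KL: "cbody K" "cbody L" "0 \<in> K" "0 \<in> L" and \<delta>: "\<delta> > 0"
    and lc: "\<And>j. j \<in> W \<Longrightarrow> midpoint_log_concave (dseg j H)"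
    and posQ: "\<And>B c v u. cbody B \<Longrightarrow> c > 0 \<Longrightarrow> v \<in> W \<Longrightarrow> u \<in> W \<Longrightarrow> v \<noteq> u \<Longrightarrow> 0 < dseg v (dseg u (dzon W H)) (B + zono W (\<lambda>_. c))"
    and posD: "\<And>B c j. cbody B \<Longrightarrow> c > 0 \<Longrightarrow> j \<in> W \<Longrightarrow> 0 < dseg j (dzon W H) (B + zono W (\<lambda>_. c))"
    and posq: "\<And>B c j. cbody B \<Longrightarrow> c > 0 \<Longrightarrow> j \<in> W \<Longrightarrow> 0 < dseg j H (B + zono W (\<lambda>_. c))"
    and f_def: "\<And>t. f t = root (Suc (Suc n)) (dzon W H (comb3 K L (zono W (\<lambda>_. 1)) (1 - t) t \<delta>))"
    and l: "0 < l1" "l1 < l2" "l2 < 1"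
  shows "(f l1 + f l2) / 2 \<le> f ((l1 + l2) / 2)"
proof (rule ccontr)
  assume "\<not> ?thesis"
  then have gap: "f ((l1 + l2) / 2) < (f l1 + f l2) / 2" by simp
  define q where "q = dzon W H"
  define Z where "Z = zono W (\<lambda>_. 1)"
  have Z: "cbody Z" "0 \<in> Z" by (auto simp: Z_def zero_in_zono)
  have q: "body_functional (Suc (Suc n)) q" unfolding q_def by (intro body_functional_dzon H)
  have f_eq: "f t = root (Suc (Suc n)) (q (comb3 K L Z (1 - t) t \<delta>))" for t
    by (simp add: f_def q_def Z_def)
  have cont: "continuous_on {l1..l2} f"
    unfolding f_eq[abs_def] continuous_on_def
  proof
    fix t assume "t \<in> {l1..l2}"
    then show "((\<lambda>t. root (Suc (Suc n)) (q (comb3 K L Z (1 - t) t \<delta>))) \<longlongrightarrow> root (Suc (Suc n)) (q (comb3 K L Z (1 - t) t \<delta>))) (at t within {l1..l2})"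
      using KL Z \<delta> l by (intro tendsto_real_root comb3_tendsto[OF q] tendsto_intros) auto
  qed
  obtain \<theta> a \<epsilon> where \<theta>l: "l1 < \<theta>" "\<theta> < l2" and \<epsilon>: "\<epsilon> > 0"
    and touch: "\<And>t. l1 \<le> t \<Longrightarrow> t \<le> l2 \<Longrightarrow> f \<theta> + a * (t - \<theta>) + \<epsilon> * (t - \<theta>)\<^sup>2 \<le> f t"
    by (rule touching_parabola[OF cont l(2) gap]) (rule that)
  have \<theta>: "0 < \<theta>" "\<theta> < 1" using \<theta>l l by auto
  \<comment> \<open>\<open>s\<close> is the signed step; \<open>\<xi>\<close> measures the dilation
    of the base body and \<open>\<zeta>\<close> the motion along the segment from \<open>K\<close>
    to \<open>L\<close>.\<close>
  define P where "P s \<xi> \<zeta> = comb3 K L Z ((1 + s * \<xi>) * (1 - \<theta>) - s * \<zeta>) ((1 + s * \<xi>) * \<theta> + s * \<zeta>) ((1 + s * \<xi>) * \<delta>)" for s \<xi> \<zeta>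
  have P0: "P 0 0 0 = comb3 K L Z (1 - \<theta>) \<theta> \<delta>" by (simp add: P_def)
  have P0': "P 0 0 0 = (dilate (1 - \<theta>) K + dilate \<theta> L) + zono W (\<lambda>_. \<delta>)"
    unfolding P0 comb3_def Z_def using dilate_zono[of \<delta> W "\<lambda>_. 1"] \<delta> by simp
  have cB: "cbody (dilate (1 - \<theta>) K + dilate \<theta> L)" using KL by simp
  have cP: "cbody (P s \<xi> \<zeta>)" for s \<xi> \<zeta> using KL Z by (simp add: P_def)
  obtain C h\<^sub>1 where h\<^sub>1: "h\<^sub>1 > 0" and upper: "\<And>h \<xi> \<zeta>. 0 < h \<Longrightarrow> h \<le> h\<^sub>1 \<Longrightarrow> \<bar>\<xi>\<bar> \<le> 1 \<Longrightarrow> \<bar>\<zeta>\<bar> \<le> 1 \<Longrightarrow>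
      dzon W (dzon W H) (P h \<xi> \<zeta>) = dzon W (dzon W H) (P (- h) \<xi> \<zeta>) \<Longrightarrow>
      dzon W H (P h \<xi> \<zeta>) + dzon W H (P (- h) \<xi> \<zeta>) - 2 * dzon W H (P 0 0 0) \<le> C * h ^ 3"
  proof (rule second_difference_upper[where P=P, OF H W KL \<theta> \<delta> lc])
    show "P s \<xi> \<zeta> = comb3 K L (zono W (\<lambda>_. 1)) ((1 + s * \<xi>) * (1 - \<theta>) - s * \<zeta>) ((1 + s * \<xi>) * \<theta> + s * \<zeta>) ((1 + s * \<xi>) * \<delta>)" for s \<xi> \<zeta>
      by (simp add: P_def Z_def)
    show "0 < dseg v (dseg u (dzon W H)) (P 0 0 0)" if "v \<in> W" "u \<in> W" "v \<noteq> u" for v u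
      unfolding P0' by (rule posQ[OF cB \<delta> that])
    show "0 < dseg j (dzon W H) (P 0 0 0)" if "j \<in> W" for j
      unfolding P0' by (rule posD[OF cB \<delta> that])
    show "0 < dseg j H (P 0 0 0)" if "j \<in> W" for j
      unfolding P0' by (rule posq[OF cB \<delta> that])
  qed (assumption | rule that)+
  note upper = upper[folded q_def]
  have qP0: "q (P 0 0 0) > 0"
  proof -
    have "0 < (\<Sum>j\<in>W. dseg j H (P 0 0 0))" unfolding P0' using W posq[OF cB \<delta>] by (intro sum_pos) auto
    then show ?thesis by (simp add: q_def dzon_def)
  qed
  define f\<^sub>0 where "f\<^sub>0 = f \<theta>"
  have f0: "f\<^sub>0 > 0" "q (P 0 0 0) = f\<^sub>0 ^ Suc (Suc n)"
    using qP0 unfolding f\<^sub>0_def f_eq P0 by (auto simp del: power_Suc)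
  \<comment> \<open>\<open>c\<close> bounds the gain per square of the step from below, for all
    directions at once; \<open>h\<close> will be so small that \<open>C * h\<close> stays below
    it.\<close>
  define c where "c = f\<^sub>0 ^ n / (1 / f\<^sub>0\<^sup>2 + (2 * a\<^sup>2 / f\<^sub>0\<^sup>2 + 1) / (f\<^sub>0 * \<epsilon>))"
  have NN: "1 / f\<^sub>0\<^sup>2 + (2 * a\<^sup>2 / f\<^sub>0\<^sup>2 + 1) / (f\<^sub>0 * \<epsilon>) > 0"
    using f0 \<epsilon> by (intro add_pos_nonneg divide_nonneg_pos) auto
  have c: "c > 0" unfolding c_def using f0 NN by simp
  define h where "h = min h\<^sub>1 (min (1/2) (min ((\<theta> - l1) / 2) (min ((l2 - \<theta>) / 2) (min (\<theta> / 4)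
    (min ((1 - \<theta>) / 4) (min (f\<^sub>0 / (f\<^sub>0 + \<bar>a\<bar>)) (c / (2 * (\<bar>C\<bar> + 1)))))))))"
  have "f\<^sub>0 / (f\<^sub>0 + \<bar>a\<bar>) > 0" "c / (2 * (\<bar>C\<bar> + 1)) > 0"
    using f0 c by (intro divide_pos_pos; simp)+
  then have h: "h > 0" unfolding h_def using h\<^sub>1 \<theta>l \<theta> by (simp only: min_less_iff_conj) simp
  have hle: "h \<le> h\<^sub>1" "h \<le> 1/2" "h \<le> (\<theta> - l1) / 2" "h \<le> (l2 - \<theta>) / 2" "h \<le> \<theta> / 4" "h \<le> (1 - \<theta>) / 4"
      "h \<le> f\<^sub>0 / (f\<^sub>0 + \<bar>a\<bar>)" "h \<le> c / (2 * (\<bar>C\<bar> + 1))"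
    unfolding h_def by (rule min.cobounded1 order_refl | rule min.coboundedI2)+
  have hC: "C * h < c"
  proof -
    have "C * h \<le> (\<bar>C\<bar> + 1) * h" using h by (intro mult_right_mono) auto
    also have "\<dots> \<le> (\<bar>C\<bar> + 1) * (c / (2 * (\<bar>C\<bar> + 1)))" using hle(8) by (intro mult_left_mono) auto
    also have "\<dots> = c / 2" by (simp add: field_simps)
    finally show ?thesis using c by linarith
  qed
  have sx: "\<bar>s * \<xi>\<bar> \<le> h" if "\<bar>s\<bar> = h" "\<bar>\<xi>\<bar> \<le> 1" for s \<xi> :: real
    using mult_left_mono[OF that(2), of h] that h by (simp add: abs_mult)
  have pos: "(1 + s * \<xi>) * (1 - \<theta>) - s * \<zeta> > 0" "(1 + s * \<xi>) * \<theta> + s * \<zeta> > 0" "(1 + s * \<xi>) * \<delta> > 0"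
      "1 / 2 \<le> 1 + s * \<xi>" "1 + s * \<xi> \<le> 2"
    if s: "\<bar>s\<bar> = h" "\<bar>\<xi>\<bar> \<le> 1" "\<bar>\<zeta>\<bar> \<le> 1" for s \<xi> \<zeta>
  proof -
    have 1: "1 / 2 \<le> 1 + s * \<xi>" "1 + s * \<xi> \<le> 2" "\<bar>s * \<zeta>\<bar> \<le> h" using sx[OF s(1,2)] sx[OF s(1,3)] hle(2) by linarith+
    then show "1 / 2 \<le> 1 + s * \<xi>" "1 + s * \<xi> \<le> 2" by auto
    have m: "1/2 * (1 - \<theta>) \<le> (1 + s * \<xi>) * (1 - \<theta>)" "1/2 * \<theta> \<le> (1 + s * \<xi>) * \<theta>"
      by (rule mult_right_mono[OF 1(1)], use \<theta> in simp)+
    have gen: "0 < A - B" "0 < A + B" if "1/2 * k \<le> A" "\<bar>B\<bar> \<le> h" "h \<le> k / 4" "0 < k" for A B k :: real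
      using that by linarith+
    show "(1 + s * \<xi>) * (1 - \<theta>) - s * \<zeta> > 0"
      by (rule gen(1)[OF m(1) 1(3) hle(6)]) (use \<theta> in simp)
    show "(1 + s * \<xi>) * \<theta> + s * \<zeta> > 0"
      by (rule gen(2)[OF m(2) 1(3) hle(5)]) (use \<theta> in simp)
    show "(1 + s * \<xi>) * \<delta> > 0" using 1 \<delta> by simp
  qed
  define g where "g \<phi> = dzon W q (P h (cos \<phi>) (sin \<phi>)) - dzon W q (P (- h) (cos \<phi>) (sin \<phi>))" for \<phi>
  \<comment> \<open>Turning the direction by \<open>pi\<close> exchanges the two bodies, so
    \<open>g\<close> changes its sign over the half circle.\<close>
  have "\<exists>\<phi>. 0 \<le> \<phi> \<and> \<phi> \<le> pi \<and> g \<phi> = 0"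
  proof -
    have gc: "continuous_on {0..pi} g"
      unfolding continuous_on_def
    proof
      fix \<phi> assume "\<phi> \<in> {0..pi}"
      have "((\<lambda>\<phi>. dzon W q (P s (cos \<phi>) (sin \<phi>))) \<longlongrightarrow> dzon W q (P s (cos \<phi>) (sin \<phi>))) (at \<phi> within {0..pi})" if "\<bar>s\<bar> = h" for s
        unfolding P_def using KL Z pos[OF that abs_cos_le_one abs_sin_le_one]
        by (intro comb3_tendsto[OF body_functional_dzon[OF q]] tendsto_intros) auto
      then show "(g \<longlongrightarrow> g \<phi>) (at \<phi> within {0..pi})"
        unfolding g_def[abs_def] using h by (intro tendsto_diff) auto
    qed
    have gpi: "g pi = - g 0" by (simp add: g_def P_def)
    show ?thesis
    proof (cases "g 0 \<le> 0")
      case True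
      then show ?thesis using IVT'[of g 0 0 pi] gc gpi by auto
    next
      case False
      then show ?thesis using IVT2'[of g pi 0 0] gc gpi by auto
    qed
  qed
  then obtain \<phi> where \<phi>: "g \<phi> = 0" by blast
  define \<xi> \<zeta> where "\<xi> = cos \<phi>" and "\<zeta> = sin \<phi>"
  have unit: "\<xi>\<^sup>2 + \<zeta>\<^sup>2 = 1" "\<bar>\<xi>\<bar> \<le> 1" "\<bar>\<zeta>\<bar> \<le> 1" by (simp_all add: \<xi>_def \<zeta>_def)
  have up: "q (P h \<xi> \<zeta>) + q (P (- h) \<xi> \<zeta>) - 2 * q (P 0 0 0) \<le> C * h ^ 3"
    using \<phi> by (intro upper h hle(1) unit) (simp add: g_def \<xi>_def \<zeta>_def)
  define b where "b = \<xi> * f\<^sub>0 + a * \<zeta>"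
  define e where "e = \<epsilon> * h\<^sup>2 * \<zeta>\<^sup>2 / 2"
  define r where "r s = root (Suc (Suc n)) (q (P s \<xi> \<zeta>))" for s
  have e: "e \<ge> 0" using \<epsilon> by (simp add: e_def)
  have rpow: "q (P s \<xi> \<zeta>) = r s ^ Suc (Suc n)" for s
    unfolding r_def using bf_nonneg[OF q cP] by (simp del: power_Suc)
  \<comment> \<open>By homogeneity the root is \<open>\<sigma> * f t\<close> with a parameter
    \<open>t\<close> close to \<open>\<theta>\<close>, so the parabola below \<open>f\<close>
    applies. The bound \<open>\<sigma> \<le> 2\<close> explains the denominator in
    \<open>e\<close>.\<close>
  have r: "f\<^sub>0 + e + s * b \<le> r s" if s: "\<bar>s\<bar> = h" for s
  proof -
    define \<sigma> where "\<sigma> = 1 + s * \<xi>"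
    define t where "t = \<theta> + s * \<zeta> / \<sigma>"
    have \<sigma>: "1/2 \<le> \<sigma>" "\<sigma> \<le> 2" using pos[OF s unit(2,3)] by (auto simp: \<sigma>_def)
    have "P s \<xi> \<zeta> = comb3 K L Z (\<sigma> * (1 - t)) (\<sigma> * t) (\<sigma> * \<delta>)"
    proof -
      have "\<sigma> * t = \<sigma> * \<theta> + s * \<zeta>" using \<sigma> by (simp add: t_def distrib_left)
      moreover have "\<sigma> * (1 - t) = \<sigma> * (1 - \<theta>) - s * \<zeta>" using calculation by (simp add: right_diff_distrib)
      ultimately show ?thesis unfolding P_def \<sigma>_def[symmetric] by (simp only:)
    qed
    also have "\<dots> = dilate \<sigma> (comb3 K L Z (1 - t) t \<delta>)" by (simp add: dilate_comb3)
    finally have "q (P s \<xi> \<zeta>) = \<sigma> ^ Suc (Suc n) * q (comb3 K L Z (1 - t) t \<delta>)"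
      using \<sigma> KL Z by (simp only:) (intro bf_dilate[OF q] cbody_comb3; simp)
    then have rs: "r s = \<sigma> * f t"
      unfolding r_def f_eq using \<sigma> by (simp add: real_root_mult real_root_power_cancel del: power_Suc)
    have "\<bar>s * \<zeta> / \<sigma>\<bar> = \<bar>s * \<zeta>\<bar> / \<sigma>" using \<sigma> by (simp add: abs_divide)
    also have "\<dots> \<le> h / (1/2)" using sx[OF s unit(3)] \<sigma> h by (intro frac_le) auto
    finally have "\<bar>t - \<theta>\<bar> \<le> 2 * h" by (simp add: t_def)
    then have "l1 \<le> t" "t \<le> l2" using hle(3,4) by (auto simp: abs_le_iff field_simps)
    then have "f\<^sub>0 + a * (t - \<theta>) + \<epsilon> * (t - \<theta>)\<^sup>2 \<le> f t" unfolding f\<^sub>0_def by (rule touch)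
    then have "\<sigma> * (f\<^sub>0 + a * (t - \<theta>) + \<epsilon> * (t - \<theta>)\<^sup>2) \<le> r s" unfolding rs using \<sigma> by (intro mult_left_mono) auto
    moreover have "\<sigma> * (f\<^sub>0 + a * (t - \<theta>) + \<epsilon> * (t - \<theta>)\<^sup>2) = f\<^sub>0 + s * b + \<epsilon> * (h\<^sup>2 * \<zeta>\<^sup>2) / \<sigma>"
    proof -
      have "\<sigma> * (a * (t - \<theta>)) = a * (s * \<zeta>)" using \<sigma> by (simp add: t_def)
      moreover have "\<sigma> * (\<epsilon> * (t - \<theta>)\<^sup>2) = \<epsilon> * (s\<^sup>2 * \<zeta>\<^sup>2) / \<sigma>" using \<sigma> by (simp add: t_def power2_eq_square)
      moreover have "s\<^sup>2 = h\<^sup>2" using s by (metis power2_abs)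
      ultimately show ?thesis by (simp add: distrib_left \<sigma>_def b_def algebra_simps)
    qed
    moreover have "e \<le> \<epsilon> * (h\<^sup>2 * \<zeta>\<^sup>2) / \<sigma>"
    proof -
      have "\<epsilon> * (h\<^sup>2 * \<zeta>\<^sup>2) / 2 \<le> \<epsilon> * (h\<^sup>2 * \<zeta>\<^sup>2) / \<sigma>"
        using \<sigma> \<epsilon> by (intro divide_left_mono mult_nonneg_nonneg) auto
      then show ?thesis by (simp add: e_def mult.assoc)
    qed
    ultimately show ?thesis by linarith
  qed
  have hb: "\<bar>h * b\<bar> \<le> f\<^sub>0"
  proof -
    have "\<bar>\<xi> * f\<^sub>0\<bar> \<le> 1 * f\<^sub>0" "\<bar>a * \<zeta>\<bar> \<le> \<bar>a\<bar> * 1"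
      using mult_right_mono[OF unit(2), of "f\<^sub>0"] mult_left_mono[OF unit(3), of "\<bar>a\<bar>"] f0
      by (auto simp: abs_mult)
    then have "\<bar>b\<bar> \<le> f\<^sub>0 + \<bar>a\<bar>" unfolding b_def by linarith
    then have "\<bar>h * b\<bar> \<le> h * (f\<^sub>0 + \<bar>a\<bar>)" using h by (simp add: abs_mult)
    also have "\<dots> \<le> f\<^sub>0" using hle(7) f0 by (simp add: pos_le_divide_eq add_pos_nonneg)
    finally show ?thesis .
  qed
  define g' where "g' = f\<^sub>0 + e"
  have g': "g' \<ge> f\<^sub>0" "g' \<ge> 0" using e f0 by (auto simp: g'_def)
  have rr: "g' + h * b \<le> r h" "g' - h * b \<le> r (- h)" "0 \<le> g' + h * b" "0 \<le> g' - h * b"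
    using r[of h] r[of "- h"] h hb g' by (auto simp: g'_def abs_le_iff)
  have "2 * f\<^sub>0 ^ Suc (Suc n) + h\<^sup>2 * (f\<^sub>0 ^ n * (f\<^sub>0 * \<epsilon> * \<zeta>\<^sup>2 + 2 * b\<^sup>2)) =
      2 * (f\<^sub>0 ^ Suc n * g') + 2 * f\<^sub>0 ^ n * (h * b)\<^sup>2"
    by (simp add: g'_def e_def power2_eq_square algebra_simps)
  also have "\<dots> \<le> 2 * (g' ^ Suc n * g') + 2 * g' ^ n * (h * b)\<^sup>2"
    using g' f0 by (intro add_mono mult_left_mono mult_right_mono power_mono) auto
  also have "\<dots> = 2 * g' ^ Suc (Suc n) + 2 * g' ^ n * (h * b)\<^sup>2" by simp
  also have "\<dots> \<le> (g' + h * b) ^ Suc (Suc n) + (g' - h * b) ^ Suc (Suc n)"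
    by (rule power_symmetric_sum_ge(1)[OF g'(2)])
  also have "\<dots> \<le> q (P h \<xi> \<zeta>) + q (P (- h) \<xi> \<zeta>)"
    unfolding rpow using rr by (intro add_mono power_mono) auto
  also have "\<dots> \<le> 2 * f\<^sub>0 ^ Suc (Suc n) + C * h ^ 3" using up f0(2) by simp
  finally have 1: "h\<^sup>2 * (f\<^sub>0 ^ n * (f\<^sub>0 * \<epsilon> * \<zeta>\<^sup>2 + 2 * b\<^sup>2)) \<le> h\<^sup>2 * (C * h)"
    by (simp add: power2_eq_square power3_eq_cube mult_ac)
  have "f\<^sub>0 ^ n * (f\<^sub>0 * \<epsilon> * \<zeta>\<^sup>2 + 2 * b\<^sup>2) \<le> C * h"
    using 1 h by (simp add: mult_le_cancel_left_pos)
  moreover have "c \<le> f\<^sub>0 ^ n * (f\<^sub>0 * \<epsilon> * \<zeta>\<^sup>2 + 2 * b\<^sup>2)"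
  proof -
    have "f\<^sub>0 ^ n * 1 \<le> f\<^sub>0 ^ n * ((f\<^sub>0 * \<epsilon> * \<zeta>\<^sup>2 + 2 * b\<^sup>2) * (1 / f\<^sub>0\<^sup>2 + (2 * a\<^sup>2 / f\<^sub>0\<^sup>2 + 1) / (f\<^sub>0 * \<epsilon>)))"
      unfolding b_def using ellipse_lower_bound[OF f0(1) \<epsilon> unit(1), of a] f0 by (intro mult_left_mono) auto
    then show ?thesis unfolding c_def using NN by (simp add: pos_divide_le_eq mult.assoc)
  qed
  ultimately show False using hC by linarith
qed

text \<open>Concavity is used between \<open>l\<close> and \<open>1 - l\<close>, where
  \<open>f\<close> dominates \<open>1 - l\<close> times the roots at \<open>K\<close> and
  \<open>L\<close>. Letting \<open>l\<close> and then \<open>\<delta>\<close> tend to 0 reaches the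
  endpoints and removes the zonotope.\<close>

lemma dzon_root_superadditive_zero:
  fixes H :: "'a::euclidean_space set \<Rightarrow> real"
  assumes H: "body_functional (Suc (Suc (Suc n))) H"
    and W: "finite W" "W \<noteq> {}"
    and KL: "cbody K" "cbody L" "0 \<in> K" "0 \<in> L"
    and lc: "\<And>j. j \<in> W \<Longrightarrow> midpoint_log_concave (dseg j H)"
    and posQ: "\<And>B c v u. cbody B \<Longrightarrow> c > 0 \<Longrightarrow> v \<in> W \<Longrightarrow> u \<in> W \<Longrightarrow> v \<noteq> u \<Longrightarrow> 0 < dseg v (dseg u (dzon W H)) (B + zono W (\<lambda>_. c))"
    and posD: "\<And>B c j. cbody B \<Longrightarrow> c > 0 \<Longrightarrow> j \<in> W \<Longrightarrow> 0 < dseg j (dzon W H) (B + zono W (\<lambda>_. c))"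
    and posq: "\<And>B c j. cbody B \<Longrightarrow> c > 0 \<Longrightarrow> j \<in> W \<Longrightarrow> 0 < dseg j H (B + zono W (\<lambda>_. c))"
  shows "root (Suc (Suc n)) (dzon W H K) + root (Suc (Suc n)) (dzon W H L) \<le> root (Suc (Suc n)) (dzon W H (K + L))"
proof -
  let ?m = "Suc (Suc n)"
  define q where "q = dzon W H"
  define Z where "Z = zono W (\<lambda>_. 1)"
  have Z: "cbody Z" "0 \<in> Z" by (auto simp: Z_def zero_in_zono)
  have q: "body_functional ?m q" unfolding q_def by (intro body_functional_dzon H)
  have qn: "0 \<le> q B" if "cbody B" for B by (rule bf_nonneg[OF q that])
  define A where "A = dilate (1/2) (K + L)"
  have cA: "cbody A" using KL by (simp add: A_def)
  define S where "S = (root ?m (q K) + root ?m (q L)) / 2"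
  have S0: "S \<ge> 0" using KL qn by (auto simp: S_def)
  have S1: "S ^ ?m \<le> q A + \<delta> * q (A + zono W (\<lambda>_. 2))" if \<delta>: "0 < \<delta>" "\<delta> \<le> 1" for \<delta>
  proof -
    define f where "f t = root ?m (dzon W H (comb3 K L (zono W (\<lambda>_. 1)) (1 - t) t \<delta>))" for t
    have f_eq: "f t = root ?m (q (comb3 K L Z (1 - t) t \<delta>))" for t by (simp add: f_def q_def Z_def)
    have d0: "dilate 0 B = {0}" if "0 \<in> B" for B :: "'a set" using that by (auto simp: dilate_def)
    have ends: "(1 - l) * root ?m (q K) \<le> f l" "(1 - l) * root ?m (q L) \<le> f (1 - l)" if l: "0 < l" "l < 1/2" for l
    proof -
      have aux: "(1 - l) * root ?m (q B) \<le> root ?m (q B')"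
        if B: "cbody B" "cbody B'" "dilate (1 - l) B \<subseteq> B'" for B B'
      proof -
        have "(1 - l) * root ?m (q B) = root ?m ((1 - l) ^ ?m * q B)"
          using l by (simp add: real_root_mult real_root_power_cancel del: power_Suc)
        also have "\<dots> = root ?m (q (dilate (1 - l) B))" using l B by (simp add: bf_dilate[OF q] del: power_Suc)
        also have "\<dots> \<le> root ?m (q B')" using B bf_mono[OF q, of "dilate (1 - l) B" B'] by simp
        finally show ?thesis .
      qed
      have "comb3 K L Z (1 - l) 0 0 \<subseteq> comb3 K L Z (1 - l) l \<delta>"
        using KL Z l \<delta> by (intro comb3_mono) auto
      then have "dilate (1 - l) K \<subseteq> comb3 K L Z (1 - l) l \<delta>"
        using KL Z by (simp add: comb3_def d0 flip: set_zero)
      then show "(1 - l) * root ?m (q K) \<le> f l" unfolding f_eq using KL Z by (intro aux) auto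
      have "comb3 K L Z 0 (1 - l) 0 \<subseteq> comb3 K L Z (1 - (1 - l)) (1 - l) \<delta>"
        using KL Z l \<delta> by (intro comb3_mono) auto
      then have "dilate (1 - l) L \<subseteq> comb3 K L Z (1 - (1 - l)) (1 - l) \<delta>"
        using KL Z by (simp add: comb3_def d0 flip: set_zero)
      then show "(1 - l) * root ?m (q L) \<le> f (1 - l)" unfolding f_eq using KL Z by (intro aux) auto
    qed
    have mid: "(1 - l) * S \<le> f (1/2)" if l: "0 < l" "l < 1/2" for l
    proof -
      have "(f l + f (1 - l)) / 2 \<le> f ((l + (1 - l)) / 2)"
        using l by (intro dzon_root_midpoint_concave[OF H W KL \<delta>(1) lc posQ posD posq f_def]) auto
      then show ?thesis using ends[OF l] by (simp add: S_def field_simps)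
    qed
    have "((\<lambda>l. (1 - l) * S) \<longlongrightarrow> (1 - 0) * S) (at_right 0)" by (intro tendsto_intros)
    moreover have "eventually (\<lambda>l::real. l \<in> {0<..<1/2}) (at_right 0)" by (intro eventually_at_right_real) simp
    then have "eventually (\<lambda>l. (1 - l) * S \<le> f (1/2)) (at_right 0)"
      by eventually_elim (auto intro: mid)
    ultimately have "(1 - 0) * S \<le> f (1/2)" by (intro tendsto_upperbound) auto
    then have "S ^ ?m \<le> f (1/2) ^ ?m" using S0 by (intro power_mono) auto
    also have "comb3 K L Z (1 - 1/2) (1/2) \<delta> = A + zono W (\<lambda>_. \<delta>)"
      using dilate_zono[of \<delta> W "\<lambda>_. 1"] \<delta> by (simp add: comb3_def A_def dilate_plus Z_def)
    then have "f (1/2) ^ ?m = q (A + zono W (\<lambda>_. \<delta>))"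
      unfolding f_eq using qn[of "A + zono W (\<lambda>_. \<delta>)"] cA \<delta> by (simp del: power_Suc)
    also have "\<dots> \<le> q A + \<delta> * q (A + zono W (\<lambda>_. 2))"
    proof -
      \<comment> \<open>Shrinking all edges from \<open>\<delta>\<close> to 0 is a displacement of
        size \<open>\<delta>\<close>, so the expansion of order zero bounds the change.\<close>
      have "\<bar>q (A + zono W (\<lambda>v. \<delta> + - \<delta>)) - q (A + zono W (\<lambda>_. \<delta>))\<bar> \<le> \<delta> * q (A + zono W (\<lambda>v. \<delta> + 1))"
        using \<delta> cA by (intro zono_expand0[OF q W(1)]) auto
      moreover have "zono W (\<lambda>v. \<delta> + - \<delta>) = 0" by (simp add: zono_def del: set_zero)
      moreover have "q (A + zono W (\<lambda>v. \<delta> + 1)) \<le> q (A + zono W (\<lambda>_. 2))"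
        using \<delta> cA by (intro bf_mono[OF q] set_plus_mono2 order_refl zono_mono) auto
      then have "\<delta> * q (A + zono W (\<lambda>v. \<delta> + 1)) \<le> \<delta> * q (A + zono W (\<lambda>_. 2))" using \<delta> by (intro mult_left_mono) auto
      ultimately show ?thesis by (simp del: set_zero)
    qed
    finally show ?thesis .
  qed
  have "((\<lambda>\<delta>. q A + \<delta> * q (A + zono W (\<lambda>_. 2))) \<longlongrightarrow> q A + 0 * q (A + zono W (\<lambda>_. 2))) (at_right 0)"
    by (intro tendsto_intros)
  moreover have "eventually (\<lambda>\<delta>::real. \<delta> \<in> {0<..<1}) (at_right 0)" by (intro eventually_at_right_real) simp
  then have "eventually (\<lambda>\<delta>. S ^ ?m \<le> q A + \<delta> * q (A + zono W (\<lambda>_. 2))) (at_right 0)"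
    by eventually_elim (auto intro: S1 simp del: power_Suc)
  ultimately have "S ^ ?m \<le> q A + 0 * q (A + zono W (\<lambda>_. 2))" by (intro tendsto_lowerbound) auto
  then have "(2 * S) ^ ?m \<le> 2 ^ ?m * q A" by (simp add: power_mult_distrib del: power_Suc)
  also have "\<dots> = q (K + L)"
    using KL by (simp add: A_def bf_dilate[OF q] power_divide del: power_Suc)
  finally have "root ?m ((2 * S) ^ ?m) \<le> root ?m (q (K + L))" by (simp del: power_Suc)
  moreover have "root ?m ((2 * S) ^ ?m) = 2 * S" using S0 by (intro real_root_power_cancel) auto
  ultimately have "2 * S \<le> root ?m (q (K + L))" by (simp only:)
  then show ?thesis by (simp add: S_def q_def)
qed

lemma dzon_root_superadditive:
  fixes H :: "'a::euclidean_space set \<Rightarrow> real"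
  assumes H: "body_functional (Suc (Suc (Suc n))) H"
    and W: "finite W" "W \<noteq> {}"
    and lc: "\<And>j. j \<in> W \<Longrightarrow> midpoint_log_concave (dseg j H)"
    and posQ: "\<And>B c v u. cbody B \<Longrightarrow> c > 0 \<Longrightarrow> v \<in> W \<Longrightarrow> u \<in> W \<Longrightarrow> v \<noteq> u \<Longrightarrow> 0 < dseg v (dseg u (dzon W H)) (B + zono W (\<lambda>_. c))"
    and posD: "\<And>B c j. cbody B \<Longrightarrow> c > 0 \<Longrightarrow> j \<in> W \<Longrightarrow> 0 < dseg j (dzon W H) (B + zono W (\<lambda>_. c))"
    and posq: "\<And>B c j. cbody B \<Longrightarrow> c > 0 \<Longrightarrow> j \<in> W \<Longrightarrow> 0 < dseg j H (B + zono W (\<lambda>_. c))"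
  shows "root_superadditive (Suc (Suc n)) (dzon W H)"
  unfolding root_superadditive_def
proof (intro allI impI)
  fix X Y :: "'a set" assume XY: "cbody X" "cbody Y"
  note q = body_functional_dzon[OF H, of W]
  obtain x y where xy: "x \<in> X" "y \<in> Y" using XY by (auto simp: cbody_def)
  let ?X = "(+) (-x) ` X" and ?Y = "(+) (-y) ` Y"
  have "?X + ?Y = (+) (-x) ` (X + ?Y)" by (rule translation_plus)
  also have "X + ?Y = (+) (-y) ` (X + Y)" using translation_plus[of "-y" Y X] by (simp add: add.commute)
  finally have eq: "dzon W H (?X + ?Y) = dzon W H (X + Y)"
    using trans[OF bf_translate[OF q] bf_translate[OF q]] XY by (metis cbody_plus cbody_translation)
  have "cbody ?X" "cbody ?Y" using XY by (intro cbody_translation; simp)+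
  moreover have "0 \<in> ?X" by (rule image_eqI[of _ _ x]) (use xy in auto)
  moreover have "0 \<in> ?Y" by (rule image_eqI[of _ _ y]) (use xy in auto)
  ultimately have "root (Suc (Suc n)) (dzon W H ?X) + root (Suc (Suc n)) (dzon W H ?Y) \<le> root (Suc (Suc n)) (dzon W H (?X + ?Y))"
    by (intro dzon_root_superadditive_zero[OF H W _ _ _ _ lc posQ posD posq])
  then show "root (Suc (Suc n)) (dzon W H X) + root (Suc (Suc n)) (dzon W H Y) \<le> root (Suc (Suc n)) (dzon W H (X + Y))"
    unfolding eq bf_translate[OF q XY(1)] bf_translate[OF q XY(2)] .
qed

section \<open>Mixed volumes with zonotopes\<close>

text \<open>Any \<open>DIM('a)\<close> of the edges span a parallelotope of positive volume. This is
  where the strict positivity of the weights comes from.\<close>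

definition general_position :: "'a::euclidean_space set \<Rightarrow> bool" where
  "general_position V \<longleftrightarrow> finite V \<and> DIM('a) \<le> card V \<and> (\<forall>J\<subseteq>V. card J \<le> DIM('a) \<longrightarrow> independent J)"

abbreviation "vol \<equiv> (\<lambda>K::'a::euclidean_space set. measure lborel K)"

text \<open>Applied to volume, this is the mixed volume with \<open>i\<close> copies of the zonotope
  spanned by \<open>V\<close>, up to the factor \<open>fact i\<close> times a binomial
  coefficient.\<close>

definition ziter :: "'a set \<Rightarrow> nat \<Rightarrow> ('a::euclidean_space set \<Rightarrow> real) \<Rightarrow> 'a set \<Rightarrow> real" where
  "ziter V i F = (dzon V ^^ i) F"

definition dsegs :: "'a list \<Rightarrow> ('a::euclidean_space set \<Rightarrow> real) \<Rightarrow> 'a set \<Rightarrow> real" where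
  "dsegs vs F = foldr dseg vs F"

lemma ziter_0 [simp]: "ziter V 0 F = F"
  by (simp add: ziter_def)

lemma ziter_Suc: "ziter V (Suc i) F = dzon V (ziter V i F)"
  by (simp add: ziter_def)

lemma dsegs_Nil [simp]: "dsegs [] F = F" and dsegs_Cons: "dsegs (v # vs) F = dseg v (dsegs vs F)"
  by (simp_all add: dsegs_def)

lemma dsegs_append: "dsegs (us @ vs) F = dsegs us (dsegs vs F)"
  by (simp add: dsegs_def)

lemma dsegs_dseg: "dsegs vs (dseg v F) = dseg v (dsegs vs F)"
  by (induction vs) (simp_all only: dsegs_Nil dsegs_Cons dseg_commute[of v])

lemma ziter_dseg: "dseg v (ziter V i F) = ziter V i (dseg v F)"
  by (induction i) (simp_all add: ziter_Suc dseg_dzon)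

lemma ziter_Suc': "ziter V (Suc i) F = ziter V i (dzon V F)"
  by (simp add: ziter_def funpow_swap1)

lemma body_functional_dsegs: "body_functional (length vs + k) F \<Longrightarrow> body_functional k (dsegs vs F)"
  by (induction vs arbitrary: k) (auto simp: dsegs_Cons intro!: body_functional_dseg)

lemma body_functional_ziter: "body_functional (i + k) F \<Longrightarrow> body_functional k (ziter V i F)"
  by (induction i arbitrary: k) (auto simp: ziter_Suc intro!: body_functional_dzon)

lemma mlc_dsegs: "body_functional (length vs + k) F \<Longrightarrow> midpoint_log_concave F \<Longrightarrow> midpoint_log_concave (dsegs vs F)"
proof (induction vs arbitrary: k)
  case (Cons v vs)
  then have b: "body_functional (length vs + Suc k) F" by simp
  show ?case
    unfolding dsegs_Cons
    by (rule midpoint_log_concave_dseg[OF body_functional_dsegs[OF b] Cons.IH[OF b Cons.prems(2)]])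
qed auto

text \<open>The difference would have degree -1: doubling a body that contains the origin halves it,
  whereas monotonicity forbids a decrease.\<close>

lemma dseg_degree_0:
  fixes F :: "'a::euclidean_space set \<Rightarrow> real"
  assumes F: "body_functional 0 F" and K: "cbody K"
  shows "dseg v F K = 0"
proof -
  have half: "dseg v F (dilate 2 X) = dseg v F X / 2" if X: "cbody X" for X
  proof -
    have "F (dilate 2 X + seg v 1) = F (dilate 2 (X + seg v (1/2)))" by (simp add: dilate_plus dilate_seg)
    also have "\<dots> = F X + (1/2) * dseg v F X" using X by (simp add: bf_dilate[OF F] bf_seg[OF F])
    finally show ?thesis using bf_dilate[OF F X, of 2] by (simp add: dseg_def[of v F "dilate 2 X"])
  qed
  obtain x where x: "x \<in> K" using K by (auto simp: cbody_def)
  let ?X = "(+) (-x) ` K"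
  have X: "cbody ?X" using K by (rule cbody_translation)
  have "0 \<in> ?X" by (rule image_eqI[of _ _ x]) (use x in auto)
  then have "dilate 1 ?X \<subseteq> dilate 2 ?X" using X by (intro dilate_mono_star) (auto simp: cbody_def)
  then have "dseg v F ?X \<le> dseg v F (dilate 2 ?X)" using dseg_mono[OF F X cbody_dilate[OF X]] by simp
  then have "dseg v F ?X \<le> 0" using half[OF X] by simp
  moreover have "dseg v F ?X \<ge> 0" by (rule dseg_nonneg[OF F X])
  ultimately have "dseg v F ?X = 0" by simp
  moreover have "dseg v F ?X = dseg v F K"
    unfolding dseg_def translation_plus using K by (simp only: bf_translate[OF F] cbody_plus cbody_seg zero_le_one)
  ultimately show ?thesis by simp
qed

text \<open>Differences commute, so the second occurrence of an edge can be moved next to the first.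
  It follows that edges already used drop out of a sum over all edges.\<close>

lemma dsegs_repeated_zero:
  fixes F :: "'a::euclidean_space set \<Rightarrow> real"
  assumes "body_functional (length vs + k) F" "v \<in> set vs" "cbody K"
  shows "dseg v (dsegs vs F) K = 0"
  using assms
proof (induction vs arbitrary: k K)
  case (Cons w vs)
  have b: "body_functional (length vs + Suc k) F" using Cons.prems by simp
  show ?case
  proof (cases "v = w")
    case True
    then show ?thesis
      unfolding dsegs_Cons using dseg_dseg_zero[OF body_functional_dsegs[OF b] Cons.prems(3)] by simp
  next
    case False
    then have "v \<in> set vs" using Cons.prems by simp
    then have "dseg v (dsegs vs F) K = 0" "dseg v (dsegs vs F) (K + seg w 1) = 0"
      using Cons.prems by (auto intro!: Cons.IH[OF b])
    then have "dseg w (dseg v (dsegs vs F)) K = 0" by (simp add: dseg_def[of w "dseg v (dsegs vs F)"])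
    then show ?thesis by (simp only: dsegs_Cons dseg_commute[of v w])
  qed
qed auto

lemma ziter_zero:
  assumes "\<And>K. cbody K \<Longrightarrow> F K = 0" "cbody K"
  shows "ziter V i F K = 0"
  using assms(2)
proof (induction i arbitrary: K)
  case (Suc i)
  then show ?case by (simp add: ziter_Suc dzon_def dseg_def)
qed (use assms in auto)

lemma bf_point_zero: "body_functional (Suc k) F \<Longrightarrow> F {0} = 0"
proof -
  assume F: "body_functional (Suc k) F"
  have "dilate 2 {0::'a} = {0}" by (simp add: dilate_def)
  then have "F {0} = 2 ^ Suc k * F {0}" using bf_dilate[OF F, of "{0}" 2] by simp
  moreover have "(1::real) < 2 ^ Suc k" by (rule one_less_power) auto
  ultimately show ?thesis by (simp del: power_Suc)
qed

text \<open>In the expansion each edge is either skipped or lowers the degree by one. With fewer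
  edges than the degree, every term ends with a functional of positive degree at a point, which is
  zero.\<close>

lemma bf_zono_low:
  fixes F :: "'a::euclidean_space set \<Rightarrow> real"
  assumes "body_functional k F" "distinct vs" "length vs < k"
  shows "F (zono (set vs) (\<lambda>_. 1)) = 0"
  using assms
proof (induction vs arbitrary: k F)
  case Nil
  then obtain k' where "k = Suc k'" by (cases k) auto
  then show ?case using Nil bf_point_zero[of k' F] by simp
next
  case (Cons a vs)
  then obtain k' where k: "k = Suc k'" by (cases k) auto
  have F: "body_functional (Suc k') F" using Cons k by simp
  have "F (zono (set (a # vs)) (\<lambda>_. 1)) = F (zono (set vs) (\<lambda>_. 1)) + 1 * dseg a F (zono (set vs) (\<lambda>_. 1))"
    using Cons.prems by (simp add: zono_insert add.commute[of "seg a 1"] bf_seg[OF F])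
  also have "F (zono (set vs) (\<lambda>_. 1)) = 0" using Cons k by (intro Cons.IH[OF F]) auto
  also have "dseg a F (zono (set vs) (\<lambda>_. 1)) = 0"
    using Cons k by (intro Cons.IH[OF body_functional_dseg[OF F]]) auto
  finally show ?case by simp
qed

text \<open>Only the term that uses every edge survives. For volume and \<open>DIM('a)\<close> edges
  this identifies the iterated difference with the volume of a parallelotope.\<close>

lemma bf_zono_top:
  fixes F :: "'a::euclidean_space set \<Rightarrow> real"
  assumes "body_functional (length vs) F" "distinct vs"
  shows "dsegs vs F {0} = F (zono (set vs) (\<lambda>_. 1))"
  using assms
proof (induction vs arbitrary: F)
  case (Cons a vs)
  have F: "body_functional (Suc (length vs)) F" using Cons by simp
  have "F (zono (set (a # vs)) (\<lambda>_. 1)) = F (zono (set vs) (\<lambda>_. 1)) + 1 * dseg a F (zono (set vs) (\<lambda>_. 1))"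
    using Cons.prems by (simp add: zono_insert add.commute[of "seg a 1"] bf_seg[OF F])
  also have "F (zono (set vs) (\<lambda>_. 1)) = 0" using Cons.prems by (intro bf_zono_low[OF F]) auto
  also have "dseg a F (zono (set vs) (\<lambda>_. 1)) = dsegs vs (dseg a F) {0}"
    using Cons.prems by (intro Cons.IH[symmetric] body_functional_dseg F) auto
  finally show ?case by (simp add: dsegs_Cons dsegs_dseg)
qed simp

text \<open>The linear map sending the standard basis to \<open>J\<close> is injective, hence
  preserves nonempty interior, and it maps the unit cube into the zonotope.\<close>

lemma measure_zono_pos:
  fixes J :: "'a::euclidean_space set"
  assumes J: "independent J" "card J = DIM('a)"
  shows "0 < measure lborel (zono J (\<lambda>_. 1))"
proof -
  have fin: "finite J" using J(1) by (rule independent_imp_finite)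
  obtain \<beta> where \<beta>: "bij_betw \<beta> (Basis :: 'a set) J"
    using finite_same_card_bij[of "Basis :: 'a set" J] fin J by auto
  define f where "f x = (\<Sum>b\<in>Basis. (x \<bullet> b) *\<^sub>R \<beta> b)" for x
  have lin: "linear f"
    unfolding f_def by (intro linearI) (simp_all add: inner_add_left scaleR_add_left sum.distrib scaleR_sum_right)
  have fb: "f b = \<beta> b" if "b \<in> Basis" for b
    using that by (simp add: f_def inner_Basis if_distrib[of "\<lambda>c. c *\<^sub>R _"] cong: if_cong)
  have im: "f ` Basis = J" using \<beta> fb by (auto simp: bij_betw_def)
  have "inj_on f (span Basis)"
  proof (rule linear_inj_on_span_independent_image[OF lin])
    show "independent (f ` Basis)" using J im by simp
    show "inj_on f Basis" using \<beta> fb by (auto simp: bij_betw_def inj_on_def)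
  qed
  then have inj: "inj f" by simp
  have sub: "f ` cbox 0 One \<subseteq> zono J (\<lambda>_. 1)"
  proof (rule image_subsetI)
    fix x :: 'a assume x: "x \<in> cbox 0 One"
    define s where "s v = (x \<bullet> inv_into Basis \<beta> v) *\<^sub>R v" for v
    have "f x = (\<Sum>v\<in>J. s v)"
      unfolding f_def using \<beta> by (subst sum.reindex_bij_betw[OF \<beta>, symmetric])
        (intro sum.cong refl, simp add: s_def bij_betw_def inv_into_f_f)
    moreover have "\<forall>v\<in>J. s v \<in> seg v 1"
    proof
      fix v assume v: "v \<in> J"
      then have "inv_into Basis \<beta> v \<in> Basis" using \<beta> by (metis bij_betw_def inv_into_into)
      then have "0 \<le> x \<bullet> inv_into Basis \<beta> v" "x \<bullet> inv_into Basis \<beta> v \<le> 1"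
        using x by (auto simp: mem_box)
      then show "s v \<in> seg v 1" by (auto simp: s_def seg_def)
    qed
    ultimately show "f x \<in> zono J (\<lambda>_. 1)"
      unfolding zono_def set_sum_alt[OF fin] by blast
  qed
  have "interior (cbox 0 (One::'a)) \<noteq> {}" by (simp add: interior_cbox box_eq_empty)
  then have "interior (f ` cbox 0 One) \<noteq> {}"
    using interior_injective_linear_image[OF lin inj] by simp
  then obtain x where "x \<in> interior (zono J (\<lambda>_. 1))" using interior_mono[OF sub] by blast
  then obtain e where e: "e > 0" "ball x e \<subseteq> zono J (\<lambda>_. 1)"
    by (auto simp: mem_interior)
  have "0 < measure lborel (ball x e)" using content_ball_pos[OF e(1), of x] by simp
  also have "\<dots> \<le> measure lborel (zono J (\<lambda>_. 1))"
    using e by (intro measure_mono_fmeasurable) auto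
  finally show ?thesis .
qed

text \<open>After \<open>DIM('a)\<close> differences the degree is 0, and translation invariance and
  monotonicity reduce \<open>K\<close> to a single point.\<close>

lemma dsegs_measure_pos:
  fixes vs :: "'a::euclidean_space list"
  assumes vs: "distinct vs" "length vs = DIM('a)" "independent (set vs)" and K: "cbody K"
  shows "0 < dsegs vs vol K"
proof -
  have bf: "body_functional (length vs) (vol :: 'a set \<Rightarrow> real)" using body_functional_measure vs by simp
  have bf0: "body_functional 0 (dsegs vs vol)" using body_functional_dsegs[of vs 0 vol] bf by simp
  have "0 < dsegs vs vol {0}"
    unfolding bf_zono_top[OF bf vs(1)] using vs by (intro measure_zono_pos) (auto simp: distinct_card)
  also obtain x where x: "x \<in> K" using K by (auto simp: cbody_def)
  have "dsegs vs vol {0} = dsegs vs vol ((+) x ` {0})"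
    by (intro bf_translate[OF bf0, symmetric]) simp
  also have "\<dots> \<le> dsegs vs vol K" using x K by (intro bf_mono[OF bf0]) auto
  finally show ?thesis .
qed

text \<open>Expanding in the edges \<open>rs\<close> writes the right-hand side as a sum of
  nonnegative terms; the left-hand side is the one that uses all edges.\<close>

lemma dsegs_le_zono:
  fixes F :: "'a::euclidean_space set \<Rightarrow> real"
  assumes "body_functional (length rs + k) F" "distinct rs" "cbody B" "c \<ge> 0"
  shows "c ^ length rs * dsegs rs F B \<le> F (B + zono (set rs) (\<lambda>_. c))"
  using assms
proof (induction rs arbitrary: F)
  case (Cons r rs)
  have F: "body_functional (Suc (length rs + k)) F" using Cons by simp
  have cb: "cbody (B + zono (set rs) (\<lambda>_. c))" using Cons.prems by (intro cbody_plus cbody_zono) auto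
  have "c * (c ^ length rs * dsegs rs (dseg r F) B) \<le> c * dseg r F (B + zono (set rs) (\<lambda>_. c))"
    using Cons.prems by (intro mult_left_mono Cons.IH body_functional_dseg F) auto
  also have "\<dots> \<le> F (B + zono (set rs) (\<lambda>_. c)) + c * dseg r F (B + zono (set rs) (\<lambda>_. c))"
    using bf_nonneg[OF F cb] by simp
  also have "\<dots> = F (B + zono (set (r # rs)) (\<lambda>_. c))"
  proof -
    have "B + zono (set (r # rs)) (\<lambda>_. c) = B + zono (set rs) (\<lambda>_. c) + seg r c"
      using Cons.prems by (simp add: zono_insert ac_simps)
    then show ?thesis using bf_seg[OF F cb Cons.prems(4)] by simp
  qed
  finally show ?case by (simp add: dsegs_Cons dsegs_dseg mult.assoc)
qed simp

lemma zono_mono_set: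
  assumes "finite W" "R \<subseteq> W" "\<And>v. v \<in> W \<Longrightarrow> 0 \<le> u v"
  shows "zono R u \<subseteq> zono W u"
proof -
  have "zono W u = zono (W - R) u + zono R u"
    unfolding zono_def using assms by (intro sum.subset_diff)
  moreover have "0 \<in> zono (W - R) u" using assms by (intro zero_in_zono) auto
  ultimately show ?thesis using set_zero_plus2 by metis
qed

text \<open>The edges \<open>us\<close> are completed to a basis by edges of the zonotope, and the
  term of the expansion belonging to this basis is positive.\<close>

lemma dsegs_zono_pos:
  fixes V :: "'a::euclidean_space set"
  assumes V: "general_position V" and us: "distinct us" "set us \<subseteq> V" "length us \<le> DIM('a)"
    and W: "finite W" "V - set us \<subseteq> W" and B: "cbody B" and c: "c > 0"
  shows "0 < dsegs us vol (B + zono W (\<lambda>_. c))"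
proof -
  have fin: "finite V" "DIM('a) \<le> card V" using V by (auto simp: general_position_def)
  have "DIM('a) - length us \<le> card (V - set us)"
    using us fin by (simp add: card_Diff_subset distinct_card)
  then obtain R where R: "R \<subseteq> V - set us" "card R = DIM('a) - length us"
    using obtain_subset_with_card_n by metis
  obtain rs where rs: "set rs = R" "distinct rs"
    using finite_distinct_list[of R] R fin finite_subset by blast
  have len: "length rs = DIM('a) - length us" using rs R distinct_card by metis
  have d: "distinct (rs @ us)" using rs R us by auto
  have "card (set (rs @ us)) = DIM('a)" using distinct_card[OF d] len us by simp
  then have ind: "independent (set (rs @ us))"
    using V rs R us unfolding general_position_def by (metis Diff_subset order.trans order_refl set_append sup.bounded_iff)
  have bf: "body_functional (length rs + 0) (dsegs us (vol :: 'a set \<Rightarrow> real))"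
    using body_functional_measure[where 'a='a] len us by (intro body_functional_dsegs) simp
  have "0 < c ^ length rs * dsegs (rs @ us) vol B"
    using c by (intro mult_pos_pos dsegs_measure_pos d ind B) (use len us in auto)
  also have "\<dots> \<le> dsegs us vol (B + zono (set rs) (\<lambda>_. c))"
    unfolding dsegs_append using c rs B by (intro dsegs_le_zono[OF bf]) auto
  also have "\<dots> \<le> dsegs us vol (B + zono W (\<lambda>_. c))"
    using rs R W c B by (intro bf_mono[OF bf] cbody_plus cbody_zono set_plus_mono2 order_refl zono_mono_set) auto
  finally show ?thesis .
qed

text \<open>Multiplying out the iterated sum over \<open>V\<close> produces nonnegative terms, and
  the list \<open>ls\<close> labels one of them.\<close>

lemma dsegs_le_ziter:
  fixes F :: "'a::euclidean_space set \<Rightarrow> real"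
  assumes "body_functional (length ls + k) F" "set ls \<subseteq> V" "finite V" "cbody A"
  shows "dsegs ls F A \<le> ziter V (length ls) F A"
  using assms
proof (induction ls arbitrary: F)
  case (Cons l ls)
  have F: "body_functional (Suc (length ls + k)) F" using Cons by simp
  have bz: "body_functional (Suc k) (ziter V (length ls) F)" using F by (intro body_functional_ziter) simp
  have "dsegs (l # ls) F A = dsegs ls (dseg l F) A" by (simp add: dsegs_Cons dsegs_dseg)
  also have "\<dots> \<le> ziter V (length ls) (dseg l F) A"
    using Cons.prems by (intro Cons.IH body_functional_dseg F) auto
  also have "\<dots> = dseg l (ziter V (length ls) F) A" by (simp add: ziter_dseg)
  also have "\<dots> \<le> dzon V (ziter V (length ls) F) A"
    unfolding dzon_def using Cons.prems by (intro member_le_sum dseg_nonneg[OF bz]) auto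
  finally show ?case by (simp add: ziter_Suc)
qed simp

lemma ziter_zono_pos:
  fixes V :: "'a::euclidean_space set"
  assumes V: "general_position V" and us: "distinct us" "set us \<subseteq> V" "length us + i \<le> DIM('a)"
    and W: "finite W" "V - set us \<subseteq> W" and B: "cbody B" and c: "c > 0"
  shows "0 < ziter V i (dsegs us vol) (B + zono W (\<lambda>_. c))"
proof -
  have fin: "finite V" "DIM('a) \<le> card V" using V by (auto simp: general_position_def)
  have "i \<le> card (V - set us)"
    using us fin by (simp add: card_Diff_subset distinct_card)
  then obtain R where R: "R \<subseteq> V - set us" "card R = i"
    using obtain_subset_with_card_n by metis
  obtain ls where ls: "set ls = R" "distinct ls"
    using finite_distinct_list[of R] R fin finite_subset by blast
  have len: "length ls = i" using ls R distinct_card by metis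
  have bf: "body_functional (length ls + (DIM('a) - length us - i)) (dsegs us (vol :: 'a set \<Rightarrow> real))"
    using body_functional_measure[where 'a='a] len us by (intro body_functional_dsegs) simp
  have cb: "cbody (B + zono W (\<lambda>_. c))" using B c by (intro cbody_plus cbody_zono) auto
  have "0 < dsegs (ls @ us) vol (B + zono W (\<lambda>_. c))"
    using ls R us len W B c by (intro dsegs_zono_pos[OF V]) auto
  also have "\<dots> \<le> ziter V i (dsegs us vol) (B + zono W (\<lambda>_. c))"
    unfolding dsegs_append using dsegs_le_ziter[OF bf _ fin(1) cb] ls R len by auto
  finally show ?thesis .
qed

lemma mlc_cong:
  assumes "\<And>K. cbody K \<Longrightarrow> F K = G K" "midpoint_log_concave F"
  shows "midpoint_log_concave G"
  using assms unfolding midpoint_log_concave_def by (metis cbody_dilate cbody_plus)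

text \<open>The induction over \<open>i\<close> needs all lists \<open>vs\<close> of distinct edges,
  because a difference along \<open>j\<close> turns the i-th iterate for \<open>vs\<close> into the
  i-th iterate for \<open>j # vs\<close>. Edges in \<open>vs\<close> contribute zero to the next
  sum, so it runs over \<open>W\<close> only and the lists stay distinct.\<close>

theorem ziter_mlc:
  fixes V :: "'a::euclidean_space set"
  assumes V: "general_position V"
  shows "distinct vs \<Longrightarrow> set vs \<subseteq> V \<Longrightarrow> length vs + i + m = DIM('a) \<Longrightarrow> m > 0 \<Longrightarrow>
    midpoint_log_concave (ziter V i (dsegs vs vol))"
proof (induction i arbitrary: vs)
  case 0
  then show ?case
    using mlc_dsegs[of vs m vol] body_functional_measure[where 'a='a] midpoint_log_concave_measure by simp
next
  case (Suc i)
  have finV: "finite V" "DIM('a) \<le> card V" using V by (auto simp: general_position_def)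
  define H where "H = ziter V i (dsegs vs vol)"
  define W where "W = V - set vs"
  have bvs: "body_functional (i + Suc m) (dsegs vs (vol :: 'a set \<Rightarrow> real))"
    using body_functional_measure[where 'a='a] Suc.prems by (intro body_functional_dsegs) (simp add: ac_simps)
  have H: "body_functional (Suc m) H" unfolding H_def by (intro body_functional_ziter bvs)
  have card: "length vs < card V" using finV Suc.prems by simp
  have W: "finite W" "W \<noteq> {}"
  proof -
    show "finite W" using finV by (simp add: W_def)
    have "card (set vs) < card V" using card Suc.prems(1) by (simp add: distinct_card)
    then show "W \<noteq> {}" unfolding W_def by (metis Diff_eq_empty_iff List.finite_set card_mono leD)
  qed
  have dH: "dseg j H = ziter V i (dsegs (j # vs) vol)" for j
    by (simp add: H_def ziter_dseg dsegs_Cons)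
  have lc: "midpoint_log_concave (dseg j H)" if "j \<in> W" for j
    unfolding dH using that Suc.prems by (intro Suc.IH) (auto simp: W_def)
  have zero: "dseg j H K = 0" if "j \<in> set vs" "cbody K" for j K
    unfolding dH dsegs_Cons
  proof (rule ziter_zero[OF _ that(2)])
    fix K :: "'a set" assume "cbody K"
    then show "dseg j (dsegs vs vol) K = 0"
      using that(1) body_functional_measure[where 'a='a] Suc.prems
      by (intro dsegs_repeated_zero[where k="Suc i + m"]) (auto simp: ac_simps)
  qed
  have VW: "dzon W H K = dzon V H K" if "cbody K" for K
    unfolding dzon_def using finV zero[OF _ that] by (intro sum.mono_neutral_left) (auto simp: W_def)
  have "midpoint_log_concave (dzon W H)"
  \<comment> \<open>In degree 1 log-concavity amounts to superadditivity, which passes to sums at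
    once. The second-order argument starts at degree 2.\<close>
  proof (cases "m = 1")
    case True
    have bj: "body_functional 1 (dseg j H)" for j using body_functional_dseg[OF H] True by simp
    have sj: "dseg j H X + dseg j H Y \<le> dseg j H (X + Y)" if "j \<in> W" "cbody X" "cbody Y" for j X Y
      using mlc_imp_root_superadditive[OF bj _ lc[OF that(1)]] that unfolding root_superadditive_def by simp
    have "root_superadditive 1 (dzon W H)"
      unfolding root_superadditive_def dzon_def
      using sj by (simp add: sum.distrib[symmetric] sum_mono)
    then show ?thesis using body_functional_dzon[OF H, of W] True by (intro root_superadditive_imp_mlc[of 1]) auto
  next
    case False
    then obtain n where m: "m = Suc (Suc n)" using Suc.prems(4) by (cases m; cases "m - 1") auto
    have zpos: "0 < ziter V i (dsegs (ps @ vs) vol) (B + zono W (\<lambda>_. c))"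
      if "distinct ps" "set ps \<subseteq> W" "length ps \<le> 3" "cbody B" "c > 0" for ps B c
      using that Suc.prems W m by (intro ziter_zono_pos[OF V]) (auto simp: W_def)
    have "card W = card V - length vs"
      using finV Suc.prems by (simp add: W_def card_Diff_subset distinct_card)
    \<comment> \<open>Two edges form the pair whose weight has to be positive, and a third one
      supplies a positive summand of \<open>dzon\<close>.\<close>
    then have cW: "3 \<le> card W" using finV Suc.prems m by simp
    have bdd: "body_functional n (dseg v (dseg u H'))" if "body_functional m H'" for v u H'
      using that m by (intro body_functional_dseg) auto
    have "root_superadditive (Suc (Suc n)) (dzon W H)"
    proof (rule dzon_root_superadditive[OF H[unfolded m] W lc])
      fix B :: "'a set" and c j assume j: "cbody B" "c > (0::real)" "j \<in> W"
      show "0 < dseg j H (B + zono W (\<lambda>_. c))"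
        unfolding dH using zpos[of "[j]" B c] j by simp
      have "card (W - {j}) > 0" using cW j W by simp
      then obtain l where l: "l \<in> W" "l \<noteq> j" by (auto simp: card_gt_0_iff)
      have cb: "cbody (B + zono W (\<lambda>_. c))" using j by (intro cbody_plus cbody_zono) auto
      have "0 < dseg l (dseg j H) (B + zono W (\<lambda>_. c))"
        using zpos[of "[l, j]" B c] j l by (simp add: dH dsegs_Cons ziter_dseg)
      also have "\<dots> \<le> dzon W (dseg j H) (B + zono W (\<lambda>_. c))"
        unfolding dzon_def using W l dseg_nonneg[OF body_functional_dseg[OF H] cb] by (intro member_le_sum) auto
      finally show "0 < dseg j (dzon W H) (B + zono W (\<lambda>_. c))" by (simp only: dseg_dzon)
    next
      fix B :: "'a set" and c v u assume j: "cbody B" "c > (0::real)" "v \<in> W" "u \<in> W" "v \<noteq> u"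
      have "card (W - {v, u}) > 0" using cW j W by (simp add: card_Diff_subset)
      then obtain l where l: "l \<in> W" "l \<noteq> v" "l \<noteq> u" by (auto simp: card_gt_0_iff)
      have cb: "cbody (B + zono W (\<lambda>_. c))" using j by (intro cbody_plus cbody_zono) auto
      have "0 < dseg l (dseg v (dseg u H)) (B + zono W (\<lambda>_. c))"
        using zpos[of "[l, v, u]" B c] j l by (simp add: dH dsegs_Cons ziter_dseg)
      also have "\<dots> \<le> dzon W (dseg v (dseg u H)) (B + zono W (\<lambda>_. c))"
        unfolding dzon_def using W l dseg_nonneg[OF body_functional_dseg[OF body_functional_dseg[OF H[unfolded m]]] cb] by (intro member_le_sum) auto
      finally show "0 < dseg v (dseg u (dzon W H)) (B + zono W (\<lambda>_. c))" by (simp only: dseg_dzon)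
    qed
    then show ?thesis using body_functional_dzon[OF H, of W] m by (intro root_superadditive_imp_mlc[of m]) auto
  qed
  then have lcW: "midpoint_log_concave (dzon W H)" .
  show ?case
    unfolding ziter_Suc H_def[symmetric]
  proof (rule mlc_cong[where F="dzon W H"])
    show "dzon W H K = dzon V H K" if "cbody K" for K by (rule VW[OF that])
  qed (rule lcW)
qed

lemma ziter_root_superadditive:
  fixes V :: "'a::euclidean_space set"
  assumes V: "general_position V" and i: "i < DIM('a)"
  shows "root_superadditive (DIM('a) - i) (ziter V i vol)"
proof (rule mlc_imp_root_superadditive)
  show "body_functional (DIM('a) - i) (ziter V i (vol :: 'a set \<Rightarrow> real))"
    using body_functional_measure[where 'a='a] i by (intro body_functional_ziter) simp
  show "midpoint_log_concave (ziter V i (vol :: 'a set \<Rightarrow> real))"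
    using ziter_mlc[OF V, of "[]" i "DIM('a) - i"] i by simp
qed (use i in simp)

lemma ziter_add: "ziter V i (\<lambda>X. F X + G X) = (\<lambda>X. ziter V i F X + ziter V i G X)"
proof (induction i)
  case (Suc i)
  show ?case unfolding ziter_Suc Suc by (rule ext) (simp add: dzon_def dseg_def sum.distrib[symmetric] algebra_simps)
qed simp

lemma dzon_insert:
  "finite V \<Longrightarrow> a \<notin> V \<Longrightarrow> dzon (insert a V) F = (\<lambda>X. dseg a F X + dzon V F X)"
  by (rule ext) (simp add: dzon_def)

text \<open>The binomial expansion stops after the term linear in the new edge, since a second
  difference along that edge vanishes.\<close>

lemma ziter_insert:
  fixes F :: "'a::euclidean_space set \<Rightarrow> real"
  assumes "body_functional (Suc j + k) F" "finite V" "a \<notin> V" "cbody K"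
  shows "ziter (insert a V) (Suc j) F K = ziter V (Suc j) F K + real (Suc j) * ziter V j (dseg a F) K"
  using assms
proof (induction j arbitrary: F k K)
  case 0
  then show ?case by (simp add: ziter_Suc dzon_def)
next
  case (Suc j)
  have F: "body_functional (Suc (Suc j + k)) F" using Suc.prems by simp
  have ext: "ziter (insert a V) (Suc j) G X = ziter V (Suc j) G X + real (Suc j) * ziter V j (dseg a G) X"
    if "body_functional (Suc j + k) G" "cbody X" for G X
    using that Suc.prems by (intro Suc.IH) auto
  have z: "ziter V j (dseg a (dseg a F)) K = 0"
    using Suc.prems by (intro ziter_zero) (auto intro: dseg_dseg_zero[OF F])
  note ins = dzon_insert[OF Suc.prems(2,3)]
  have "ziter (insert a V) (Suc (Suc j)) F K = ziter (insert a V) (Suc j) (dzon (insert a V) F) K"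
    by (simp only: ziter_Suc')
  also have "\<dots> = ziter V (Suc j) (dzon (insert a V) F) K + real (Suc j) * ziter V j (dseg a (dzon (insert a V) F)) K"
    using Suc.prems by (intro ext body_functional_dzon F)
  also have "ziter V (Suc j) (dzon (insert a V) F) K = ziter V (Suc j) (dseg a F) K + ziter V (Suc (Suc j)) F K"
    by (simp only: ins ziter_add ziter_Suc'[of V "Suc j"])
  also have "ziter V j (dseg a (dzon (insert a V) F)) K = ziter V (Suc j) (dseg a F) K"
    unfolding dseg_dzon unfolding ins ziter_add z ziter_Suc' by simp
  finally show ?case by (simp add: algebra_simps)
qed

text \<open>Formally this is the exponential of \<open>\<rho>\<close> times \<open>dzon V\<close>:
  it factors over the edges, and each factor has two terms because the square of
  \<open>dseg v\<close> is zero.\<close>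

lemma bf_zono_expansion:
  fixes F :: "'a::euclidean_space set \<Rightarrow> real"
  assumes "finite V" "body_functional k F" "cbody K" "0 \<le> \<rho>"
  shows "F (K + zono V (\<lambda>_. \<rho>)) = (\<Sum>j\<le>k. \<rho> ^ j / fact j * ziter V j F K)"
  using assms
proof (induction V arbitrary: k F rule: finite_induct)
  case empty
  have "ziter {} (Suc j) F K = 0" for j by (simp add: ziter_Suc dzon_def)
  then have "(\<Sum>j\<le>k. \<rho> ^ j / fact j * ziter {} j F K) = F K"
    by (simp add: sum.atMost_shift)
  then show ?case by simp
next
  case (insert a V)
  have cb: "cbody (K + zono V (\<lambda>_. \<rho>))" using insert.prems by (intro cbody_plus cbody_zono) auto
  have "K + zono (insert a V) (\<lambda>_. \<rho>) = K + zono V (\<lambda>_. \<rho>) + seg a \<rho>"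
    using insert.hyps by (simp add: zono_insert ac_simps)
  then have 1: "F (K + zono (insert a V) (\<lambda>_. \<rho>)) = F (K + zono V (\<lambda>_. \<rho>)) + \<rho> * dseg a F (K + zono V (\<lambda>_. \<rho>))"
    using bf_seg[OF insert.prems(1) cb] insert.prems by simp
  show ?case
  proof (cases k)
    case 0
    then have "dseg a F (K + zono V (\<lambda>_. \<rho>)) = 0" using insert.prems cb by (intro dseg_degree_0) auto
    then show ?thesis unfolding 1 using insert.IH[OF insert.prems] 0 by simp
  next
    case (Suc k')
    have F: "body_functional (Suc k') F" using insert.prems Suc by simp
    have e: "\<rho> ^ Suc j / fact (Suc j) * ziter (insert a V) (Suc j) F K =
        \<rho> ^ Suc j / fact (Suc j) * ziter V (Suc j) F K + \<rho> * (\<rho> ^ j / fact j * ziter V j (dseg a F) K)"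
      if "j \<le> k'" for j
    proof -
      have "body_functional (Suc j + (k' - j)) F" using F that by simp
      then have "ziter (insert a V) (Suc j) F K = ziter V (Suc j) F K + real (Suc j) * ziter V j (dseg a F) K"
        using insert by (intro ziter_insert) auto
      then show ?thesis by (simp add: distrib_left fact_Suc del: of_nat_Suc)
    qed
    have "(\<Sum>j\<le>Suc k'. \<rho> ^ j / fact j * ziter (insert a V) j F K)
       = F K + (\<Sum>j\<le>k'. \<rho> ^ Suc j / fact (Suc j) * ziter (insert a V) (Suc j) F K)"
      by (subst sum.atMost_Suc_shift) simp
    also have "\<dots> = F K + (\<Sum>j\<le>k'. \<rho> ^ Suc j / fact (Suc j) * ziter V (Suc j) F K + \<rho> * (\<rho> ^ j / fact j * ziter V j (dseg a F) K))"
      using e by (intro arg_cong2[where f="(+)"] sum.cong refl) auto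
    also have "\<dots> = (\<Sum>j\<le>Suc k'. \<rho> ^ j / fact j * ziter V j F K) + \<rho> * (\<Sum>j\<le>k'. \<rho> ^ j / fact j * ziter V j (dseg a F) K)"
      by (subst sum.atMost_Suc_shift) (simp only: sum.distrib sum_distrib_left, simp)
    also have "\<dots> = F (K + zono V (\<lambda>_. \<rho>)) + \<rho> * dseg a F (K + zono V (\<lambda>_. \<rho>))"
      using insert.IH[OF F insert.prems(2,3)] insert.IH[OF body_functional_dseg[OF F] insert.prems(2,3)] by simp
    finally show ?thesis unfolding 1 Suc by simp
  qed
qed

section \<open>Approximation of the ball by zonotopes\<close>

text \<open>Each marginal \<open>y \<bullet> X\<close> of a standard Gaussian vector is a centred
  normal variable with deviation \<open>norm y\<close>. The norm thus becomes an average of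
  functions \<open>\<bar>y \<bullet> a\<bar>\<close>, which are support functions of
  segments.\<close>

lemma gaussian_vector:
  "\<exists>(M :: ('a::euclidean_space \<Rightarrow> real) measure) (X :: ('a \<Rightarrow> real) \<Rightarrow> 'a).
    prob_space M \<and> integrable M X \<and> (\<forall>y. (\<integral>\<omega>. \<bar>y \<bullet> X \<omega>\<bar> \<partial>M) = norm y * sqrt (2 / pi))"
proof -
  define N where "N = density lborel (\<lambda>x. ennreal (std_normal_density x))"
  have pN: "prob_space N" unfolding N_def by (rule prob_space_normal_density) simp
  define M where "M = PiM (Basis :: 'a set) (\<lambda>_. N)"
  define X where "X \<omega> = (\<Sum>b\<in>Basis. \<omega> b *\<^sub>R b)" for \<omega> :: "'a \<Rightarrow> real"
  interpret N: prob_space N by fact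
  interpret product_prob_space "\<lambda>_::'a. N" Basis by standard
  interpret Q: prob_space M unfolding M_def by (intro prob_space_PiM pN)
  have [measurable_cong]: "sets N = sets borel" by (simp add: N_def)
  have comp_meas: "(\<lambda>\<omega>. \<omega> b) \<in> M \<rightarrow>\<^sub>M N" if "b \<in> Basis" for b
    unfolding M_def using that by measurable
  have comp: "distributed M lborel (\<lambda>\<omega>. \<omega> b) std_normal_density" if "b \<in> Basis" for b
  proof -
    have "distr M N (\<lambda>\<omega>. \<omega> b) = N"
      unfolding M_def using that by (intro distr_PiM_component pN)
    moreover have "distr M N (\<lambda>\<omega>. \<omega> b) = distr M lborel (\<lambda>\<omega>. \<omega> b)"
      by (rule distr_cong) (auto simp: N_def)
    ultimately show ?thesis
      using comp_meas[OF that] by (auto simp: distributed_def N_def)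
  qed
  have indep: "Q.indep_vars (\<lambda>_. borel) (\<lambda>b \<omega>. \<omega> b) Basis"
  proof -
    have "Q.indep_vars (\<lambda>_. N) (\<lambda>b \<omega>. \<omega> b) Basis"
    proof (subst Q.indep_vars_iff_distr_eq_PiM')
      have "distr M (PiM Basis (\<lambda>_. N)) (\<lambda>x. \<lambda>i\<in>Basis. x i) = distr M M (\<lambda>x. x)"
        unfolding M_def by (intro distr_cong) (auto simp: space_PiM PiE_def extensional_restrict)
      also have "\<dots> = M" by (rule distr_id)
      also have "M = PiM Basis (\<lambda>i. distr M N (\<lambda>\<omega>. \<omega> i))"
        unfolding M_def by (intro PiM_cong refl) (subst distr_PiM_component, auto intro: pN)
      finally show "distr M (PiM Basis (\<lambda>_. N)) (\<lambda>x. \<lambda>i\<in>Basis. x i) = PiM Basis (\<lambda>i. distr M N (\<lambda>\<omega>. \<omega> i))" .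
    qed (auto intro: comp_meas)
    then have "Q.indep_vars (\<lambda>_. borel) (\<lambda>b. (\<lambda>x. x) \<circ> (\<lambda>\<omega>. \<omega> b)) Basis"
      by (rule Q.indep_vars_compose) (auto simp: N_def)
    then show ?thesis by (simp add: comp_def)
  qed
  have int_comp: "integrable M (\<lambda>\<omega>. \<omega> b)" if "b \<in> Basis" for b
    using integrable_std_normal_moment[of 1]
    by (subst distributed_integrable[OF comp[OF that], of "\<lambda>x. x", symmetric]) auto
  have intX: "integrable M X"
    unfolding X_def by (intro Bochner_Integration.integrable_sum integrable_scaleR_left int_comp) auto
  have abs: "(\<integral>\<omega>. \<bar>y \<bullet> X \<omega>\<bar> \<partial>M) = norm y * sqrt (2 / pi)" for y
  proof (cases "y = 0")
    case False
    \<comment> \<open>Coordinates in which \<open>y\<close> vanishes are dropped, because their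
      contributions have deviation 0 and no normal density.\<close>
    define I where "I = {b \<in> Basis. y \<bullet> b \<noteq> 0}"
    have I: "finite I" "I \<subseteq> Basis" by (auto simp: I_def)
    have "I \<noteq> {}" using False euclidean_all_zero_iff[of y] by (auto simp: I_def)
    have eq: "y \<bullet> X \<omega> = (\<Sum>b\<in>I. (y \<bullet> b) * \<omega> b)" for \<omega>
    proof -
      have "y \<bullet> X \<omega> = (\<Sum>b\<in>Basis. (y \<bullet> b) * \<omega> b)" by (simp add: X_def inner_sum_right mult.commute)
      also have "\<dots> = (\<Sum>b\<in>I. (y \<bullet> b) * \<omega> b)"
        by (intro sum.mono_neutral_right) (auto simp: I_def)
      finally show ?thesis .
    qed
    have nrm: "norm y = sqrt (\<Sum>b\<in>I. \<bar>y \<bullet> b\<bar>\<^sup>2)"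
    proof -
      have "(\<Sum>b\<in>I. \<bar>y \<bullet> b\<bar>\<^sup>2) = (\<Sum>b\<in>Basis. (y \<bullet> b)\<^sup>2)"
        by (subst power2_abs) (intro sum.mono_neutral_left, auto simp: I_def)
      then show ?thesis using norm_eq_sqrt_inner[of y] euclidean_inner[of y y] by (simp add: power2_eq_square)
    qed
    have "distributed M lborel (\<lambda>\<omega>. \<Sum>b\<in>I. (y \<bullet> b) * \<omega> b) (normal_density (\<Sum>b\<in>I. 0) (sqrt (\<Sum>b\<in>I. \<bar>y \<bullet> b\<bar>\<^sup>2)))"
    proof (rule Q.sum_indep_normal[OF I(1) \<open>I \<noteq> {}\<close>])
      have "Q.indep_vars (\<lambda>_. borel) (\<lambda>b \<omega>. \<omega> b) I"
        using indep I(2) by (rule Q.indep_vars_subset)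
      then have "Q.indep_vars (\<lambda>_. borel) (\<lambda>b. (\<lambda>x. (y \<bullet> b) * x) \<circ> (\<lambda>\<omega>. \<omega> b)) I"
        by (rule Q.indep_vars_compose) auto
      then show "Q.indep_vars (\<lambda>_. borel) (\<lambda>b \<omega>. (y \<bullet> b) * \<omega> b) I" by (simp add: comp_def)
      fix b assume b: "b \<in> I"
      then show "0 < \<bar>y \<bullet> b\<bar>" by (simp add: I_def)
      have "distributed M lborel (\<lambda>\<omega>. 0 + (y \<bullet> b) * \<omega> b) (normal_density (0 + (y \<bullet> b) * 0) (\<bar>y \<bullet> b\<bar> * 1))"
        using b I by (intro Q.normal_density_affine comp) (auto simp: I_def)
      then show "distributed M lborel (\<lambda>\<omega>. (y \<bullet> b) * \<omega> b) (normal_density 0 \<bar>y \<bullet> b\<bar>)" by simp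
    qed
    then have D: "distributed M lborel (\<lambda>\<omega>. y \<bullet> X \<omega>) (normal_density 0 (norm y))"
      by (simp add: eq nrm)
    have "(\<integral>\<omega>. \<bar>y \<bullet> X \<omega>\<bar> \<partial>M) = (\<integral>x. normal_density 0 (norm y) x * \<bar>x\<bar> \<partial>lborel)"
      by (subst distributed_integral[OF D, of "\<lambda>x. \<bar>x\<bar>", symmetric]) (auto simp: normal_density_nonneg)
    also have "\<dots> = norm y * sqrt (2 / pi)"
    proof (rule has_bochner_integral_integral_eq)
      show "has_bochner_integral lborel (\<lambda>x. normal_density 0 (norm y) x * \<bar>x\<bar>) (norm y * sqrt (2 / pi))"
        using normal_moment_abs_odd[of "norm y" 0 0] False by simp
    qed
    finally show ?thesis .
  qed simp
  show ?thesis using Q.prob_space_axioms intX abs by blast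
qed

text \<open>Replacing the Gaussian vector by a simple function close to it in the mean changes the
  average of \<open>\<bar>y \<bullet> a\<bar>\<close> by at most a small multiple of
  \<open>norm y\<close>, uniformly in \<open>y\<close>, and leaves a finite sum.\<close>

lemma finite_support_function_approx:
  assumes \<eta>: "\<eta> > (0::real)"
  obtains S :: "'a::euclidean_space set" and \<mu> :: "'a \<Rightarrow> real" where "finite S"
    "\<And>a. a \<in> S \<Longrightarrow> 0 \<le> \<mu> a" "\<And>y. \<bar>(\<Sum>a\<in>S. \<mu> a * \<bar>y \<bullet> a\<bar>) - norm y\<bar> \<le> \<eta> * norm y"
proof -
  obtain M :: "('a \<Rightarrow> real) measure" and X :: "('a \<Rightarrow> real) \<Rightarrow> 'a" where MX: "prob_space M \<and> integrable M X \<and>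
      (\<forall>y. (\<integral>\<omega>. \<bar>y \<bullet> X \<omega>\<bar> \<partial>M) = norm y * sqrt (2 / pi))"
    using gaussian_vector[where 'a='a] by (elim exE)
  from MX have M: "prob_space M" by (rule conjunct1)
  from MX have X: "integrable M X" by (elim conjE)
  from MX have abs: "(\<integral>\<omega>. \<bar>y \<bullet> X \<omega>\<bar> \<partial>M) = norm y * sqrt (2 / pi)" for y by (elim conjE) (rule spec)
  interpret prob_space M by fact
  define c where "c = sqrt (2 / pi)"
  have c: "c > 0" by (simp add: c_def)
  obtain x where x: "has_bochner_integral M X x" using X unfolding integrable.simps by blast
  obtain s where s: "\<And>i::nat. Bochner_Integration.simple_bochner_integrable M (s i)"
    and lim: "(\<lambda>i. \<integral>\<^sup>+\<omega>. norm (X \<omega> - s i \<omega>) \<partial>M) \<longlonglongrightarrow> 0"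
    using x unfolding has_bochner_integral.simps by blast
  have "eventually (\<lambda>i. (\<integral>\<^sup>+\<omega>. norm (X \<omega> - s i \<omega>) \<partial>M) < ennreal (c * \<eta>)) sequentially"
    using lim c \<eta> by (intro order_tendstoD) auto
  then obtain i where i: "(\<integral>\<^sup>+\<omega>. norm (X \<omega> - s i \<omega>) \<partial>M) < ennreal (c * \<eta>)"
    by (auto simp: eventually_sequentially)
  define f where "f = s i"
  have f: "simple_function M f" using s[of i] unfolding f_def Bochner_Integration.simple_bochner_integrable.simps by blast
  have [measurable]: "f \<in> borel_measurable M" "X \<in> borel_measurable M"
    using f X by (auto intro: borel_measurable_simple_function)
  have Xf: "integrable M (\<lambda>\<omega>. X \<omega> - f \<omega>)"
    proof (rule integrableI_bounded)
    show "(\<lambda>\<omega>. X \<omega> - f \<omega>) \<in> borel_measurable M" by measurable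
    show "(\<integral>\<^sup>+\<omega>. ennreal (norm (X \<omega> - f \<omega>)) \<partial>M) < \<infinity>"
      using order_less_le_trans[OF i, of \<infinity>] by (simp add: f_def)
  qed
  have err: "(\<integral>\<omega>. norm (X \<omega> - f \<omega>) \<partial>M) \<le> c * \<eta>"
  proof -
    have "ennreal (\<integral>\<omega>. norm (X \<omega> - f \<omega>) \<partial>M) = (\<integral>\<^sup>+\<omega>. norm (X \<omega> - f \<omega>) \<partial>M)"
      using Xf by (intro nn_integral_eq_integral[symmetric]) auto
    also have "\<dots> \<le> ennreal (c * \<eta>)" using i by (simp add: f_def)
    finally show ?thesis using c \<eta> by (simp add: ennreal_le_iff)
  qed
  define S where "S = f ` space M"
  have S: "finite S" using f by (simp add: S_def simple_functionD)
  define p where "p a = measure M {\<omega> \<in> space M. f \<omega> = a}" for a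
  have sumf: "(\<integral>\<omega>. \<bar>y \<bullet> f \<omega>\<bar> \<partial>M) = (\<Sum>a\<in>S. p a * \<bar>y \<bullet> a\<bar>)" for y
  proof -
    have "(\<integral>\<omega>. \<bar>y \<bullet> f \<omega>\<bar> \<partial>M) = (\<integral>\<omega>. (\<Sum>a\<in>S. indicator {\<omega> \<in> space M. f \<omega> = a} \<omega> * \<bar>y \<bullet> a\<bar>) \<partial>M)"
    proof (intro Bochner_Integration.integral_cong refl)
      fix \<omega> assume \<omega>: "\<omega> \<in> space M"
      have "(\<Sum>a\<in>S. indicator {\<omega> \<in> space M. f \<omega> = a} \<omega> * \<bar>y \<bullet> a\<bar>) = (\<Sum>a\<in>S. if a = f \<omega> then \<bar>y \<bullet> a\<bar> else 0)"
        using \<omega> by (intro sum.cong) (auto simp: indicator_def)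
      then show "\<bar>y \<bullet> f \<omega>\<bar> = (\<Sum>a\<in>S. indicator {\<omega> \<in> space M. f \<omega> = a} \<omega> * \<bar>y \<bullet> a\<bar>)"
        using \<omega> S by (simp add: S_def)
    qed
    also have "\<dots> = (\<Sum>a\<in>S. p a * \<bar>y \<bullet> a\<bar>)"
    proof (subst Bochner_Integration.integral_sum)
      fix a
      show "integrable M (\<lambda>\<omega>. indicator {\<omega> \<in> space M. f \<omega> = a} \<omega> * \<bar>y \<bullet> a\<bar>)"
        by (intro integrable_mult_left integrable_real_indicator) (auto simp: less_top[symmetric])
    qed (simp add: p_def Int_def conj_commute conj_left_commute)
    finally show ?thesis .
  qed
  have intX: "integrable M (\<lambda>\<omega>. \<bar>y \<bullet> X \<omega>\<bar>)" for y using X by auto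
  have intf: "integrable M f" using Bochner_Integration.integrable_diff[OF X Xf] by simp
  have intf': "integrable M (\<lambda>\<omega>. \<bar>y \<bullet> f \<omega>\<bar>)" for y using intf by auto
  have approx: "\<bar>(\<Sum>a\<in>S. p a * \<bar>y \<bullet> a\<bar>) - c * norm y\<bar> \<le> c * \<eta> * norm y" for y
  proof -
    have "(\<Sum>a\<in>S. p a * \<bar>y \<bullet> a\<bar>) - c * norm y = (\<integral>\<omega>. \<bar>y \<bullet> f \<omega>\<bar> - \<bar>y \<bullet> X \<omega>\<bar> \<partial>M)"
      using intX[of y] intf'[of y] by (simp add: sumf abs c_def)
    also have "\<bar>\<dots>\<bar> \<le> (\<integral>\<omega>. norm y * norm (X \<omega> - f \<omega>) \<partial>M)"
    proof (rule order_trans[OF integral_abs_bound], rule integral_mono)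
      show "integrable M (\<lambda>\<omega>. norm y * norm (X \<omega> - f \<omega>))" using Xf by auto
      show "integrable M (\<lambda>\<omega>. \<bar>\<bar>y \<bullet> f \<omega>\<bar> - \<bar>y \<bullet> X \<omega>\<bar>\<bar>)" using intX[of y] intf'[of y] by auto
      fix \<omega>
      have "\<bar>\<bar>y \<bullet> f \<omega>\<bar> - \<bar>y \<bullet> X \<omega>\<bar>\<bar> \<le> \<bar>y \<bullet> f \<omega> - y \<bullet> X \<omega>\<bar>" by (rule abs_triangle_ineq3)
      also have "\<dots> = \<bar>y \<bullet> (X \<omega> - f \<omega>)\<bar>" by (simp add: inner_diff_right abs_minus_commute)
      also have "\<dots> \<le> norm y * norm (X \<omega> - f \<omega>)" by (rule Cauchy_Schwarz_ineq2)
      finally show "\<bar>\<bar>y \<bullet> f \<omega>\<bar> - \<bar>y \<bullet> X \<omega>\<bar>\<bar> \<le> norm y * norm (X \<omega> - f \<omega>)" .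
    qed
    also have "\<dots> \<le> norm y * (c * \<eta>)" using err by (simp add: mult_left_mono)
    finally show ?thesis by (simp add: mult_ac)
  qed
  show ?thesis
  proof (rule that[of S "\<lambda>a. p a / c"])
    fix y :: 'a
    have "(\<Sum>a\<in>S. p a / c * \<bar>y \<bullet> a\<bar>) - norm y = ((\<Sum>a\<in>S. p a * \<bar>y \<bullet> a\<bar>) - c * norm y) / c"
      using c by (simp add: diff_divide_distrib sum_divide_distrib)
    also have "\<bar>\<dots>\<bar> \<le> c * \<eta> * norm y / c" using divide_right_mono[OF approx[of y], of c] c by (simp add: abs_divide)
    finally show "\<bar>(\<Sum>a\<in>S. p a / c * \<bar>y \<bullet> a\<bar>) - norm y\<bar> \<le> \<eta> * norm y" using c by simp
  qed (use S c in \<open>auto simp: p_def\<close>)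
qed

text \<open>The vectors are chosen one at a time. The forbidden positions are finitely many points
  and finitely many proper subspaces spanned by earlier vectors, a null set that contains no
  ball.\<close>

lemma general_position_perturbation:
  fixes t :: "'b \<Rightarrow> 'a::euclidean_space"
  assumes "finite S" and r: "r > 0"
  obtains x where "inj_on x S" "\<And>a. a \<in> S \<Longrightarrow> dist (x a) (t a) < r"
    "\<And>J. J \<subseteq> x ` S \<Longrightarrow> card J \<le> DIM('a) \<Longrightarrow> independent J"
proof -
  have "\<exists>x. inj_on x S \<and> (\<forall>a\<in>S. dist (x a) (t a) < r) \<and> (\<forall>J. J \<subseteq> x ` S \<longrightarrow> card J \<le> DIM('a) \<longrightarrow> independent J)"
    using assms(1)
  proof (induction S rule: finite_induct)
    case empty
    show ?case by (auto simp: independent_empty)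
  next
    case (insert a S)
    then obtain x where x: "inj_on x S" "\<And>a. a \<in> S \<Longrightarrow> dist (x a) (t a) < r"
      "\<And>J. J \<subseteq> x ` S \<Longrightarrow> card J \<le> DIM('a) \<Longrightarrow> independent J" by blast
    define Bad where "Bad = x ` S \<union> (\<Union>J\<in>{J. J \<subseteq> x ` S \<and> card J < DIM('a)}. span J)"
    have "negligible Bad"
      unfolding Bad_def
    proof (intro negligible_Un negligible_Union)
      show "negligible (x ` S)" using insert by (intro negligible_finite) auto
      show "finite (span ` {J. J \<subseteq> x ` S \<and> card J < DIM('a)})" using insert by auto
      fix T assume "T \<in> span ` {J. J \<subseteq> x ` S \<and> card J < DIM('a)}"
      then obtain J where J: "T = span J" "J \<subseteq> x ` S" "card J < DIM('a)" by auto
      have "finite J" using J(2) insert.hyps by (auto intro: finite_subset)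
      then have "dim (span J) < DIM('a)" using dim_le_card'[of J] J(3) by simp
      then show "negligible T" unfolding J(1) by (rule negligible_lowdim)
    qed
    moreover have "\<not> negligible (ball (t a) r)" using r by (intro open_not_negligible) auto
    ultimately have "\<not> ball (t a) r \<subseteq> Bad" using negligible_subset by blast
    then obtain z where "z \<in> ball (t a) r" "z \<notin> Bad" by blast
    then have z: "dist (t a) z < r" "z \<notin> Bad" by auto
    have zS: "z \<notin> x ` S" using z(2) by (simp add: Bad_def)
    let ?x = "x(a := z)"
    have im: "?x ` insert a S = insert z (x ` S)" using insert.hyps by auto
    have "independent J" if J: "J \<subseteq> insert z (x ` S)" "card J \<le> DIM('a)" for J
    proof (cases "z \<in> J")
      case False
      then show ?thesis using J by (intro x(3)) auto
    next
      case True
      have fin: "finite J" using J(1) insert.hyps by (auto intro: finite_subset)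
      have sub: "J - {z} \<subseteq> x ` S" using J by auto
      have card: "card (J - {z}) < DIM('a)" using J(2) fin True by (simp add: card_gt_0_iff) (metis One_nat_def Suc_pred card_gt_0_iff empty_iff not_less_eq_eq not_le)
      have "independent (J - {z})" using sub card by (intro x(3)) auto
      moreover have "z \<notin> span (J - {z})" using z(2) sub card by (auto simp: Bad_def)
      ultimately have "independent (insert z (J - {z}))" by (subst independent_insert) auto
      moreover have "insert z (J - {z}) = J" using True by auto
      ultimately show ?thesis by metis
    qed
    moreover have "inj_on ?x (insert a S)"
      using x(1) zS insert.hyps by (auto simp: inj_on_def)
    moreover have "\<forall>b\<in>insert a S. dist (?x b) (t b) < r"
      using x(2) z(1) insert.hyps by (auto simp: dist_commute)
    ultimately show ?case unfolding im[symmetric] by blast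
  qed
  then show ?thesis using that by blast
qed

lemma zono_alt: "finite V \<Longrightarrow> zono V (\<lambda>_. 1) = {\<Sum>v\<in>V. c v *\<^sub>R v |c. \<forall>v\<in>V. 0 \<le> c v \<and> c v \<le> 1}"
proof -
  assume V: "finite V"
  have "zono V (\<lambda>_. 1) = {sum s V |s. \<forall>v\<in>V. s v \<in> seg v 1}"
    unfolding zono_def by (rule set_sum_alt[OF V])
  also have "\<dots> = {\<Sum>v\<in>V. c v *\<^sub>R v |c. \<forall>v\<in>V. 0 \<le> c v \<and> c v \<le> 1}"
  proof safe
    fix s assume "\<forall>v\<in>V. s v \<in> seg v 1"
    then have "\<forall>v\<in>V. \<exists>c. 0 \<le> c \<and> c \<le> 1 \<and> s v = c *\<^sub>R v" unfolding seg_def by (meson atLeastAtMost_iff imageE)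
    from bchoice[OF this] obtain c where c: "\<forall>v\<in>V. 0 \<le> c v \<and> c v \<le> 1 \<and> s v = c v *\<^sub>R v" ..
    then have "sum s V = (\<Sum>v\<in>V. c v *\<^sub>R v)" by (intro sum.cong) auto
    with c show "\<exists>c. sum s V = (\<Sum>v\<in>V. c v *\<^sub>R v) \<and> (\<forall>v\<in>V. 0 \<le> c v \<and> c v \<le> 1)" by blast
  next
    fix c assume "\<forall>v\<in>V. (0::real) \<le> c v \<and> c v \<le> 1"
    then show "\<exists>s. (\<Sum>v\<in>V. c v *\<^sub>R v) = sum s V \<and> (\<forall>v\<in>V. s v \<in> seg v 1)"
      by (intro exI[of _ "\<lambda>v. c v *\<^sub>R v"]) (auto simp: seg_def)
  qed
  finally show ?thesis .
qed

text \<open>Inclusions between convex bodies are read off from support functions: \<open>h\<close>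
  belongs to the centred zonotope and lies between \<open>1 - \<kappa>\<close> and 1 times the
  norm.\<close>

theorem zonotope_approx_ball:
  assumes \<epsilon>: "\<epsilon> > 0"
  obtains V and a :: "'a::euclidean_space" where "general_position V"
    "(+) a ` zono V (\<lambda>_. 1) \<subseteq> cball 0 1"
    "cball 0 1 \<subseteq> dilate (1 + \<epsilon>) ((+) a ` zono V (\<lambda>_. 1))"
proof -
  define \<kappa> where "\<kappa> = \<epsilon> / (1 + \<epsilon>)"
  have \<kappa>: "0 < \<kappa>" "\<kappa> < 1" "1 / (1 - \<kappa>) = 1 + \<epsilon>" using \<epsilon> by (auto simp: \<kappa>_def field_simps)
  obtain S :: "'a set" and \<mu> where S: "finite S" "\<And>a. a \<in> S \<Longrightarrow> 0 \<le> \<mu> a"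
    and ap: "\<And>y. \<bar>(\<Sum>a\<in>S. \<mu> a * \<bar>y \<bullet> a\<bar>) - norm y\<bar> \<le> \<kappa> / 4 * norm y"
    using finite_support_function_approx[of "\<kappa> / 4"] \<kappa> by auto
  \<comment> \<open>Shrinking by \<open>\<kappa> / 2\<close> leaves room for two errors of at most
    \<open>\<kappa> / 4\<close> each, one from the finite sum and one from the perturbation.\<close>
  define \<rho> where "\<rho> = 1 - \<kappa> / 2"
  have \<rho>: "0 < \<rho>" "\<rho> < 1" using \<kappa> by (auto simp: \<rho>_def)
  \<comment> \<open>The factor 2 compensates for centring: the segment of edge \<open>v\<close>
    centred at the origin has support function \<open>\<bar>y \<bullet> v\<bar> / 2\<close>.\<close>
  define t where "t a = (2 * \<rho> * \<mu> a) *\<^sub>R a" for a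
  define r where "r = \<kappa> / (2 * (real (card S) + 1))"
  have r: "r > 0" using \<kappa> by (simp add: r_def)
  have rS: "real (card S) * r \<le> \<kappa> / 2"
    using \<kappa> by (simp add: r_def field_simps)
  obtain x where x: "inj_on x S" "\<And>a. a \<in> S \<Longrightarrow> dist (x a) (t a) < r"
    "\<And>J. J \<subseteq> x ` S \<Longrightarrow> card J \<le> DIM('a) \<Longrightarrow> independent J"
    using general_position_perturbation[OF S(1) r, of t] by blast
  define V where "V = x ` S"
  have V: "finite V" using S by (simp add: V_def)
  define h where "h y = (\<Sum>v\<in>V. \<bar>y \<bullet> v\<bar>) / 2" for y
  have h: "\<bar>h y - \<rho> * norm y\<bar> \<le> \<kappa> / 2 * norm y" for y
  proof -
    have "(\<Sum>v\<in>V. \<bar>y \<bullet> v\<bar>) = (\<Sum>a\<in>S. \<bar>y \<bullet> x a\<bar>)" unfolding V_def using x(1) by (simp add: sum.reindex)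
    moreover have "\<bar>(\<Sum>a\<in>S. \<bar>y \<bullet> x a\<bar>) - (\<Sum>a\<in>S. \<bar>y \<bullet> t a\<bar>)\<bar> \<le> real (card S) * (norm y * r)"
    proof -
      have "\<bar>\<Sum>a\<in>S. \<bar>y \<bullet> x a\<bar> - \<bar>y \<bullet> t a\<bar>\<bar> \<le> (\<Sum>a\<in>S. norm y * r)"
      proof (rule order_trans[OF sum_abs], rule sum_mono)
        fix a assume a: "a \<in> S"
        have "\<bar>\<bar>y \<bullet> x a\<bar> - \<bar>y \<bullet> t a\<bar>\<bar> \<le> \<bar>y \<bullet> x a - y \<bullet> t a\<bar>" by (rule abs_triangle_ineq3)
        also have "\<dots> = \<bar>y \<bullet> (x a - t a)\<bar>" by (simp add: inner_diff_right)
        also have "\<dots> \<le> norm y * norm (x a - t a)" by (rule Cauchy_Schwarz_ineq2)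
        also have "\<dots> \<le> norm y * r" using x(2)[OF a] by (intro mult_left_mono) (auto simp: dist_norm)
        finally show "\<bar>\<bar>y \<bullet> x a\<bar> - \<bar>y \<bullet> t a\<bar>\<bar> \<le> norm y * r" .
      qed
      then show ?thesis by (simp add: sum_subtractf)
    qed
    moreover have "(\<Sum>a\<in>S. \<bar>y \<bullet> t a\<bar>) = 2 * \<rho> * (\<Sum>a\<in>S. \<mu> a * \<bar>y \<bullet> a\<bar>)"
      unfolding sum_distrib_left using \<rho> S(2) by (intro sum.cong refl) (simp add: t_def abs_mult)
    moreover have "\<bar>\<rho> * (\<Sum>a\<in>S. \<mu> a * \<bar>y \<bullet> a\<bar>) - \<rho> * norm y\<bar> \<le> \<kappa> / 4 * norm y"
    proof -
      have "\<bar>\<rho> * (\<Sum>a\<in>S. \<mu> a * \<bar>y \<bullet> a\<bar>) - \<rho> * norm y\<bar> = \<rho> * \<bar>(\<Sum>a\<in>S. \<mu> a * \<bar>y \<bullet> a\<bar>) - norm y\<bar>"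
        using \<rho> by (simp add: right_diff_distrib[symmetric] abs_mult)
      also have "\<dots> \<le> 1 * (\<kappa> / 4 * norm y)" using ap[of y] \<rho> by (intro mult_mono) auto
      finally show ?thesis by simp
    qed
    moreover have "real (card S) * (norm y * r) \<le> \<kappa> / 2 * norm y"
      using mult_right_mono[OF rS, of "norm y"] by (simp add: mult_ac)
    ultimately show ?thesis unfolding h_def by linarith
  qed
  have h_le: "h y \<le> norm y" and h_ge: "(1 - \<kappa>) * norm y \<le> h y" for y
  proof -
    have e: "\<rho> * norm y = norm y - \<kappa> / 2 * norm y" "(1 - \<kappa>) * norm y = norm y - \<kappa> / 2 * norm y - \<kappa> / 2 * norm y"
      by (auto simp: \<rho>_def left_diff_distrib)
    have "h y \<le> \<rho> * norm y + \<kappa> / 2 * norm y" "\<rho> * norm y - \<kappa> / 2 * norm y \<le> h y"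
      using h[of y] by linarith+
    then show "h y \<le> norm y" "(1 - \<kappa>) * norm y \<le> h y" unfolding e by linarith+
  qed
  have "DIM('a) \<le> card V"
  proof (rule ccontr)
    assume "\<not> ?thesis"
    then have "dim V < DIM('a)" using dim_le_card'[OF V] by simp
    then obtain y where y: "y \<noteq> 0" "\<And>v. v \<in> span V \<Longrightarrow> orthogonal y v"
      using orthogonal_to_subspace_exists[of V] by auto
    then have "h y = 0" by (simp add: h_def orthogonal_def span_base)
    then show False using h_ge[of y] \<kappa> y(1) by (simp add: mult_le_0_iff)
  qed
  then have gp: "general_position V"
    unfolding general_position_def using V x(3) by (auto simp: V_def)
  define a where "a = - (1/2) *\<^sub>R (\<Sum>v\<in>V. v)"
  define A where "A = (+) a ` zono V (\<lambda>_. 1)"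
  have A_alt: "A = {\<Sum>v\<in>V. (c v - 1/2) *\<^sub>R v |c. \<forall>v\<in>V. 0 \<le> c v \<and> c v \<le> 1}"
  proof -
    have "a + (\<Sum>v\<in>V. c v *\<^sub>R v) = (\<Sum>v\<in>V. (c v - 1/2) *\<^sub>R v)" for c
      by (simp add: a_def scaleR_diff_left sum_subtractf scaleR_sum_right sum_negf)
    note eq = this
    show ?thesis
    proof
      show "A \<subseteq> {\<Sum>v\<in>V. (c v - 1/2) *\<^sub>R v |c. \<forall>v\<in>V. 0 \<le> c v \<and> c v \<le> 1}"
        unfolding A_def zono_alt[OF V] by (auto simp: eq)
      show "{\<Sum>v\<in>V. (c v - 1/2) *\<^sub>R v |c. \<forall>v\<in>V. 0 \<le> c v \<and> c v \<le> 1} \<subseteq> A"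
        unfolding A_def zono_alt[OF V] by (auto simp: eq[symmetric])
    qed
  qed
  have cA: "cbody A" unfolding A_def by (intro cbody_translation cbody_zono) auto
  have sup: "y \<bullet> z \<le> h y" if z: "z \<in> A" for y z
  proof -
    obtain c where c: "z = (\<Sum>v\<in>V. (c v - 1/2) *\<^sub>R v)" "\<And>v. v \<in> V \<Longrightarrow> 0 \<le> c v \<and> c v \<le> 1"
      using z unfolding A_alt by blast
    have "y \<bullet> z = (\<Sum>v\<in>V. (c v - 1/2) * (y \<bullet> v))" by (simp add: c(1) inner_sum_right)
    also have "\<dots> \<le> (\<Sum>v\<in>V. \<bar>y \<bullet> v\<bar> / 2)"
    proof (rule sum_mono)
      fix v assume "v \<in> V"
      then have "\<bar>c v - 1/2\<bar> \<le> 1/2" using c(2)[of v] unfolding abs_le_iff by linarith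
      then have "\<bar>c v - 1/2\<bar> * \<bar>y \<bullet> v\<bar> \<le> 1/2 * \<bar>y \<bullet> v\<bar>" by (intro mult_right_mono) auto
      then show "(c v - 1/2) * (y \<bullet> v) \<le> \<bar>y \<bullet> v\<bar> / 2" using abs_ge_self[of "(c v - 1/2) * (y \<bullet> v)"] by (simp add: abs_mult)
    qed
    also have "\<dots> = h y" by (simp add: h_def sum_divide_distrib)
    finally show ?thesis .
  qed
  have att: "\<exists>z\<in>A. y \<bullet> z = h y" for y
  proof
    let ?c = "\<lambda>v. if y \<bullet> v > 0 then 1 else (0::real)"
    show "(\<Sum>v\<in>V. (?c v - 1/2) *\<^sub>R v) \<in> A" unfolding A_alt by (intro CollectI exI[of _ ?c]) auto
    have "y \<bullet> (\<Sum>v\<in>V. (?c v - 1/2) *\<^sub>R v) = (\<Sum>v\<in>V. \<bar>y \<bullet> v\<bar> / 2)"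
      unfolding inner_sum_right by (intro sum.cong refl) auto
    then show "y \<bullet> (\<Sum>v\<in>V. (?c v - 1/2) *\<^sub>R v) = h y" by (simp add: h_def sum_divide_distrib)
  qed
  have 1: "A \<subseteq> cball 0 1"
  proof
    fix z assume z: "z \<in> A"
    have "norm z * norm z \<le> 1 * norm z" using sup[OF z, of z] h_le[of z] by (simp add: norm_eq_sqrt_inner)
    then have "norm z \<le> 1" by (cases "z = 0") (auto simp: mult_le_cancel_right)
    then show "z \<in> cball 0 1" by simp
  qed
  \<comment> \<open>A point outside \<open>A\<close> would be separated from it by a hyperplane,
    against the lower bound for \<open>h\<close> in the direction of the normal.\<close>
  have 2: "cball 0 (1 - \<kappa>) \<subseteq> A"
  proof (rule subsetI, rule ccontr)
    fix p assume p: "p \<in> cball 0 (1 - \<kappa>)" "p \<notin> A"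
    obtain y b where yb: "y \<bullet> p < b" "\<And>z. z \<in> A \<Longrightarrow> y \<bullet> z > b"
      using separating_hyperplane_closed_point[of A p] cA p(2) by (auto simp: cbody_def compact_imp_closed)
    obtain z where z: "z \<in> A" "(- y) \<bullet> z = h (- y)" using att by blast
    have "(1 - \<kappa>) * norm y \<le> - b" using z yb(2)[OF z(1)] h_ge[of "- y"] by simp
    also have "\<dots> < (- y) \<bullet> p" using yb(1) by simp
    also have "\<dots> \<le> norm y * norm p" using norm_cauchy_schwarz[of "- y" p] by simp
    also have "\<dots> \<le> norm y * (1 - \<kappa>)" using p(1) by (intro mult_left_mono) auto
    finally show False by (simp add: mult.commute)
  qed
  have 3: "cball 0 1 \<subseteq> dilate (1 + \<epsilon>) A"
  proof
    fix z :: 'a assume z: "z \<in> cball 0 1"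
    have "(1 - \<kappa>) *\<^sub>R z \<in> cball 0 (1 - \<kappa>)" using z \<kappa> by (simp add: mult_left_le)
    then have "(1 - \<kappa>) *\<^sub>R z \<in> A" using 2 by blast
    moreover have "z = (1 + \<epsilon>) *\<^sub>R ((1 - \<kappa>) *\<^sub>R z)" using \<kappa> by (simp flip: \<kappa>(3))
    ultimately show "z \<in> dilate (1 + \<epsilon>) A" unfolding dilate_def by blast
  qed
  show ?thesis using that[OF gp] 1 3 by (simp add: A_def)
qed

section \<open>Quermassintegrals of bodies\<close>

text \<open>The limit is not assumed to be a polynomial. That the volume of parallel bodies is one,
  which is Steiner's formula, comes out as a consequence.\<close>

lemma polynomial_coefficients_convergent:
  fixes a :: "nat \<Rightarrow> nat \<Rightarrow> real"
  assumes "\<And>\<rho>. 0 \<le> \<rho> \<Longrightarrow> convergent (\<lambda>k. \<Sum>j\<le>n. a k j * \<rho> ^ j)" "j \<le> n"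
  shows "convergent (\<lambda>k. a k j)"
  using assms
proof (induction n arbitrary: a j)
  case 0
  from "0.prems"(1)[of 1] "0.prems"(2) show ?case by simp
next
  case (Suc n)
  define p where "p k \<rho> = (\<Sum>j\<le>Suc n. a k j * \<rho> ^ j)" for k \<rho>
  define e :: "nat \<Rightarrow> real" where "e j = 2 ^ j - 2 ^ Suc n" for j
  have conv: "convergent (\<lambda>k. p k \<rho>)" if "0 \<le> \<rho>" for \<rho>
    unfolding p_def using Suc.prems(1)[OF that] .
  have low: "convergent (\<lambda>k. a k j)" if j: "j \<le> n" for j
  proof -
    have c: "convergent (\<lambda>k. \<Sum>j\<le>n. (e j * a k j) * \<rho> ^ j)" if \<rho>: "0 \<le> \<rho>" for \<rho>
    proof -
      \<comment> \<open>the top coefficient cancels in \<open>p (2 \<rho>) - 2 ^ (n + 1) p \<rho>\<close>\<close>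
      have "(\<Sum>j\<le>n. (e j * a k j) * \<rho> ^ j) = p k (2 * \<rho>) - 2 ^ Suc n * p k \<rho>" for k
      proof -
        have "p k (2 * \<rho>) - 2 ^ Suc n * p k \<rho> = (\<Sum>j\<le>Suc n. (e j * a k j) * \<rho> ^ j)"
          unfolding p_def sum_distrib_left sum_subtractf[symmetric]
          by (intro sum.cong refl) (simp add: e_def power_mult_distrib algebra_simps)
        then show ?thesis by (simp add: e_def)
      qed
      moreover have "convergent (\<lambda>k. p k (2 * \<rho>) - 2 ^ Suc n * p k \<rho>)"
        using \<rho> by (intro convergent_diff convergent_mult convergent_const conv) auto
      ultimately show ?thesis by simp
    qed
    have "convergent (\<lambda>k. e j * a k j)" by (rule Suc.IH[OF _ j]) (rule c)
    then have "convergent (\<lambda>k. inverse (e j) * (e j * a k j))"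
      by (rule convergent_mult[OF convergent_const])
    moreover have "(2::real) ^ j < 2 ^ Suc n" using j by (intro power_strict_increasing) auto
    then have "e j \<noteq> 0" by (simp add: e_def)
    then have "inverse (e j) * (e j * a k j) = a k j" for k by simp
    ultimately show ?thesis by (simp only:)
  qed
  show ?case
  proof (cases "j \<le> n")
    case False
    with Suc.prems(2) have j: "j = Suc n" by simp
    have "convergent (\<lambda>k. p k 1 - (\<Sum>j\<le>n. a k j))"
      by (intro convergent_diff conv convergent_sum low) auto
    moreover have "p k 1 - (\<Sum>j\<le>n. a k j) = a k (Suc n)" for k by (simp add: p_def)
    ultimately show ?thesis by (simp add: j)
  qed (rule low)
qed

lemma steiner_coeffs_unique:
  fixes K :: "'a::euclidean_space set"
  assumes "steiner_coeffs K w" "steiner_coeffs K w'" "i \<le> DIM('a)"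
  shows "w i = w' i"
proof -
  let ?n = "DIM('a)"
  define c where "c j = real (?n choose j) * w j - real (?n choose j) * w' j" for j
  have "(\<Sum>j\<le>?n. c j * \<rho> ^ j) = 0" if "\<rho> \<ge> 0" for \<rho>
    using assms(1,2) that by (simp add: steiner_coeffs_def c_def left_diff_distrib sum_subtractf)
  then have "{0..} \<subseteq> {\<rho>. (\<Sum>j\<le>?n. c j * \<rho> ^ j) = 0}" by auto
  then have "infinite {\<rho>. (\<Sum>j\<le>?n. c j * \<rho> ^ j) = 0}"
    using infinite_Ici[of "0::real"] finite_subset by blast
  then have "c i = 0" using polyfun_finite_roots[of c ?n] assms(3) by blast
  then show ?thesis using assms(3) by (simp add: c_def)
qed

lemma quermass_body_eq:
  fixes K :: "'a::euclidean_space set"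
  assumes "steiner_coeffs K w" "i \<le> DIM('a)"
  shows "quermass_body i K = w i"
  unfolding quermass_body_def
  by (rule the_equality) (use assms steiner_coeffs_unique in blast)+

text \<open>A translate of \<open>K\<close> lies in \<open>dilate (1 + \<epsilon>) K\<close>, and
  the multiple of \<open>B\<close> lies in the same dilate of the approximant; so a translate of the
  parallel body fits into a dilate of the approximating one.\<close>

lemma parallel_body_sandwich:
  fixes K B Z :: "'a::euclidean_space set"
  assumes K: "cbody K" and B: "cbody B" and Z: "cbody Z"
    and sub: "(+) a ` Z \<subseteq> B" "B \<subseteq> dilate (1 + \<epsilon>) ((+) a ` Z)" and \<epsilon>: "0 \<le> \<epsilon>" and \<rho>: "0 \<le> \<rho>"
  shows "vol (K + dilate \<rho> Z) \<le> vol (K + dilate \<rho> B)"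
    and "vol (K + dilate \<rho> B) \<le> (1 + \<epsilon>) ^ DIM('a) * vol (K + dilate \<rho> Z)"
proof -
  let ?A = "(+) a ` Z"
  note bf = body_functional_measure[where 'a='a]
  have A: "cbody ?A" using Z by simp
  have d: "dilate \<rho> ?A = (+) (\<rho> *\<^sub>R a) ` dilate \<rho> Z"
    by (auto simp: dilate_def image_image scaleR_add_right)
  have "K + dilate \<rho> ?A = (+) (\<rho> *\<^sub>R a) ` (K + dilate \<rho> Z)"
    unfolding d by (metis add.commute translation_plus)
  then have v: "vol (K + dilate \<rho> ?A) = vol (K + dilate \<rho> Z)"
    using bf_translate[OF bf, of "K + dilate \<rho> Z" "\<rho> *\<^sub>R a"] K Z by simp
  have "K + dilate \<rho> ?A \<subseteq> K + dilate \<rho> B"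
    using sub(1) by (intro set_plus_mono2) (auto simp: dilate_def)
  then show "vol (K + dilate \<rho> Z) \<le> vol (K + dilate \<rho> B)"
    unfolding v[symmetric] using K A B by (intro bf_mono[OF bf]) auto
  obtain x where x: "x \<in> K" using K by (auto simp: cbody_def)
  have "(+) (\<epsilon> *\<^sub>R x) ` K \<subseteq> dilate (1 + \<epsilon>) K"
  proof -
    have "dilate (1 + \<epsilon>) K = dilate 1 K + dilate \<epsilon> K"
      using K \<epsilon> by (subst dilate_add) (auto simp: cbody_def)
    moreover have "{\<epsilon> *\<^sub>R x} \<subseteq> dilate \<epsilon> K" using x by (auto simp: dilate_def)
    then have "{\<epsilon> *\<^sub>R x} + K \<subseteq> dilate \<epsilon> K + K" by (intro set_plus_mono2) auto
    ultimately show ?thesis unfolding singleton_plus by (simp add: add.commute[of "dilate \<epsilon> K"])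
  qed
  moreover have "dilate \<rho> B \<subseteq> dilate (1 + \<epsilon>) (dilate \<rho> ?A)"
  proof -
    have "dilate \<rho> B \<subseteq> dilate \<rho> (dilate (1 + \<epsilon>) ?A)"
      unfolding dilate_def[of \<rho>] by (rule image_mono[OF sub(2)])
    then show ?thesis by (simp add: mult.commute)
  qed
  ultimately have "(+) (\<epsilon> *\<^sub>R x) ` K + dilate \<rho> B \<subseteq> dilate (1 + \<epsilon>) (K + dilate \<rho> ?A)"
    unfolding dilate_plus by (rule set_plus_mono2)
  then have "vol ((+) (\<epsilon> *\<^sub>R x) ` (K + dilate \<rho> B)) \<le> vol (dilate (1 + \<epsilon>) (K + dilate \<rho> ?A))"
    unfolding translation_plus by (intro bf_mono[OF bf]) (use K A B in auto)
  also have "vol ((+) (\<epsilon> *\<^sub>R x) ` (K + dilate \<rho> B)) = vol (K + dilate \<rho> B)"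
    using K B by (intro bf_translate[OF bf]) auto
  also have "vol (dilate (1 + \<epsilon>) (K + dilate \<rho> ?A)) = (1 + \<epsilon>) ^ DIM('a) * vol (K + dilate \<rho> ?A)"
    using K A \<epsilon> by (intro bf_dilate[OF bf]) auto
  finally show "vol (K + dilate \<rho> B) \<le> (1 + \<epsilon>) ^ DIM('a) * vol (K + dilate \<rho> Z)" by (simp add: v)
qed

lemma zonotope_sequence:
  "\<exists>(V :: nat \<Rightarrow> 'a::euclidean_space set) a. \<forall>k. general_position (V k) \<and>
    (+) (a k) ` zono (V k) (\<lambda>_. 1) \<subseteq> cball 0 1 \<and>
    cball 0 1 \<subseteq> dilate (1 + inverse (real (Suc k))) ((+) (a k) ` zono (V k) (\<lambda>_. 1))"
proof -
  have "\<exists>V (a::'a). general_position V \<and> (+) a ` zono V (\<lambda>_. 1) \<subseteq> cball 0 1 \<and>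
      cball 0 1 \<subseteq> dilate (1 + inverse (real (Suc k))) ((+) a ` zono V (\<lambda>_. 1))" for k :: nat
  proof -
    have "0 < inverse (real (Suc k))" by simp
    from zonotope_approx_ball[OF this] obtain V and a :: 'a where 1: "general_position V"
      and 2: "(+) a ` zono V (\<lambda>_. 1) \<subseteq> cball 0 1"
      and 3: "cball 0 1 \<subseteq> dilate (1 + inverse (real (Suc k))) ((+) a ` zono V (\<lambda>_. 1))" .
    show ?thesis by (rule exI[of _ V], rule exI[of _ a]) (intro conjI 1 2 3)
  qed
  then have "\<forall>k. \<exists>V (a::'a). general_position V \<and> (+) a ` zono V (\<lambda>_. 1) \<subseteq> cball 0 1 \<and>
      cball 0 1 \<subseteq> dilate (1 + inverse (real (Suc k))) ((+) a ` zono V (\<lambda>_. 1))" ..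
  then show ?thesis unfolding choice_iff .
qed

text \<open>One sequence of zonotopes serves all bodies and all indices. The limits satisfy the
  defining polynomial identity of \<open>quermass_body\<close>, so the existence of the coefficients
  is obtained here, and every property of \<open>ziter\<close> that is closed under limits is
  inherited.\<close>

theorem steiner_formula_limit:
  obtains V :: "nat \<Rightarrow> 'a::euclidean_space set" where "\<And>k. general_position (V k)"
    "\<And>K i. cbody K \<Longrightarrow> i \<le> DIM('a) \<Longrightarrow>
      (\<lambda>k. ziter (V k) i vol K / (fact i * real (DIM('a) choose i))) \<longlonglongrightarrow> quermass_body i K"
proof -
  let ?n = "DIM('a)"
  obtain V :: "nat \<Rightarrow> 'a set" and a where Va: "\<forall>k. general_position (V k) \<and>
      (+) (a k) ` zono (V k) (\<lambda>_. 1) \<subseteq> cball 0 1 \<and>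
      cball 0 1 \<subseteq> dilate (1 + inverse (real (Suc k))) ((+) (a k) ` zono (V k) (\<lambda>_. 1))"
    using zonotope_sequence[where 'a='a] by (elim exE)
  from Va have gp: "general_position (V k)" for k by blast
  from Va have sub: "(+) (a k) ` zono (V k) (\<lambda>_. 1) \<subseteq> cball 0 1"
      "cball 0 1 \<subseteq> dilate (1 + inverse (real (Suc k))) ((+) (a k) ` zono (V k) (\<lambda>_. 1))" for k by blast+
  have fin: "finite (V k)" for k using gp by (simp add: general_position_def)
  have "(\<lambda>k. ziter (V k) i vol K / (fact i * real (?n choose i))) \<longlonglongrightarrow> quermass_body i K"
    if K: "cbody K" and i: "i \<le> ?n" for K i
  proof -
    define p where "p k \<rho> = (\<Sum>j\<le>?n. ziter (V k) j vol K / fact j * \<rho> ^ j)" for k \<rho>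
    define P where "P \<rho> = vol (K + dilate \<rho> (cball 0 1))" for \<rho>
    have pe: "p k \<rho> = vol (K + dilate \<rho> (zono (V k) (\<lambda>_. 1)))" if "0 \<le> \<rho>" for k \<rho>
    proof -
      have "dilate \<rho> (zono (V k) (\<lambda>_. 1)) = zono (V k) (\<lambda>_. \<rho>)" using that by (simp add: dilate_zono)
      then show ?thesis
        using bf_zono_expansion[OF fin body_functional_measure K that, of k] by (simp add: p_def mult.commute)
    qed
    have lim: "(\<lambda>k. p k \<rho>) \<longlonglongrightarrow> P \<rho>" if \<rho>: "0 \<le> \<rho>" for \<rho>
    proof (rule tendsto_sandwich)
      have le: "p k \<rho> \<le> P \<rho>" "P \<rho> \<le> (1 + inverse (real (Suc k))) ^ ?n * p k \<rho>" for k
        using parallel_body_sandwich[OF K _ _ sub(1)[of k] sub(2)[of k] _ \<rho>]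
        by (simp_all add: pe[OF \<rho>] P_def)
      show "\<forall>\<^sub>F k in sequentially. p k \<rho> \<le> P \<rho>" using le by simp
      show "\<forall>\<^sub>F k in sequentially. P \<rho> / (1 + inverse (real (Suc k))) ^ ?n \<le> p k \<rho>"
      proof (intro always_eventually allI)
        fix k
        have "0 < (1 + inverse (real (Suc k))) ^ ?n" by (intro zero_less_power add_pos_pos) auto
        with le(2)[of k] show "P \<rho> / (1 + inverse (real (Suc k))) ^ ?n \<le> p k \<rho>"
          by (simp add: pos_divide_le_eq mult.commute)
      qed
      have "(\<lambda>k. P \<rho> / (1 + inverse (real (Suc k))) ^ ?n) \<longlonglongrightarrow> P \<rho> / (1 + 0) ^ ?n"
        by (intro tendsto_intros LIMSEQ_inverse_real_of_nat) auto
      then show "(\<lambda>k. P \<rho> / (1 + inverse (real (Suc k))) ^ ?n) \<longlonglongrightarrow> P \<rho>" by simp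
    qed simp
    define c where "c j = lim (\<lambda>k. ziter (V k) j vol K / fact j)" for j
    have c: "(\<lambda>k. ziter (V k) j vol K / fact j) \<longlonglongrightarrow> c j" if "j \<le> ?n" for j
    proof -
      have "convergent (\<lambda>k. ziter (V k) j vol K / fact j)"
      proof (rule polynomial_coefficients_convergent[OF _ that])
        fix \<rho> :: real assume "0 \<le> \<rho>"
        from lim[OF this] show "convergent (\<lambda>k. \<Sum>j\<le>?n. ziter (V k) j vol K / fact j * \<rho> ^ j)"
          unfolding p_def by (rule convergentI)
      qed
      then show ?thesis by (simp add: c_def convergent_LIMSEQ_iff)
    qed
    have "steiner_coeffs K (\<lambda>j. c j / real (?n choose j))"
      unfolding steiner_coeffs_def
    proof (intro allI impI)
      fix \<rho> :: real assume \<rho>: "0 \<le> \<rho>"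
      have "(\<lambda>k. p k \<rho>) \<longlonglongrightarrow> (\<Sum>j\<le>?n. c j * \<rho> ^ j)"
        unfolding p_def by (intro tendsto_sum tendsto_mult tendsto_const c) auto
      then have "P \<rho> = (\<Sum>j\<le>?n. c j * \<rho> ^ j)" using lim[OF \<rho>] LIMSEQ_unique by blast
      moreover have "{x + \<rho> *\<^sub>R b |x b. x \<in> K \<and> b \<in> cball 0 1} = K + dilate \<rho> (cball 0 1)"
        unfolding set_plus_eq dilate_def by blast
      ultimately show "measure lborel {x + \<rho> *\<^sub>R b |x b. x \<in> K \<and> b \<in> cball 0 1} =
          (\<Sum>j\<le>?n. real (?n choose j) * (c j / real (?n choose j)) * \<rho> ^ j)"
        by (simp add: P_def)
    qed
    then have "quermass_body i K = c i / real (?n choose i)" using i by (rule quermass_body_eq)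
    moreover have "(\<lambda>k. ziter (V k) i vol K / fact i / real (?n choose i)) \<longlonglongrightarrow> c i / real (?n choose i)"
      using i by (intro tendsto_divide tendsto_const c) auto
    ultimately show ?thesis by (simp add: divide_divide_eq_left)
  qed
  with gp show ?thesis using that by blast
qed

context
  fixes i :: nat and TYP :: "'a::euclidean_space itself"
  assumes i: "i < DIM('a)"
begin

lemma
  fixes K L :: "'a set"
  shows quermass_body_nonneg: "cbody K \<Longrightarrow> 0 \<le> quermass_body i K"
    and quermass_body_mono: "cbody K \<Longrightarrow> cbody L \<Longrightarrow> K \<subseteq> L \<Longrightarrow> quermass_body i K \<le> quermass_body i L"
    and quermass_body_dilate: "cbody K \<Longrightarrow> 0 < c \<Longrightarrow> quermass_body i (dilate c K) = c ^ (DIM('a) - i) * quermass_body i K"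
    and quermass_body_superadditive: "root_superadditive (DIM('a) - i) (quermass_body i :: 'a set \<Rightarrow> real)"
proof -
  let ?m = "DIM('a) - i" and ?c = "fact i * real (DIM('a) choose i)"
  obtain V :: "nat \<Rightarrow> 'a set" where gp: "\<And>k. general_position (V k)"
    and lim': "\<And>K i. cbody K \<Longrightarrow> i \<le> DIM('a) \<Longrightarrow>
      (\<lambda>k. ziter (V k) i vol K / (fact i * real (DIM('a) choose i))) \<longlonglongrightarrow> quermass_body i K"
    by (rule steiner_formula_limit[where 'a='a]) (rule that, assumption+)
  have c: "0 < ?c" using i by (simp add: zero_less_binomial)
  have lim: "(\<lambda>k. ziter (V k) i vol K / ?c) \<longlonglongrightarrow> quermass_body i K" if "cbody K" for K
    using lim'[OF that, of i] i by simp
  have bf: "body_functional ?m (ziter (V k) i vol)" for k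
    using body_functional_measure[where 'a='a] i by (intro body_functional_ziter) simp
  show "0 \<le> quermass_body i K" if "cbody K" for K :: "'a set"
    using lim[OF that] by (rule LIMSEQ_le_const) (use c bf_nonneg[OF bf that] in auto)
  show "quermass_body i K \<le> quermass_body i L" if "cbody K" "cbody L" "K \<subseteq> L" for K L :: "'a set"
    using lim[OF that(1)] lim[OF that(2)] by (rule LIMSEQ_le) (use c bf_mono[OF bf that] in \<open>auto simp: divide_right_mono\<close>)
  show "quermass_body i (dilate c K) = c ^ ?m * quermass_body i K" if K: "cbody K" "0 < c" for c and K :: "'a set"
  proof -
    have "(\<lambda>k. c ^ ?m * (ziter (V k) i vol K / ?c)) \<longlonglongrightarrow> c ^ ?m * quermass_body i K"
      by (intro tendsto_mult tendsto_const lim K)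
    moreover have "(\<lambda>k. c ^ ?m * (ziter (V k) i vol K / ?c)) \<longlonglongrightarrow> quermass_body i (dilate c K)"
      using lim[of "dilate c K"] K by (simp add: bf_dilate[OF bf K])
    ultimately show ?thesis using LIMSEQ_unique by blast
  qed
  show "root_superadditive ?m (quermass_body i :: 'a set \<Rightarrow> real)"
    unfolding root_superadditive_def
  proof (intro allI impI)
    fix X Y :: "'a set" assume X: "cbody X" and Y: "cbody Y"
    have "(\<lambda>k. root ?m (ziter (V k) i vol X / ?c) + root ?m (ziter (V k) i vol Y / ?c))
        \<longlonglongrightarrow> root ?m (quermass_body i X) + root ?m (quermass_body i Y)"
      by (intro tendsto_add tendsto_real_root lim X Y)
    moreover have "(\<lambda>k. root ?m (ziter (V k) i vol (X + Y) / ?c)) \<longlonglongrightarrow> root ?m (quermass_body i (X + Y))"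
      by (intro tendsto_real_root lim cbody_plus X Y)
    ultimately show "root ?m (quermass_body i X) + root ?m (quermass_body i Y) \<le> root ?m (quermass_body i (X + Y))"
    proof (rule LIMSEQ_le, intro exI allI impI)
      fix k :: nat
      have "root ?m (ziter (V k) i vol X) + root ?m (ziter (V k) i vol Y) \<le> root ?m (ziter (V k) i vol (X + Y))"
        using ziter_root_superadditive[OF gp i] X Y unfolding root_superadditive_def by blast
      then show "root ?m (ziter (V k) i vol X / ?c) + root ?m (ziter (V k) i vol Y / ?c)
          \<le> root ?m (ziter (V k) i vol (X + Y) / ?c)"
        using i c by (simp only: real_root_divide add_divide_distrib[symmetric]) (auto intro!: divide_right_mono real_root_ge_zero)
    qed
  qed
qed

lemma quermass_body_combination:
  fixes K L :: "'a set"
  assumes K: "cbody K" and L: "cbody L" and st: "0 < s" "0 < t" and xy: "0 \<le> x" "0 \<le> y"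
    and W: "x ^ (DIM('a) - i) \<le> quermass_body i K" "y ^ (DIM('a) - i) \<le> quermass_body i L"
  shows "(s * x + t * y) ^ (DIM('a) - i) \<le> quermass_body i (dilate s K + dilate t L)"
proof -
  let ?m = "DIM('a) - i"
  have m: "0 < ?m" using i by simp
  have r: "c * z \<le> root ?m (quermass_body i (dilate c X))"
    if "cbody X" "0 < c" "0 \<le> z" "z ^ ?m \<le> quermass_body i X" for c z and X :: "'a set"
  proof -
    have "(c * z) ^ ?m \<le> quermass_body i (dilate c X)"
      using that by (simp add: quermass_body_dilate power_mult_distrib)
    then have "root ?m ((c * z) ^ ?m) \<le> root ?m (quermass_body i (dilate c X))"
      using m by (intro real_root_le_mono)
    moreover have "root ?m ((c * z) ^ ?m) = c * z" using that m by (intro real_root_power_cancel) auto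
    ultimately show ?thesis by simp
  qed
  have cb: "cbody (dilate s K)" "cbody (dilate t L)" "cbody (dilate s K + dilate t L)" using K L by simp_all
  have "s * x + t * y \<le> root ?m (quermass_body i (dilate s K)) + root ?m (quermass_body i (dilate t L))"
    using r[OF K st(1) xy(1) W(1)] r[OF L st(2) xy(2) W(2)] by simp
  also have "\<dots> \<le> root ?m (quermass_body i (dilate s K + dilate t L))"
    using quermass_body_superadditive cb unfolding root_superadditive_def by blast
  finally have "(s * x + t * y) ^ ?m \<le> root ?m (quermass_body i (dilate s K + dilate t L)) ^ ?m"
    using st xy by (intro power_mono) auto
  also have "\<dots> = quermass_body i (dilate s K + dilate t L)"
    using m quermass_body_nonneg[OF cb(3)] by (rule real_root_pow_pos2)
  finally show ?thesis .
qed

lemma quermass_cbody: "cbody K \<Longrightarrow> quermass i K = ennreal (quermass_body i K)"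
  by (auto simp: quermass_def cbody_def)

text \<open>For superlevel sets of the combination only convexity is established, so the supremum
  clause of \<open>quermass\<close> for non-compact sets has to be covered.\<close>

lemma quermass_mono:
  fixes C D :: "'a set"
  assumes CD: "convex C" "convex D" "C \<subseteq> D"
  shows "quermass i C \<le> quermass i D"
proof -
  have body: "ennreal (quermass_body i K) \<le> quermass i D" if K: "cbody K" "K \<subseteq> D" for K
  proof (cases "compact D")
    case True
    have "D \<noteq> {}" using K by (auto simp: cbody_def)
    with True CD have D: "cbody D" by (simp add: cbody_def)
    show ?thesis unfolding quermass_cbody[OF D] by (rule ennreal_leI[OF quermass_body_mono[OF K(1) D K(2)]])
  next
    case False
    then have "D \<noteq> {}" by auto
    then show ?thesis using False K by (auto simp: quermass_def cbody_def intro!: SUP_upper)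
  qed
  consider "C = {}" | "cbody C" | "C \<noteq> {}" "\<not> compact C" using CD(1) by (auto simp: cbody_def)
  then show ?thesis
  proof cases
    case 1 then show ?thesis by (simp add: quermass_def)
  next
    case 2 then show ?thesis using body CD(3) by (simp add: quermass_cbody)
  next
    case 3
    then have "quermass i C = (SUP K\<in>{K. compact K \<and> convex K \<and> K \<noteq> {} \<and> K \<subseteq> C}. ennreal (quermass_body i K))"
      by (simp add: quermass_def)
    also have "\<dots> \<le> quermass i D"
      using CD(3) by (intro SUP_least body) (auto simp: cbody_def)
    finally show ?thesis .
  qed
qed

end

section \<open>Power means on the extended half-line\<close>

lemma ennreal_trichotomy:
  obtains "x = (0::ennreal)" | "x = top" | r where "0 < r" "x = ennreal r"
proof (cases x)
  case (real r)
  with that show ?thesis by (cases "r = 0") auto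
qed (use that in auto)

lemma ennreal_powr_ennreal [simp]: "0 < r \<Longrightarrow> ennreal_powr (ennreal r) a = ennreal (r powr a)"
  by (auto simp: ennreal_powr_def)

lemma ennreal_powr_0_right [simp]: "ennreal_powr x 0 = 1"
  by (simp add: ennreal_powr_def)

lemma ennreal_powr_zero_left [simp]: "ennreal_powr 0 a = (if a = 0 then 1 else if 0 < a then 0 else top)"
  by (simp add: ennreal_powr_def)

lemma ennreal_powr_top [simp]: "ennreal_powr top a = (if a = 0 then 1 else if 0 < a then top else 0)"
  by (simp add: ennreal_powr_def)

lemma ennreal_powr_powr:
  assumes "a \<noteq> 0" "b \<noteq> 0"
  shows "ennreal_powr (ennreal_powr x a) b = ennreal_powr x (a * b)"
  by (cases x rule: ennreal_trichotomy) (use assms in \<open>auto simp: powr_powr zero_less_mult_iff\<close>)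

lemma ennreal_powr_one [simp]: "ennreal_powr x 1 = x"
  by (cases x rule: ennreal_trichotomy) auto

lemma ennreal_powr_inverse [simp]: "a \<noteq> 0 \<Longrightarrow> ennreal_powr (ennreal_powr x a) (1 / a) = x"
  by (simp add: ennreal_powr_powr)

lemma ennreal_powr_inverse' [simp]: "a \<noteq> 0 \<Longrightarrow> ennreal_powr (ennreal_powr x (1 / a)) a = x"
  by (simp add: ennreal_powr_powr)

lemma ennreal_powr_mono:
  assumes "0 \<le> a" "x \<le> y"
  shows "ennreal_powr x a \<le> ennreal_powr y a"
proof (cases x rule: ennreal_trichotomy)
  case x: (3 r)
  show ?thesis
    by (cases y rule: ennreal_trichotomy) (use assms x in \<open>auto simp: powr_mono2 ennreal_le_iff\<close>)
qed (use assms in \<open>auto simp: top_unique\<close>)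

lemma ennreal_powr_minus: "ennreal_powr x (- a) = inverse (ennreal_powr x a)"
  by (cases x rule: ennreal_trichotomy) (auto simp: powr_minus inverse_ennreal)

lemma ennreal_powr_antimono:
  assumes "a \<le> 0" "x \<le> y"
  shows "ennreal_powr y a \<le> ennreal_powr x a"
proof (cases "a = 0")
  case a: False
  show ?thesis
  proof (cases x rule: ennreal_trichotomy)
    case x: (3 r)
    show ?thesis
      by (cases y rule: ennreal_trichotomy) (use assms x a in \<open>auto simp: powr_mono2' ennreal_le_iff\<close>)
  qed (use assms a in \<open>auto simp: top_unique\<close>)
qed simp

lemma ennreal_powr_mult:
  assumes "0 < a"
  shows "ennreal_powr (x * y) a = ennreal_powr x a * ennreal_powr y a"
proof (cases x rule: ennreal_trichotomy)
  case 1
  then show ?thesis using assms by simp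
next
  case 2
  then show ?thesis using assms
    by (cases y rule: ennreal_trichotomy) (auto simp: ennreal_top_mult ennreal_mult_top)
next
  case x: (3 r)
  then show ?thesis using assms
    by (cases y rule: ennreal_trichotomy)
      (auto simp: ennreal_top_mult ennreal_mult_top powr_mult simp flip: ennreal_mult)
qed

lemma ennreal_powr_pos: "0 \<le> a \<Longrightarrow> 0 < x \<Longrightarrow> 0 < ennreal_powr x a"
  by (cases x rule: ennreal_trichotomy) auto

text \<open>For a positive exponent the function is monotone and onto, hence continuous; negative
  exponents follow by inversion.\<close>

lemma continuous_on_ennreal_powr:
  assumes "a \<noteq> 0"
  shows "continuous_on UNIV (\<lambda>x. ennreal_powr x a)"
proof -
  have pos: "continuous_on UNIV (\<lambda>x. ennreal_powr x b)" if b: "0 < b" for b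
  proof (rule continuous_onI_mono)
    have "range (\<lambda>x. ennreal_powr x b) = UNIV"
    proof (rule surjI)
      show "ennreal_powr (ennreal_powr x (1 / b)) b = x" for x using b by simp
    qed
    then show "open (range (\<lambda>x. ennreal_powr x b))" by simp
  qed (use b in \<open>auto intro: ennreal_powr_mono\<close>)
  show ?thesis
  proof (cases "0 < a")
    case False
    then have "0 < - a" using assms by simp
    then have "continuous_on UNIV (\<lambda>x. inverse (ennreal_powr x (- a)))"
      by (intro continuous_on_inverse_ennreal pos)
    then show ?thesis using ennreal_powr_minus[of _ "- a"] by simp
  qed (rule pos)
qed

lemma tendsto_ennreal_powr:
  assumes "a \<noteq> 0" "(f \<longlongrightarrow> x) G"
  shows "((\<lambda>k. ennreal_powr (f k) a) \<longlongrightarrow> ennreal_powr x a) G"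
proof -
  have "isCont (\<lambda>x. ennreal_powr x a) x"
    using continuous_on_ennreal_powr[OF assms(1)] by (simp add: continuous_on_eq_continuous_at)
  then show ?thesis using assms(2) by (rule isCont_tendsto_compose)
qed

section \<open>Monotonicity, positivity and interchange of means\<close>

lemma power_mean_real:
  "a \<noteq> 0 \<Longrightarrow> 0 < a \<or> 0 < u \<and> 0 < v \<Longrightarrow>
    power_mean (ereal a) s t u v = ennreal_powr (ennreal s * ennreal_powr u a + ennreal t * ennreal_powr v a) (1 / a)"
  by (auto simp: power_mean_def Let_def zero_ereal_def)

lemma power_mean_geometric:
  "0 < u \<Longrightarrow> 0 < v \<Longrightarrow> power_mean 0 s t u v = ennreal_powr u s * ennreal_powr v t"
  by (auto simp: power_mean_def)

lemma power_mean_infty [simp]: "power_mean \<infinity> s t u v = max u v"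
  and power_mean_minus_infty [simp]: "power_mean (-\<infinity>) s t u v = min u v"
  by (auto simp: power_mean_def)

lemma power_mean_mono:
  assumes st: "0 < s" "0 < t" and le: "u \<le> u'" "v \<le> v'"
  shows "power_mean \<alpha> s t u v \<le> power_mean \<alpha> s t u' v'"
proof (cases "\<alpha> \<le> 0 \<and> (u = 0 \<or> v = 0)")
  case True
  then show ?thesis by (auto simp: power_mean_def)
next
  case False
  then have pos: "0 < \<alpha> \<or> (0 < u \<and> 0 < v)" by (auto simp: zero_less_iff_neq_zero)
  then have pos': "0 < \<alpha> \<or> (0 < u' \<and> 0 < v')" using le by auto
  show ?thesis
  proof (cases \<alpha>)
    case (real a)
    show ?thesis
    proof (cases "a = 0")
      case True
      then show ?thesis using pos pos' real st le
        by (auto simp: power_mean_geometric zero_ereal_def[symmetric] intro!: mult_mono ennreal_powr_mono)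
    next
      case a: False
      have "ennreal_powr (ennreal s * ennreal_powr u a + ennreal t * ennreal_powr v a) (1 / a)
          \<le> ennreal_powr (ennreal s * ennreal_powr u' a + ennreal t * ennreal_powr v' a) (1 / a)"
      proof (cases "0 < a")
        case True
        then show ?thesis using le by (intro ennreal_powr_mono add_mono mult_left_mono) auto
      next
        case False
        then show ?thesis using le by (intro ennreal_powr_antimono add_mono mult_left_mono) auto
      qed
      moreover have "0 < a \<or> 0 < u \<and> 0 < v" "0 < a \<or> 0 < u' \<and> 0 < v'"
        using pos pos' real by (auto simp: zero_ereal_def)
      ultimately show ?thesis using a by (simp add: real power_mean_real)
    qed
  qed (use le in \<open>auto simp: max.coboundedI1 max.coboundedI2 min.coboundedI1 min.coboundedI2 intro!: max.mono min.mono\<close>)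
qed

lemma power_mean_diag:
  assumes st: "0 < s" "0 < t" "s + t = 1" and r: "0 < r"
  shows "power_mean \<alpha> s t (ennreal r) (ennreal r) = ennreal r"
proof (cases \<alpha>)
  case (real a)
  show ?thesis
  proof (cases "a = 0")
    case True
    then show ?thesis using real r st
      by (simp add: zero_ereal_def[symmetric] power_mean_geometric ennreal_mult[symmetric] powr_add[symmetric])
  next
    case False
    have "ennreal s * ennreal (r powr a) + ennreal t * ennreal (r powr a) = ennreal (r powr a)"
      using st by (simp add: ennreal_mult[symmetric] ennreal_plus[symmetric] distrib_right[symmetric] del: ennreal_plus)
    then show ?thesis using False real r by (simp add: power_mean_real powr_powr)
  qed
qed (use r in auto)

lemma power_mean_pos:
  assumes st: "0 < s" "0 < t" "s + t = 1" and uv: "0 < u" "0 < v"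
  shows "0 < power_mean \<alpha> s t u v"
proof -
  have "0 < min u v" using uv by simp
  then obtain w where w: "0 < w" "w < min u v" using dense by blast
  then obtain r where r': "0 < r" "w = ennreal r" by (cases w rule: ennreal_trichotomy) auto
  then have r: "0 < ennreal r" "ennreal r < min u v" using w by auto
  have "ennreal r = power_mean \<alpha> s t (ennreal r) (ennreal r)"
    using power_mean_diag[OF st r'(1)] by simp
  also have "\<dots> \<le> power_mean \<alpha> s t u v" using r by (intro power_mean_mono st) auto
  finally show ?thesis using r by order
qed

lemma ennreal_convex_comb: "0 < l \<Longrightarrow> l < 1 \<Longrightarrow> ennreal (1 - l) * x + ennreal l * x = x"
  by (simp add: distrib_right[symmetric] ennreal_plus[symmetric] del: ennreal_plus)

text \<open>Two means of the same order can be taken in either order, because for finite nonzero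
  orders both are linear after passing to powers; for negative orders every inequality is reversed
  on the way there and on the way back. The superlevel sets of the combination are convex for this
  reason.\<close>

lemma power_mean_exchange:
  assumes \<alpha>: "\<alpha> \<noteq> -\<infinity>" and l: "0 < l" "l < 1" and st: "0 < s" "0 < t"
    and pos: "0 < u1" "0 < u2" "0 < v1" "0 < v2"
    and c: "c \<le> power_mean \<alpha> s t u1 v1" "c \<le> power_mean \<alpha> s t u2 v2"
    and u: "power_mean \<alpha> (1 - l) l u1 u2 \<le> u" and v: "power_mean \<alpha> (1 - l) l v1 v2 \<le> v"
  shows "c \<le> power_mean \<alpha> s t u v"
proof -
  have upos: "0 < u" "0 < v"
    using power_mean_pos[of "1 - l" l u1 u2 \<alpha>] power_mean_pos[of "1 - l" l v1 v2 \<alpha>] u v l pos by auto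
  show ?thesis
  proof (cases \<alpha>)
    case (real a)
    show ?thesis
    proof (cases "a = 0")
      case True
      then have [simp]: "\<alpha> = 0" using real by (simp add: zero_ereal_def)
      have eq: "ennreal_powr (ennreal_powr x b * ennreal_powr y d) e = ennreal_powr (ennreal_powr x e) b * ennreal_powr (ennreal_powr y e) d"
        if "0 < b" "0 < d" "0 < e" for x y b d e
        using that by (simp add: ennreal_powr_mult ennreal_powr_powr mult.commute)
      let ?A = "ennreal_powr u1 s * ennreal_powr v1 t" and ?B = "ennreal_powr u2 s * ennreal_powr v2 t"
      have "c = ennreal_powr c (1 - l) * ennreal_powr c l"
        using l by (cases c rule: ennreal_trichotomy) (auto simp: ennreal_mult[symmetric] powr_add[symmetric])
      also have "\<dots> \<le> ennreal_powr ?A (1 - l) * ennreal_powr ?B l"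
        using c l pos by (intro mult_mono ennreal_powr_mono) (auto simp: power_mean_geometric)
      also have "\<dots> = ennreal_powr (ennreal_powr u1 (1 - l) * ennreal_powr u2 l) s * ennreal_powr (ennreal_powr v1 (1 - l) * ennreal_powr v2 l) t"
        using l st by (simp add: ennreal_powr_mult ennreal_powr_powr mult_ac)
      also have "\<dots> \<le> ennreal_powr u s * ennreal_powr v t"
        using u v pos st by (intro mult_mono ennreal_powr_mono) (auto simp: power_mean_geometric)
      finally show ?thesis using upos by (simp add: power_mean_geometric)
    next
      case a: False
      let ?p = "\<lambda>x. ennreal_powr x a"
      define s' t' l' k where "s' = ennreal s" and "t' = ennreal t" and "l' = ennreal l" and "k = ennreal (1 - l)"
      have pm: "power_mean \<alpha> s t x y = ennreal_powr (s' * ?p x + t' * ?p y) (1 / a)"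
        "power_mean \<alpha> (1 - l) l x y = ennreal_powr (k * ?p x + l' * ?p y) (1 / a)" if "0 < x" "0 < y" for x y
        using that a by (simp_all add: real power_mean_real s'_def t'_def l'_def k_def)
      have cc: "k * x + l' * x = x" for x using ennreal_convex_comb[OF l] by (simp add: k_def l'_def)
      have re: "s' * (k * x + l' * y) + t' * (k * z + l' * w) = k * (s' * x + t' * z) + l' * (s' * y + t' * w)" for x y z w
        by (simp add: distrib_left mult_ac add_ac)
      show ?thesis
      proof (cases "0 < a")
        case True
        have i: "?p x \<le> X" if "x \<le> ennreal_powr X (1 / a)" for x X
          using ennreal_powr_mono[of a x "ennreal_powr X (1 / a)"] that True by simp
        have j: "X \<le> ?p x" if "ennreal_powr X (1 / a) \<le> x" for x X
          using ennreal_powr_mono[of a "ennreal_powr X (1 / a)" x] that True by simp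
        have "?p c = k * ?p c + l' * ?p c" by (simp add: cc)
        also have "\<dots> \<le> k * (s' * ?p u1 + t' * ?p v1) + l' * (s' * ?p u2 + t' * ?p v2)"
          using c pos by (intro add_mono mult_left_mono i) (auto simp: pm)
        also have "\<dots> \<le> s' * ?p u + t' * ?p v"
          unfolding re[symmetric] using u v pos by (intro add_mono mult_left_mono j) (auto simp: pm)
        finally have "ennreal_powr (?p c) (1 / a) \<le> ennreal_powr (s' * ?p u + t' * ?p v) (1 / a)"
          using True by (intro ennreal_powr_mono) auto
        then show ?thesis using a upos by (simp add: pm)
      next
        case False
        have i: "X \<le> ?p x" if "x \<le> ennreal_powr X (1 / a)" for x X
          using ennreal_powr_antimono[of a x "ennreal_powr X (1 / a)"] that False a by simp
        have j: "?p x \<le> X" if "ennreal_powr X (1 / a) \<le> x" for x X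
          using ennreal_powr_antimono[of a "ennreal_powr X (1 / a)" x] that False a by simp
        have "s' * ?p u + t' * ?p v \<le> k * (s' * ?p u1 + t' * ?p v1) + l' * (s' * ?p u2 + t' * ?p v2)"
          unfolding re[symmetric] using u v pos by (intro add_mono mult_left_mono j) (auto simp: pm)
        also have "\<dots> \<le> k * ?p c + l' * ?p c"
          using c pos by (intro add_mono mult_left_mono i) (auto simp: pm)
        also have "\<dots> = ?p c" by (simp add: cc)
        finally have "ennreal_powr (?p c) (1 / a) \<le> ennreal_powr (s' * ?p u + t' * ?p v) (1 / a)"
          using False by (intro ennreal_powr_antimono) auto
        then show ?thesis using a upos by (simp add: pm)
      qed
    qed
  qed (use assms in \<open>auto simp: le_max_iff_disj max_def split: if_splits\<close>)
qed

text \<open>A mean of total weight 1 fixes constants, so the concavity of \<open>f\<close> includes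
  quasi-concavity. Closedness is upper semicontinuity, and boundedness is decay at infinity.\<close>

lemma Q_class_superlevel:
  fixes f :: "'a::euclidean_space \<Rightarrow> ennreal"
  assumes f: "f \<in> Q_class \<alpha>" and r: "0 < r"
  shows "compact {x. ennreal r \<le> f x}" "convex {x. ennreal r \<le> f x}"
proof -
  have usc: "upper_semicontinuous f" and lim: "(f \<longlongrightarrow> 0) at_infinity" and conc: "alpha_concave \<alpha> f"
    using f by (auto simp: Q_class_def)
  have "open {x. f x < ennreal r}"
  proof (subst open_subopen, safe)
    fix x assume "f x < ennreal r"
    then have "\<forall>\<^sub>F y in nhds x. f y < ennreal r" using usc by (simp add: upper_semicontinuous_def)
    then show "\<exists>T. open T \<and> x \<in> T \<and> T \<subseteq> {x. f x < ennreal r}" by (auto simp: eventually_nhds)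
  qed
  moreover have "{x. ennreal r \<le> f x} = - {x. f x < ennreal r}" by auto
  ultimately have "closed {x. ennreal r \<le> f x}" by (simp add: closed_def)
  moreover have "bounded {x. ennreal r \<le> f x}"
  proof -
    have "\<forall>\<^sub>F x in at_infinity. f x < ennreal r" using lim r by (intro order_tendstoD) auto
    then obtain b where b: "\<And>x. b \<le> norm x \<Longrightarrow> f x < ennreal r" by (auto simp: eventually_at_infinity)
    show ?thesis by (rule boundedI[of _ b]) (use b in \<open>auto simp: not_le[symmetric] intro: ccontr\<close>)
  qed
  ultimately show "compact {x. ennreal r \<le> f x}" by (simp add: compact_eq_bounded_closed)
  show "convex {x. ennreal r \<le> f x}"
    unfolding convex_alt
  proof safe
    fix x y and l :: real assume xy: "ennreal r \<le> f x" "ennreal r \<le> f y" and l: "0 \<le> l" "l \<le> 1"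
    show "ennreal r \<le> f ((1 - l) *\<^sub>R x + l *\<^sub>R y)"
    proof (cases "l = 0 \<or> l = 1")
      case False
      then have l': "0 < l" "l < 1" using l by auto
      have pos: "0 < f x" "0 < f y" using xy r by (auto intro: less_le_trans[of 0 "ennreal r"])
      have "ennreal r = power_mean \<alpha> (1 - l) l (ennreal r) (ennreal r)" using power_mean_diag[of "1 - l" l r \<alpha>] l' r by simp
      also have "\<dots> \<le> power_mean \<alpha> (1 - l) l (f x) (f y)" using xy l' by (intro power_mean_mono) auto
      also have "\<dots> \<le> f ((1 - l) *\<^sub>R x + l *\<^sub>R y)" using conc pos l' by (auto simp: alpha_concave_def)
      finally show ?thesis .
    qed (use xy in auto)
  qed
qed

section \<open>Superlevel sets of the combination\<close>

lemma sup_combination_ge: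
  assumes "0 < f x" "0 < g y"
  shows "power_mean \<alpha> s t (f x) (g y) \<le> sup_combination \<alpha> s t f g (s *\<^sub>R x + t *\<^sub>R y)"
proof -
  have "s *\<^sub>R x + t *\<^sub>R y \<in> {s *\<^sub>R x + t *\<^sub>R y |x y. 0 < f x \<and> 0 < g y}" using assms by blast
  then show ?thesis unfolding sup_combination_def using assms by (simp only: if_True) (intro Sup_upper, blast)
qed

lemma sup_combination_greaterE:
  assumes "c < sup_combination \<alpha> s t f g z"
  obtains x y where "z = s *\<^sub>R x + t *\<^sub>R y" "0 < f x" "0 < g y" "c < power_mean \<alpha> s t (f x) (g y)"
  using assms that by (auto simp: sup_combination_def less_Sup_iff split: if_splits)

text \<open>The supremum in the combination is not known to be attained, so the level
  \<open>c\<close> is approached by smaller levels, for which actual decompositions of both points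
  exist.\<close>

lemma convex_sup_combination_superlevel:
  assumes f: "alpha_concave \<alpha> f" and g: "alpha_concave \<alpha> g" and \<alpha>: "\<alpha> \<noteq> -\<infinity>" and st: "0 < s" "0 < t"
  shows "convex {z. c \<le> sup_combination \<alpha> s t f g z}"
  unfolding convex_alt
proof safe
  fix z1 z2 and l :: real
  let ?h = "sup_combination \<alpha> s t f g"
  assume z: "c \<le> ?h z1" "c \<le> ?h z2" and l: "0 \<le> l" "l \<le> 1"
  show "c \<le> ?h ((1 - l) *\<^sub>R z1 + l *\<^sub>R z2)"
  proof (cases "l = 0 \<or> l = 1")
    case False
    then have l': "0 < l" "l < 1" using l by auto
    show ?thesis
    proof (rule dense_le)
      fix c' assume c': "c' < c"
      obtain x1 y1 where 1: "z1 = s *\<^sub>R x1 + t *\<^sub>R y1" "0 < f x1" "0 < g y1" "c' < power_mean \<alpha> s t (f x1) (g y1)"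
        using sup_combination_greaterE[OF less_le_trans[OF c' z(1)]] .
      obtain x2 y2 where 2: "z2 = s *\<^sub>R x2 + t *\<^sub>R y2" "0 < f x2" "0 < g y2" "c' < power_mean \<alpha> s t (f x2) (g y2)"
        using sup_combination_greaterE[OF less_le_trans[OF c' z(2)]] .
      let ?x = "(1 - l) *\<^sub>R x1 + l *\<^sub>R x2" and ?y = "(1 - l) *\<^sub>R y1 + l *\<^sub>R y2"
      have fx: "power_mean \<alpha> (1 - l) l (f x1) (f x2) \<le> f ?x" and gy: "power_mean \<alpha> (1 - l) l (g y1) (g y2) \<le> g ?y"
        using f g 1 2 l' by (auto simp: alpha_concave_def)
      have pos: "0 < f ?x" "0 < g ?y"
        using power_mean_pos[of "1 - l" l "f x1" "f x2" \<alpha>] power_mean_pos[of "1 - l" l "g y1" "g y2" \<alpha>] fx gy l' 1 2 by auto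
      have "c' \<le> power_mean \<alpha> s t (f ?x) (g ?y)"
        by (rule power_mean_exchange[OF \<alpha> l' st 1(2) 2(2) 1(3) 2(3) _ _ fx gy]) (use 1 2 in auto)
      also have "\<dots> \<le> ?h (s *\<^sub>R ?x + t *\<^sub>R ?y)" using pos by (rule sup_combination_ge)
      also have "s *\<^sub>R ?x + t *\<^sub>R ?y = (1 - l) *\<^sub>R z1 + l *\<^sub>R z2"
        by (simp add: 1(1) 2(1) scaleR_add_right mult.commute)
      finally show "c' \<le> ?h ((1 - l) *\<^sub>R z1 + l *\<^sub>R z2)" .
    qed
  qed (use z in auto)
qed

section \<open>A layer inequality for the mean of negative order\<close>

lemma borel_measurable_antimono_ennreal:
  fixes F :: "real \<Rightarrow> ennreal"
  assumes "antimono_on {0<..} F"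
  shows "(\<lambda>x. F x * indicator {0<..} x) \<in> borel_measurable borel"
proof (rule borel_measurableI_greater)
  have F: "F y \<le> F x" if "0 < x" "x \<le> y" for x y using assms that by (auto simp: monotone_on_def)
  fix y
  let ?S = "{x \<in> space borel. y < F x * indicator {0<..} x}"
  have S: "x \<in> ?S \<longleftrightarrow> 0 < x \<and> y < F x" for x by (auto simp: indicator_def)
  have "is_interval ?S"
    unfolding is_interval_1
  proof (intro ballI allI impI)
    fix a b x assume "a \<in> ?S" "b \<in> ?S" "a \<le> x \<and> x \<le> b"
    then have "0 < x" "y < F b" "F b \<le> F x" unfolding S using F[of x b] by auto
    then show "x \<in> ?S" unfolding S by auto
  qed
  then show "?S \<in> sets borel" by (rule real_interval_borel_measurable)
qed

text \<open>The change of variables \<open>c = x ^ m\<close> is made on compact intervals, followed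
  by monotone convergence.\<close>

lemma nn_integral_power_substitution:
  fixes \<phi> :: "real \<Rightarrow> ennreal"
  assumes [measurable]: "\<phi> \<in> borel_measurable borel" and \<phi>: "\<And>c. c \<le> 0 \<Longrightarrow> \<phi> c = 0" and m: "0 < m"
  shows "(\<integral>\<^sup>+c. \<phi> c \<partial>lborel) = (\<integral>\<^sup>+x. ennreal (real m * x ^ (m - 1)) * \<phi> (x ^ m) * indicator {0<..} x \<partial>lborel)"
proof -
  let ?I = "\<lambda>k x. indicator {0..real k} x :: ennreal"
  let ?J = "\<lambda>k c. indicator {0..real k ^ m} c :: ennreal"
  have sub: "(\<integral>\<^sup>+c. \<phi> c * ?J (Suc k) c \<partial>lborel)
      = (\<integral>\<^sup>+x. \<phi> (x ^ m) * ennreal (real m * x ^ (m - 1)) * ?I (Suc k) x \<partial>lborel)" for k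
  proof -
    have "continuous_on {0..real (Suc k)} (\<lambda>x. real m * x ^ (m - 1))" by (intro continuous_intros)
    then have "(\<integral>\<^sup>+c. \<phi> c * indicator {0 ^ m..real (Suc k) ^ m} c \<partial>lborel)
        = (\<integral>\<^sup>+x. \<phi> (x ^ m) * ennreal (real m * x ^ (m - 1)) * ?I (Suc k) x \<partial>lborel)"
      by (intro nn_integral_substitution_aux[where g = "\<lambda>x. x ^ m"])
        (auto intro!: derivative_eq_intros simp: mult_ac)
    then show ?thesis using m by (simp add: zero_power)
  qed
  have SUP: "(\<integral>\<^sup>+x. f x \<partial>lborel) = (SUP k. \<integral>\<^sup>+x. f x * indicator {0..b k} x \<partial>lborel)"
    if [measurable]: "f \<in> borel_measurable borel" and f: "\<And>x. x < 0 \<Longrightarrow> f x = 0"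
      and b: "incseq b" "filterlim b at_top sequentially" for f :: "real \<Rightarrow> ennreal" and b :: "nat \<Rightarrow> real"
  proof -
    have "f x = (SUP k. f x * indicator {0..b k} x)" for x
    proof (rule antisym)
      obtain k where k: "x \<le> b k" using b(2) unfolding filterlim_at_top eventually_sequentially by (meson order_refl)
      have "f x = f x * indicator {0..b k} x" using k f[of x] by (auto simp: indicator_def not_le)
      also have "\<dots> \<le> (SUP k. f x * indicator {0..b k} x)" by (rule SUP_upper) simp
      finally show "f x \<le> (SUP k. f x * indicator {0..b k} x)" .
      show "(SUP k. f x * indicator {0..b k} x) \<le> f x" by (rule SUP_least) (auto simp: indicator_def)
    qed
    then have "(\<integral>\<^sup>+x. f x \<partial>lborel) = (\<integral>\<^sup>+x. (SUP k. f x * indicator {0..b k} x) \<partial>lborel)" by simp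
    also have "\<dots> = (SUP k. \<integral>\<^sup>+x. f x * indicator {0..b k} x \<partial>lborel)"
    proof (rule nn_integral_monotone_convergence_SUP)
      show "incseq (\<lambda>k x. f x * indicator {0..b k} x)"
      proof (rule incseq_SucI, rule le_funI)
        fix k x
        have "b k \<le> b (Suc k)" using b(1) by (rule incseq_SucD)
        then show "f x * indicator {0..b k} x \<le> f x * indicator {0..b (Suc k)} x"
          by (auto simp: indicator_def)
      qed
    qed measurable
    finally show ?thesis .
  qed
  have lin: "incseq (\<lambda>k. real (Suc k))" "filterlim (\<lambda>k. real (Suc k)) at_top sequentially"
    using filterlim_compose[OF filterlim_real_sequentially filterlim_Suc] by (auto simp: incseq_def)
  have pw: "incseq (\<lambda>k. real (Suc k) ^ m)" "filterlim (\<lambda>k. real (Suc k) ^ m) at_top sequentially"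
    using m filterlim_pow_at_top[OF m lin(2)] by (auto simp: incseq_def intro!: power_mono)
  have "(\<integral>\<^sup>+c. \<phi> c \<partial>lborel) = (SUP k. \<integral>\<^sup>+c. \<phi> c * ?J (Suc k) c \<partial>lborel)"
    by (rule SUP[OF _ _ pw]) (auto simp: \<phi>)
  also have "\<dots> = (SUP k. \<integral>\<^sup>+x. (ennreal (real m * x ^ (m - 1)) * \<phi> (x ^ m) * indicator {0<..} x) * ?I (Suc k) x \<partial>lborel)"
    unfolding sub
  proof (intro SUP_cong refl nn_integral_cong)
    fix k :: nat and x :: real
    show "\<phi> (x ^ m) * ennreal (real m * x ^ (m - 1)) * ?I (Suc k) x
        = ennreal (real m * x ^ (m - 1)) * \<phi> (x ^ m) * indicator {0<..} x * ?I (Suc k) x"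
      using \<phi>[of "x ^ m"] m by (cases "x = 0") (auto simp: indicator_def mult_ac zero_power)
  qed
  also have "\<dots> = (\<integral>\<^sup>+x. ennreal (real m * x ^ (m - 1)) * \<phi> (x ^ m) * indicator {0<..} x \<partial>lborel)"
    by (rule SUP[OF _ _ lin, symmetric]) (auto simp: indicator_def)
  finally show ?thesis .
qed

text \<open>The layer-cake density of \<open>F\<close> in the level variable \<open>x\<close>, where the level is \<open>x\<^sup>m\<close>.\<close>

definition power_layer :: "nat \<Rightarrow> (real \<Rightarrow> ennreal) \<Rightarrow> real \<Rightarrow> ennreal" where
  "power_layer m F x =
    ennreal (real m * x ^ (m - 1)) * emeasure lborel {r. 0 < r \<and> ennreal (x ^ m) < F r} * indicator {0<..} x"

context
  fixes F :: "real \<Rightarrow> ennreal" and m :: nat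
  assumes antimono: "antimono_on {0<..} F" and m: "0 < m"
begin

lemma antimono_Ioi: "0 < x \<Longrightarrow> x \<le> y \<Longrightarrow> F y \<le> F x"
  using antimono by (auto simp: monotone_on_def)

lemma antimono_level_measurable: "{r. 0 < r \<and> c < F r} \<in> sets borel"
proof (rule real_interval_borel_measurable)
  show "is_interval {r. 0 < r \<and> c < F r}"
    unfolding is_interval_1 using antimono_Ioi by (auto intro: less_le_trans)
qed

lemma power_layer_measurable: "power_layer m F \<in> borel_measurable borel" (is ?m)
  and power_layer_integral: "(\<integral>\<^sup>+r\<in>{0<..}. F r \<partial>lborel) = (\<integral>\<^sup>+x. power_layer m F x \<partial>lborel)" (is ?i)
proof -
  define \<phi> where "\<phi> c = emeasure lborel {r. 0 < r \<and> ennreal c < F r} * indicator {0<..} c" for c :: real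
  have \<phi>: "\<phi> \<in> borel_measurable borel"
    unfolding \<phi>_def
  proof (rule borel_measurable_antimono_ennreal, rule monotone_onI)
    fix x y :: real assume "x \<le> y"
    then have "ennreal x \<le> ennreal y" by (simp add: ennreal_leI)
    then show "emeasure lborel {r. 0 < r \<and> ennreal y < F r} \<le> emeasure lborel {r. 0 < r \<and> ennreal x < F r}"
      using antimono_level_measurable by (intro emeasure_mono) auto
  qed
  have eq: "power_layer m F x = ennreal (real m * x ^ (m - 1)) * \<phi> (x ^ m) * indicator {0<..} x" for x
    by (simp add: power_layer_def \<phi>_def indicator_def)
  show ?m using \<phi> unfolding eq[abs_def] by measurable
  let ?G = "\<lambda>r. F r * indicator {0<..} r"
  have "(\<integral>\<^sup>+r. ?G r \<partial>lborel) = (\<integral>\<^sup>+c\<in>{0<..}. emeasure lborel {r \<in> space lborel. ennreal c < ?G r} \<partial>lborel)"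
    using borel_measurable_antimono_ennreal[OF antimono]
    by (intro nn_integral_layer_cake) (auto intro: lborel.sigma_finite_measure_axioms)
  also have "\<dots> = (\<integral>\<^sup>+c. \<phi> c \<partial>lborel)"
  proof (rule nn_integral_cong)
    fix c :: real
    have "{r \<in> space lborel. ennreal c < ?G r} = {r. 0 < r \<and> ennreal c < F r}"
      by (auto simp: indicator_def)
    then show "emeasure lborel {r \<in> space lborel. ennreal c < ?G r} * indicator {0<..} c = \<phi> c"
      by (simp add: \<phi>_def)
  qed
  also have "\<dots> = (\<integral>\<^sup>+x. power_layer m F x \<partial>lborel)"
    unfolding eq by (rule nn_integral_power_substitution[OF \<phi> _ m]) (simp add: \<phi>_def)
  finally show ?i .
qed

text \<open>The set of \<open>r\<close> with \<open>F r\<close> above the level is an interval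
  starting at 0, so a length above \<open>c / d\<close> forces it to contain a point
  \<open>R\<close> beyond \<open>c / d\<close>.\<close>

lemma power_layer_greaterE:
  assumes c: "0 \<le> c" "ennreal c < power_layer m F x"
  obtains R where "0 < R" "0 < x" "c < real m * x ^ (m - 1) * R" "ennreal (x ^ m) < F R"
proof -
  have x: "0 < x"
  proof (rule ccontr)
    assume "\<not> 0 < x"
    then have "power_layer m F x = 0" by (simp add: power_layer_def)
    with c show False by simp
  qed
  define d where "d = real m * x ^ (m - 1)"
  have d: "0 < d" using x m by (simp add: d_def)
  have "\<exists>R. 0 < R \<and> ennreal (x ^ m) < F R \<and> c / d < R"
  proof (rule ccontr)
    assume "\<not> ?thesis"
    then have "{r. 0 < r \<and> ennreal (x ^ m) < F r} \<subseteq> {0<..c / d}" by auto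
    then have "emeasure lborel {r. 0 < r \<and> ennreal (x ^ m) < F r} \<le> emeasure lborel {0<..c / d}"
      by (intro emeasure_mono) auto
    also have "\<dots> = ennreal (c / d)" using c d by simp
    finally have "power_layer m F x \<le> ennreal d * ennreal (c / d)"
      using x by (simp add: power_layer_def d_def mult_left_mono)
    also have "\<dots> = ennreal c" using c d by (simp add: ennreal_mult[symmetric])
    finally show False using c by simp
  qed
  then obtain R where "0 < R" "ennreal (x ^ m) < F R" "c / d < R" by blast
  moreover have "c < d * R" using \<open>c / d < R\<close> d by (simp add: pos_divide_less_eq mult.commute)
  ultimately show ?thesis using that x by (simp add: d_def)
qed

lemma power_layer_ge:
  assumes R: "0 < R" "ennreal (x ^ m) < F R" and x: "0 < x"
  shows "ennreal (real m * x ^ (m - 1) * R) \<le> power_layer m F x"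
proof -
  have "{0<..R} \<subseteq> {r. 0 < r \<and> ennreal (x ^ m) < F r}" using antimono_Ioi R by (auto intro: less_le_trans)
  then have "emeasure lborel {0<..R} \<le> emeasure lborel {r. 0 < r \<and> ennreal (x ^ m) < F r}"
    using antimono_level_measurable by (intro emeasure_mono) auto
  then have "ennreal R \<le> emeasure lborel {r. 0 < r \<and> ennreal (x ^ m) < F r}" using R by simp
  then have "ennreal (real m * x ^ (m - 1)) * ennreal R \<le> power_layer m F x"
    using x by (simp add: power_layer_def mult_left_mono)
  then show ?thesis using x R by (simp add: ennreal_mult)
qed

end

text \<open>Jensen's inequality for powers with weights of arbitrary total, written without
  division. The induction step is Chebyshev's inequality, since \<open>P\<close>, \<open>Q\<close>
  and their powers are ordered alike.\<close>

lemma weighted_power_convexity: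
  fixes a b P Q :: real
  assumes "0 \<le> a" "0 \<le> b" "0 \<le> P" "0 \<le> Q"
  shows "(a * P + b * Q) ^ Suc k \<le> (a + b) ^ k * (a * P ^ Suc k + b * Q ^ Suc k)"
proof (induction k)
  case (Suc k)
  have "0 \<le> (P - Q) * (P ^ Suc k - Q ^ Suc k)"
  proof (cases "P \<le> Q")
    case True
    then have "P ^ Suc k \<le> Q ^ Suc k" using assms by (intro power_mono) auto
    with True show ?thesis by (intro mult_nonpos_nonpos) auto
  next
    case False
    then have "Q ^ Suc k \<le> P ^ Suc k" using assms by (intro power_mono) auto
    with False show ?thesis by (intro mult_nonneg_nonneg) auto
  qed
  then have "0 \<le> (a * b) * ((P - Q) * (P ^ Suc k - Q ^ Suc k))" by (rule mult_nonneg_nonneg[rotated]) (use assms in simp)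
  also have "\<dots> = (a + b) * (a * P ^ Suc (Suc k) + b * Q ^ Suc (Suc k)) - (a * P + b * Q) * (a * P ^ Suc k + b * Q ^ Suc k)"
    by (simp add: algebra_simps)
  finally have 1: "(a * P + b * Q) * (a * P ^ Suc k + b * Q ^ Suc k) \<le> (a + b) * (a * P ^ Suc (Suc k) + b * Q ^ Suc (Suc k))"
    by simp
  have "(a * P + b * Q) ^ Suc (Suc k) \<le> (a * P + b * Q) * ((a + b) ^ k * (a * P ^ Suc k + b * Q ^ Suc k))"
    unfolding power_Suc[of _ "Suc k"] using assms Suc.IH by (intro mult_left_mono) auto
  also have "\<dots> = (a + b) ^ k * ((a * P + b * Q) * (a * P ^ Suc k + b * Q ^ Suc k))" by (simp add: mult_ac)
  also have "\<dots> \<le> (a + b) ^ k * ((a + b) * (a * P ^ Suc (Suc k) + b * Q ^ Suc (Suc k)))"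
    using assms 1 by (intro mult_left_mono) auto
  finally show ?case by (simp add: mult_ac)
qed simp

text \<open>This is \<open>M\<^sub>\<alpha>\<^sup>(\<^sup>l\<^sup>)\<close> for the extremal exponent \<open>\<alpha> = -1/m\<close>.\<close>

definition neg_mean :: "nat \<Rightarrow> real \<Rightarrow> real \<Rightarrow> real \<Rightarrow> real" where
  "neg_mean m l r \<rho> = ((1 - l) * r powr (- 1 / real m) + l * \<rho> powr (- 1 / real m)) powr (- real m)"

text \<open>Jensen's inequality for the m-th power with weights \<open>(1 - l) * x\<close> and
  \<open>l * y\<close> at the points \<open>p / x\<close> and \<open>q / y\<close>. The left-hand
  side is the weighted harmonic mean of two layer densities without their common factor
  \<open>m\<close>.\<close>

lemma neg_mean_layer:
  assumes m: "0 < m" and l: "0 < l" "l < 1" and pos: "0 < R" "0 < S" "0 < x" "0 < y"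
  shows "1 / ((1 - l) / (x ^ (m - 1) * R) + l / (y ^ (m - 1) * S))
    \<le> ((1 - l) * x + l * y) ^ (m - 1) * neg_mean m l R S"
proof -
  obtain k where k: "m = Suc k" using m by (cases m) auto
  define p q where "p = R powr (- 1 / real m)" and "q = S powr (- 1 / real m)"
  have pq: "0 < p" "0 < q" using pos by (auto simp: p_def q_def)
  have R: "1 / R = p ^ m" "1 / S = q ^ m"
  proof -
    have "(r powr (- 1 / real m)) ^ m = r powr (- 1 / real m * real m)" if "0 < r" for r
      using that by (subst powr_realpow[symmetric]) (auto simp: powr_powr)
    then show "1 / R = p ^ m" "1 / S = q ^ m" using pos m by (simp_all add: p_def q_def powr_minus_divide)
  qed
  define w where "w = (1 - l) * p + l * q"
  have w: "0 < w" unfolding w_def using pq l by (intro add_pos_pos mult_pos_pos) auto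
  have M: "neg_mean m l R S = 1 / w ^ m"
    using w unfolding neg_mean_def p_def[symmetric] q_def[symmetric] w_def[symmetric]
    by (simp add: powr_minus_divide powr_realpow)
  let ?z = "(1 - l) * x + l * y"
  have z: "0 < ?z" using pos l by (intro add_pos_pos mult_pos_pos) auto
  define h where "h = (1 - l) / (x ^ k * R) + l / (y ^ k * S)"
  have h: "0 < h" unfolding h_def using pos l by (intro add_pos_pos divide_pos_pos mult_pos_pos) auto
  have "w ^ Suc k \<le> ?z ^ k * h"
  proof -
    have "((1 - l) * x * (p / x) + l * y * (q / y)) ^ Suc k
        \<le> ?z ^ k * ((1 - l) * x * (p / x) ^ Suc k + l * y * (q / y) ^ Suc k)"
      using pos pq l by (intro weighted_power_convexity) auto
    moreover have "(1 - l) * x * (p / x) + l * y * (q / y) = w" using pos by (simp add: w_def)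
    moreover have "(1 - l) * x * (p / x) ^ Suc k + l * y * (q / y) ^ Suc k = (1 - l) * (p ^ m / x ^ k) + l * (q ^ m / y ^ k)"
      using pos by (simp add: power_divide k)
    moreover have "\<dots> = h" unfolding R[symmetric] h_def by (simp add: mult.commute)
    ultimately show ?thesis by simp
  qed
  then have "1 / h \<le> ?z ^ k * (1 / w ^ Suc k)" using h w by (simp add: field_simps)
  then show ?thesis using M by (simp add: k h_def)
qed

lemma ennreal_power_less_improve:
  assumes "0 < m" "0 \<le> x" "ennreal (x ^ m) < y"
  obtains x' where "x < x'" "ennreal (x' ^ m) \<le> y"
proof -
  obtain w where w: "ennreal (x ^ m) < w" "w < y" using dense[OF assms(3)] by blast
  then obtain d where d: "w = ennreal d" "0 \<le> d" by (cases w) auto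
  have "x ^ m < d" using w(1) assms(2) by (simp add: d ennreal_less_iff)
  then have "root m (x ^ m) < root m d" using assms(1) by simp
  then have "x < root m d" using assms by (simp add: real_root_power_cancel)
  moreover have "ennreal (root m d ^ m) \<le> y" using w assms(1) d by simp
  ultimately show ?thesis using that by blast
qed

lemma neg_mean_pos: "0 < r \<Longrightarrow> 0 < \<rho> \<Longrightarrow> 0 < l \<Longrightarrow> l < 1 \<Longrightarrow> 0 < neg_mean m l r \<rho>"
proof -
  assume "0 < r" "0 < \<rho>" "0 < l" "l < 1"
  then have "0 < (1 - l) * r powr (- 1 / real m) + l * \<rho> powr (- 1 / real m)"
    by (intro add_pos_pos mult_pos_pos) auto
  then show ?thesis by (simp add: neg_mean_def)
qed

theorem neg_mean_layer_inequality:
  fixes F G H :: "real \<Rightarrow> ennreal"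
  assumes m: "0 < m" and l: "0 < l" "l < 1"
    and F: "antimono_on {0<..} F"
    and G: "antimono_on {0<..} G"
    and H: "antimono_on {0<..} H"
    and FGH: "\<And>r \<rho> x y. 0 < r \<Longrightarrow> 0 < \<rho> \<Longrightarrow> 0 < x \<Longrightarrow> 0 < y \<Longrightarrow> ennreal (x ^ m) \<le> F r \<Longrightarrow> ennreal (y ^ m) \<le> G \<rho>
      \<Longrightarrow> ennreal (((1 - l) * x + l * y) ^ m) \<le> H (neg_mean m l r \<rho>)"
    and \<theta>: "0 \<le> \<theta>" "ennreal \<theta> < (\<integral>\<^sup>+r\<in>{0<..}. F r \<partial>lborel)" "ennreal \<theta> < (\<integral>\<^sup>+r\<in>{0<..}. G r \<partial>lborel)"
  shows "ennreal \<theta> \<le> (\<integral>\<^sup>+r\<in>{0<..}. H r \<partial>lborel)"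
proof -
  let ?u = "power_layer m F" and ?v = "power_layer m G" and ?w = "power_layer m H"
  note Fm = power_layer_measurable[where F=F and m=m, OF F m] power_layer_integral[where F=F and m=m, OF F m]
  note Gm = power_layer_measurable[where F=G and m=m, OF G m] power_layer_integral[where F=G and m=m, OF G m]
  note Hm = power_layer_measurable[where F=H and m=m, OF H m] power_layer_integral[where F=H and m=m, OF H m]
  obtain U where U: "U > 0" "\<And>c. 0 < c \<Longrightarrow> c < 1 \<Longrightarrow> \<exists>x. ennreal (c * U) < ?u x"
    "ennreal \<theta> < (\<integral>\<^sup>+x. min (?u x) (ennreal U) \<partial>lborel)"
    using truncation_level[OF Fm(1) \<theta>(2)[unfolded Fm(2)]] by metis
  obtain V where V: "V > 0" "\<And>c. 0 < c \<Longrightarrow> c < 1 \<Longrightarrow> \<exists>x. ennreal (c * V) < ?v x"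
    "ennreal \<theta> < (\<integral>\<^sup>+x. min (?v x) (ennreal V) \<partial>lborel)"
    using truncation_level[OF Gm(1) \<theta>(3)[unfolded Gm(2)]] by metis
  \<comment> \<open>With the weighted harmonic mean as height the coefficients of the two truncated
    integrals add up to 1, so their common lower bound \<open>\<theta>\<close> carries over.\<close>
  define N where "N = 1 / ((1 - l) / U + l / V)"
  have s: "0 < (1 - l) / U + l / V" using U V l by (intro add_pos_pos divide_pos_pos) auto
  then have N: "0 < N" by (simp add: N_def)
  have "ennreal (N * (1 - l) / U) * (\<integral>\<^sup>+x. min (?u x) (ennreal U) \<partial>lborel) +
      ennreal (N * l / V) * (\<integral>\<^sup>+x. min (?v x) (ennreal V) \<partial>lborel) \<le> (\<integral>\<^sup>+x. ?w x \<partial>lborel)"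
  proof (rule nn_integral_superlevel_ineq[OF Fm(1) Gm(1) Hm(1) U(1) V(1) N _ l(1) U(2) V(2)])
    fix c x y assume c: "0 < c" "c < 1" and x: "ennreal (c * U) < ?u x" and y: "ennreal (c * V) < ?v y"
    let ?z = "(1 - l) * x + l * y"
    have cU: "0 \<le> c * U" "0 \<le> c * V" using c U V by auto
    obtain R where R: "0 < R" "0 < x" "c * U < real m * x ^ (m - 1) * R" "ennreal (x ^ m) < F R"
      using power_layer_greaterE[where F=F and m=m, OF F m cU(1) x] .
    obtain S where S: "0 < S" "0 < y" "c * V < real m * y ^ (m - 1) * S" "ennreal (y ^ m) < G S"
      using power_layer_greaterE[where F=G and m=m, OF G m cU(2) y] .
    have z: "0 < ?z" using R S l by (intro add_pos_pos mult_pos_pos) auto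
    \<comment> \<open>Raising \<open>x\<close> slightly makes the bound for \<open>H\<close> strict,
      as membership in its layer requires.\<close>
    obtain x' where x': "x < x'" "ennreal (x' ^ m) \<le> F R"
      using ennreal_power_less_improve[OF m less_imp_le[OF R(2)] R(4)] .
    have "?z < (1 - l) * x' + l * y" using x' l by simp
    then have "ennreal (?z ^ m) < ennreal (((1 - l) * x' + l * y) ^ m)"
      using z m by (simp add: ennreal_less_iff power_strict_mono)
    also have "\<dots> \<le> H (neg_mean m l R S)" using R S x' by (intro FGH) auto
    finally have Hz: "ennreal (?z ^ m) < H (neg_mean m l R S)" .
    let ?a = "x ^ (m - 1) * R" and ?b = "y ^ (m - 1) * S"
    have ab: "0 < ?a" "0 < ?b" using R S by auto
    have "(1 - l) / ?a + l / ?b < (1 - l) * real m / (c * U) + l * real m / (c * V)"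
    proof (rule add_strict_mono)
      have "0 < c * U" "0 < c * V" using c U V by auto
      then show "(1 - l) / ?a < (1 - l) * real m / (c * U)" "l / ?b < l * real m / (c * V)"
        using R(3) S(3) ab l by (simp_all add: divide_simps mult_ac)
    qed
    also have "\<dots> = real m / (c * N)" by (simp add: N_def add_divide_distrib distrib_left mult_ac)
    finally have "(1 - l) / ?a + l / ?b < real m / (c * N)" .
    moreover have "0 < (1 - l) / ?a + l / ?b" using ab l by (intro add_pos_pos divide_pos_pos) auto
    ultimately have "c * N < real m * (1 / ((1 - l) / ?a + l / ?b))"
      using c N m by (simp add: pos_less_divide_eq mult_ac)
    also have "\<dots> \<le> real m * (?z ^ (m - 1) * neg_mean m l R S)"
      using neg_mean_layer[OF m l R(1) S(1) R(2) S(2)] by (intro mult_left_mono) auto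
    finally have "ennreal (c * N) < ennreal (real m * ?z ^ (m - 1) * neg_mean m l R S)"
      using c N by (simp add: ennreal_less_iff mult.assoc)
    also have "\<dots> \<le> ?w ?z"
      using neg_mean_pos[OF R(1) S(1) l] Hz z by (intro power_layer_ge[where F=H and m=m, OF H m]) auto
    finally show "ennreal (c * N) < ?w ?z" .
  qed (use l in auto)
  moreover have "ennreal \<theta> \<le> ennreal (N * (1 - l) / U) * (\<integral>\<^sup>+x. min (?u x) (ennreal U) \<partial>lborel) +
      ennreal (N * l / V) * (\<integral>\<^sup>+x. min (?v x) (ennreal V) \<partial>lborel)"
  proof -
    have one: "N * (1 - l) / U + N * l / V = 1" proof -
      have "N * (1 - l) / U + N * l / V = N * ((1 - l) / U + l / V)" by (simp add: distrib_left)
      then show ?thesis using s by (simp add: N_def)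
    qed
    have "ennreal \<theta> = ennreal ((N * (1 - l) / U + N * l / V) * \<theta>)" unfolding one by simp
    also have "\<dots> = ennreal (N * (1 - l) / U) * ennreal \<theta> + ennreal (N * l / V) * ennreal \<theta>"
      unfolding distrib_right using N U V l \<theta> by (subst ennreal_plus) (auto simp: ennreal_mult[symmetric])
    also have "\<dots> \<le> ennreal (N * (1 - l) / U) * (\<integral>\<^sup>+x. min (?u x) (ennreal U) \<partial>lborel) +
      ennreal (N * l / V) * (\<integral>\<^sup>+x. min (?v x) (ennreal V) \<partial>lborel)"
      using U(3) V(3) by (intro add_mono mult_left_mono) auto
    finally show ?thesis .
  qed
  ultimately show ?thesis unfolding Hm(2) by (rule order_trans[rotated])
qed

section \<open>Rescaling to the extremal order\<close>

lemma ennreal_le_divideD: "0 < b \<Longrightarrow> 0 \<le> a \<Longrightarrow> ennreal a \<le> ennreal (1 / b) * y \<Longrightarrow> ennreal (b * a) \<le> y"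
proof -
  assume b: "0 < b" and a: "0 \<le> a" and le: "ennreal a \<le> ennreal (1 / b) * y"
  have "ennreal (b * a) = ennreal b * ennreal a" using a b by (simp add: ennreal_mult)
  also have "\<dots> \<le> ennreal b * (ennreal (1 / b) * y)" by (rule mult_left_mono[OF le]) simp
  also have "\<dots> = y" using b by (simp add: mult.assoc[symmetric] ennreal_mult[symmetric])
  finally show ?thesis .
qed

lemma nn_integral_rescale:
  fixes F :: "real \<Rightarrow> ennreal"
  assumes F: "antimono_on {0<..} F" and c: "0 < c"
  shows "(\<integral>\<^sup>+r\<in>{0<..}. F r \<partial>lborel) = ennreal c * (\<integral>\<^sup>+r\<in>{0<..}. F (c * r) \<partial>lborel)"
proof -
  have "(\<integral>\<^sup>+r\<in>{0<..}. F r \<partial>lborel) = ennreal c * (\<integral>\<^sup>+r. F (0 + c * r) * indicator {0<..} (0 + c * r) \<partial>lborel)"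
    using nn_integral_real_affine[OF borel_measurable_antimono_ennreal[OF F], of c 0] c by simp
  also have "(\<lambda>r. F (0 + c * r) * indicator {0<..} (0 + c * r)) = (\<lambda>r. F (c * r) * indicator {0<..} r)"
    using c by (auto simp: indicator_def zero_less_mult_iff)
  finally show ?thesis .
qed

lemma antimono_rescale:
  fixes F :: "real \<Rightarrow> ennreal"
  assumes F: "antimono_on {0<..} F" and c: "0 < c"
  shows "antimono_on {0<..} (\<lambda>r. ennreal a * F (c * r))"
  using F c by (auto simp: monotone_on_def intro!: mult_left_mono)

text \<open>Applied to \<open>F (I P\<^sup>-\<^sup>m r) / P\<^sup>m\<close> and \<open>G (J Q\<^sup>-\<^sup>m \<rho>) / Q\<^sup>m\<close>, whose integrals slightly exceed \<open>1\<close>.\<close>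

lemma rescaled_layer_inequality:
  fixes F G H :: "real \<Rightarrow> ennreal" and \<mu> :: "real \<Rightarrow> real \<Rightarrow> real"
  assumes m: "0 < m" and st: "0 < s" "0 < t"
    and F: "antimono_on {0<..} F" and G: "antimono_on {0<..} G" and H: "antimono_on {0<..} H"
    and FGH: "\<And>r \<rho> x y. 0 < r \<Longrightarrow> 0 < \<rho> \<Longrightarrow> 0 < x \<Longrightarrow> 0 < y \<Longrightarrow> ennreal (x ^ m) \<le> F r \<Longrightarrow> ennreal (y ^ m) \<le> G \<rho>
      \<Longrightarrow> ennreal ((s * x + t * y) ^ m) \<le> H (\<mu> r \<rho>)"
    and I: "0 < I" "ennreal I < (\<integral>\<^sup>+r\<in>{0<..}. F r \<partial>lborel)"
    and J: "0 < J" "ennreal J < (\<integral>\<^sup>+r\<in>{0<..}. G r \<partial>lborel)"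
    and P: "0 < P" and Q: "0 < Q" and C: "0 < C"
    and \<mu>: "\<And>r \<rho>. 0 < r \<Longrightarrow> 0 < \<rho> \<Longrightarrow>
      C * neg_mean m (t * Q / (s * P + t * Q)) r \<rho> \<le> \<mu> (I / P ^ m * r) (J / Q ^ m * \<rho>)"
  shows "ennreal (C * (s * P + t * Q) ^ m) \<le> (\<integral>\<^sup>+r\<in>{0<..}. H r \<partial>lborel)"
proof -
  define D where "D = s * P + t * Q"
  \<comment> \<open>With this weight \<open>s * (P * x) + t * (Q * y)\<close> is \<open>D\<close>
    times a convex combination of \<open>x\<close> and \<open>y\<close>.\<close>
  define l where "l = t * Q / D"
  have D: "0 < D" unfolding D_def using st P Q by (intro add_pos_pos mult_pos_pos) auto
  have l: "0 < l" "l < 1" "1 - l = s * P / D"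
    using D st P Q by (simp_all add: l_def field_simps) (simp_all add: D_def)
  define c d where "c = I / P ^ m" and "d = J / Q ^ m"
  have cd: "0 < c" "0 < d" using I J P Q by (auto simp: c_def d_def)
  \<comment> \<open>The scaling of the values and that of the argument together divide the integral
    by \<open>I\<close>.\<close>
  have big: "ennreal 1 < (\<integral>\<^sup>+r\<in>{0<..}. ennreal (1 / P ^ m) * F (I / P ^ m * r) \<partial>lborel)"
    if F: "antimono_on {0<..} F" and I: "0 < I" "ennreal I < (\<integral>\<^sup>+r\<in>{0<..}. F r \<partial>lborel)" and P: "0 < P"
    for F :: "real \<Rightarrow> ennreal" and I P
  proof (rule ccontr)
    let ?X = "\<integral>\<^sup>+r\<in>{0<..}. F (I / P ^ m * r) \<partial>lborel"
    have c: "0 < I / P ^ m" using I P by simp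
    have "(\<lambda>r. F (I / P ^ m * r) * indicator {0<..} r) \<in> borel_measurable lborel"
      using borel_measurable_antimono_ennreal[OF antimono_rescale[OF F c, of 1]]
      by (simp only: ennreal_1 mult_1 measurable_lborel1 measurable_lborel2)
    from nn_integral_cmult[OF this, of "ennreal (1 / P ^ m)"]
    have "(\<integral>\<^sup>+r\<in>{0<..}. ennreal (1 / P ^ m) * F (I / P ^ m * r) \<partial>lborel) = ennreal (1 / P ^ m) * ?X"
      by (simp only: mult.assoc)
    moreover assume "\<not> ?thesis"
    ultimately have "ennreal (1 / P ^ m) * ?X \<le> 1" by simp
    then have "ennreal I * (ennreal (1 / P ^ m) * ?X) \<le> ennreal I * 1" by (rule mult_left_mono) simp
    then have "ennreal (I / P ^ m) * ?X \<le> ennreal I"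
      using I P by (simp add: mult.assoc[symmetric] ennreal_mult[symmetric])
    then show False using nn_integral_rescale[OF F c] I(2) by simp
  qed
  have "ennreal 1 \<le> (\<integral>\<^sup>+r\<in>{0<..}. ennreal (1 / D ^ m) * H (C * r) \<partial>lborel)"
  proof (rule neg_mean_layer_inequality[OF m l(1,2) antimono_rescale[OF F cd(1)] antimono_rescale[OF G cd(2)] antimono_rescale[OF H C]])
    fix r \<rho> x y :: real
    assume pos: "0 < r" "0 < \<rho>" "0 < x" "0 < y" and Fx: "ennreal (x ^ m) \<le> ennreal (1 / P ^ m) * F (c * r)"
      and Gy: "ennreal (y ^ m) \<le> ennreal (1 / Q ^ m) * G (d * \<rho>)"
    have "ennreal ((P * x) ^ m) \<le> F (c * r)" "ennreal ((Q * y) ^ m) \<le> G (d * \<rho>)"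
      using ennreal_le_divideD[OF _ _ Fx] ennreal_le_divideD[OF _ _ Gy] P Q pos by (simp_all add: power_mult_distrib)
    then have "ennreal ((s * (P * x) + t * (Q * y)) ^ m) \<le> H (\<mu> (c * r) (d * \<rho>))"
      using pos cd P Q by (intro FGH) auto
    also have "\<dots> \<le> H (C * neg_mean m l r \<rho>)"
    proof -
      have "0 < C * neg_mean m l r \<rho>" using C neg_mean_pos[OF pos(1,2) l(1,2)] by simp
      moreover have "C * neg_mean m l r \<rho> \<le> \<mu> (c * r) (d * \<rho>)"
        using \<mu>[OF pos(1,2)] by (simp add: l_def D_def c_def d_def)
      ultimately show ?thesis using H by (auto simp: monotone_on_def)
    qed
    also have "s * (P * x) + t * (Q * y) = D * ((1 - l) * x + l * y)"
      using D unfolding l(3) by (simp add: l_def distrib_left)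
    finally have "ennreal (1 / D ^ m) * ennreal ((D * ((1 - l) * x + l * y)) ^ m) \<le> ennreal (1 / D ^ m) * H (C * neg_mean m l r \<rho>)"
      by (rule mult_left_mono) simp
    moreover have "ennreal (1 / D ^ m) * ennreal ((D * w) ^ m) = ennreal (w ^ m)" if "0 \<le> w" for w
      using D that by (simp add: ennreal_mult[symmetric] power_mult_distrib)
    ultimately show "ennreal (((1 - l) * x + l * y) ^ m) \<le> ennreal (1 / D ^ m) * H (C * neg_mean m l r \<rho>)"
      using l(1,2) pos by simp
  qed (use big[OF F I P] big[OF G J Q] in \<open>auto simp: c_def d_def\<close>)
  also have "\<dots> = ennreal (1 / D ^ m) * (\<integral>\<^sup>+r\<in>{0<..}. H (C * r) \<partial>lborel)"
  proof -
    have [measurable]: "(\<lambda>r. H (C * r) * indicator {0<..} r) \<in> borel_measurable borel"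
      using borel_measurable_antimono_ennreal[OF antimono_rescale[OF H C, of 1]] by simp
    show ?thesis by (subst nn_integral_cmult[symmetric]) (auto simp: mult.assoc)
  qed
  finally have "ennreal (D ^ m * 1) \<le> (\<integral>\<^sup>+r\<in>{0<..}. H (C * r) \<partial>lborel)"
    using D by (intro ennreal_le_divideD) auto
  then have "ennreal C * ennreal (D ^ m * 1) \<le> ennreal C * (\<integral>\<^sup>+r\<in>{0<..}. H (C * r) \<partial>lborel)"
    by (rule mult_left_mono) simp
  then show ?thesis using C D by (simp add: nn_integral_rescale[OF H C] ennreal_mult D_def)
qed

text \<open>The weighted arithmetic-geometric inequality for the powers -1/m, inverted by the
  decreasing power \<open>- m\<close>.\<close>

lemma neg_mean_le_geometric:
  assumes "0 < m" "0 < l" "l < 1" "0 < r" "0 < \<rho>"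
  shows "neg_mean m l r \<rho> \<le> r powr (1 - l) * \<rho> powr l"
proof -
  let ?p = "r powr (- 1 / real m)" and ?q = "\<rho> powr (- 1 / real m)"
  have le: "?p powr (1 - l) * ?q powr l \<le> (1 - l) * ?p + l * ?q"
    using assms by (intro Youngs_inequality_0) auto
  have "neg_mean m l r \<rho> \<le> (?p powr (1 - l) * ?q powr l) powr (- real m)"
    unfolding neg_mean_def using assms le by (intro powr_mono2') auto
  also have "\<dots> = r powr (1 - l) * \<rho> powr l"
    using assms by (simp add: powr_mult powr_powr)
  finally show ?thesis .
qed

lemma neg_mean_le_max:
  assumes "0 < m" "0 < l" "l < 1" "0 < r" "0 < \<rho>"
  shows "neg_mean m l r \<rho> \<le> max r \<rho>"
proof -
  have "neg_mean m l r \<rho> \<le> r powr (1 - l) * \<rho> powr l" by (rule neg_mean_le_geometric[OF assms])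
  also have "\<dots> \<le> (1 - l) * r + l * \<rho>" using assms by (intro Youngs_inequality_0) auto
  also have "\<dots> \<le> max r \<rho>" using assms by (intro convex_bound_le) auto
  finally show ?thesis .
qed

text \<open>Positive orders pass through the geometric mean. For negative ones, convexity of
  \<open>x powr k\<close> applies with \<open>k = e / a\<close>, which is at least 1.\<close>

lemma neg_mean_le_power_mean:
  assumes "0 < m" "0 < l" "l < 1" "0 < r" "0 < \<rho>" and a: "a \<noteq> 0" "- 1 / real m \<le> a"
  shows "neg_mean m l r \<rho> \<le> ((1 - l) * r powr a + l * \<rho> powr a) powr (1 / a)"
proof (cases "0 < a")
  case True
  have "r powr (1 - l) * \<rho> powr l = ((r powr a) powr (1 - l) * (\<rho> powr a) powr l) powr (1 / a)"
    using assms by (simp add: powr_mult powr_powr)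
  also have "\<dots> \<le> ((1 - l) * r powr a + l * \<rho> powr a) powr (1 / a)"
    using assms True by (intro powr_mono2 Youngs_inequality_0) auto
  finally show ?thesis using neg_mean_le_geometric[OF assms(1-5)] by simp
next
  case False
  define e where "e = - 1 / real m"
  define k where "k = e / a"
  have e: "e < 0" using assms by (simp add: e_def)
  have a0: "a < 0" using False a by simp
  have k: "1 \<le> k" "a * k = e" using a0 a(2)[folded e_def] by (simp_all add: k_def le_divide_eq)
  let ?p = "r powr a" and ?q = "\<rho> powr a"
  let ?w = "(1 - l) * ?p + l * ?q"
  have w: "0 < ?w" using assms by (intro add_pos_pos mult_pos_pos) auto
  have "?w powr k \<le> (1 - l) * ?p powr k + l * ?q powr k"
  proof -
    have "convex_on {0<..} (\<lambda>x::real. x powr k)"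
      by (rule powr_convex[OF k(1)])
    then show ?thesis
      using assms by (intro convex_onD[of "{0<..}" "\<lambda>x. x powr k" l ?p ?q, unfolded real_scaleR_def]) auto
  qed
  also have "\<dots> = (1 - l) * r powr e + l * \<rho> powr e" by (simp add: powr_powr k)
  finally have "neg_mean m l r \<rho> \<le> (?w powr k) powr (- real m)"
    unfolding neg_mean_def e_def[symmetric] using w by (intro powr_mono2') auto
  also have "\<dots> = ?w powr (1 / a)"
  proof -
    have "k * (- real m) = 1 / a" using assms(1) a0 by (simp add: k_def e_def)
    then show ?thesis by (simp add: powr_powr)
  qed
  finally show ?thesis .
qed

section \<open>Quermassintegrals of functions\<close>

lemma power_mean_commute: "power_mean \<alpha> s t u v = power_mean \<alpha> t s v u"
  by (auto simp: power_mean_def Let_def max.commute min.commute mult.commute add.commute)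

lemma sup_combination_commute: "sup_combination \<alpha> s t f g = sup_combination \<alpha> t s g f"
proof
  fix z
  have "{s *\<^sub>R x + t *\<^sub>R y |x y. 0 < f x \<and> 0 < g y} = {t *\<^sub>R x + s *\<^sub>R y |x y. 0 < g x \<and> 0 < f y}"
    by (metis (no_types, opaque_lifting) add.commute)
  moreover have "{power_mean \<alpha> s t (f x) (g y) |x y. z = s *\<^sub>R x + t *\<^sub>R y \<and> 0 < f x \<and> 0 < g y} =
      {power_mean \<alpha> t s (g x) (f y) |x y. z = t *\<^sub>R x + s *\<^sub>R y \<and> 0 < g x \<and> 0 < f y}"
    unfolding power_mean_commute[of \<alpha> s t] by (metis (no_types, opaque_lifting) add.commute)
  ultimately show "sup_combination \<alpha> s t f g z = sup_combination \<alpha> t s g f z"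
    unfolding sup_combination_def by (simp only:)
qed

lemma power_mean_ennreal:
  assumes "0 < s" "0 < t" "0 < r" "0 < \<rho>" "a \<noteq> 0"
  shows "power_mean (ereal a) s t (ennreal r) (ennreal \<rho>) = ennreal ((s * r powr a + t * \<rho> powr a) powr (1 / a))"
proof -
  have "0 < s * r powr a + t * \<rho> powr a" using assms by (intro add_pos_pos mult_pos_pos) auto
  moreover have "ennreal s * ennreal (r powr a) + ennreal t * ennreal (\<rho> powr a) = ennreal (s * r powr a + t * \<rho> powr a)"
    using assms by (simp add: ennreal_mult)
  ultimately show ?thesis using assms by (simp add: power_mean_real del: ennreal_plus)
qed

lemma power_mean_geometric_ennreal:
  assumes "0 < r" "0 < \<rho>"
  shows "power_mean 0 s t (ennreal r) (ennreal \<rho>) = ennreal (r powr s * \<rho> powr t)"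
  using assms by (simp add: power_mean_geometric ennreal_mult)

lemma positive_approx_from_below:
  assumes "(0::ennreal) < I"
  obtains u :: "nat \<Rightarrow> ennreal" where "\<And>k. 0 < u k" "\<And>k. u k < I" "u \<longlonglongrightarrow> I"
proof -
  obtain w where w: "\<And>k::nat. w k < I" "w \<longlonglongrightarrow> I" using approx_from_below_dense_linorder[OF assms] by blast
  obtain y where y: "0 < y" "y < I" using dense[OF assms] by blast
  show ?thesis
  proof (rule that[of "\<lambda>k. max (w k) y"])
    show "(\<lambda>k. max (w k) y) \<longlonglongrightarrow> I" using tendsto_max[OF w(2) tendsto_const[of y]] y by (simp add: max.absorb1)
  qed (use w y in \<open>auto simp: less_max_iff_disj\<close>)
qed

text \<open>The layer argument works with reals strictly below the two integrals. Continuity of the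
  mean along sequences from below recovers the integrals themselves, infinite values
  included.\<close>

lemma power_mean_le_if_strictly_below:
  assumes st: "0 < s" "0 < t" and \<beta>: "\<beta> \<noteq> \<infinity>" and I: "0 < I" and J: "0 < J"
    and le: "\<And>I' J'. 0 < I' \<Longrightarrow> I' < I \<Longrightarrow> 0 < J' \<Longrightarrow> J' < J \<Longrightarrow> power_mean \<beta> s t I' J' \<le> X"
  shows "power_mean \<beta> s t I J \<le> X"
proof -
  obtain u where u: "\<And>k::nat. 0 < u k" "\<And>k. u k < I" "u \<longlonglongrightarrow> I"
    by (rule positive_approx_from_below[OF I]) (rule that, assumption+)
  obtain v where v: "\<And>k::nat. 0 < v k" "\<And>k. v k < J" "v \<longlonglongrightarrow> J"
    by (rule positive_approx_from_below[OF J]) (rule that, assumption+)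
  have "(\<lambda>k. power_mean \<beta> s t (u k) (v k)) \<longlonglongrightarrow> power_mean \<beta> s t I J"
  proof (cases \<beta>)
    case (real a)
    show ?thesis
    proof (cases "a = 0")
      case True
      then have "\<beta> = 0" using real by (simp add: zero_ereal_def)
      moreover have "(\<lambda>k. ennreal_powr (u k) s * ennreal_powr (v k) t) \<longlonglongrightarrow> ennreal_powr I s * ennreal_powr J t"
        using u v st ennreal_powr_pos[of s I] ennreal_powr_pos[of t J] I J
        by (intro tendsto_mult_ennreal tendsto_ennreal_powr) auto
      ultimately show ?thesis using u v I J by (simp add: power_mean_geometric)
    next
      case False
      have "(\<lambda>k. ennreal_powr (ennreal s * ennreal_powr (u k) a + ennreal t * ennreal_powr (v k) a) (1 / a))
          \<longlonglongrightarrow> ennreal_powr (ennreal s * ennreal_powr I a + ennreal t * ennreal_powr J a) (1 / a)"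
        using False u v
        by (intro tendsto_ennreal_powr tendsto_add ennreal_tendsto_cmult) auto
      then show ?thesis using False u v I J by (simp add: real power_mean_real)
    qed
  qed (use u v \<beta> in \<open>auto intro: tendsto_min\<close>)
  then show ?thesis by (rule LIMSEQ_le_const2) (use u v le in auto)
qed

context
  fixes i m :: nat and f g :: "'a::euclidean_space \<Rightarrow> ennreal" and \<alpha> :: ereal and s t :: real
  assumes i: "i < DIM('a)" and f: "f \<in> Q_class \<alpha>" and g: "g \<in> Q_class \<alpha>"
    and st: "0 < s" "0 < t" and \<alpha>: "\<alpha> \<noteq> -\<infinity>"
    and m_def: "m = DIM('a) - i"
begin

abbreviation (input) "lev \<equiv> \<lambda>h r. {x. ennreal r \<le> h x}"
abbreviation (input) "comb \<equiv> sup_combination \<alpha> s t f g"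

lemma Q_class_quermass_antimono:
  assumes "h \<in> Q_class \<alpha>"
  shows "antimono_on {0<..} (\<lambda>r. quermass i (lev h r :: 'a set))"
proof (rule monotone_onI)
  fix r r' :: real assume "r \<in> {0<..}" "r' \<in> {0<..}" and le: "r \<le> r'"
  then show "quermass i (lev h r') \<le> quermass i (lev h r)"
    using Q_class_superlevel(2)[OF assms]
    by (intro quermass_mono[OF i]) (auto intro: order_trans[OF ennreal_leI[OF le]])
qed

lemma sup_combination_quermass_antimono: "antimono_on {0<..} (\<lambda>r. quermass i (lev comb r))"
proof (rule monotone_onI)
  fix r r' :: real assume "r \<in> {0<..}" "r' \<in> {0<..}" and le: "r \<le> r'"
  then show "quermass i (lev comb r') \<le> quermass i (lev comb r)"
    using f g
    by (intro quermass_mono[OF i] convex_sup_combination_superlevel \<alpha> st)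
      (auto simp: Q_class_def intro: order_trans[OF ennreal_leI[OF le]])
qed

lemma Q_class_level_cbody:
  assumes "h \<in> Q_class \<alpha>" "0 < r" "lev h r \<noteq> {}"
  shows "cbody (lev h r :: 'a set)"
  using assms Q_class_superlevel[OF assms(1,2)] by (simp add: cbody_def)

lemma quermass_sup_combination_level:
  assumes r: "0 < r" "0 < \<rho>" and ne: "lev f r \<noteq> {}" "lev g \<rho> \<noteq> {}" and xy: "0 \<le> x" "0 \<le> y"
    and x: "ennreal (x ^ m) \<le> quermass i (lev f r)" and y: "ennreal (y ^ m) \<le> quermass i (lev g \<rho>)"
    and \<mu>: "ennreal \<mu> \<le> power_mean \<alpha> s t (ennreal r) (ennreal \<rho>)"
  shows "ennreal ((s * x + t * y) ^ m) \<le> quermass i (lev comb \<mu>)"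
proof -
  note K = Q_class_level_cbody[OF f r(1) ne(1)] and L = Q_class_level_cbody[OF g r(2) ne(2)]
  have "x ^ m \<le> quermass_body i (lev f r)"
    using x K quermass_body_nonneg[OF i K] by (simp add: quermass_cbody[OF i K] ennreal_le_iff)
  moreover have "y ^ m \<le> quermass_body i (lev g \<rho>)"
    using y L quermass_body_nonneg[OF i L] by (simp add: quermass_cbody[OF i L] ennreal_le_iff)
  ultimately have "(s * x + t * y) ^ m \<le> quermass_body i (dilate s (lev f r) + dilate t (lev g \<rho>))"
    unfolding m_def by (intro quermass_body_combination[OF i K L st xy])
  then have "ennreal ((s * x + t * y) ^ m) \<le> quermass i (dilate s (lev f r) + dilate t (lev g \<rho>))"
    using K L by (simp add: quermass_cbody[OF i] ennreal_leI)
  also have "\<dots> \<le> quermass i (lev comb \<mu>)"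
  proof (rule quermass_mono[OF i])
    have "cbody (dilate s (lev f r) + dilate t (lev g \<rho>))" using K L by simp
    then show "convex (dilate s (lev f r) + dilate t (lev g \<rho>))" by (simp add: cbody_def)
    show "convex (lev comb \<mu>)"
      using f g by (intro convex_sup_combination_superlevel \<alpha> st) (auto simp: Q_class_def)
    show "dilate s (lev f r) + dilate t (lev g \<rho>) \<subseteq> lev comb \<mu>"
    proof
      fix z assume "z \<in> dilate s (lev f r) + dilate t (lev g \<rho>)"
      then obtain a b where ab: "z = s *\<^sub>R a + t *\<^sub>R b" "ennreal r \<le> f a" "ennreal \<rho> \<le> g b"
        unfolding set_plus_eq dilate_def by blast
      have pos: "0 < f a" "0 < g b"
        using ab r less_le_trans[of 0 "ennreal r" "f a"] less_le_trans[of 0 "ennreal \<rho>" "g b"] by auto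
      have "ennreal \<mu> \<le> power_mean \<alpha> s t (f a) (g b)"
        using \<mu> power_mean_mono[OF st ab(2,3)] by (rule order_trans)
      also have "\<dots> \<le> comb z" unfolding ab(1) using pos by (rule sup_combination_ge)
      finally show "z \<in> lev comb \<mu>" by simp
    qed
  qed
  finally show ?thesis .
qed

text \<open>\<open>P\<close>, \<open>Q\<close> and \<open>C\<close> are left free. Each range of
  orders chooses them so that the claimed mean appears as
  \<open>C * (s * P + t * Q) ^ m\<close>.\<close>

lemma sup_combination_layer_bound:
  assumes I: "0 < I" "ennreal I < quermass_fun i f" and J: "0 < J" "ennreal J < quermass_fun i g"
    and P: "0 < P" and Q: "0 < Q" and C: "0 < C"
    and \<mu>: "\<And>r \<rho>. 0 < r \<Longrightarrow> 0 < \<rho> \<Longrightarrow> ennreal (\<mu> r \<rho>) = power_mean \<alpha> s t (ennreal r) (ennreal \<rho>)"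
    and ge: "\<And>r \<rho>. 0 < r \<Longrightarrow> 0 < \<rho> \<Longrightarrow>
      C * neg_mean m (t * Q / (s * P + t * Q)) r \<rho> \<le> \<mu> (I / P ^ m * r) (J / Q ^ m * \<rho>)"
  shows "ennreal (C * (s * P + t * Q) ^ m) \<le> quermass_fun i comb"
  unfolding quermass_fun_def
proof (rule rescaled_layer_inequality[OF _ st Q_class_quermass_antimono[OF f] Q_class_quermass_antimono[OF g]
    sup_combination_quermass_antimono _ I[unfolded quermass_fun_def] J[unfolded quermass_fun_def] P Q C ge])
  show "0 < m" using i by (simp add: m_def)
  fix r \<rho> x y :: real
  assume pos: "0 < r" "0 < \<rho>" "0 < x" "0 < y"
    and le: "ennreal (x ^ m) \<le> quermass i (lev f r)" "ennreal (y ^ m) \<le> quermass i (lev g \<rho>)"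
  have ne: "X \<noteq> {}" if "ennreal (z ^ m) \<le> quermass i X" "0 < z" for X :: "'a set" and z :: real
  proof
    assume "X = {}"
    then have "quermass i X = 0" by (simp add: quermass_def)
    with that(1) zero_less_power[OF that(2), of m] show False by (simp add: ennreal_eq_0_iff)
  qed
  have "lev f r \<noteq> {}" "lev g \<rho> \<noteq> {}"
    using ne[OF le(1) pos(3)] ne[OF le(2) pos(4)] .
  then show "ennreal ((s * x + t * y) ^ m) \<le> quermass i (lev comb (\<mu> r \<rho>))"
    using pos le \<mu>[OF pos(1,2)] by (intro quermass_sup_combination_level[of r \<rho>]) auto
qed

lemma sup_combination_quermass_real:
  assumes \<alpha>ge: "ereal (- 1 / real m) \<le> \<alpha>" and st1: "\<alpha> = 0 \<Longrightarrow> s + t = 1"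
    and I: "0 < I" "ennreal I < quermass_fun i f" and J: "0 < J" "ennreal J < quermass_fun i g"
  shows "power_mean (beta_exponent \<alpha> m) s t (ennreal I) (ennreal J) \<le> quermass_fun i comb"
proof -
  have m: "0 < m" using i by (simp add: m_def)
  have pow: "(x powr c) ^ m = x powr (c * real m)" if "0 < x" for x c
    using that by (subst powr_realpow[symmetric]) (auto simp: powr_powr)
  have frac: "0 < t * q / (s * p + t * q)" "t * q / (s * p + t * q) < 1" "0 < s * p + t * q"
      "1 - t * q / (s * p + t * q) = s * p / (s * p + t * q)" if "0 < p" "0 < q" for p q
  proof -
    have "0 < s * p" "0 < t * q" using that st by auto
    then show "0 < t * q / (s * p + t * q)" "t * q / (s * p + t * q) < 1" "0 < s * p + t * q"
      "1 - t * q / (s * p + t * q) = s * p / (s * p + t * q)" by (auto simp: divide_simps)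
  qed
  show ?thesis
  proof (cases \<alpha>)
    case PInf
    \<comment> \<open>Then \<open>I / P ^ m = 1\<close> and \<open>J / Q ^ m = 1\<close>, so the
      levels are not rescaled and the comparison with the maximum suffices.\<close>
    define P Q where "P = I powr (1 / real m)" and "Q = J powr (1 / real m)"
    have PQ: "0 < P" "0 < Q" "P ^ m = I" "Q ^ m = J"
      using I J m by (auto simp: P_def Q_def pow)
    have "ennreal (1 * (s * P + t * Q) ^ m) \<le> quermass_fun i comb"
    proof (rule sup_combination_layer_bound[OF I J PQ(1,2) zero_less_one, of max])
      fix r \<rho> :: real assume r: "0 < r" "0 < \<rho>"
      show "ennreal (max r \<rho>) = power_mean \<alpha> s t (ennreal r) (ennreal \<rho>)"
        using r by (simp add: PInf max_def ennreal_le_iff)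
      show "1 * neg_mean m (t * Q / (s * P + t * Q)) r \<rho> \<le> max (I / P ^ m * r) (J / Q ^ m * \<rho>)"
        using neg_mean_le_max[OF m frac(1,2)[OF PQ(1,2)] r] PQ I J by simp
    qed
    moreover have "power_mean (beta_exponent \<alpha> m) s t (ennreal I) (ennreal J) = ennreal ((s * P + t * Q) powr real m)"
      using power_mean_ennreal[OF st I(1) J(1), of "1 / real m"] m by (simp add: PInf beta_exponent_def P_def Q_def)
    ultimately show ?thesis using frac(3)[OF PQ(1,2)] by (simp add: powr_realpow)
  next
    case (real a)
    have a: "- 1 / real m \<le> a" using \<alpha>ge by (simp add: real)
    consider "a = 0" | "a = - 1 / real m" | "a \<noteq> 0" "- 1 / real m < a" using a by linarith
    then show ?thesis
    proof cases
      case 1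
      then have \<alpha>0: "\<alpha> = 0" and st': "s + t = 1" using real st1 by (auto simp: zero_ereal_def)
      \<comment> \<open>The geometric mean is multiplicative, so \<open>I\<close> and
        \<open>J\<close> leave it as this constant; \<open>s + t = 1\<close> makes \<open>t\<close>
        the weight of the mean and trivialises the power of \<open>s + t\<close>.\<close>
      let ?C = "I powr s * J powr t"
      have C: "0 < ?C" using I J by simp
      have "ennreal (?C * (s * 1 + t * 1) ^ m) \<le> quermass_fun i comb"
      proof (rule sup_combination_layer_bound[OF I J zero_less_one zero_less_one C, of "\<lambda>r \<rho>. r powr s * \<rho> powr t"])
        fix r \<rho> :: real assume r: "0 < r" "0 < \<rho>"
        show "ennreal (r powr s * \<rho> powr t) = power_mean \<alpha> s t (ennreal r) (ennreal \<rho>)"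
          using r by (simp add: \<alpha>0 power_mean_geometric_ennreal)
        have "neg_mean m t r \<rho> \<le> r powr (1 - t) * \<rho> powr t"
          using st st' r by (intro neg_mean_le_geometric[OF m]) auto
        moreover have "1 - t = s" using st' by simp
        ultimately have "?C * neg_mean m t r \<rho> \<le> ?C * (r powr s * \<rho> powr t)"
          using C by (intro mult_left_mono) auto
        then show "?C * neg_mean m (t * 1 / (s * 1 + t * 1)) r \<rho> \<le> (I / 1 ^ m * r) powr s * (J / 1 ^ m * \<rho>) powr t"
          using I J r by (simp add: st' powr_mult mult_ac)
      qed
      moreover have "beta_exponent \<alpha> m = 0" using m by (simp add: \<alpha>0 beta_exponent_def zero_ereal_def)
      ultimately show ?thesis using I J by (simp add: st' power_mean_geometric_ennreal)
    next
      case 2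
      \<comment> \<open>The claimed mean is a minimum here, so both integrals may be lowered to the
        same number. The power of \<open>s + t\<close> in \<open>C\<close> accounts for weights
        whose total is not 1.\<close>
      define K where "K = min I J"
      have K: "0 < K" "ennreal K < quermass_fun i f" "ennreal K < quermass_fun i g"
        using I J by (auto simp: K_def min_def ennreal_leI not_le intro: le_less_trans[of _ "ennreal I"] le_less_trans[of _ "ennreal J"])
      define C where "C = K * (s + t) powr (- real m)"
      have C: "0 < C" using K st by (simp add: C_def)
      have a0: "a \<noteq> 0" "1 / a = - real m" using m by (auto simp: 2)
      have "ennreal (C * (s * 1 + t * 1) ^ m) \<le> quermass_fun i comb"
      proof (rule sup_combination_layer_bound[OF K(1,2) K(1,3) zero_less_one zero_less_one C, of "\<lambda>r \<rho>. (s * r powr a + t * \<rho> powr a) powr (1 / a)"])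
        fix r \<rho> :: real assume r: "0 < r" "0 < \<rho>"
        show "ennreal ((s * r powr a + t * \<rho> powr a) powr (1 / a)) = power_mean \<alpha> s t (ennreal r) (ennreal \<rho>)"
          using power_mean_ennreal[OF st r a0(1)] by (simp add: real)
        define l where "l = t / (s + t)"
        have l: "1 - l = s / (s + t)" "0 < s + t" "0 < l" "l < 1" using st by (auto simp: l_def divide_simps)
        define w where "w = (1 - l) * r powr a + l * \<rho> powr a"
        have w: "0 < w" unfolding w_def using l r by (intro add_pos_pos mult_pos_pos) auto
        have "s * (K * r) powr a + t * (K * \<rho>) powr a = K powr a * ((s + t) * w)"
          using K r l unfolding w_def l(1) by (simp add: powr_mult l_def distrib_left mult_ac)
        then have "(s * (K * r) powr a + t * (K * \<rho>) powr a) powr (1 / a) = (K powr a * ((s + t) * w)) powr (1 / a)" by simp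
        also have "\<dots> = K * ((s + t) powr (- real m) * w powr (- real m))"
        proof -
          have "(K powr a) powr (1 / a) = K" using K a0(1) by (simp add: powr_powr)
          then show ?thesis using K l w by (simp add: powr_mult a0(2))
        qed
        moreover have "neg_mean m l r \<rho> = w powr (- real m)" unfolding neg_mean_def w_def 2 ..
        ultimately show "C * neg_mean m (t * 1 / (s * 1 + t * 1)) r \<rho> \<le>
            (s * (K / 1 ^ m * r) powr a + t * (K / 1 ^ m * \<rho>) powr a) powr (1 / a)"
          by (simp add: C_def flip: l_def)
      qed
      moreover have "C * (s * 1 + t * 1) ^ m = K"
        using st by (simp add: C_def powr_minus_divide powr_realpow)
      moreover have "beta_exponent \<alpha> m = -\<infinity>" by (simp add: real 2 beta_exponent_def)
      ultimately show ?thesis using I J by (simp add: K_def min_def ennreal_le_iff split: if_splits)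
    next
      case 3
      have am: "0 < 1 + a * real m" using mult_strict_right_mono[OF 3(2), of "real m"] m by simp
      \<comment> \<open>The claimed order. By \<open>a * (1 - b * real m) = b\<close>, the choice
        \<open>P = I powr b\<close> turns \<open>(I / P ^ m * r) powr a\<close> into
        \<open>P * r powr a\<close>, so that \<open>P\<close> and \<open>Q\<close> act as weights of
        the mean.\<close>
      define b where "b = a / (1 + a * real m)"
      have ba: "b * (1 + a * real m) = a" using am by (simp add: b_def)
      have b: "b \<noteq> 0" "1 / b = 1 / a + real m" "a * (1 - b * real m) = b"
      proof -
        show "b \<noteq> 0" using ba 3(1) by auto
        show "1 / b = 1 / a + real m" using 3(1) by (simp add: b_def add_divide_distrib)
        have "a * (1 - b * real m) = b * (1 + a * real m) - a * b * real m"
          unfolding ba by (simp add: right_diff_distrib)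
        also have "\<dots> = b" by (simp add: distrib_left)
        finally show "a * (1 - b * real m) = b" .
      qed
      define P Q where "P = I powr b" and "Q = J powr b"
      have PQ: "0 < P" "0 < Q" using I J by (auto simp: P_def Q_def)
      define D where "D = s * P + t * Q"
      have D: "0 < D" using frac(3)[OF PQ] by (simp add: D_def)
      have C: "0 < D powr (1 / a)" using D by simp
      have "ennreal (D powr (1 / a) * (s * P + t * Q) ^ m) \<le> quermass_fun i comb"
      proof (rule sup_combination_layer_bound[OF I J PQ C, of "\<lambda>r \<rho>. (s * r powr a + t * \<rho> powr a) powr (1 / a)"])
        fix r \<rho> :: real assume r: "0 < r" "0 < \<rho>"
        show "ennreal ((s * r powr a + t * \<rho> powr a) powr (1 / a)) = power_mean \<alpha> s t (ennreal r) (ennreal \<rho>)"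
          using power_mean_ennreal[OF st r 3(1)] by (simp add: real)
        define l where "l = t * Q / D"
        have l: "1 - l = s * P / D" "0 < l" "l < 1" using frac[OF PQ] by (auto simp: l_def D_def)
        let ?w = "(1 - l) * r powr a + l * \<rho> powr a"
        have w: "0 < ?w" using l r by (intro add_pos_pos mult_pos_pos) auto
        have sc: "(x / (x powr b) ^ m * y) powr a = x powr b * y powr a" if "0 < x" "0 < y" for x y
        proof -
          have "x / (x powr b) ^ m = x powr (1 - b * real m)" using that by (simp add: pow powr_diff)
          then show ?thesis using that b(3) by (simp add: powr_mult powr_powr mult.commute)
        qed
        have "s * (I / P ^ m * r) powr a + t * (J / Q ^ m * \<rho>) powr a = s * (P * r powr a) + t * (Q * \<rho> powr a)"
          unfolding P_def Q_def using sc I J r by simp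
        also have "\<dots> = D * ?w" unfolding l(1) using D by (simp add: l_def distrib_left mult_ac)
        finally have "(s * (I / P ^ m * r) powr a + t * (J / Q ^ m * \<rho>) powr a) powr (1 / a) = D powr (1 / a) * ?w powr (1 / a)"
          using D w by (simp add: powr_mult)
        moreover have "neg_mean m l r \<rho> \<le> ?w powr (1 / a)"
          using neg_mean_le_power_mean[OF m l(2,3) r 3(1) a] .
        ultimately show "D powr (1 / a) * neg_mean m (t * Q / (s * P + t * Q)) r \<rho> \<le>
            (s * (I / P ^ m * r) powr a + t * (J / Q ^ m * \<rho>) powr a) powr (1 / a)"
          using C by (simp add: D_def[symmetric] l_def[symmetric] mult_left_mono)
      qed
      also have "D powr (1 / a) * (s * P + t * Q) ^ m = D powr (1 / b)"
        using D by (simp add: D_def[symmetric] b(2) powr_add powr_realpow)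
      also have "beta_exponent \<alpha> m = ereal b"
      proof -
        have "ereal a / (1 + ereal a * ereal (real m)) = ereal b" using am by (simp add: b_def one_ereal_def)
        then show ?thesis using 3(2) by (simp add: real beta_exponent_def)
      qed
      moreover have "power_mean (ereal b) s t (ennreal I) (ennreal J) = ennreal (D powr (1 / b))"
        using power_mean_ennreal[OF st I(1) J(1) b(1)] by (simp add: D_def P_def Q_def)
      ultimately show ?thesis by simp
    qed
  qed (use \<alpha> in simp)
qed

text \<open>A single nonempty superlevel set of \<open>f\<close> is used, contributing
  \<open>x = 0\<close>. Dilating the superlevel sets of \<open>g\<close> by \<open>t\<close> gives
  \<open>t ^ m\<close>, and rescaling the levels gives the remaining factor
  \<open>t powr c\<close>.\<close>

lemma sup_combination_quermass_ge_right:
  assumes c: "0 \<le> c"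
    and le: "\<And>r \<rho>. 0 < r \<Longrightarrow> 0 < \<rho> \<Longrightarrow> ennreal (t powr c * \<rho>) \<le> power_mean \<alpha> s t (ennreal r) (ennreal \<rho>)"
  shows "ennreal (t powr (c + real m)) * quermass_fun i g \<le> quermass_fun i comb"
proof -
  have m: "0 < m" using i by (simp add: m_def)
  obtain x0 where "f x0 \<noteq> 0" using f by (auto simp: Q_class_def)
  then obtain r where r: "0 < r" "ennreal r \<le> f x0"
    by (cases "f x0" rule: ennreal_trichotomy) (auto intro: that[of 1])
  have lev: "ennreal (t ^ m) * quermass i (lev g \<rho>) \<le> quermass i (lev comb (t powr c * \<rho>))" if \<rho>: "0 < \<rho>" for \<rho>
  proof (cases "lev g \<rho> = {}")
    case False
    note L = Q_class_level_cbody[OF g \<rho> False]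
    define W where "W = quermass_body i (lev g \<rho>)"
    have W: "0 \<le> W" using quermass_body_nonneg[OF i L] by (simp add: W_def)
    have eq: "quermass i (lev g \<rho>) = ennreal W" by (simp add: quermass_cbody[OF i L] W_def)
    have "ennreal ((s * 0 + t * root m W) ^ m) \<le> quermass i (lev comb (t powr c * \<rho>))"
      using r W m False by (intro quermass_sup_combination_level[OF r(1) \<rho>] le[OF r(1) \<rho>]) (auto simp: eq zero_power)
    then show ?thesis using W m st by (simp add: eq power_mult_distrib ennreal_mult[symmetric])
  qed (simp add: quermass_def)
  have tc: "0 < t powr c" using st by simp
  note anti = sup_combination_quermass_antimono
  have "ennreal (t powr (c + real m)) * quermass_fun i g = ennreal (t powr c) * (ennreal (t ^ m) * quermass_fun i g)"
    using st by (simp add: powr_add powr_realpow ennreal_mult mult.assoc)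
  also have "ennreal (t ^ m) * quermass_fun i g = (\<integral>\<^sup>+\<rho>. ennreal (t ^ m) * (quermass i (lev g \<rho>) * indicator {0<..} \<rho>) \<partial>lborel)"
    unfolding quermass_fun_def
    by (rule nn_integral_cmult[symmetric]) (use borel_measurable_antimono_ennreal[OF Q_class_quermass_antimono[OF g]] in simp)
  also have "\<dots> \<le> (\<integral>\<^sup>+\<rho>\<in>{0<..}. quermass i (lev comb (t powr c * \<rho>)) \<partial>lborel)"
    using lev by (intro nn_integral_mono) (auto simp: indicator_def)
  also have "ennreal (t powr c) * \<dots> = quermass_fun i comb"
    unfolding quermass_fun_def by (rule nn_integral_rescale[OF anti tc, symmetric])
  finally show ?thesis by (simp add: mult_left_mono)
qed

text \<open>For a positive order the mean does not vanish with one of its arguments. Here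
  \<open>c\<close> is the reciprocal of \<open>\<alpha>\<close>, or 0 for infinite order, and
  \<open>1 / (c + m)\<close> is the order of the claimed mean.\<close>

lemma sup_combination_quermass_zero:
  assumes \<alpha>pos: "0 < \<alpha>"
  shows "power_mean (beta_exponent \<alpha> m) s t 0 (quermass_fun i g) \<le> quermass_fun i comb"
proof -
  have m: "0 < m" using i by (simp add: m_def)
  obtain c where c: "0 \<le> c" "beta_exponent \<alpha> m = ereal (1 / (c + real m))"
    "\<And>r \<rho>. 0 < r \<Longrightarrow> 0 < \<rho> \<Longrightarrow> ennreal (t powr c * \<rho>) \<le> power_mean \<alpha> s t (ennreal r) (ennreal \<rho>)"
  proof (cases \<alpha>)
    case (real a)
    then have a: "0 < a" using \<alpha>pos by (simp add: zero_ereal_def)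
    show ?thesis
    proof (rule that[of "1 / a"])
      have am: "0 < 1 + a * real m" using a by (intro add_pos_nonneg) auto
      have "ereal a / (1 + ereal a * ereal (real m)) = ereal (a / (1 + a * real m))"
        using am by (simp add: one_ereal_def)
      moreover have "a / (1 + a * real m) = 1 / (1 / a + real m)" using a am by (simp add: field_simps)
      moreover have "a \<noteq> - 1 / real m" using a divide_nonneg_nonneg[of 1 "real m"] by linarith
      ultimately show "beta_exponent \<alpha> m = ereal (1 / (1 / a + real m))" by (simp add: real beta_exponent_def)
      fix r \<rho> :: real assume r: "0 < r" "0 < \<rho>"
      have "t powr (1 / a) * \<rho> = (t * \<rho> powr a) powr (1 / a)" using r a st by (simp add: powr_mult powr_powr)
      also have "\<dots> \<le> (s * r powr a + t * \<rho> powr a) powr (1 / a)" using r a st by (intro powr_mono2) auto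
      finally show "ennreal (t powr (1 / a) * \<rho>) \<le> power_mean \<alpha> s t (ennreal r) (ennreal \<rho>)"
        using power_mean_ennreal[OF st r, of a] a by (simp add: real ennreal_leI)
    qed (use a in simp)
  next
    case PInf
    show ?thesis
      by (rule that[of 0]) (use st in \<open>auto simp: PInf beta_exponent_def\<close>)
  qed (use \<alpha> in simp)
  define b where "b = 1 / (c + real m)"
  have b: "0 < b" "1 / b = c + real m" using c(1) m by (auto simp: b_def intro!: add_nonneg_pos)
  have "power_mean (ereal b) s t 0 (quermass_fun i g) = ennreal_powr (ennreal t * ennreal_powr (quermass_fun i g) b) (1 / b)"
    using b by (simp add: power_mean_real)
  also have "\<dots> = ennreal (t powr (c + real m)) * quermass_fun i g"
  proof -
    have "ennreal_powr (ennreal t * ennreal_powr (quermass_fun i g) b) (1 / b)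
        = ennreal_powr (ennreal t) (1 / b) * ennreal_powr (ennreal_powr (quermass_fun i g) b) (1 / b)"
      using b(1) by (intro ennreal_powr_mult) simp
    also have "\<dots> = ennreal (t powr (1 / b)) * quermass_fun i g"
      using b(1) st by (simp only: ennreal_powr_inverse ennreal_powr_ennreal)
    finally show ?thesis unfolding b(2) .
  qed
  finally show ?thesis
    using sup_combination_quermass_ge_right[OF c(1,3)] by (simp add: c(2) b_def)
qed

end

lemma beta_exponent_nonpos:
  assumes "\<alpha> \<le> 0" "ereal (- 1 / real m) \<le> \<alpha>" "0 < m"
  shows "beta_exponent \<alpha> m \<le> 0"
proof (cases \<alpha>)
  case (real a)
  then have a: "a \<le> 0" "- 1 / real m \<le> a" using assms by (auto simp: zero_ereal_def)
  show ?thesis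
  proof (cases "a = - 1 / real m")
    case False
    then have am: "0 < 1 + a * real m" using mult_strict_right_mono[of "- 1 / real m" a "real m"] a assms(3) by simp
    then have "ereal a / (1 + ereal a * ereal (real m)) = ereal (a / (1 + a * real m))" by (simp add: one_ereal_def)
    moreover have "a / (1 + a * real m) \<le> 0" using a am by (simp add: divide_nonpos_pos)
    ultimately show ?thesis using False by (simp add: real beta_exponent_def zero_ereal_def)
  qed (simp add: real beta_exponent_def)
qed (use assms in auto)

text \<open>If an integral vanishes, the claimed mean is 0 for nonpositive \<open>\<alpha>\<close>.
  For positive \<open>\<alpha>\<close> it need not be, and symmetry of the combination reduces this
  case to a vanishing integral of the first function.\<close>

lemma quermass_fun_sup_combination:
  fixes f g :: "'a::euclidean_space \<Rightarrow> ennreal"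
  assumes i: "i < DIM('a)" and st: "0 < s" "0 < t" and \<alpha>: "ereal (- 1 / real (DIM('a) - i)) \<le> \<alpha>"
    and f: "f \<in> Q_class \<alpha>" and g: "g \<in> Q_class \<alpha>" and st1: "\<alpha> = 0 \<Longrightarrow> s + t = 1"
  shows "power_mean (beta_exponent \<alpha> (DIM('a) - i)) s t (quermass_fun i f) (quermass_fun i g)
    \<le> quermass_fun i (sup_combination \<alpha> s t f g)"
proof -
  let ?m = "DIM('a) - i" and ?I = "quermass_fun i f" and ?J = "quermass_fun i g"
  have m: "0 < ?m" using i by simp
  have \<alpha>inf: "\<alpha> \<noteq> -\<infinity>" using \<alpha> by auto
  consider "0 < ?I" "0 < ?J" | "?I = 0 \<or> ?J = 0" "\<alpha> \<le> 0" | "?I = 0" "0 < \<alpha>" | "?J = 0" "0 < \<alpha>"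
    by (metis not_le zero_less_iff_neq_zero)
  then show ?thesis
  proof cases
    case 1
    have ninf: "beta_exponent \<alpha> ?m \<noteq> \<infinity>"
    proof (cases \<alpha>)
      case (real a)
      show ?thesis
      proof (cases "a = - 1 / real ?m")
        case False
        then have "1 + a * real ?m \<noteq> 0" using m by (auto simp: field_simps)
        then have "ereal a / (1 + ereal a * ereal (real ?m)) = ereal (a / (1 + a * real ?m))" by (simp add: one_ereal_def)
        then show ?thesis using False by (simp add: real beta_exponent_def)
      qed (simp add: real beta_exponent_def)
    qed (use \<alpha>inf in \<open>auto simp: beta_exponent_def\<close>)
    show ?thesis
    proof (rule power_mean_le_if_strictly_below[OF st ninf 1])
      fix I' J' assume I': "0 < I'" "I' < ?I" and J': "0 < J'" "J' < ?J"
      obtain x where "0 < x" "I' = ennreal x" using I' by (cases I' rule: ennreal_trichotomy) auto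
      moreover obtain y where "0 < y" "J' = ennreal y" using J' by (cases J' rule: ennreal_trichotomy) auto
      ultimately show "power_mean (beta_exponent \<alpha> ?m) s t I' J' \<le> quermass_fun i (sup_combination \<alpha> s t f g)"
        using I' J' sup_combination_quermass_real[OF i f g st \<alpha>inf refl \<alpha> st1, of x y] by simp
    qed
  next
    case 2
    then have "power_mean (beta_exponent \<alpha> ?m) s t ?I ?J = 0"
      using beta_exponent_nonpos[OF 2(2) \<alpha> m] by (auto simp: power_mean_def)
    then show ?thesis by simp
  next
    case 3
    then show ?thesis using sup_combination_quermass_zero[OF i f g st \<alpha>inf refl] by simp
  next
    case 4
    then show ?thesis
      using sup_combination_quermass_zero[OF i g f st(2,1) \<alpha>inf refl]
      by (simp add: power_mean_commute[of _ s t] sup_combination_commute[of _ s t])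
  qed
qed

theorem corollary4p8:
  fixes f g :: "real ^ 'n \<Rightarrow> ennreal"
    and i :: nat
    and s t :: real
    and \<alpha> :: ereal
  assumes "i < CARD('n)"
    and "s > 0" and "t > 0"
    and "\<alpha> \<ge> ereal (- 1 / real (CARD('n) - i))"
    and "f \<in> Q_class \<alpha>" and "g \<in> Q_class \<alpha>"
    and "\<alpha> = 0 \<Longrightarrow> s + t = 1"
  shows "quermass_fun i (sup_combination \<alpha> s t f g)
    \<ge> power_mean (beta_exponent \<alpha> (CARD('n) - i)) s t (quermass_fun i f) (quermass_fun i g)"
  using quermass_fun_sup_combination[of i s t \<alpha> f g] assms by simp

end
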